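(* Let $M$ be a complete Riemannian manifold and let $\gamma:[a,b]\to M$ be a geodesic. For $t\in(a,b]$ let $H_t$ be the index form of $\gamma|_{[a,t]}$ on smooth vector fields vanishing at the endpoints $a$ and $t$, let $\mathrm{ind}(H_b)$ be the index of $H_b$, and for $\lambda\in\mathbb{R}$ let $\mathrm{nul}(H_t-\lambda I)$ be the nullity as defined in the context, with $\mathrm{nul}(H_t)=\mathrm{nul}(H_t-0\cdot I)$. Then there is a real number $\lambda_0<0$ such that $$\mathrm{ind}(H_b)=\sum_{\lambda<0}\mathrm{nul}(H_b-\lambda I)=\sum_{\lambda\in(\lambda_0,0)}\mathrm{nul}(H_b-\lambda I)=\sum_{t\in(a,b)}\mathrm{nul}(H_t).$$ In other words, the index of $H_b$ equals the number of values $t\in(a,b)$ conjugate to $a$ along $\gamma$, counted with multiplicity.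
   Context: Primes denote covariant differentiation along $\gamma$, and $R$ is the curvature tensor with convention $R(X,Y)Z=\nabla_X\nabla_YZ-\nabla_Y\nabla_XZ-\nabla_{[X,Y]}Z$. The operator $R(t):=R(\dot\gamma(t),\cdot)\dot\gamma(t)$ is self-adjoint on $T_{\gamma(t)}M$. For $t\in(a,b]$, the index form $H_t$ is the symmetric bilinear form on the space of smooth vector fields along $\gamma|_{[a,t]}$ vanishing at $a$ and $t$ given by $$H_t(X,Y)=\int_a^t \langle X',Y'\rangle+\langle R(\dot\gamma,X)\dot\gamma,Y\rangle\,ds .$$ The index of a symmetric bilinear form is the maximal dimension (a priori possibly infinite) of a subspace on which it is negative definite. For $\lambda\in\mathbb{R}$ and $t\in(a,b]$, $\mathrm{nul}(H_t-\lambda I)$ is the dimension of the vector space of smooth vector fields $X$ along $\gamma|_{[a,t]}$ satisfying $-X''+R(\dot\gamma,X)\dot\gamma=\lambda X$ and $X(a)=X(t)=0$. Equivalently, it is the dimension of the kernel of the symmetric bilinear form $H_t(X,Y)-\lambda\int_a^t\langle X,Y\rangle\,ds$. A value $t\in(a,b]$ is conjugate to $a$ along $\gamma$ if $\mathrm{nul}(H_t)>0$, i.e. if there is a nonzero Jacobi field (solution of $-X''+R(\dot\gamma,X)\dot\gamma=0$) along $\gamma|_{[a,t]}$ with $X(a)=X(t)=0$; its multiplicity is $\mathrm{nul}(H_t)$. The sums are over all real $\lambda$ (respectively $t$) in the indicated ranges, with values in $\{0,1,2,\dots\}\cup\{\infty\}$. *)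

theory Defs
  imports "HOL-Analysis.Analysis" "HOL-Library.Function_Algebras"
begin

section \<open>Function spaces and dimensions with values in \<open>enat\<close>\<close>

instantiation "fun" :: (type, real_vector) real_vector
begin

definition scaleR_fun :: "real \<Rightarrow> ('a \<Rightarrow> 'b) \<Rightarrow> 'a \<Rightarrow> 'b"
  where "scaleR_fun r f = (\<lambda>x. r *\<^sub>R f x)"

instance
  by standard (simp_all add: scaleR_fun_def fun_eq_iff algebra_simps)

end

text \<open>The library function \<open>dim\<close> has values in the natural numbers and is meaningless on
  infinite-dimensional spaces.\<close>

definition edim :: "'a::real_vector set \<Rightarrow> enat"
  where "edim V = (if \<exists>B. finite B \<and> V \<subseteq> span B then enat (dim V) else \<infinity>)"

definition negative_definite_on :: "('a::real_vector \<Rightarrow> 'a \<Rightarrow> real) \<Rightarrow> 'a set \<Rightarrow> bool"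
  where "negative_definite_on H W \<longleftrightarrow> (\<forall>X\<in>W. X \<noteq> 0 \<longrightarrow> H X X < 0)"

definition form_index :: "('a::real_vector \<Rightarrow> 'a \<Rightarrow> real) \<Rightarrow> 'a set \<Rightarrow> enat"
  where "form_index H V = Sup {edim W |W. subspace W \<and> W \<subseteq> V \<and> negative_definite_on H W}"


section \<open>Smoothness\<close>

fun Ck_on :: "nat \<Rightarrow> ('a::real_normed_vector \<Rightarrow> 'b::real_normed_vector) \<Rightarrow> 'a set \<Rightarrow> bool" where
  "Ck_on 0 f S \<longleftrightarrow> continuous_on S f"
| "Ck_on (Suc k) f S \<longleftrightarrow> (\<forall>x\<in>S. f differentiable (at x)) \<and>
     (\<forall>v. Ck_on k (\<lambda>x. frechet_derivative f (at x) v) S)"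

text \<open>To be used on open sets only.\<close>

definition smooth_on :: "('a::real_normed_vector \<Rightarrow> 'b::real_normed_vector) \<Rightarrow> 'a set \<Rightarrow> bool"
  where "smooth_on f S \<longleftrightarrow> (\<forall>k. Ck_on k f S)"

text \<open>Smoothness of a function of one real variable on a relatively open subset \<open>J\<close> of a
  nondegenerate interval; at end points of the interval the derivatives are one-sided.\<close>

definition smooth_path_on :: "(real \<Rightarrow> 'b::real_normed_vector) \<Rightarrow> real set \<Rightarrow> bool"
  where "smooth_path_on f J \<longleftrightarrow> (\<exists>D :: nat \<Rightarrow> real \<Rightarrow> 'b. (\<forall>s\<in>J. D 0 s = f s) \<and>
     (\<forall>k. \<forall>s\<in>J. (D k has_vector_derivative D (Suc k) s) (at s within J)))"


section \<open>Smooth manifolds and tangent vectors\<close>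

text \<open>The manifold is the type \<open>'m\<close>, its dimension is \<open>CARD('n)\<close>. A chart is a pair of
  its domain and its coordinate map, whose values outside the domain are irrelevant.\<close>

type_synonym ('m, 'n) chart = "'m set \<times> ('m \<Rightarrow> real^'n)"

definition chart_inv :: "('m, 'n::finite) chart \<Rightarrow> real^'n \<Rightarrow> 'm"
  where "chart_inv c = inv_into (fst c) (snd c)"

definition is_chart :: "('m::topological_space, 'n::finite) chart \<Rightarrow> bool"
  where "is_chart c \<longleftrightarrow> open (fst c) \<and> open (snd c ` fst c) \<and>
     homeomorphism (fst c) (snd c ` fst c) (snd c) (chart_inv c)"

definition transition :: "('m, 'n::finite) chart \<Rightarrow> ('m, 'n) chart \<Rightarrow> real^'n \<Rightarrow> real^'n"
  where "transition c d = snd d \<circ> chart_inv c"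

definition smooth_atlas :: "('m::topological_space, 'n::finite) chart set \<Rightarrow> bool"
  where "smooth_atlas A \<longleftrightarrow> (\<forall>c\<in>A. is_chart c) \<and> (\<Union>c\<in>A. fst c) = UNIV \<and>
     (\<forall>c\<in>A. \<forall>d\<in>A. smooth_on (transition c d) (snd c ` (fst c \<inter> fst d)))"

text \<open>A tangent vector at \<open>p\<close> is the family of its components in all the charts around
  \<open>p\<close>, which transform by the derivatives of the transition maps. The components in
  all other charts are set to 0, so that the tangent spaces are vector spaces under
  pointwise operations.\<close>

type_synonym ('m, 'n) tvec = "('m, 'n) chart \<Rightarrow> real^'n"

definition coord_change ::
  "('m, 'n::finite) chart \<Rightarrow> ('m, 'n) chart \<Rightarrow> 'm \<Rightarrow> real^'n \<Rightarrow> real^'n"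
  where "coord_change c d p = frechet_derivative (transition c d) (at (snd c p))"

definition tangent_space :: "('m, 'n::finite) chart set \<Rightarrow> 'm \<Rightarrow> ('m, 'n) tvec set"
  where "tangent_space A p = {v. (\<forall>c. \<not> (c \<in> A \<and> p \<in> fst c) \<longrightarrow> v c = 0) \<and>
     (\<forall>c\<in>A. \<forall>d\<in>A. p \<in> fst c \<inter> fst d \<longrightarrow> v d = coord_change c d p (v c))}"

definition coord_vec ::
  "('m, 'n::finite) chart set \<Rightarrow> ('m, 'n) chart \<Rightarrow> 'm \<Rightarrow> 'n \<Rightarrow> ('m, 'n) tvec"
  where "coord_vec A c p i =
    (\<lambda>d. if d \<in> A \<and> p \<in> fst d then coord_change c d p (axis i 1) else 0)"


section \<open>Riemannian metrics and the Levi-Civita connection\<close>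

text \<open>The value \<open>g p v w\<close> matters only for \<open>v\<close> and \<open>w\<close> in the tangent
  space at \<open>p\<close>.\<close>

type_synonym ('m, 'n) metric = "'m \<Rightarrow> ('m, 'n) tvec \<Rightarrow> ('m, 'n) tvec \<Rightarrow> real"

definition metric_matrix ::
  "('m, 'n::finite) chart set \<Rightarrow> ('m, 'n) metric \<Rightarrow> ('m, 'n) chart \<Rightarrow> real^'n \<Rightarrow> real^'n^'n"
  where "metric_matrix A g c x = (\<chi> i j.
    g (chart_inv c x) (coord_vec A c (chart_inv c x) i) (coord_vec A c (chart_inv c x) j))"

definition inner_product_on :: "('v::real_vector \<Rightarrow> 'v \<Rightarrow> real) \<Rightarrow> 'v set \<Rightarrow> bool"
  where "inner_product_on h V \<longleftrightarrow>
    (\<forall>v\<in>V. \<forall>w\<in>V. h v w = h w v) \<and>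
    (\<forall>u\<in>V. \<forall>v\<in>V. \<forall>w\<in>V. h (u + v) w = h u w + h v w) \<and>
    (\<forall>r. \<forall>v\<in>V. \<forall>w\<in>V. h (r *\<^sub>R v) w = r * h v w) \<and>
    (\<forall>v\<in>V. v \<noteq> 0 \<longrightarrow> h v v > 0)"

definition riemannian_metric :: "('m, 'n::finite) chart set \<Rightarrow> ('m, 'n) metric \<Rightarrow> bool"
  where "riemannian_metric A g \<longleftrightarrow> (\<forall>p. inner_product_on (g p) (tangent_space A p)) \<and>
    (\<forall>c\<in>A. smooth_on (metric_matrix A g c) (snd c ` fst c))"

text \<open>The derivative at \<open>x\<close> in direction \<open>w\<close> of \<open>g(u,v)\<close>, where the
  vector fields \<open>u\<close>, \<open>v\<close> have constant components in the chart \<open>c\<close>.\<close>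

definition metric_deriv :: "('m, 'n::finite) chart set \<Rightarrow> ('m, 'n) metric \<Rightarrow> ('m, 'n) chart \<Rightarrow>
    real^'n \<Rightarrow> real^'n \<Rightarrow> real^'n \<Rightarrow> real^'n \<Rightarrow> real"
  where "metric_deriv A g c x w u v =
    frechet_derivative (\<lambda>y. u \<bullet> (metric_matrix A g c y *v v)) (at x) w"

text \<open>The vector with components \<open>\<Sum>i j. \<Gamma>\<^sup>k\<^sub>i\<^sub>j u\<^sup>i v\<^sup>j\<close>, where
  \<open>\<Gamma>\<^sup>k\<^sub>i\<^sub>j = \<Sum>l. g\<^sup>k\<^sup>l (\<partial>\<^sub>i g\<^sub>j\<^sub>l + \<partial>\<^sub>j g\<^sub>i\<^sub>l - \<partial>\<^sub>l g\<^sub>i\<^sub>j) / 2\<close>.\<close>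

definition christoffel :: "('m, 'n::finite) chart set \<Rightarrow> ('m, 'n) metric \<Rightarrow> ('m, 'n) chart \<Rightarrow>
    real^'n \<Rightarrow> real^'n \<Rightarrow> real^'n \<Rightarrow> real^'n"
  where "christoffel A g c x u v = matrix_inv (metric_matrix A g c x) *v
    (\<chi> l. (metric_deriv A g c x u v (axis l 1) + metric_deriv A g c x v u (axis l 1)
           - metric_deriv A g c x (axis l 1) u v) / 2)"

text \<open>\<open>nabla A g c X Y\<close> is \<open>\<nabla>\<^sub>X Y\<close> for vector fields given by their
  components as functions of the coordinates in the chart \<open>c\<close>.\<close>

definition nabla :: "('m, 'n::finite) chart set \<Rightarrow> ('m, 'n) metric \<Rightarrow> ('m, 'n) chart \<Rightarrow>
    (real^'n \<Rightarrow> real^'n) \<Rightarrow> (real^'n \<Rightarrow> real^'n) \<Rightarrow> real^'n \<Rightarrow> real^'n"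
  where "nabla A g c X Y x =
    frechet_derivative Y (at x) (X x) + christoffel A g c x (X x) (Y x)"

definition lie_bracket ::
  "(real^'n::finite \<Rightarrow> real^'n) \<Rightarrow> (real^'n \<Rightarrow> real^'n) \<Rightarrow> real^'n \<Rightarrow> real^'n"
  where "lie_bracket X Y x =
    frechet_derivative Y (at x) (X x) - frechet_derivative X (at x) (Y x)"

definition curvature_field :: "('m, 'n::finite) chart set \<Rightarrow> ('m, 'n) metric \<Rightarrow> ('m, 'n) chart \<Rightarrow>
    (real^'n \<Rightarrow> real^'n) \<Rightarrow> (real^'n \<Rightarrow> real^'n) \<Rightarrow> (real^'n \<Rightarrow> real^'n) \<Rightarrow> real^'n \<Rightarrow> real^'n"
  where "curvature_field A g c X Y Z x =
    nabla A g c X (nabla A g c Y Z) x - nabla A g c Y (nabla A g c X Z) x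
    - nabla A g c (lie_bracket X Y) Z x"

text \<open>The curvature tensor on tangent vectors at \<open>p\<close>. As it is tensorial, the vectors may
  be extended to vector fields with constant components in the chart.\<close>

definition curvature :: "('m, 'n::finite) chart set \<Rightarrow> ('m, 'n) metric \<Rightarrow> 'm \<Rightarrow>
    ('m, 'n) tvec \<Rightarrow> ('m, 'n) tvec \<Rightarrow> ('m, 'n) tvec \<Rightarrow> ('m, 'n) tvec"
  where "curvature A g p u v w = (\<lambda>c. if c \<in> A \<and> p \<in> fst c
    then curvature_field A g c (\<lambda>_. u c) (\<lambda>_. v c) (\<lambda>_. w c) (snd c p) else 0)"


section \<open>Curves, vector fields along curves, geodesics\<close>

text \<open>Curves are defined on a nondegenerate interval \<open>I\<close>; derivatives are taken within
  \<open>I\<close>. A vector field along a curve is extended by 0 outside \<open>I\<close>, so that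
  different fields are different functions.\<close>

definition smooth_curve ::
  "('m::topological_space, 'n::finite) chart set \<Rightarrow> real set \<Rightarrow> (real \<Rightarrow> 'm) \<Rightarrow> bool"
  where "smooth_curve A I \<gamma> \<longleftrightarrow> continuous_on I \<gamma> \<and>
    (\<forall>c\<in>A. smooth_path_on (\<lambda>s. snd c (\<gamma> s)) {s \<in> I. \<gamma> s \<in> fst c})"

definition vector_fields_along :: "('m, 'n::finite) chart set \<Rightarrow> real set \<Rightarrow> (real \<Rightarrow> 'm) \<Rightarrow>
    (real \<Rightarrow> ('m, 'n) tvec) set"
  where "vector_fields_along A I \<gamma> = {X. (\<forall>s. s \<notin> I \<longrightarrow> X s = 0) \<and>
    (\<forall>s\<in>I. X s \<in> tangent_space A (\<gamma> s)) \<and>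
    (\<forall>c\<in>A. smooth_path_on (\<lambda>s. X s c) {s \<in> I. \<gamma> s \<in> fst c})}"

definition velocity :: "('m, 'n::finite) chart set \<Rightarrow> real set \<Rightarrow> (real \<Rightarrow> 'm) \<Rightarrow>
    real \<Rightarrow> ('m, 'n) tvec"
  where "velocity A I \<gamma> s = (\<lambda>c. if s \<in> I \<and> c \<in> A \<and> \<gamma> s \<in> fst c
    then vector_derivative (\<lambda>r. snd c (\<gamma> r)) (at s within I) else 0)"

definition cov_deriv :: "('m, 'n::finite) chart set \<Rightarrow> ('m, 'n) metric \<Rightarrow> real set \<Rightarrow>
    (real \<Rightarrow> 'm) \<Rightarrow> (real \<Rightarrow> ('m, 'n) tvec) \<Rightarrow> real \<Rightarrow> ('m, 'n) tvec"
  where "cov_deriv A g I \<gamma> X s = (\<lambda>c. if s \<in> I \<and> c \<in> A \<and> \<gamma> s \<in> fst c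
    then vector_derivative (\<lambda>r. X r c) (at s within I)
         + christoffel A g c (snd c (\<gamma> s)) (velocity A I \<gamma> s c) (X s c)
    else 0)"

definition geodesic :: "('m::topological_space, 'n::finite) chart set \<Rightarrow> ('m, 'n) metric \<Rightarrow>
    real set \<Rightarrow> (real \<Rightarrow> 'm) \<Rightarrow> bool"
  where "geodesic A g I \<gamma> \<longleftrightarrow> smooth_curve A I \<gamma> \<and>
    (\<forall>s\<in>I. cov_deriv A g I \<gamma> (velocity A I \<gamma>) s = 0)"

text \<open>Completeness in the sense of geodesics: the exponential map is defined on the whole
  tangent bundle.\<close>

definition complete_riemannian ::
  "('m::topological_space, 'n::finite) chart set \<Rightarrow> ('m, 'n) metric \<Rightarrow> bool"
  where "complete_riemannian A g \<longleftrightarrow> (\<forall>p. \<forall>v\<in>tangent_space A p.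
    \<exists>\<sigma>. geodesic A g UNIV \<sigma> \<and> \<sigma> 0 = p \<and> velocity A UNIV \<sigma> 0 = v)"


section \<open>The index form, Jacobi fields and conjugate values\<close>

definition variation_fields :: "('m, 'n::finite) chart set \<Rightarrow> (real \<Rightarrow> 'm) \<Rightarrow> real \<Rightarrow> real \<Rightarrow>
    (real \<Rightarrow> ('m, 'n) tvec) set"
  where "variation_fields A \<gamma> a t =
    {X \<in> vector_fields_along A {a..t} \<gamma>. X a = 0 \<and> X t = 0}"

text \<open>\<open>s \<mapsto> R(\<gamma>', X) \<gamma>'\<close> along the restriction of \<open>\<gamma>\<close> to \<open>I\<close>.\<close>

definition curvature_along :: "('m, 'n::finite) chart set \<Rightarrow> ('m, 'n) metric \<Rightarrow> real set \<Rightarrow>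
    (real \<Rightarrow> 'm) \<Rightarrow> (real \<Rightarrow> ('m, 'n) tvec) \<Rightarrow> real \<Rightarrow> ('m, 'n) tvec"
  where "curvature_along A g I \<gamma> X s =
    curvature A g (\<gamma> s) (velocity A I \<gamma> s) (X s) (velocity A I \<gamma> s)"

definition index_form :: "('m, 'n::finite) chart set \<Rightarrow> ('m, 'n) metric \<Rightarrow> (real \<Rightarrow> 'm) \<Rightarrow>
    real \<Rightarrow> real \<Rightarrow> (real \<Rightarrow> ('m, 'n) tvec) \<Rightarrow> (real \<Rightarrow> ('m, 'n) tvec) \<Rightarrow> real"
  where "index_form A g \<gamma> a t X Y = integral {a..t} (\<lambda>s.
    g (\<gamma> s) (cov_deriv A g {a..t} \<gamma> X s) (cov_deriv A g {a..t} \<gamma> Y s)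
    + g (\<gamma> s) (curvature_along A g {a..t} \<gamma> X s) (Y s))"

definition ind :: "('m, 'n::finite) chart set \<Rightarrow> ('m, 'n) metric \<Rightarrow> (real \<Rightarrow> 'm) \<Rightarrow>
    real \<Rightarrow> real \<Rightarrow> enat"
  where "ind A g \<gamma> a t = form_index (index_form A g \<gamma> a t) (variation_fields A \<gamma> a t)"

definition eigenfields :: "('m, 'n::finite) chart set \<Rightarrow> ('m, 'n) metric \<Rightarrow> (real \<Rightarrow> 'm) \<Rightarrow>
    real \<Rightarrow> real \<Rightarrow> real \<Rightarrow> (real \<Rightarrow> ('m, 'n) tvec) set"
  where "eigenfields A g \<gamma> a t \<mu> = {X \<in> variation_fields A \<gamma> a t. \<forall>s\<in>{a..t}.
    - cov_deriv A g {a..t} \<gamma> (cov_deriv A g {a..t} \<gamma> X) s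
    + curvature_along A g {a..t} \<gamma> X s = \<mu> *\<^sub>R X s}"

definition nul :: "('m, 'n::finite) chart set \<Rightarrow> ('m, 'n) metric \<Rightarrow> (real \<Rightarrow> 'm) \<Rightarrow>
    real \<Rightarrow> real \<Rightarrow> real \<Rightarrow> enat"
  where "nul A g \<gamma> a t \<mu> = edim (eigenfields A g \<gamma> a t \<mu>)"

definition conjugate_value :: "('m, 'n::finite) chart set \<Rightarrow> ('m, 'n) metric \<Rightarrow> (real \<Rightarrow> 'm) \<Rightarrow>
    real \<Rightarrow> real \<Rightarrow> bool"
  where "conjugate_value A g \<gamma> a t \<longleftrightarrow> nul A g \<gamma> a t 0 > 0"

end

theory Submission
  imports Defs "HOL-Complex_Analysis.Great_Picard"
begin

text \<open>In a parallel orthonormal frame along \<open>\<gamma>\<close> the index form becomes the form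
  \<open>Q x = \<integral> |x'|\<^sup>2 + \<langle>K x, x\<rangle>\<close> with a symmetric matrix function \<open>K\<close>, and the nullities count the
  solutions of \<open>- x'' + K x = \<mu> x\<close> with Dirichlet conditions. For this system three
  inequalities between the index \<open>i\<close>, the number \<open>e\<close> of negative eigenvalues and the number \<open>c\<close> of
  interior conjugate values (all with multiplicity) close up to a cycle.

  \<open>e \<le> i\<close>: eigenfields for distinct eigenvalues are orthogonal for \<open>Q\<close>, so \<open>Q\<close> is negative
  definite on the span of those for negative eigenvalues.

  \<open>i \<le> c\<close>: let \<open>J\<close> be the matrix solution of \<open>J'' = K J\<close> with \<open>J a = 0\<close>, \<open>J' a = 1\<close>. A field
  satisfying \<open>c\<close> linear conditions at the conjugate values can be written \<open>x = J v\<close>, and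
  Legendre's identity \<open>Q x = \<integral> |x' - J' v|\<^sup>2\<close> shows \<open>Q x \<ge> 0\<close>.

  \<open>c \<le> e\<close>: the Jacobi fields vanishing at \<open>a\<close> and at a conjugate value \<open>t\<close>, continued by zero
  beyond \<open>t\<close>, span a space of dimension \<open>c\<close> on which \<open>Q\<close> vanishes. If \<open>c > e\<close>, some nonzero
  element of it is \<open>L\<^sup>2\<close>-orthogonal to the eigenfields with negative eigenvalue. Such an element
  minimizes the Rayleigh quotient of \<open>Q\<close> on the orthogonal complement, so it is an eigenfield
  and in particular differentiable, which a broken Jacobi field is not.\<close>

text \<open>The obstacle is the absence of a form domain: the space of smooth fields is not
  complete, and a broken Jacobi field is not an admissible argument of the form. Everything in c <=
  e therefore passes through the solution operator \<open>G\<close> of - x'' + (K + l) x = f with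
  zero end values, on continuous functions with the L2 product; the constant l is chosen so that K +
  l >= 1. An eigenvalue mu of the system is the eigenvalue 1 / (mu + l) of \<open>G\<close>. Thus mu
  >= 0 reads "at most 1 / l", minimizing the quotient of Q becomes maximizing that of
  \<open>G\<close>, and Q w = 0 becomes <G w, w> >= |w|^2 / l. Hoelder bounds on \<open>G f\<close>
  supply the compactness. In i <= c the difficulty sits at the conjugate values, where J is
  singular. Symmetry of the Wronskian shows that J degenerates there only to first order, which also
  makes these values finite in number, and it tells which vectors lie in the range of J. Finiteness
  of the negative spectrum comes out of the cycle: e <= i holds for every finite set of eigenvalues,
  and c is finite. The same l bounds all eigenvalues below and so yields lambda_0.\<close>

section \<open>Dimensions with values in \<open>enat\<close> and the counting of linear
  conditions\<close>

lemma edim_basis: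
  assumes "independent B" "B \<subseteq> V" "V \<subseteq> span B"
  shows "edim V = (if finite B then enat (card B) else \<infinity>)"
proof (cases "finite B")
  case True
  then have "\<exists>B. finite B \<and> V \<subseteq> span B" using assms by blast
  moreover have "dim V = card B" using assms dim_unique by blast
  ultimately show ?thesis using True by (simp add: edim_def)
next
  case False
  have "\<not> (\<exists>C. finite C \<and> V \<subseteq> span C)"
    using independent_span_bound[OF _ assms(1)] assms(2) False by blast
  then show ?thesis using False by (simp add: edim_def)
qed

lemma edim_finite_obtain:
  assumes "edim V = enat k"
  obtains B where "independent B" "B \<subseteq> V" "V \<subseteq> span B" "finite B" "card B = k"
proof -
  obtain B where B: "B \<subseteq> V" "independent B" "V \<subseteq> span B"
    using maximal_independent_subset by blast
  with edim_basis[OF B(2,1,3)] assms that show ?thesis by (auto split: if_splits)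
qed

text \<open>An infinite independent set contains finite ones of every size, so a uniform bound on
  the finite independent subsets already forces finite dimension.\<close>

lemma edim_leI:
  assumes "\<And>B. B \<subseteq> V \<Longrightarrow> independent B \<Longrightarrow> finite B \<Longrightarrow> card B \<le> k"
  shows "edim V \<le> enat k"
proof -
  obtain B where B: "B \<subseteq> V" "independent B" "V \<subseteq> span B"
    using maximal_independent_subset by blast
  have "finite B"
  proof (rule ccontr)
    assume "infinite B"
    then obtain C where "C \<subseteq> B" "finite C" "card C = Suc k"
      using infinite_arbitrarily_large by blast
    with assms[of C] B independent_mono[of B C] show False by auto
  qed
  with assms[of B] B edim_basis[OF B(2,1,3)] show ?thesis by simp
qed

lemma edim_image_inj:
  assumes "linear f" "subspace V" "inj_on f V"
  shows "edim (f ` V) = edim V"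
proof -
  obtain B where B: "B \<subseteq> V" "independent B" "V \<subseteq> span B"
    using maximal_independent_subset by blast
  have sp: "span B = V" using B assms(2) by (metis span_subspace)
  have "independent (f ` B)"
    using assms(1,3) B sp by (simp add: linear_independent_injective_image)
  moreover have "f ` B \<subseteq> f ` V" using B by blast
  moreover have "f ` V \<subseteq> span (f ` B)" using linear_span_image[OF assms(1), of B] sp by simp
  ultimately have "edim (f ` V) = (if finite (f ` B) then enat (card (f ` B)) else \<infinity>)"
    by (rule edim_basis)
  moreover have "inj_on f B" using assms(3) B(1) inj_on_subset by blast
  ultimately show ?thesis
    using edim_basis[OF B(2,1,3)] by (simp add: card_image finite_image_iff)
qed

text \<open>Linearity is demanded only on \<open>V\<close>: the functionals below involve
  derivatives and integrals, whose additivity is available only for differentiable or integrable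
  arguments.\<close>

definition functional_on :: "'a::real_vector set \<Rightarrow> ('a \<Rightarrow> real) \<Rightarrow> bool"
  where "functional_on V \<phi> \<longleftrightarrow> (\<forall>x\<in>V. \<forall>y\<in>V. \<phi> (x + y) = \<phi> x + \<phi> y) \<and>
    (\<forall>r. \<forall>x\<in>V. \<phi> (r *\<^sub>R x) = r * \<phi> x)"

text \<open>One step of Gaussian elimination with pivot \<open>b\<close>. The factors
  \<open>q x\<close> are arbitrary here; later they are chosen so that a functional vanishes on
  every shifted vector.\<close>

lemma independent_shift:
  assumes "independent (insert b B)" "b \<notin> B"
  shows "independent ((\<lambda>x. x - q x *\<^sub>R b) ` B) \<and> inj_on (\<lambda>x. x - q x *\<^sub>R b) B"
proof -
  have key: "(\<forall>x\<in>F. u x = 0)" if "finite F" "F \<subseteq> B" "(\<Sum>x\<in>F. u x *\<^sub>R (x - q x *\<^sub>R b)) = 0" for F u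
  proof -
    \<comment> \<open>A relation between shifted vectors is a relation in \<open>insert b F\<close>:
      the subtracted multiples of \<open>b\<close> are collected into its coefficient.\<close>
    let ?u = "\<lambda>x. if x = b then - (\<Sum>x\<in>F. u x * q x) else u x"
    have "b \<notin> F" using that assms by blast
    have e: "(\<Sum>x\<in>F. ?u x *\<^sub>R x) = (\<Sum>x\<in>F. u x *\<^sub>R x)"
      using \<open>b \<notin> F\<close> by (intro sum.cong) auto
    have "(\<Sum>x\<in>insert b F. ?u x *\<^sub>R x) = 0"
      using that(3) \<open>b \<notin> F\<close> \<open>finite F\<close>
      by (simp add: e algebra_simps sum_subtractf scaleR_sum_left scaleR_diff_right)
    then have "?u x = 0" if "x \<in> F" for x
      using independentD[OF assms(1), of "insert b F" ?u x] that \<open>finite F\<close> \<open>F \<subseteq> B\<close> by blast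
    then show ?thesis using \<open>b \<notin> F\<close> by (metis (full_types))
  qed
  have inj: "inj_on (\<lambda>x. x - q x *\<^sub>R b) B"
  proof (rule inj_onI, rule ccontr)
    fix x y assume xy: "x \<in> B" "y \<in> B" "x - q x *\<^sub>R b = y - q y *\<^sub>R b" "x \<noteq> y"
    have "\<forall>z\<in>{x,y}. (if z = x then 1 else - 1 :: real) = 0"
      by (rule key) (use xy in auto)
    then show False by auto
  qed
  moreover have "independent ((\<lambda>x. x - q x *\<^sub>R b) ` B)"
    unfolding independent_explicit_module
  proof (intro allI impI)
    fix t u v assume t: "finite t" "t \<subseteq> (\<lambda>x. x - q x *\<^sub>R b) ` B" "(\<Sum>v\<in>t. u v *\<^sub>R v) = 0" "v \<in> t"
    then obtain F where F: "F \<subseteq> B" "finite F" "t = (\<lambda>x. x - q x *\<^sub>R b) ` F"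
      by (meson finite_subset_image)
    have "(\<Sum>x\<in>F. u (x - q x *\<^sub>R b) *\<^sub>R (x - q x *\<^sub>R b)) = 0"
      using t(3) F inj by (simp add: sum.reindex[OF inj_on_subset[OF inj F(1)]])
    from key[OF F(2,1) this] t(4) F(3) show "u v = 0" by auto
  qed
  ultimately show ?thesis by simp
qed

text \<open>Each condition costs at most one vector: elimination with a pivot on which
  \<open>\<phi> i\<close> is nonzero leaves \<open>card B - 1\<close> independent vectors in its
  kernel. The induction generalizes over \<open>V\<close>, because the remaining functionals are
  then considered on that kernel.\<close>

lemma functionals_common_zero:
  assumes "finite I" "subspace V" "B \<subseteq> V" "independent B" "finite B" "card I < card B"
    and "\<And>i. i \<in> I \<Longrightarrow> functional_on V (\<phi> i)"
  obtains v where "v \<in> V" "v \<noteq> 0" "\<And>i. i \<in> I \<Longrightarrow> \<phi> i v = 0"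
  using assms
proof (induction I arbitrary: B V thesis rule: finite_induct)
  case empty
  then obtain b where "b \<in> B" by fastforce
  then show ?case using empty by (metis dependent_zero empty_iff subsetD)
next
  case (insert i I)
  have fi: "functional_on V (\<phi> i)" using insert.prems by simp
  let ?V = "{v \<in> V. \<phi> i v = 0}"
  have z: "\<phi> i 0 = 0"
    using fi insert.prems(2) unfolding functional_on_def subspace_def by (metis mult_zero_left scaleR_zero_left)
  have sV: "subspace ?V"
    using fi insert.prems(2) z unfolding functional_on_def subspace_def by auto
  have fV: "functional_on ?V (\<phi> j)" if "j \<in> I" for j
    using insert.prems(7)[of j] that unfolding functional_on_def by auto
  have "\<exists>B'. B' \<subseteq> ?V \<and> independent B' \<and> finite B' \<and> card I < card B'"
  proof (cases "\<forall>b\<in>B. \<phi> i b = 0")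
    case True
    then show ?thesis using insert by (intro exI[of _ B]) auto
  next
    case False
    then obtain b where b: "b \<in> B" "\<phi> i b \<noteq> 0" by blast
    let ?q = "\<lambda>x. \<phi> i x / \<phi> i b"
    let ?f = "\<lambda>x. x - ?q x *\<^sub>R b"
    have "insert b (B - {b}) = B" using b by blast
    then have ind: "independent (?f ` (B - {b})) \<and> inj_on ?f (B - {b})"
      using independent_shift[of b "B - {b}" ?q] insert.prems by simp
    have "?f x \<in> ?V" if "x \<in> B" for x
    proof -
      have x: "x \<in> V" "b \<in> V" using that b insert.prems by auto
      then have m: "(- ?q x) *\<^sub>R b \<in> V" using insert.prems(2) subspace_scale by blast
      have "\<phi> i (x + (- ?q x) *\<^sub>R b) = \<phi> i x + (- ?q x) * \<phi> i b"
        using fi x m unfolding functional_on_def by metis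
      moreover have "x + (- ?q x) *\<^sub>R b \<in> V" using x m insert.prems(2) subspace_add by blast
      ultimately show ?thesis using b by simp
    qed
    then have "?f ` (B - {b}) \<subseteq> ?V" by blast
    moreover have "card (?f ` (B - {b})) = card B - 1"
      using ind b insert.prems by (simp add: card_image)
    ultimately show ?thesis using ind insert by (intro exI[of _ "?f ` (B - {b})"]) auto
  qed
  then obtain B' where B': "B' \<subseteq> ?V" "independent B'" "finite B'" "card I < card B'" by blast
  obtain v where "v \<in> ?V" "v \<noteq> 0" "\<And>j. j \<in> I \<Longrightarrow> \<phi> j v = 0"
    using insert.IH[OF _ sV B' fV] by blast
  then show ?case using insert.prems(1)[of v] by auto
qed

text \<open>The contrapositive of counting conditions. It bounds eigenspaces, with initial
  derivatives as functionals, and negative definite subspaces, with conditions at the conjugate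
  values.\<close>

lemma edim_le_functionals:
  assumes "finite I" "subspace V" "\<And>i. i \<in> I \<Longrightarrow> functional_on V (\<phi> i)"
    and "\<And>v. v \<in> V \<Longrightarrow> (\<And>i. i \<in> I \<Longrightarrow> \<phi> i v = 0) \<Longrightarrow> v = 0"
  shows "edim V \<le> enat (card I)"
proof (rule edim_leI, rule ccontr)
  fix B assume B: "B \<subseteq> V" "independent B" "finite B" "\<not> card B \<le> card I"
  then obtain v where "v \<in> V" "v \<noteq> 0" "\<And>i. i \<in> I \<Longrightarrow> \<phi> i v = 0"
    using functionals_common_zero[OF assms(1,2) B(1,2,3), of \<phi>] assms(3) by (metis not_le)
  then show False using assms(4) by blast
qed

text \<open>\<open>indep\<close> says that the sum of the \<open>V l\<close> is direct, so the union
  of their bases is independent. The last conclusion keeps the decomposition of the vectors of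
  \<open>span B\<close>, which is what allows the form to be evaluated on them.\<close>

lemma edim_direct_sum_ge:
  fixes V :: "'i \<Rightarrow> 'a::real_vector set"
  assumes "finite L" "\<And>l. l \<in> L \<Longrightarrow> subspace (V l)" "\<And>l. l \<in> L \<Longrightarrow> edim (V l) = enat (d l)"
    and indep: "\<And>x. (\<And>l. l \<in> L \<Longrightarrow> x l \<in> V l) \<Longrightarrow> (\<Sum>l\<in>L. x l) = 0 \<Longrightarrow> (\<forall>l\<in>L. x l = 0)"
    and sub: "subspace U" "\<And>l. l \<in> L \<Longrightarrow> V l \<subseteq> U"
  obtains B where "independent B" "finite B" "card B = (\<Sum>l\<in>L. d l)" "B \<subseteq> U"
    "\<And>v. v \<in> span B \<Longrightarrow> \<exists>x. (\<forall>l\<in>L. x l \<in> V l) \<and> v = (\<Sum>l\<in>L. x l)"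
proof -
  have "\<exists>B. \<forall>l\<in>L. independent (B l) \<and> B l \<subseteq> V l \<and> finite (B l) \<and> card (B l) = d l"
    by (rule bchoice) (metis assms(3) edim_finite_obtain)
  then obtain B where B: "\<And>l. l \<in> L \<Longrightarrow> independent (B l)" "\<And>l. l \<in> L \<Longrightarrow> B l \<subseteq> V l"
    "\<And>l. l \<in> L \<Longrightarrow> finite (B l)" "\<And>l. l \<in> L \<Longrightarrow> card (B l) = d l" by blast
  have disj: "B l \<inter> B m = {}" if "l \<in> L" "m \<in> L" "l \<noteq> m" for l m
  proof (rule ccontr)
    assume "B l \<inter> B m \<noteq> {}"
    then obtain b where b: "b \<in> B l" "b \<in> B m" by blast
    \<comment> \<open>A common basis vector would decompose zero nontrivially, as \<open>b\<close>
      in \<open>V l\<close> plus \<open>- b\<close> in \<open>V m\<close>.\<close>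
    let ?x = "\<lambda>j. if j = l then b else if j = m then - b else 0"
    have "\<forall>j\<in>L. ?x j = 0"
    proof (rule indep)
      show "?x j \<in> V j" if "j \<in> L" for j
        using b B(2) assms(2) that \<open>l \<in> L\<close> \<open>m \<in> L\<close> by (auto simp: subspace_0 subspace_neg subset_iff)
      have "(\<Sum>j\<in>L. ?x j) = (\<Sum>j\<in>{l,m}. ?x j)"
        using that assms(1) by (intro sum.mono_neutral_right) auto
      then show "(\<Sum>j\<in>L. ?x j) = 0" using that by simp
    qed
    then have "b = 0" using that by auto
    then show False using b B(1)[OF that(1)] dependent_zero by blast
  qed
  let ?B = "\<Union>l\<in>L. B l"
  have fB: "finite ?B" using assms(1) B(3) by blast
  have split: "(\<Sum>b\<in>?B. u b *\<^sub>R b) = (\<Sum>l\<in>L. \<Sum>b\<in>B l. u b *\<^sub>R b)" for u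
    using assms(1) B(3) disj by (intro sum.UNION_disjoint) auto
  have inV: "(\<Sum>b\<in>B l. u b *\<^sub>R b) \<in> V l" if "l \<in> L" for u l
    using that assms(2) B(2) by (intro subspace_sum subspace_scale) auto
  have indB: "independent ?B"
  proof -
    have "u v = 0" if u: "(\<Sum>b\<in>?B. u b *\<^sub>R b) = 0" and v: "v \<in> ?B" for u v
    proof -
      from v obtain l where l: "l \<in> L" "v \<in> B l" by blast
      have "\<forall>l\<in>L. (\<Sum>b\<in>B l. u b *\<^sub>R b) = 0"
        by (rule indep) (use inV u split in auto)
      then show ?thesis using l B(1,3) independentD[of "B l" "B l" u v] by blast
    qed
    then show ?thesis using independent_if_scalars_zero[OF fB] by blast
  qed
  show ?thesis
  proof (rule that[OF indB fB])
    show "card ?B = (\<Sum>l\<in>L. d l)"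
      using card_UN_disjoint[of L B] assms(1) B(3,4) disj by auto
    show "?B \<subseteq> U" using B(2) sub(2) by blast
    show "\<exists>x. (\<forall>l\<in>L. x l \<in> V l) \<and> v = (\<Sum>l\<in>L. x l)" if v: "v \<in> span ?B" for v
    proof -
      obtain u where "v = (\<Sum>b\<in>?B. u b *\<^sub>R b)" using v unfolding span_finite[OF fB] by blast
      then show ?thesis using split inV by (intro exI[of _ "\<lambda>l. \<Sum>b\<in>B l. u b *\<^sub>R b"]) auto
    qed
  qed
qed

subsection \<open>Linear differential equations\<close>

lemma continuous_on_Icc_bound:
  fixes f :: "real \<Rightarrow> 'a::real_normed_vector"
  assumes "continuous_on {a..b} f"
  obtains C where "0 \<le> C" "\<And>s. s \<in> {a..b} \<Longrightarrow> norm (f s) \<le> C"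
proof -
  have "bounded (f ` {a..b})" using assms compact_imp_bounded compact_continuous_image by blast
  then obtain C where "\<And>s. s \<in> {a..b} \<Longrightarrow> norm (f s) \<le> C"
    unfolding bounded_iff by blast
  then show ?thesis using that[of "max 0 C"] by (simp add: le_max_iff_disj)
qed

text \<open>Every integration raises the power of \<open>t - a\<close> by one and divides by the new
  exponent. The resulting factorial makes the series of the \<open>u n\<close> converge on the whole
  interval at once, whatever the size of \<open>L\<close>.\<close>

lemma volterra_term_bound:
  fixes A :: "real \<Rightarrow> 'a::banach \<Rightarrow>\<^sub>L 'a"
  assumes A: "continuous_on {a..b} A" "\<And>s. s \<in> {a..b} \<Longrightarrow> norm (A s) \<le> L"
    and u: "\<And>n t. u (Suc n) t = integral {a..t} (\<lambda>s. A s (u n s))"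
    and u0: "continuous_on {a..b} (u 0)" "\<And>s. s \<in> {a..b} \<Longrightarrow> norm (u 0 s) \<le> C"
  shows "continuous_on {a..b} (u n) \<and> (\<forall>t\<in>{a..b}. norm (u n t) \<le> C * (L * (t - a)) ^ n / fact n)"
proof (induction n)
  case 0
  then show ?case using u0 by simp
next
  case (Suc n)
  have c: "continuous_on {a..b} (\<lambda>s. A s (u n s))" using A Suc by (intro continuous_intros) auto
  have "continuous_on {a..b} (u (Suc n))"
    unfolding u using indefinite_integral_continuous_1[OF integrable_continuous_real[OF c]] by simp
  moreover have "norm (u (Suc n) t) \<le> C * (L * (t - a)) ^ Suc n / fact (Suc n)" if t: "t \<in> {a..b}" for t
  proof -
    let ?g = "\<lambda>s. L * (C * (L * (s - a)) ^ n / fact n)"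
    let ?G = "\<lambda>s. C * (L * (s - a)) ^ Suc n / fact (Suc n)"
    have "(?g has_integral (?G t - ?G a)) {a..t}"
    proof (rule fundamental_theorem_of_calculus)
      fix s assume "s \<in> {a..t}"
      have "((\<lambda>s. L * (s - a)) has_real_derivative L) (at s within {a..t})"
        by (auto intro!: derivative_eq_intros)
      from DERIV_cdivide[OF DERIV_cmult[OF DERIV_power_Suc[OF this]]]
      have "(?G has_real_derivative C * ((1 + real n) * (L * (L * (s - a)) ^ n)) / fact (Suc n)) (at s within {a..t})" .
      moreover have "C * ((1 + real n) * (L * (L * (s - a)) ^ n)) / fact (Suc n) = ?g s"
        by (simp add: divide_simps)
      ultimately have "(?G has_real_derivative ?g s) (at s within {a..t})" by (rule DERIV_cong)
      then show "(?G has_vector_derivative ?g s) (at s within {a..t})"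
        by (rule has_real_derivative_iff_has_vector_derivative[THEN iffD1])
    qed (use t in auto)
    then have "integral {a..t} ?g = ?G t" "?g integrable_on {a..t}"
      by (auto dest: integral_unique intro: has_integral_integrable)
    moreover have "norm (integral {a..t} (\<lambda>s. A s (u n s))) \<le> integral {a..t} ?g"
    proof (rule integral_norm_bound_integral)
      show "(\<lambda>s. A s (u n s)) integrable_on {a..t}"
        using c t by (intro integrable_continuous_real continuous_on_subset[OF c]) auto
      show "?g integrable_on {a..t}" by fact
      fix s assume s: "s \<in> {a..t}"
      have "norm (A s (u n s)) \<le> norm (A s) * norm (u n s)" by (rule norm_blinfun)
      also have "\<dots> \<le> ?g s"
        using A(2)[of s] Suc s t order_trans[OF norm_ge_zero] by (intro mult_mono) auto
      finally show "norm (A s (u n s)) \<le> ?g s" .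
    qed
    ultimately show ?thesis unfolding u by simp
  qed
  ultimately show ?case by blast
qed

text \<open>Picard iteration written as a series: the iterated integrals \<open>u n\<close> are
  summed uniformly, the sum satisfies the integral equation, and the differential equation follows
  from the fundamental theorem.\<close>

lemma linear_ode_exists:
  fixes A :: "real \<Rightarrow> 'a::banach \<Rightarrow>\<^sub>L 'a"
  assumes ab: "a \<le> b" and A: "continuous_on {a..b} A" and f: "continuous_on {a..b} f"
  obtains x where "x a = x0"
    "\<And>s. s \<in> {a..b} \<Longrightarrow> (x has_vector_derivative (A s (x s) + f s)) (at s within {a..b})"
proof -
  obtain L where L0: "0 \<le> L" and L: "\<And>s. s \<in> {a..b} \<Longrightarrow> norm (A s) \<le> L"
    using continuous_on_Icc_bound[OF A] by blast
  \<comment> \<open>The zeroth term carries the initial value and the inhomogeneity; the later terms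
    involve only \<open>A\<close>.\<close>
  define \<phi> where "\<phi> t = x0 + integral {a..t} f" for t
  have c\<phi>: "continuous_on {a..b} \<phi>" unfolding \<phi>_def
    using indefinite_integral_continuous_1[OF integrable_continuous_real[OF f]]
    by (intro continuous_intros) auto
  obtain C where C0: "0 \<le> C" and C: "\<And>s. s \<in> {a..b} \<Longrightarrow> norm (\<phi> s) \<le> C"
    using continuous_on_Icc_bound[OF c\<phi>] by blast
  define u where "u = rec_nat \<phi> (\<lambda>n v t. integral {a..t} (\<lambda>s. A s (v s)))"
  have u0: "u 0 = \<phi>" and uS: "\<And>n t. u (Suc n) t = integral {a..t} (\<lambda>s. A s (u n s))"
    by (simp_all add: u_def)
  have cu: "continuous_on {a..b} (u n)" and bu: "\<And>t. t \<in> {a..b} \<Longrightarrow> norm (u n t) \<le> C * (L * (t - a)) ^ n / fact n" for n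
  proof -
    have "continuous_on {a..b} (u n) \<and> (\<forall>t\<in>{a..b}. norm (u n t) \<le> C * (L * (t - a)) ^ n / fact n)"
      by (rule volterra_term_bound[of a b A L u C n, OF A]) (use L C c\<phi> in \<open>auto simp: u0 uS\<close>)
    then show "continuous_on {a..b} (u n)"
      "\<And>t. t \<in> {a..b} \<Longrightarrow> norm (u n t) \<le> C * (L * (t - a)) ^ n / fact n" by auto
  qed
  define S where "S n t = (\<Sum>i<n. u i t)" for n t
  define X where "X t = (\<Sum>i. u i t)" for t
  have UL: "uniform_limit {a..b} S X sequentially"
    unfolding S_def X_def
  proof (rule Weierstrass_m_test)
    fix n t assume t: "t \<in> {a..b}"
    have "norm (u n t) \<le> C * (L * (t - a)) ^ n / fact n" using bu t by blast
    also have "\<dots> \<le> C * (L * (b - a)) ^ n / fact n"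
      using t C0 L0 by (intro divide_right_mono mult_left_mono power_mono) auto
    finally show "norm (u n t) \<le> C * (inverse (fact n) * (L * (b - a)) ^ n)"
      by (simp add: field_simps)
  qed (intro summable_mult summable_exp)
  have cS: "continuous_on {a..b} (S n)" for n unfolding S_def using cu by (intro continuous_intros)
  have cX: "continuous_on {a..b} X"
    by (rule uniform_limit_theorem[OF _ UL]) (use cS in auto)
  have ULA: "uniform_limit {a..b} (\<lambda>n s. A s (S n s)) (\<lambda>s. A s (X s)) sequentially"
  proof (rule uniform_limitI)
    fix e :: real assume "0 < e"
    \<comment> \<open>\<open>L\<close> may be zero, hence the denominator
      \<open>L + 1\<close>.\<close>
    then have "0 < e / (L + 1)" using L0 by simp
    from uniform_limitD[OF UL this]
    show "\<forall>\<^sub>F n in sequentially. \<forall>s\<in>{a..b}. dist (A s (S n s)) (A s (X s)) < e"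
    proof (rule eventually_mono, intro ballI)
      fix n s assume h: "\<forall>s\<in>{a..b}. dist (S n s) (X s) < e / (L + 1)" "s \<in> {a..b}"
      have "dist (A s (S n s)) (A s (X s)) = norm (A s (S n s - X s))"
        by (simp add: dist_norm blinfun.diff_right)
      also have "\<dots> \<le> norm (A s) * norm (S n s - X s)" by (rule norm_blinfun)
      also have "\<dots> \<le> L * norm (S n s - X s)" using L h by (intro mult_right_mono) auto
      also have "\<dots> \<le> (L + 1) * norm (S n s - X s)" by (intro mult_right_mono) auto
      also have "\<dots> < e" using h L0 by (auto simp: dist_norm field_simps)
      finally show "dist (A s (S n s)) (A s (X s)) < e" .
    qed
  qed
  have SS: "S (Suc n) t = \<phi> t + integral {a..t} (\<lambda>s. A s (S n s))" if "t \<in> {a..b}" for n t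
  proof -
    have "integral {a..t} (\<lambda>s. A s (S n s)) = (\<Sum>i<n. integral {a..t} (\<lambda>s. A s (u i s)))"
      unfolding S_def blinfun.sum_right
    proof (rule integral_sum)
      fix i
      have "continuous_on {a..t} (\<lambda>s. A s (u i s))"
        using that by (intro continuous_intros continuous_on_subset[OF A] continuous_on_subset[OF cu]) auto
      then show "(\<lambda>s. A s (u i s)) integrable_on {a..t}" by (rule integrable_continuous_real)
    qed simp
    then show ?thesis unfolding S_def sum.lessThan_Suc_shift by (simp add: u0 uS)
  qed
  have X: "X t = \<phi> t + integral {a..t} (\<lambda>s. A s (X s))" if t: "t \<in> {a..b}" for t
  proof -
    have sub: "{a..t} \<subseteq> {a..b}" using t by auto
    have "continuous_on {a..t} (\<lambda>s. A s (S n s))" for n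
      by (intro continuous_intros continuous_on_subset[OF A sub] continuous_on_subset[OF cS sub])
    with uniform_limit_on_subset[OF ULA sub]
    obtain I J where I: "\<And>n. ((\<lambda>s. A s (S n s)) has_integral I n) {a..t}"
      "((\<lambda>s. A s (X s)) has_integral J) {a..t}" "I \<longlonglongrightarrow> J"
      by (rule uniform_limit_integral) auto
    have "(\<lambda>n. S (Suc n) t) \<longlonglongrightarrow> \<phi> t + J"
      unfolding SS[OF t] using I integral_unique[OF I(1)] by (auto intro!: tendsto_intros)
    moreover have "(\<lambda>n. S (Suc n) t) \<longlonglongrightarrow> X t"
      using tendsto_uniform_limitI[OF UL t] LIMSEQ_Suc by blast
    ultimately show ?thesis using LIMSEQ_unique integral_unique[OF I(2)] by metis
  qed
  have cAX: "continuous_on {a..b} (\<lambda>s. A s (X s))" using A cX by (intro continuous_intros)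
  \<comment> \<open>\<open>Y\<close> is the right-hand side of the integral equation, which the
    fundamental theorem can differentiate directly; on the interval it agrees with the
    series.\<close>
  define Y where "Y t = \<phi> t + integral {a..t} (\<lambda>s. A s (X s))" for t
  have YX: "Y t = X t" if "t \<in> {a..b}" for t using X[OF that] by (simp add: Y_def)
  show ?thesis
  proof (rule that[of Y])
    show "Y a = x0" by (simp add: Y_def \<phi>_def)
    fix s assume s: "s \<in> {a..b}"
    have "(Y has_vector_derivative (0 + f s + A s (X s))) (at s within {a..b})"
      unfolding Y_def \<phi>_def
      by (intro has_vector_derivative_add has_vector_derivative_const
          integral_has_vector_derivative s f cAX)
    then show "(Y has_vector_derivative (A s (Y s) + f s)) (at s within {a..b})"
      using YX[OF s] by (simp add: add.commute)
  qed
qed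

text \<open>Gronwall's argument: |x|^2 exp (k r) is nonincreasing for k = - 2 L and nonincreasing
  backwards for k = 2 L. The first choice handles \<open>s\<close> to the right of the zero
  \<open>t\<close>, the second \<open>s\<close> to its left.\<close>

lemma linear_ode_zero:
  fixes x :: "real \<Rightarrow> 'a::euclidean_space"
  assumes A: "continuous_on {a..b} A"
    and x: "\<And>s. s \<in> {a..b} \<Longrightarrow> (x has_vector_derivative blinfun_apply (A s) (x s)) (at s within {a..b})"
    and t: "t \<in> {a..b}" "x t = 0" and s: "s \<in> {a..b}"
  shows "x s = 0"
proof -
  obtain L where L0: "0 \<le> L" and L: "\<And>s. s \<in> {a..b} \<Longrightarrow> norm (A s) \<le> L"
    using continuous_on_Icc_bound[OF A] by blast
  have cx: "continuous_on {a..b} x"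
    using x has_vector_derivative_continuous continuous_on_eq_continuous_within by blast
  have xAx: "\<bar>x r \<bullet> A r (x r)\<bar> \<le> L * (x r \<bullet> x r)" if "r \<in> {a..b}" for r
  proof -
    have "\<bar>x r \<bullet> A r (x r)\<bar> \<le> norm (x r) * norm (A r (x r))" by (rule Cauchy_Schwarz_ineq2)
    also have "\<dots> \<le> norm (x r) * (L * norm (x r))"
      using norm_blinfun[of "A r" "x r"] mult_right_mono[OF L[OF that] norm_ge_zero[of "x r"]]
      by (intro mult_left_mono) auto
    also have "\<dots> = L * (x r \<bullet> x r)" by (simp add: dot_square_norm power2_eq_square)
    finally show ?thesis .
  qed
  have D: "((\<lambda>r. (x r \<bullet> x r) * exp (k * r)) has_real_derivative
      (2 * (x r \<bullet> A r (x r)) + k * (x r \<bullet> x r)) * exp (k * r)) (at r)" if "r \<in> {a<..<b}" for r k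
  proof -
    have "(x has_vector_derivative A r (x r)) (at r)"
      using x[of r] that at_within_Icc_at[of a r b] by auto
    then have "(x has_derivative (\<lambda>h. h *\<^sub>R A r (x r))) (at r)" by (simp add: has_vector_derivative_def)
    then show ?thesis
      unfolding has_field_derivative_def
      by (auto intro!: derivative_eq_intros simp: algebra_simps inner_commute)
  qed
  have c: "continuous_on {p..q} (\<lambda>r. (x r \<bullet> x r) * exp (k * r))" if "{p..q} \<subseteq> {a..b}" for p q k
    by (intro continuous_intros continuous_on_subset[OF cx that])
  have "(x s \<bullet> x s) * exp ((if t \<le> s then - 2 * L else 2 * L) * s) \<le> 0"
  proof (cases "t \<le> s")
    case True
    have "(x s \<bullet> x s) * exp (- 2 * L * s) \<le> (x t \<bullet> x t) * exp (- 2 * L * t)"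
    proof (rule DERIV_nonpos_imp_decreasing_open[OF True])
      fix r assume "t < r" "r < s"
      then have r: "r \<in> {a<..<b}" "r \<in> {a..b}" using s t by auto
      have "2 * (x r \<bullet> A r (x r)) + - 2 * L * (x r \<bullet> x r) \<le> 0" using xAx[OF r(2)] by (simp add: algebra_simps abs_le_iff)
      then show "\<exists>y. ((\<lambda>r. (x r \<bullet> x r) * exp (- 2 * L * r)) has_real_derivative y) (at r) \<and> y \<le> 0"
        using D[OF r(1), of "- 2 * L"] by (meson exp_ge_zero mult_nonpos_nonneg)
    qed (use c[of t s "- 2 * L"] s t in auto)
    then show ?thesis using t True by simp
  next
    case False
    have "(x s \<bullet> x s) * exp (2 * L * s) \<le> (x t \<bullet> x t) * exp (2 * L * t)"
    proof (rule DERIV_nonneg_imp_increasing_open[of s t "\<lambda>r. (x r \<bullet> x r) * exp (2 * L * r)"])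
      fix r assume "s < r" "r < t"
      then have r: "r \<in> {a<..<b}" "r \<in> {a..b}" using s t by auto
      have "2 * (x r \<bullet> A r (x r)) + 2 * L * (x r \<bullet> x r) \<ge> 0" using xAx[OF r(2)] by (simp add: algebra_simps abs_le_iff)
      then show "\<exists>y. ((\<lambda>r. (x r \<bullet> x r) * exp (2 * L * r)) has_real_derivative y) (at r) \<and> y \<ge> 0"
        using D[OF r(1), of "2 * L"] by (blast intro: mult_nonneg_nonneg[OF _ exp_ge_zero])
    qed (use c[of s t] s t False in auto)
    then show ?thesis using t False by simp
  qed
  then have "x s \<bullet> x s \<le> 0" by (simp add: mult_le_0_iff)
  then show ?thesis using inner_gt_zero_iff[of "x s"] by linarith
qed

lemma bounded_bilinear_mat_vec: "bounded_bilinear (\<lambda>(A::real^'n^'m) x. A *v x)"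
  unfolding bilinear_conv_bounded_bilinear[symmetric] bilinear_def
  by (intro conjI allI linearI)
    (simp_all add: matrix_vector_mult_def vec_eq_iff sum.distrib algebra_simps sum_distrib_left)

lemma bounded_bilinear_mat_mat: "bounded_bilinear (\<lambda>(A::real^'n^'m) (B::real^'k^'n). A ** B)"
  unfolding bilinear_conv_bounded_bilinear[symmetric] bilinear_def
  by (intro conjI allI linearI)
    (simp_all add: matrix_matrix_mult_def vec_eq_iff sum.distrib algebra_simps sum_distrib_left)

text \<open>In finite dimension pointwise continuity of a family of linear maps is continuity in the
  operator norm, so coefficients can be checked vector by vector.\<close>

lemma linear_ode_exists_pointwise:
  fixes F :: "real \<Rightarrow> 'a::euclidean_space \<Rightarrow> 'a"
  assumes ab: "a \<le> b" and F: "\<And>s. linear (F s)" "\<And>x. continuous_on {a..b} (\<lambda>s. F s x)"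
    and f: "continuous_on {a..b} f"
  obtains x where "x a = x0"
    "\<And>s. s \<in> {a..b} \<Longrightarrow> (x has_vector_derivative (F s (x s) + f s)) (at s within {a..b})"
proof -
  define A where "A s = Blinfun (F s)" for s
  have A: "blinfun_apply (A s) = F s" for s
    unfolding A_def using F(1) by (simp add: bounded_linear_Blinfun_apply linear_conv_bounded_linear)
  have "continuous_on {a..b} A"
    by (rule continuous_on_blinfun_componentwise) (simp add: A F)
  from linear_ode_exists[OF ab this f] show ?thesis using that unfolding A by metis
qed

lemma linear_ode_zero_pointwise:
  fixes F :: "real \<Rightarrow> 'a::euclidean_space \<Rightarrow> 'a"
  assumes F: "\<And>s. linear (F s)" "\<And>x. continuous_on {a..b} (\<lambda>s. F s x)"
    and x: "\<And>s. s \<in> {a..b} \<Longrightarrow> (x has_vector_derivative F s (x s)) (at s within {a..b})"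
    and t: "t \<in> {a..b}" "x t = 0" and s: "s \<in> {a..b}"
  shows "x s = 0"
proof -
  define A where "A s = Blinfun (F s)" for s
  have A: "blinfun_apply (A s) = F s" for s
    unfolding A_def using F(1) by (simp add: bounded_linear_Blinfun_apply linear_conv_bounded_linear)
  have "continuous_on {a..b} A"
    by (rule continuous_on_blinfun_componentwise) (simp add: A F)
  then show ?thesis using linear_ode_zero[of a b A x t s] x t s unfolding A by blast
qed

subsection \<open>Smooth functions of one variable\<close>

text \<open>Finite regularity, one-sided at end points. Product rule, chain rule and bootstrapping
  for differential equations are inductions on the order, for which \<open>smooth_path_on\<close>,
  fixing all derivatives at once, is unsuitable.\<close>

fun Cpath :: "nat \<Rightarrow> (real \<Rightarrow> 'b::real_normed_vector) \<Rightarrow> real set \<Rightarrow> bool" where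
  "Cpath 0 f J \<longleftrightarrow> continuous_on J f"
| "Cpath (Suc k) f J \<longleftrightarrow> (\<exists>f'. (\<forall>s\<in>J. (f has_vector_derivative f' s) (at s within J)) \<and> Cpath k f' J)"

text \<open>The absence of isolated points is what makes derivatives within \<open>J\<close>
  unique.\<close>

definition perfect_on :: "real set \<Rightarrow> bool"
  where "perfect_on J \<longleftrightarrow> (\<forall>s\<in>J. at s within J \<noteq> bot)"

lemma perfect_on_Icc: "a < b \<Longrightarrow> perfect_on {a..b}"
  by (simp add: perfect_on_def trivial_limit_within islimpt_Icc)

lemma has_vector_derivative_cong_on:
  assumes "s \<in> J" "\<And>r. r \<in> J \<Longrightarrow> f r = g r"
  shows "(f has_vector_derivative D) (at s within J) \<longleftrightarrow> (g has_vector_derivative D) (at s within J)"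
  using has_vector_derivative_transform[of s J g f D] has_vector_derivative_transform[of s J f g D] assms
  by auto

lemma Cpath_cong: "(\<And>s. s \<in> J \<Longrightarrow> f s = g s) \<Longrightarrow> Cpath k f J \<Longrightarrow> Cpath k g J"
proof (cases k)
  case 0
  assume "\<And>s. s \<in> J \<Longrightarrow> f s = g s" "Cpath k f J"
  then show ?thesis using 0 continuous_on_cong[of J J f g] by simp
next
  case (Suc l)
  assume "\<And>s. s \<in> J \<Longrightarrow> f s = g s" "Cpath k f J"
  then show ?thesis using Suc has_vector_derivative_cong_on[of _ J f g] by auto
qed

lemma Cpath_continuous: "Cpath k f J \<Longrightarrow> continuous_on J f"
  by (cases k) (auto simp: continuous_on_eq_continuous_within intro: has_vector_derivative_continuous)

lemma Cpath_Suc_D: "Cpath (Suc k) f J \<Longrightarrow> Cpath k f J"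
proof (induction k arbitrary: f)
  case 0
  then show ?case using Cpath_continuous[of "Suc 0"] by simp
next
  case (Suc k)
  then obtain f' where "\<forall>s\<in>J. (f has_vector_derivative f' s) (at s within J)" "Cpath (Suc k) f' J"
    unfolding Cpath.simps(2)[of "Suc k"] by blast
  then show ?case using Suc.IH by auto
qed

lemma smooth_path_on_obtain:
  assumes "smooth_path_on f J"
  obtains f' where "\<And>s. s \<in> J \<Longrightarrow> (f has_vector_derivative f' s) (at s within J)" "smooth_path_on f' J"
proof -
  obtain D where D: "\<forall>s\<in>J. D 0 s = f s" "\<forall>k. \<forall>s\<in>J. (D k has_vector_derivative D (Suc k) s) (at s within J)"
    using assms unfolding smooth_path_on_def by blast
  show ?thesis
  proof
    show "smooth_path_on (D 1) J"
      unfolding smooth_path_on_def using D(2) by (intro exI[of _ "\<lambda>k. D (Suc k)"]) auto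
    show "(f has_vector_derivative D 1 s) (at s within J)" if "s \<in> J" for s
      using D(2)[rule_format, OF that, of 0] has_vector_derivative_cong_on[OF that, of "D 0" f] D(1) by simp
  qed
qed

lemma smooth_path_on_Cpath:
  assumes "smooth_path_on f J"
  shows "Cpath k f J"
  using assms
proof (induction k arbitrary: f)
  case 0
  obtain f' where "\<And>s. s \<in> J \<Longrightarrow> (f has_vector_derivative f' s) (at s within J)"
    using smooth_path_on_obtain[OF 0] by blast
  then show ?case
    by (auto simp: continuous_on_eq_continuous_within intro: has_vector_derivative_continuous)
next
  case (Suc k)
  obtain f' where f': "\<And>s. s \<in> J \<Longrightarrow> (f has_vector_derivative f' s) (at s within J)" "smooth_path_on f' J"
    using smooth_path_on_obtain[OF Suc.prems] by blast
  then show ?case using Suc.IH[OF f'(2)] unfolding Cpath.simps(2) by (intro exI[of _ f'] conjI ballI)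
qed

text \<open>The derivatives provided by \<open>Cpath k\<close> for different \<open>k\<close> are
  unrelated at first; uniqueness on a perfect set identifies all of them with iterated values of
  \<open>vector_derivative\<close>.\<close>

lemma Cpath_smooth_path_on:
  assumes J: "perfect_on J" and f: "\<And>k. Cpath k f J"
  shows "smooth_path_on f J"
proof -
  define D where "D = rec_nat f (\<lambda>_ g s. vector_derivative g (at s within J))"
  have D0: "D 0 = f" and DS: "D (Suc k) s = vector_derivative (D k) (at s within J)" for k s
    by (simp_all add: D_def)
  have "Cpath n (D k) J" for n k
  proof (induction k arbitrary: n)
    case 0
    then show ?case using f D0 by simp
  next
    case (Suc k)
    from Suc[of "Suc n"] obtain f' where f': "\<And>s. s \<in> J \<Longrightarrow> (D k has_vector_derivative f' s) (at s within J)" "Cpath n f' J"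
      by auto
    have "f' s = D (Suc k) s" if "s \<in> J" for s
      unfolding DS using vector_derivative_within[OF _ f'(1)[OF that]] J that by (simp add: perfect_on_def)
    then show ?case using Cpath_cong f'(2) by blast
  qed
  then have "(D k has_vector_derivative D (Suc k) s) (at s within J)" if "s \<in> J" for s k
  proof -
    from \<open>\<And>n k. Cpath n (D k) J\<close>[of "Suc 0" k] that
    obtain v where "(D k has_vector_derivative v) (at s within J)" by auto
    then show ?thesis unfolding DS
      using vector_derivative_within[of s J "D k" v] J that by (simp add: perfect_on_def)
  qed
  then show ?thesis unfolding smooth_path_on_def using D0 by (intro exI[of _ D]) auto
qed

lemma smooth_path_on_cong:
  assumes "\<And>s. s \<in> J \<Longrightarrow> f s = g s" "smooth_path_on f J"
  shows "smooth_path_on g J"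
  using assms(2) unfolding smooth_path_on_def
  by (rule ex_forward) (simp add: assms(1))

lemma smooth_path_on_subset: "smooth_path_on f J \<Longrightarrow> I \<subseteq> J \<Longrightarrow> smooth_path_on f I"
  unfolding smooth_path_on_def
  by (erule ex_forward) (blast intro: has_vector_derivative_within_subset)

lemma smooth_path_on_continuous: "smooth_path_on f J \<Longrightarrow> continuous_on J f"
  using smooth_path_on_Cpath[of f J 0] by simp

lemma smooth_path_on_deriv:
  assumes "perfect_on J" "smooth_path_on f J" "\<And>s. s \<in> J \<Longrightarrow> (f has_vector_derivative f' s) (at s within J)"
  shows "smooth_path_on f' J"
proof -
  obtain g where g: "\<And>s. s \<in> J \<Longrightarrow> (f has_vector_derivative g s) (at s within J)" "smooth_path_on g J"
    using smooth_path_on_obtain[OF assms(2)] by blast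
  have "g s = f' s" if "s \<in> J" for s
    by (rule vector_derivative_unique_within[OF _ g(1)[OF that] assms(3)[OF that]])
      (use assms(1) that in \<open>simp add: perfect_on_def\<close>)
  then show ?thesis using smooth_path_on_cong[OF _ g(2)] by blast
qed

lemma smooth_path_on_vector_derivative:
  assumes "perfect_on J" "smooth_path_on f J"
  shows "smooth_path_on (\<lambda>s. vector_derivative f (at s within J)) J"
    and "s \<in> J \<Longrightarrow> (f has_vector_derivative vector_derivative f (at s within J)) (at s within J)"
proof -
  obtain f' where f': "\<And>s. s \<in> J \<Longrightarrow> (f has_vector_derivative f' s) (at s within J)" "smooth_path_on f' J"
    using smooth_path_on_obtain[OF assms(2)] by blast
  have e: "vector_derivative f (at s within J) = f' s" if "s \<in> J" for s
    by (rule vector_derivative_within[OF _ f'(1)[OF that]])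
      (use assms(1) that in \<open>simp add: perfect_on_def\<close>)
  show "smooth_path_on (\<lambda>s. vector_derivative f (at s within J)) J"
    by (rule smooth_path_on_cong[OF _ f'(2)]) (simp add: e)
  show "s \<in> J \<Longrightarrow> (f has_vector_derivative vector_derivative f (at s within J)) (at s within J)"
    using e f'(1) by simp
qed

lemma smooth_path_on_const [simp]: "smooth_path_on (\<lambda>_. c) J"
  unfolding smooth_path_on_def
  by (intro exI[of _ "\<lambda>k _. if k = 0 then c else 0"]) auto

lemma smooth_path_onE:
  assumes "smooth_path_on f J"
  obtains D where "\<And>s. s \<in> J \<Longrightarrow> D 0 s = f s"
    "\<And>k s. s \<in> J \<Longrightarrow> (D k has_vector_derivative D (Suc k) s) (at s within J)"
proof -
  obtain D where D: "(\<forall>s\<in>J. D 0 s = f s) \<and> (\<forall>k. \<forall>s\<in>J. (D k has_vector_derivative D (Suc k) s) (at s within J))"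
    using assms unfolding smooth_path_on_def by (rule exE)
  show ?thesis using that[of D] D by blast
qed

lemma smooth_path_on_linear:
  assumes "bounded_linear L" "smooth_path_on f J"
  shows "smooth_path_on (\<lambda>s. L (f s)) J"
proof -
  obtain D where D: "\<And>s. s \<in> J \<Longrightarrow> D 0 s = f s" "\<And>k s. s \<in> J \<Longrightarrow> (D k has_vector_derivative D (Suc k) s) (at s within J)"
    using smooth_path_onE[OF assms(2)] by blast
  show ?thesis unfolding smooth_path_on_def
  proof (intro exI[of _ "\<lambda>k s. L (D k s)"] conjI ballI allI)
    show "L (D 0 s) = L (f s)" if "s \<in> J" for s using D(1) that by simp
    show "((\<lambda>s. L (D k s)) has_vector_derivative L (D (Suc k) s)) (at s within J)" if "s \<in> J" for k s
      by (rule bounded_linear.has_vector_derivative[OF assms(1)]) (use D(2) that in blast)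
  qed
qed

lemma smooth_path_on_add:
  assumes "smooth_path_on f J" "smooth_path_on g J"
  shows "smooth_path_on (\<lambda>s. f s + g s) J"
proof -
  obtain D where D: "\<And>s. s \<in> J \<Longrightarrow> D 0 s = f s" "\<And>k s. s \<in> J \<Longrightarrow> (D k has_vector_derivative D (Suc k) s) (at s within J)"
    using smooth_path_onE[OF assms(1)] by blast
  obtain E where E: "\<And>s. s \<in> J \<Longrightarrow> E 0 s = g s" "\<And>k s. s \<in> J \<Longrightarrow> (E k has_vector_derivative E (Suc k) s) (at s within J)"
    using smooth_path_onE[OF assms(2)] by blast
  show ?thesis unfolding smooth_path_on_def
  proof (intro exI[of _ "\<lambda>k s. D k s + E k s"] conjI ballI allI)
    show "D 0 s + E 0 s = f s + g s" if "s \<in> J" for s using D(1) E(1) that by simp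
    show "((\<lambda>s. D k s + E k s) has_vector_derivative (D (Suc k) s + E (Suc k) s)) (at s within J)"
      if "s \<in> J" for k s
      by (rule has_vector_derivative_add) (use D(2) E(2) that in blast)+
  qed
qed

lemma smooth_path_on_scaleR: "smooth_path_on f J \<Longrightarrow> smooth_path_on (\<lambda>s. c *\<^sub>R f s) J"
  by (rule smooth_path_on_linear[OF bounded_linear_scaleR_right])

lemma smooth_path_on_minus: "smooth_path_on f J \<Longrightarrow> smooth_path_on (\<lambda>s. - f s) J"
  by (rule smooth_path_on_linear[OF bounded_linear_minus[OF bounded_linear_ident]])

lemma smooth_path_on_diff: "smooth_path_on f J \<Longrightarrow> smooth_path_on g J \<Longrightarrow> smooth_path_on (\<lambda>s. f s - g s) J"
  using smooth_path_on_add[OF _ smooth_path_on_minus, of f J g] by simp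

lemma smooth_path_on_sum:
  "(\<And>i. i \<in> I \<Longrightarrow> smooth_path_on (f i) J) \<Longrightarrow> smooth_path_on (\<lambda>s. \<Sum>i\<in>I. f i s) J"
  by (induction I rule: infinite_finite_induct) (auto intro: smooth_path_on_add)

lemma Cpath_add: "Cpath k f J \<Longrightarrow> Cpath k g J \<Longrightarrow> Cpath k (\<lambda>s. f s + g s) J"
proof (induction k arbitrary: f g)
  case (Suc k)
  then obtain f' g' where "\<forall>s\<in>J. (f has_vector_derivative f' s) (at s within J)" "Cpath k f' J"
    "\<forall>s\<in>J. (g has_vector_derivative g' s) (at s within J)" "Cpath k g' J"
    unfolding Cpath.simps(2) by blast
  then have "\<forall>s\<in>J. ((\<lambda>s. f s + g s) has_vector_derivative (f' s + g' s)) (at s within J)"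
    "Cpath k (\<lambda>s. f' s + g' s) J"
    using Suc.IH by (blast intro: has_vector_derivative_add)+
  then show ?case unfolding Cpath.simps(2) by (intro exI[of _ "\<lambda>s. f' s + g' s"] conjI)
qed (auto intro: continuous_intros)

lemma Cpath_const: "Cpath k (\<lambda>_. c) J"
  by (rule smooth_path_on_Cpath) simp

lemma Cpath_sum: "(\<And>i. i \<in> I \<Longrightarrow> Cpath k (f i) J) \<Longrightarrow> Cpath k (\<lambda>s. \<Sum>i\<in>I. f i s) J"
  by (induction I rule: infinite_finite_induct) (auto intro: Cpath_add Cpath_const)

lemma Cpath_bilinear:
  assumes B: "bounded_bilinear B"
  shows "Cpath k f J \<Longrightarrow> Cpath k g J \<Longrightarrow> Cpath k (\<lambda>s. B (f s) (g s)) J"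
proof (induction k arbitrary: f g)
  case 0
  then show ?case using bounded_bilinear.continuous_on[OF B] by simp
next
  case (Suc k)
  then obtain f' g' where "\<forall>s\<in>J. (f has_vector_derivative f' s) (at s within J)" "Cpath k f' J"
    "\<forall>s\<in>J. (g has_vector_derivative g' s) (at s within J)" "Cpath k g' J"
    unfolding Cpath.simps(2) by blast
  note d = this
  have "Cpath k (\<lambda>s. B (f s) (g' s) + B (f' s) (g s)) J"
    using Cpath_Suc_D[of k f J] Cpath_Suc_D[of k g J] Suc.prems d(2,4) by (intro Cpath_add Suc.IH)
  moreover have "\<forall>s\<in>J. ((\<lambda>s. B (f s) (g s)) has_vector_derivative (B (f s) (g' s) + B (f' s) (g s))) (at s within J)"
    using d(1,3) bounded_bilinear.has_vector_derivative[OF B] by blast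
  ultimately show ?case
    unfolding Cpath.simps(2) by (intro exI[of _ "\<lambda>s. B (f s) (g' s) + B (f' s) (g s)"] conjI)
qed

lemma smooth_path_on_bilinear:
  assumes "bounded_bilinear B" "perfect_on J" "smooth_path_on f J" "smooth_path_on g J"
  shows "smooth_path_on (\<lambda>s. B (f s) (g s)) J"
  by (rule Cpath_smooth_path_on[OF assms(2)])
    (intro Cpath_bilinear[OF assms(1)] smooth_path_on_Cpath assms(3,4))

text \<open>Intersecting \<open>J\<close> with an open neighbourhood does not change the filter
  \<open>at s within J\<close>, so the local derivatives are values of one global derivative, which
  is again locally smooth; hence the induction on the order.\<close>

lemma smooth_path_on_local:
  assumes J: "perfect_on J"
    and loc: "\<And>s. s \<in> J \<Longrightarrow> \<exists>U. open U \<and> s \<in> U \<and> smooth_path_on f (J \<inter> U)"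
  shows "smooth_path_on f J"
proof (rule Cpath_smooth_path_on[OF J])
  have aw: "at s within J \<inter> U = at s within J" if "open U" "s \<in> U" for s U
    by (rule at_within_nhd[of s U]) (use that in auto)
  fix k show "Cpath k f J"
    using loc
  proof (induction k arbitrary: f)
    case 0
    have "continuous (at s within J) f" if s: "s \<in> J" for s
    proof -
      obtain U where U: "open U" "s \<in> U" "smooth_path_on f (J \<inter> U)" using 0[OF s] by (elim exE conjE)
      have "continuous (at s within J \<inter> U) f"
        using smooth_path_on_continuous[OF U(3)] that U(2) unfolding continuous_on_eq_continuous_within by blast
      then show ?thesis unfolding aw[OF U(1,2)] .
    qed
    then show ?case by (simp add: continuous_on_eq_continuous_within)
  next
    case (Suc k)
    let ?f = "\<lambda>s. vector_derivative f (at s within J)"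
    have d: "(f has_vector_derivative ?f s) (at s within J) \<and> (\<exists>U. open U \<and> s \<in> U \<and> smooth_path_on ?f (J \<inter> U))"
      if s: "s \<in> J" for s
    proof -
      obtain U where U: "open U" "s \<in> U" "smooth_path_on f (J \<inter> U)"
        using Suc.prems[OF s] by (elim exE conjE)
      have p: "perfect_on (J \<inter> U)" using J aw[OF U(1)] by (auto simp: perfect_on_def)
      note v = smooth_path_on_vector_derivative[OF p U(3)]
      have "smooth_path_on ?f (J \<inter> U)"
        by (rule smooth_path_on_cong[OF _ v(1)]) (simp add: aw[OF U(1)])
      moreover have "(f has_vector_derivative ?f s) (at s within J)"
        using v(2)[of s] U(2) s unfolding aw[OF U(1,2)] by blast
      ultimately show ?thesis using U(1,2) by blast
    qed
    have "Cpath k ?f J" by (rule Suc.IH) (rule d[THEN conjunct2])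
    then show ?case using d[THEN conjunct1] unfolding Cpath.simps(2) by (intro exI[of _ ?f] conjI ballI)
  qed
qed

text \<open>\<open>Ck_on\<close> controls derivatives in fixed directions only. The chain rule is
  therefore expanded over the basis, with the coordinates of the velocity as scalar
  coefficients.\<close>

lemma Cpath_compose:
  fixes F :: "'a::euclidean_space \<Rightarrow> 'b::real_normed_vector"
  assumes x: "smooth_path_on x J" "\<And>s. s \<in> J \<Longrightarrow> x s \<in> S"
  shows "Ck_on k F S \<Longrightarrow> Cpath k (\<lambda>s. F (x s)) J"
proof (induction k arbitrary: F)
  case 0
  then show ?case using continuous_on_compose2[of S F J x] smooth_path_on_continuous[OF x(1)] x(2) by auto
next
  case (Suc k)
  obtain x' where x': "\<And>s. s \<in> J \<Longrightarrow> (x has_vector_derivative x' s) (at s within J)" "smooth_path_on x' J"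
    using smooth_path_on_obtain[OF x(1)] by blast
  let ?D = "\<lambda>s. \<Sum>i\<in>Basis. (x' s \<bullet> i) *\<^sub>R frechet_derivative F (at (x s)) i"
  have "((\<lambda>s. F (x s)) has_vector_derivative ?D s) (at s within J)" if s: "s \<in> J" for s
  proof -
    let ?F = "frechet_derivative F (at (x s))"
    have F: "(F has_derivative ?F) (at (x s))"
      using Suc.prems x(2)[OF s] by (simp add: frechet_derivative_works)
    then have "((\<lambda>s. F (x s)) has_derivative (\<lambda>h. ?F (h *\<^sub>R x' s))) (at s within J)"
      using x'(1)[OF s] has_derivative_compose[of x "\<lambda>h. h *\<^sub>R x' s" s J F] by (simp add: has_vector_derivative_def)
    moreover have "?F (h *\<^sub>R x' s) = h *\<^sub>R ?D s" for h
    proof -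
      have l: "linear ?F" using F by (rule has_derivative_linear)
      have "?F (x' s) = ?F (\<Sum>i\<in>Basis. (x' s \<bullet> i) *\<^sub>R i)" by (simp add: euclidean_representation)
      also have "\<dots> = ?D s" using l by (simp add: linear_sum linear_cmul)
      finally show ?thesis using l by (simp add: linear_cmul)
    qed
    ultimately show ?thesis by (simp add: has_vector_derivative_def)
  qed
  moreover have "Cpath k ?D J"
  proof (rule Cpath_sum)
    fix i :: 'a assume "i \<in> Basis"
    have "Cpath k (\<lambda>s. x' s \<bullet> i) J"
      by (intro smooth_path_on_Cpath smooth_path_on_linear[OF bounded_linear_inner_left] x')
    moreover have "Cpath k (\<lambda>s. frechet_derivative F (at (x s)) i) J"
      using Suc.prems by (intro Suc.IH) simp
    ultimately show "Cpath k (\<lambda>s. (x' s \<bullet> i) *\<^sub>R frechet_derivative F (at (x s)) i) J"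
      by (rule Cpath_bilinear[OF bounded_bilinear_scaleR])
  qed
  ultimately show ?case unfolding Cpath.simps(2) by (intro exI[of _ ?D] conjI ballI)
qed

lemma smooth_path_on_compose:
  fixes F :: "'a::euclidean_space \<Rightarrow> 'b::real_normed_vector"
  assumes "perfect_on J" "smooth_path_on x J" "\<And>s. s \<in> J \<Longrightarrow> x s \<in> S" "smooth_on F S"
  shows "smooth_path_on (\<lambda>s. F (x s)) J"
  by (rule Cpath_smooth_path_on[OF assms(1)], rule Cpath_compose[OF assms(2,3)])
    (use assms(4) in \<open>auto simp: smooth_on_def\<close>)

subsection \<open>Sturm-Liouville systems\<close>

lemma enat_sum: "enat (sum d L) = (\<Sum>l\<in>L. enat (d l))"
  by (induction L rule: infinite_finite_induct) (auto simp: zero_enat_def simp flip: plus_enat_simps(1))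

text \<open>Functions on an interval are extended by zero, so that they are determined by their values on
  the interval and the linear structure is that of all functions on the line.\<close>

definition sl_space :: "real \<Rightarrow> real \<Rightarrow> (real \<Rightarrow> real^'n) set"
  where "sl_space a t = {x. (\<forall>s. s \<notin> {a..t} \<longrightarrow> x s = 0) \<and> smooth_path_on x {a..t} \<and> x a = 0 \<and> x t = 0}"

definition ivl_deriv :: "real \<Rightarrow> real \<Rightarrow> (real \<Rightarrow> 'a::real_normed_vector) \<Rightarrow> real \<Rightarrow> 'a"
  where "ivl_deriv a t x s = vector_derivative x (at s within {a..t})"

definition sl_form :: "(real \<Rightarrow> real^'n^'n) \<Rightarrow> real \<Rightarrow> real \<Rightarrow> (real \<Rightarrow> real^'n) \<Rightarrow> (real \<Rightarrow> real^'n) \<Rightarrow> real"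
  where "sl_form K a t x y =
    integral {a..t} (\<lambda>s. ivl_deriv a t x s \<bullet> ivl_deriv a t y s + (K s *v x s) \<bullet> y s)"

definition sl_eig :: "(real \<Rightarrow> real^'n^'n) \<Rightarrow> real \<Rightarrow> real \<Rightarrow> real \<Rightarrow> (real \<Rightarrow> real^'n) set"
  where "sl_eig K a t \<mu> = {x \<in> sl_space a t. \<forall>s\<in>{a..t}.
    - ivl_deriv a t (ivl_deriv a t x) s + K s *v x s = \<mu> *\<^sub>R x s}"

definition L2_inner :: "real \<Rightarrow> real \<Rightarrow> (real \<Rightarrow> 'a::real_inner) \<Rightarrow> (real \<Rightarrow> 'a) \<Rightarrow> real"
  where "L2_inner a b x y = integral {a..b} (\<lambda>s. x s \<bullet> y s)"

lemmas bilin_mat_vec_deriv = bounded_bilinear.has_vector_derivative[OF bounded_bilinear_mat_vec]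
lemmas inner_deriv = bounded_bilinear.has_vector_derivative[OF bounded_bilinear_inner]
lemmas cont_mat_vec [continuous_intros] = bounded_bilinear.continuous_on[OF bounded_bilinear_mat_vec]

lemma mat_vec_const_deriv:
  assumes "(M has_vector_derivative M') (at s within S)"
  shows "((\<lambda>s. (M s :: real^'n^'m) *v u) has_vector_derivative M' *v u) (at s within S)"
  using bilin_mat_vec_deriv[OF assms has_vector_derivative_const[of u "at s within S"]] by simp

lemma subspace_sl_space: "subspace (sl_space a t)"
proof -
  have "c *\<^sub>R x \<in> sl_space a t" "x + y \<in> sl_space a t"
    if "x \<in> sl_space a t" "y \<in> sl_space a t" for c x and y :: "real \<Rightarrow> real^'n"
    using that smooth_path_on_scaleR[of x _ c] smooth_path_on_add[of x _ y]
    by (auto simp: sl_space_def plus_fun_def scaleR_fun_def)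
  moreover have "0 \<in> sl_space a t" by (simp add: sl_space_def zero_fun_def)
  ultimately show ?thesis by (auto simp: subspace_def)
qed

lemma ivl_deriv_works:
  assumes "a < t" "smooth_path_on x {a..t}"
  shows "s \<in> {a..t} \<Longrightarrow> (x has_vector_derivative ivl_deriv a t x s) (at s within {a..t})"
    and "smooth_path_on (ivl_deriv a t x) {a..t}"
  using smooth_path_on_vector_derivative[OF perfect_on_Icc[OF assms(1)] assms(2)]
  by (simp_all add: ivl_deriv_def[abs_def])

lemma ivl_deriv_eq:
  assumes "a < t" "s \<in> {a..t}" "(x has_vector_derivative D) (at s within {a..t})"
  shows "ivl_deriv a t x s = D"
  using vector_derivative_within[OF _ assms(3)] perfect_on_Icc[OF assms(1)] assms(2)
  by (simp add: ivl_deriv_def perfect_on_def)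

lemma ivl_deriv_linear:
  assumes "a < t" "smooth_path_on x {a..t}" "smooth_path_on y {a..t}" "s \<in> {a..t}"
  shows "ivl_deriv a t (x + y) s = ivl_deriv a t x s + ivl_deriv a t y s"
    and "ivl_deriv a t (c *\<^sub>R x) s = c *\<^sub>R ivl_deriv a t x s"
proof -
  note d = ivl_deriv_works(1)[OF assms(1,2,4)] ivl_deriv_works(1)[OF assms(1,3,4)]
  show "ivl_deriv a t (x + y) s = ivl_deriv a t x s + ivl_deriv a t y s"
    by (rule ivl_deriv_eq[OF assms(1,4)]) (use has_vector_derivative_add[OF d] in \<open>simp add: plus_fun_def\<close>)
  show "ivl_deriv a t (c *\<^sub>R x) s = c *\<^sub>R ivl_deriv a t x s"
    by (rule ivl_deriv_eq[OF assms(1,4)])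
      (use bounded_linear.has_vector_derivative[OF bounded_linear_scaleR_right d(1)] in \<open>simp add: scaleR_fun_def\<close>)
qed

lemma continuous_on_deriv:
  "(\<And>s. s \<in> S \<Longrightarrow> (x has_vector_derivative x' s) (at s within S)) \<Longrightarrow> continuous_on S x"
  unfolding continuous_on_eq_continuous_within using has_vector_derivative_continuous by blast

lemma constant_on_Icc:
  fixes f :: "real \<Rightarrow> 'b::real_normed_vector"
  assumes "\<And>s. s \<in> {a..b} \<Longrightarrow> (f has_vector_derivative 0) (at s within {a..b})"
    and "s \<in> {a..b}" "t \<in> {a..b}"
  shows "f s = f t"
proof -
  have "\<exists>c. \<forall>s\<in>{a..b}. f s = c"
    by (rule has_derivative_zero_constant) (use assms(1) in \<open>simp_all add: has_vector_derivative_def\<close>)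
  then show ?thesis using assms by auto
qed

lemma L2_inner_self_eq_0:
  assumes "continuous_on {a..b} x" "a < b"
  shows "L2_inner a b x x = 0 \<longleftrightarrow> (\<forall>s\<in>{a..b}. x s = 0)"
  unfolding L2_inner_def using assms by (subst integral_eq_0_iff) (auto intro!: continuous_intros)

lemma L2_inner_self_ge_0: "0 \<le> L2_inner a b x x"
  unfolding L2_inner_def
  by (cases "(\<lambda>s. x s \<bullet> x s) integrable_on {a..b}") (auto intro: integral_nonneg simp: not_integrable_integral)

lemma L2_inner_commute: "L2_inner a b x y = L2_inner a b y x"
  by (simp add: L2_inner_def inner_commute)

lemma L2_inner_integrable:
  fixes a b :: real
  shows "continuous_on {a..b} x \<Longrightarrow> continuous_on {a..b} y \<Longrightarrow> (\<lambda>s. x s \<bullet> y s) integrable_on {a..b}"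
  by (intro integrable_continuous_real continuous_intros)

lemma sl_form_commute:
  assumes "\<And>s u v. s \<in> {a..t} \<Longrightarrow> (K s *v u) \<bullet> v = u \<bullet> (K s *v v)"
  shows "sl_form K a t x y = sl_form K a t y x"
  unfolding sl_form_def using assms by (intro integral_cong) (simp add: inner_commute)

section \<open>Eigenfunctions of a Sturm-Liouville system and their span\<close>

locale sturm_liouville =
  fixes K :: "real \<Rightarrow> real^'n^'n" and a b :: real
  assumes ab: "a < b"
    and smooth_K: "smooth_path_on K {a..b}"
    and sym_K: "s \<in> {a..b} \<Longrightarrow> (K s *v u) \<bullet> v = u \<bullet> (K s *v v)"
begin

lemma cont_K: "continuous_on {a..b} K"
  by (rule smooth_path_on_continuous[OF smooth_K])

lemma restrict:
  assumes "t \<in> {a<..b}"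
  shows "sturm_liouville K a t"
  using assms sym_K smooth_path_on_subset[OF smooth_K, of "{a..t}"] by unfold_locales auto

lemma sl_spaceD:
  assumes "x \<in> sl_space a b"
  shows "smooth_path_on x {a..b}" "x a = 0" "x b = 0" "\<And>s. s \<notin> {a..b} \<Longrightarrow> x s = 0"
    "continuous_on {a..b} x" "continuous_on {a..b} (ivl_deriv a b x)"
    "\<And>s. s \<in> {a..b} \<Longrightarrow> (x has_vector_derivative ivl_deriv a b x s) (at s within {a..b})"
proof -
  show sm: "smooth_path_on x {a..b}" "x a = 0" "x b = 0" "\<And>s. s \<notin> {a..b} \<Longrightarrow> x s = 0"
    using assms by (auto simp: sl_space_def)
  show "continuous_on {a..b} x" "continuous_on {a..b} (ivl_deriv a b x)"
    using smooth_path_on_continuous sm(1) ivl_deriv_works(2)[OF ab sm(1)] by blast+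
  show "\<And>s. s \<in> {a..b} \<Longrightarrow> (x has_vector_derivative ivl_deriv a b x s) (at s within {a..b})"
    using ivl_deriv_works(1)[OF ab sm(1)] .
qed

lemma sl_eigD:
  assumes "x \<in> sl_eig K a b \<mu>"
  shows "x \<in> sl_space a b"
    "\<And>s. s \<in> {a..b} \<Longrightarrow> (ivl_deriv a b x has_vector_derivative (K s *v x s - \<mu> *\<^sub>R x s)) (at s within {a..b})"
proof -
  show x: "x \<in> sl_space a b" using assms by (simp add: sl_eig_def)
  fix s assume s: "s \<in> {a..b}"
  have "- ivl_deriv a b (ivl_deriv a b x) s + K s *v x s = \<mu> *\<^sub>R x s" using assms s by (simp add: sl_eig_def)
  then have "ivl_deriv a b (ivl_deriv a b x) s = K s *v x s - \<mu> *\<^sub>R x s" by (simp add: algebra_simps)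
  then show "(ivl_deriv a b x has_vector_derivative (K s *v x s - \<mu> *\<^sub>R x s)) (at s within {a..b})"
    using ivl_deriv_works(1)[OF ab ivl_deriv_works(2)[OF ab sl_spaceD(1)[OF x]] s] by simp
qed

text \<open>Bootstrapping: the equation turns regularity of \<open>x\<close> into one more order for
  \<open>y\<close>, and \<open>y\<close> into one more for \<open>x\<close>, so both are carried
  through the induction together.\<close>

lemma solution_smooth:
  assumes "\<And>s. s \<in> {a..b} \<Longrightarrow> (x has_vector_derivative y s) (at s within {a..b})"
    and "\<And>s. s \<in> {a..b} \<Longrightarrow> (y has_vector_derivative (K s *v x s - \<mu> *\<^sub>R x s)) (at s within {a..b})"
  shows "smooth_path_on x {a..b}"
proof -
  have p: "perfect_on {a..b}" using ab by (rule perfect_on_Icc)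
  have "Cpath k x {a..b} \<and> Cpath k y {a..b}" for k
  proof (induction k)
    case 0
    then show ?case using continuous_on_deriv[OF assms(1)] continuous_on_deriv[OF assms(2)] by simp
  next
    case (Suc k)
    have "Cpath k (\<lambda>s. K s *v x s + (- \<mu>) *\<^sub>R x s) {a..b}"
      using Suc by (intro Cpath_add Cpath_bilinear[OF bounded_bilinear_mat_vec] smooth_path_on_Cpath[OF smooth_K]
          Cpath_bilinear[OF bounded_bilinear_scaleR] Cpath_const) auto
    then have "Cpath k (\<lambda>s. K s *v x s - \<mu> *\<^sub>R x s) {a..b}" by simp
    then have "Cpath (Suc k) y {a..b}" unfolding Cpath.simps(2)
      by (intro conjI exI[of _ "\<lambda>s. K s *v x s - \<mu> *\<^sub>R x s"] ballI assms(2))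
    moreover have "Cpath (Suc k) x {a..b}" unfolding Cpath.simps(2)
      using Suc by (intro conjI exI[of _ y] ballI assms(1)) simp_all
    ultimately show ?case by simp
  qed
  then show ?thesis using Cpath_smooth_path_on[OF p] by blast
qed

lemma solution_in_eig:
  assumes "\<And>s. s \<in> {a..b} \<Longrightarrow> (x has_vector_derivative y s) (at s within {a..b})"
    and "\<And>s. s \<in> {a..b} \<Longrightarrow> (y has_vector_derivative (K s *v x s - \<mu> *\<^sub>R x s)) (at s within {a..b})"
    and "x a = 0" "x b = 0"
  shows "(\<lambda>s. if s \<in> {a..b} then x s else 0) \<in> sl_eig K a b \<mu>"
proof -
  let ?x = "\<lambda>s. if s \<in> {a..b} then x s else 0"
  have "smooth_path_on ?x {a..b}"
    by (rule smooth_path_on_cong[OF _ solution_smooth[OF assms(1,2)]]) auto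
  then have "?x \<in> sl_space a b" using assms(3,4) ab by (simp add: sl_space_def)
  moreover have "ivl_deriv a b ?x s = y s" if "s \<in> {a..b}" for s
    by (rule ivl_deriv_eq[OF ab that], rule has_vector_derivative_transform[OF that _ assms(1)[OF that]]) simp
  then have "ivl_deriv a b (ivl_deriv a b ?x) s = K s *v x s - \<mu> *\<^sub>R x s" if "s \<in> {a..b}" for s
    by (intro ivl_deriv_eq[OF ab that] has_vector_derivative_transform[OF that _ assms(2)[OF that]])
  ultimately show ?thesis by (simp add: sl_eig_def)
qed

text \<open>Uniqueness for the first-order system of the pair \<open>(x, y)\<close>, whose value
  vanishes at \<open>t\<close>.\<close>

lemma solution_zero:
  assumes x: "\<And>s. s \<in> {a..b} \<Longrightarrow> (x has_vector_derivative y s) (at s within {a..b})"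
    and y: "\<And>s. s \<in> {a..b} \<Longrightarrow> (y has_vector_derivative (K s *v x s - \<mu> *\<^sub>R x s)) (at s within {a..b})"
    and t: "t \<in> {a..b}" "x t = 0" "y t = 0" and s: "s \<in> {a..b}"
  shows "x s = 0"
proof -
  define F where "F s = (\<lambda>z :: (real^'n) \<times> (real^'n). (snd z, K s *v fst z - \<mu> *\<^sub>R fst z))" for s
  have "linear (F s)" for s
    unfolding F_def by (intro linearI) (simp_all add: matrix_vector_right_distrib algebra_simps matrix_vector_mult_scaleR)
  moreover have "continuous_on {a..b} (\<lambda>s. F s z)" for z
    unfolding F_def by (intro continuous_intros cont_K)
  ultimately have "(x s, y s) = 0"
    by (rule linear_ode_zero_pointwise[where x="\<lambda>s. (x s, y s)", of F a b t s])
      (use t s in \<open>auto simp: F_def zero_prod_def intro!: has_vector_derivative_Pair x y\<close>)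
  then show ?thesis by (simp add: zero_prod_def)
qed

lemma green_has_integral:
  assumes x: "\<And>s. s \<in> {a..b} \<Longrightarrow> (x has_vector_derivative x' s) (at s within {a..b})"
    and p: "\<And>s. s \<in> {a..b} \<Longrightarrow> (p has_vector_derivative p' s) (at s within {a..b})"
  shows "((\<lambda>s. p s \<bullet> x' s + p' s \<bullet> x s) has_integral (p b \<bullet> x b - p a \<bullet> x a)) {a..b}"
  by (rule fundamental_theorem_of_calculus) (use ab x p in \<open>auto intro!: inner_deriv\<close>)

text \<open>Integration by parts puts both derivatives on \<open>x\<close>; the boundary terms drop
  out because \<open>y\<close> vanishes at the ends.\<close>

lemma form_eig:
  assumes x: "x \<in> sl_eig K a b \<mu>" and y: "y \<in> sl_space a b"
  shows "sl_form K a b x y = \<mu> * L2_inner a b x y"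
proof -
  note X = sl_eigD[OF x] sl_spaceD[OF sl_eigD(1)[OF x]] and Y = sl_spaceD[OF y]
  let ?D = "ivl_deriv a b"
  have "((\<lambda>s. ?D x s \<bullet> ?D y s + (K s *v x s - \<mu> *\<^sub>R x s) \<bullet> y s) has_integral
      (?D x b \<bullet> y b - ?D x a \<bullet> y a)) {a..b}"
    by (rule green_has_integral[OF Y(7) X(2)])
  then have "((\<lambda>s. ?D x s \<bullet> ?D y s + (K s *v x s - \<mu> *\<^sub>R x s) \<bullet> y s) has_integral 0) {a..b}"
    using Y by simp
  moreover have "((\<lambda>s. \<mu> * (x s \<bullet> y s)) has_integral \<mu> * L2_inner a b x y) {a..b}"
    unfolding L2_inner_def
    by (intro has_integral_mult_right integrable_integral L2_inner_integrable X Y)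
  ultimately have "((\<lambda>s. (?D x s \<bullet> ?D y s + (K s *v x s - \<mu> *\<^sub>R x s) \<bullet> y s) + \<mu> * (x s \<bullet> y s))
      has_integral (0 + \<mu> * L2_inner a b x y)) {a..b}" by (rule has_integral_add)
  then have "((\<lambda>s. ?D x s \<bullet> ?D y s + (K s *v x s) \<bullet> y s) has_integral (\<mu> * L2_inner a b x y)) {a..b}"
    by (simp add: inner_diff_left)
  then show ?thesis unfolding sl_form_def by (rule integral_unique)
qed

text \<open>The symmetric form evaluated from either side gives \<open>\<mu>\<close> and
  \<open>\<nu>\<close> times the same L2 product.\<close>

lemma eig_orthogonal:
  assumes "x \<in> sl_eig K a b \<mu>" "y \<in> sl_eig K a b \<nu>" "\<mu> \<noteq> \<nu>"
  shows "L2_inner a b x y = 0"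
proof -
  have "\<mu> * L2_inner a b x y = \<nu> * L2_inner a b y x"
    using form_eig[OF assms(1) sl_eigD(1)[OF assms(2)]] form_eig[OF assms(2) sl_eigD(1)[OF assms(1)]]
      sl_form_commute[of a b K x y] sym_K by simp
  then show ?thesis using assms(3) by (simp add: L2_inner_commute[of _ _ y])
qed

lemma L2_inner_space:
  assumes "x \<in> sl_space a b" "y \<in> sl_space a b" "z \<in> sl_space a b"
  shows "L2_inner a b z (x + y) = L2_inner a b z x + L2_inner a b z y"
    "L2_inner a b z (c *\<^sub>R x) = c * L2_inner a b z x"
    "L2_inner a b x x = 0 \<longleftrightarrow> x = 0"
proof -
  note c = sl_spaceD(5)[OF assms(1)] sl_spaceD(5)[OF assms(2)] sl_spaceD(5)[OF assms(3)]
  show "L2_inner a b z (x + y) = L2_inner a b z x + L2_inner a b z y"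
    unfolding L2_inner_def plus_fun_def inner_add_right
    by (intro integral_add L2_inner_integrable c)
  show "L2_inner a b z (c *\<^sub>R x) = c * L2_inner a b z x"
    unfolding L2_inner_def scaleR_fun_def by simp
  show "L2_inner a b x x = 0 \<longleftrightarrow> x = 0"
    using L2_inner_self_eq_0[OF c(1) ab] sl_spaceD(4)[OF assms(1)] by (auto simp: fun_eq_iff)
qed

lemma form_add_left:
  assumes "x \<in> sl_space a b" "y \<in> sl_space a b" "z \<in> sl_space a b"
  shows "sl_form K a b (x + y) z = sl_form K a b x z + sl_form K a b y z"
proof -
  note X = sl_spaceD[OF assms(1)] and Y = sl_spaceD[OF assms(2)] and Z = sl_spaceD[OF assms(3)]
  have i: "(\<lambda>s. ivl_deriv a b x s \<bullet> ivl_deriv a b z s + (K s *v x s) \<bullet> z s) integrable_on {a..b}"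
    "(\<lambda>s. ivl_deriv a b y s \<bullet> ivl_deriv a b z s + (K s *v y s) \<bullet> z s) integrable_on {a..b}"
    by (intro integrable_continuous_real continuous_intros X Y Z cont_K)+
  show ?thesis
    unfolding sl_form_def integral_add[OF i, symmetric]
    by (intro integral_cong) (simp add: ivl_deriv_linear[OF ab X(1) Y(1)] inner_add_left matrix_vector_right_distrib)
qed

lemma subspace_eig: "subspace (sl_eig K a b \<mu>)"
proof -
  have "c *\<^sub>R x \<in> sl_eig K a b \<mu>" "x + y \<in> sl_eig K a b \<mu>"
    if x: "x \<in> sl_eig K a b \<mu>" and y: "y \<in> sl_eig K a b \<mu>" for c x y
  proof -
    note X = sl_eigD[OF x] sl_spaceD[OF sl_eigD(1)[OF x]] and Y = sl_eigD[OF y] sl_spaceD[OF sl_eigD(1)[OF y]]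
    have add: "(\<lambda>s. if s \<in> {a..b} then x s + y s else 0) \<in> sl_eig K a b \<mu>"
      by (rule solution_in_eig[where y="\<lambda>s. ivl_deriv a b x s + ivl_deriv a b y s"])
        (use X Y has_vector_derivative_add[OF X(2) Y(2)] in
          \<open>auto intro!: has_vector_derivative_add simp: matrix_vector_right_distrib algebra_simps\<close>)
    have scale: "(\<lambda>s. if s \<in> {a..b} then c *\<^sub>R x s else 0) \<in> sl_eig K a b \<mu>"
      by (rule solution_in_eig[where y="\<lambda>s. c *\<^sub>R ivl_deriv a b x s"])
        (use X bounded_linear.has_vector_derivative[OF bounded_linear_scaleR_right X(2), of _ c]
             bounded_linear.has_vector_derivative[OF bounded_linear_scaleR_right X(9), of _ c] in
          \<open>auto simp: matrix_vector_mult_scaleR algebra_simps\<close>)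
    have "x + y = (\<lambda>s. if s \<in> {a..b} then x s + y s else 0)"
      "c *\<^sub>R x = (\<lambda>s. if s \<in> {a..b} then c *\<^sub>R x s else 0)"
      using X(6) Y(6) by (auto simp: fun_eq_iff scaleR_fun_def)
    then show "c *\<^sub>R x \<in> sl_eig K a b \<mu>" "x + y \<in> sl_eig K a b \<mu>" using add scale by simp_all
  qed
  moreover have "0 \<in> sl_eig K a b \<mu>"
    using solution_in_eig[of "\<lambda>_. 0" "\<lambda>_. 0"] by (simp add: zero_fun_def)
  ultimately show ?thesis by (auto simp: subspace_def)
qed

text \<open>A solution vanishing at \<open>a\<close> is determined by its initial derivative, which
  has \<open>CARD('n)\<close> components.\<close>

lemma edim_eig_finite: "edim (sl_eig K a b \<mu>) \<le> enat CARD('n)"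
proof -
  have "edim (sl_eig K a b \<mu>) \<le> enat (card (UNIV :: 'n set))"
  proof (rule edim_le_functionals[of UNIV _ "\<lambda>i x. ivl_deriv a b x a $ i"])
    show "functional_on (sl_eig K a b \<mu>) (\<lambda>x. ivl_deriv a b x a $ i)" for i
      unfolding functional_on_def
      using ivl_deriv_linear[OF ab sl_spaceD(1)[OF sl_eigD(1)] sl_spaceD(1)[OF sl_eigD(1)], of _ \<mu> _ \<mu> a] ab
      by (auto simp: )
    fix x assume x: "x \<in> sl_eig K a b \<mu>" "\<And>i. i \<in> UNIV \<Longrightarrow> ivl_deriv a b x a $ i = 0"
    note X = sl_eigD[OF x(1)] sl_spaceD[OF sl_eigD(1)[OF x(1)]]
    have d: "ivl_deriv a b x a = 0" using x(2) by (simp add: vec_eq_iff)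
    show "x = 0"
    proof (rule ext)
      fix s show "x s = 0 s"
        using X(6)[of s] solution_zero[OF X(9) X(2), of a s] X(4) d ab by (cases "s \<in> {a..b}") auto
    qed
  qed (use subspace_eig in auto)
  then show ?thesis .
qed

text \<open>This is e <= i for an arbitrary finite set of negative numbers. Finiteness of the set of
  all negative eigenvalues is deduced from it later, so it cannot be presupposed here.\<close>

lemma eig_sum_le_index:
  assumes L: "finite L" "L \<subseteq> {..<0}"
  shows "(\<Sum>\<mu>\<in>L. edim (sl_eig K a b \<mu>)) \<le> form_index (sl_form K a b) (sl_space a b)"
proof -
  have "\<exists>d. \<forall>\<mu>. edim (sl_eig K a b \<mu>) = enat (d \<mu>)"
    using edim_eig_finite by (intro choice allI) (metis enat_ile)
  then obtain d where d: "\<And>\<mu>. edim (sl_eig K a b \<mu>) = enat (d \<mu>)" by blast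
  have inS: "(\<Sum>\<mu>\<in>M. x \<mu>) \<in> sl_space a b" if "\<forall>\<mu>\<in>M. x \<mu> \<in> sl_eig K a b \<mu>" for x M
    by (rule subspace_sum[OF subspace_sl_space]) (use that sl_eigD(1) in blast)
  \<comment> \<open>Orthogonality isolates a single component of the sum; this gives both the
    independence of the eigenspaces and the diagonal shape of the form below.\<close>
  have ip: "L2_inner a b (x \<nu>) (\<Sum>\<mu>\<in>L. x \<mu>) = L2_inner a b (x \<nu>) (x \<nu>)"
    if x: "\<forall>\<mu>\<in>L. x \<mu> \<in> sl_eig K a b \<mu>" and \<nu>: "\<nu> \<in> L" for x \<nu>
  proof -
    have *: "L2_inner a b (x \<nu>) (\<Sum>\<mu>\<in>M. x \<mu>) = (\<Sum>\<mu>\<in>M. L2_inner a b (x \<nu>) (x \<mu>))" if "finite M" "M \<subseteq> L" for M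
      using that
    proof (induction M rule: finite_induct)
      case empty
      then show ?case by (simp add: L2_inner_def)
    next
      case (insert m M)
      have e: "(\<Sum>\<mu>\<in>insert m M. x \<mu>) = x m + (\<Sum>\<mu>\<in>M. x \<mu>)"
        using insert by (intro sum.insert)
      have "L2_inner a b (x \<nu>) (\<Sum>\<mu>\<in>insert m M. x \<mu>) = L2_inner a b (x \<nu>) (x m) + L2_inner a b (x \<nu>) (\<Sum>\<mu>\<in>M. x \<mu>)"
        unfolding e by (rule L2_inner_space) (use insert x \<nu> inS[of M x] sl_eigD(1) in blast)+
      also have "\<dots> = (\<Sum>\<mu>\<in>insert m M. L2_inner a b (x \<nu>) (x \<mu>))" using insert by simp
      finally show ?case .
    qed
    also have "(\<Sum>\<mu>\<in>L. L2_inner a b (x \<nu>) (x \<mu>)) = (\<Sum>\<mu>\<in>{\<nu>}. L2_inner a b (x \<nu>) (x \<mu>))"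
      by (rule sum.mono_neutral_right) (use L \<nu> x eig_orthogonal[of "x \<nu>" \<nu>] in blast)+
    finally show ?thesis using L(1) by (simp add: * )
  qed
  obtain B where B: "independent B" "finite B" "card B = (\<Sum>\<mu>\<in>L. d \<mu>)" "B \<subseteq> sl_space a b"
    "\<And>v. v \<in> span B \<Longrightarrow> \<exists>x. (\<forall>\<mu>\<in>L. x \<mu> \<in> sl_eig K a b \<mu>) \<and> v = (\<Sum>\<mu>\<in>L. x \<mu>)"
  proof (rule edim_direct_sum_ge[OF L(1) subspace_eig d _ subspace_sl_space])
    show "\<forall>\<mu>\<in>L. x \<mu> = 0" if x: "\<And>\<mu>. \<mu> \<in> L \<Longrightarrow> x \<mu> \<in> sl_eig K a b \<mu>" "(\<Sum>\<mu>\<in>L. x \<mu>) = 0" for x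
    proof
      fix \<nu> assume \<nu>: "\<nu> \<in> L"
      have "L2_inner a b (x \<nu>) (x \<nu>) = L2_inner a b (x \<nu>) 0" using ip[of x \<nu>] x \<nu> by simp
      then have "L2_inner a b (x \<nu>) (x \<nu>) = 0" by (simp add: L2_inner_def)
      then show "x \<nu> = 0" using L2_inner_space(3)[of "x \<nu>" "x \<nu>" "x \<nu>"] sl_eigD(1)[OF x(1)[OF \<nu>]] by blast
    qed
    show "sl_eig K a b \<mu> \<subseteq> sl_space a b" for \<mu> using sl_eigD(1) by blast
  qed blast
  \<comment> \<open>On the span the form is the sum of
    \<open>\<mu> * L2_inner a b (x \<mu>) (x \<mu>)\<close>: all terms are nonpositive and one with
    \<open>x \<nu> \<noteq> 0\<close> is negative.\<close>
  have neg: "negative_definite_on (sl_form K a b) (span B)"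
    unfolding negative_definite_on_def
  proof (intro ballI impI)
    fix v assume v: "v \<in> span B" "v \<noteq> 0"
    obtain x where x: "\<forall>\<mu>\<in>L. x \<mu> \<in> sl_eig K a b \<mu>" "v = (\<Sum>\<mu>\<in>L. x \<mu>)" using B(5)[OF v(1)] by blast
    have vS: "v \<in> sl_space a b" using inS x by blast
    have "sl_form K a b (\<Sum>\<mu>\<in>M. x \<mu>) v = (\<Sum>\<mu>\<in>M. sl_form K a b (x \<mu>) v)" if "finite M" "M \<subseteq> L" for M
      using that
    proof (induction M rule: finite_induct)
      case empty
      have "sl_form K a b 0 v = sl_form K a b 0 v + sl_form K a b 0 v"
        using form_add_left[OF subspace_0[OF subspace_sl_space] subspace_0[OF subspace_sl_space] vS]
        by (simp only: add_0)
      then show ?case unfolding sum.empty by linarith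
    next
      case (insert m M)
      have e: "(\<Sum>\<mu>\<in>insert m M. x \<mu>) = x m + (\<Sum>\<mu>\<in>M. x \<mu>)"
        using insert by (intro sum.insert)
      have "sl_form K a b (\<Sum>\<mu>\<in>insert m M. x \<mu>) v = sl_form K a b (x m) v + sl_form K a b (\<Sum>\<mu>\<in>M. x \<mu>) v"
        unfolding e by (rule form_add_left) (use insert x vS inS[of M x] sl_eigD(1) in blast)+
      also have "\<dots> = (\<Sum>\<mu>\<in>insert m M. sl_form K a b (x \<mu>) v)" using insert by simp
      finally show ?case .
    qed
    then have "sl_form K a b v v = (\<Sum>\<mu>\<in>L. sl_form K a b (x \<mu>) v)" using L(1) x(2) by simp
    also have "\<dots> = (\<Sum>\<mu>\<in>L. \<mu> * L2_inner a b (x \<mu>) (x \<mu>))"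
    proof (rule sum.cong[OF refl])
      fix \<mu> assume \<mu>: "\<mu> \<in> L"
      show "sl_form K a b (x \<mu>) v = \<mu> * L2_inner a b (x \<mu>) (x \<mu>)"
        using form_eig[of "x \<mu>" \<mu> v] x(1) \<mu> vS ip[OF x(1) \<mu>] x(2) by simp
    qed
    also have "\<dots> < 0"
    proof -
      obtain \<nu> where \<nu>: "\<nu> \<in> L" "x \<nu> \<noteq> 0" using v(2) x(2) by (metis sum.neutral)
      have "L2_inner a b (x \<nu>) (x \<nu>) \<noteq> 0"
        using L2_inner_space(3)[of "x \<nu>" "x \<nu>" "x \<nu>"] x(1) \<nu> sl_eigD(1) by blast
      then have "0 < L2_inner a b (x \<nu>) (x \<nu>)" using L2_inner_self_ge_0[of a b "x \<nu>"] by simp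
      then have "\<nu> * L2_inner a b (x \<nu>) (x \<nu>) < 0" using \<nu>(1) L(2) by (auto simp: mult_less_0_iff)
      moreover have "(\<Sum>\<mu>\<in>L - {\<nu>}. \<mu> * L2_inner a b (x \<mu>) (x \<mu>)) \<le> 0"
        using L(2) L2_inner_self_ge_0 by (intro sum_nonpos mult_nonpos_nonneg) auto
      ultimately show ?thesis using sum.remove[OF L(1) \<nu>(1), of "\<lambda>\<mu>. \<mu> * L2_inner a b (x \<mu>) (x \<mu>)"] by simp
    qed
    finally show "sl_form K a b v v < 0" .
  qed
  have "span B \<subseteq> sl_space a b" using span_minimal[OF B(4) subspace_sl_space] .
  then have "edim (span B) \<le> form_index (sl_form K a b) (sl_space a b)"
    unfolding form_index_def by (intro Sup_upper CollectI exI[of _ "span B"] conjI refl subspace_span neg)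
  moreover have "edim (span B) = enat (card B)"
    using edim_basis[OF B(1) span_superset order_refl] B(2) by simp
  moreover have "enat (\<Sum>\<mu>\<in>L. d \<mu>) = (\<Sum>\<mu>\<in>L. edim (sl_eig K a b \<mu>))"
    unfolding d by (rule enat_sum)
  ultimately show ?thesis using B(3) by simp
qed

end

subsection \<open>The Jacobi matrix and the inequality between index and conjugate values\<close>

text \<open>By rank-nullity \<open>P (ker M)\<close> fills the whole orthogonal complement of the range of \<open>M\<close>.\<close>

lemma range_orthogonal_kernel:
  fixes M P :: "real^'n^'n"
  assumes orth: "\<And>u w. M *v w = 0 \<Longrightarrow> (M *v u) \<bullet> (P *v w) = 0"
    and inj: "\<And>w. M *v w = 0 \<Longrightarrow> P *v w = 0 \<Longrightarrow> w = 0"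
    and z: "\<And>w. M *v w = 0 \<Longrightarrow> z \<bullet> (P *v w) = 0"
  shows "z \<in> range ((*v) M)"
proof -
  let ?N = "{w. M *v w = 0}" and ?R = "range ((*v) M)"
  have sN: "subspace ?N" by (auto simp: subspace_def matrix_vector_right_distrib matrix_vector_mult_scaleR)
  have sR: "subspace ?R" by (intro linear_subspace_image) auto
  \<comment> \<open>The kernel is the orthogonal complement of the row space, whose dimension is
    that of the range; rank-nullity is obtained in this form.\<close>
  have row_orth: "?N = {y \<in> UNIV. \<forall>x\<in>span (rows M). orthogonal x y}"
  proof -
    have "row i M = M $ i" for i by (simp add: row_def vec_eq_iff)
    moreover have "M *v y = 0 \<longleftrightarrow> (\<forall>i. (M $ i) \<bullet> y = 0)" for y
      by (simp add: vec_eq_iff[of "M *v y"] matrix_vector_mul_component)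
    ultimately have "M *v y = 0 \<longleftrightarrow> (\<forall>x\<in>rows M. orthogonal x y)" for y
      by (auto simp: rows_def orthogonal_def)
    moreover have "(\<forall>x\<in>rows M. orthogonal x y) \<longleftrightarrow> (\<forall>x\<in>span (rows M). orthogonal x y)" for y
      by (meson orthogonal_commute orthogonal_to_span span_base)
    ultimately show ?thesis by auto
  qed
  have dN: "dim ?N + dim ?R = CARD('n)"
    using dim_subspace_orthogonal_to_vectors[of "span (rows M)" UNIV]
    unfolding row_orth[symmetric] by (simp add: row_rank_def[symmetric] rank_dim_range)
  let ?Rp = "{y \<in> UNIV. \<forall>x\<in>?R. orthogonal x y}"
  have dRp: "dim ?Rp + dim ?R = CARD('n)"
    using dim_subspace_orthogonal_to_vectors[OF sR subspace_UNIV] by simp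
  have "dim ((*v) P ` ?N) = dim ?N"
  proof (rule dim_image_eq)
    show "inj_on ((*v) P) (span ?N)"
    proof (rule inj_onI)
      fix x y assume "x \<in> span ?N" "y \<in> span ?N" "P *v x = P *v y"
      then have "M *v (x - y) = 0" "P *v (x - y) = 0"
        unfolding span_eq_iff[THEN iffD2, OF sN] by (auto simp: matrix_vector_mult_diff_distrib)
      then show "x = y" using inj[of "x - y"] by simp
    qed
  qed auto
  moreover have "(*v) P ` ?N \<subseteq> ?Rp" using orth by (auto simp: orthogonal_def)
  moreover have "subspace ((*v) P ` ?N)" by (intro linear_subspace_image sN) auto
  moreover have "subspace ?Rp"
    by (auto simp: subspace_def orthogonal_def inner_add_right)
  ultimately have eq: "(*v) P ` ?N = ?Rp" using dN dRp by (intro subspace_dim_equal) auto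
  have "z \<in> ?R\<^sup>\<bottom>\<^sup>\<bottom>"
  proof -
    have "orthogonal y z" if "y \<in> ?R\<^sup>\<bottom>" for y
    proof -
      have "y \<in> ?Rp" using that by (auto simp: orthogonal_comp_def orthogonal_commute)
      then obtain w where "M *v w = 0" "y = P *v w" unfolding eq[symmetric] by blast
      then show ?thesis using z[of w] by (simp add: orthogonal_def inner_commute)
    qed
    then show ?thesis by (auto simp: orthogonal_comp_def orthogonal_commute)
  qed
  then show ?thesis using orthogonal_comp_self[OF sR] by simp
qed

text \<open>\<open>P\<close> is the derivative of \<open>J\<close>. The initial values make
  \<open>J s *v u\<close> the Jacobi field that is 0 at \<open>a\<close> and has derivative
  \<open>u\<close> there.\<close>

locale jacobi_matrix = sturm_liouville K a b
  for K :: "real \<Rightarrow> real^'n^'n" and a b :: real +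
  fixes J P :: "real \<Rightarrow> real^'n^'n"
  assumes J_deriv: "s \<in> {a..b} \<Longrightarrow> (J has_vector_derivative P s) (at s within {a..b})"
    and P_deriv: "s \<in> {a..b} \<Longrightarrow> (P has_vector_derivative K s ** J s) (at s within {a..b})"
    and J_a: "J a = 0" and P_a: "P a = mat 1"

lemma (in sturm_liouville) jacobi_matrix_exists: "\<exists>J P. jacobi_matrix K a b J P"
proof -
  define F where "F s = (\<lambda>z :: (real^'n^'n) \<times> (real^'n^'n). (snd z, K s ** fst z))" for s
  have "linear (F s)" for s
    using bounded_bilinear.add_right[OF bounded_bilinear_mat_mat]
      bounded_bilinear.scaleR_right[OF bounded_bilinear_mat_mat]
    unfolding F_def by (intro linearI) simp_all
  moreover have "continuous_on {a..b} (\<lambda>s. F s z)" for z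
    unfolding F_def by (intro continuous_on_Pair continuous_on_const
        bounded_bilinear.continuous_on[OF bounded_bilinear_mat_mat] cont_K)
  ultimately obtain z where z: "z a = (0, mat 1)"
    "\<And>s. s \<in> {a..b} \<Longrightarrow> (z has_vector_derivative (F s (z s) + 0)) (at s within {a..b})"
    using linear_ode_exists_pointwise[of a b F "\<lambda>_. 0" "(0, mat 1)"] ab by (metis continuous_on_const less_imp_le)
  have "jacobi_matrix K a b (\<lambda>s. fst (z s)) (\<lambda>s. snd (z s))"
  proof unfold_locales
    fix s assume s: "s \<in> {a..b}"
    show "((\<lambda>s. fst (z s)) has_vector_derivative snd (z s)) (at s within {a..b})"
      using bounded_linear.has_vector_derivative[OF bounded_linear_fst z(2)[OF s]] by (simp add: F_def)
    show "((\<lambda>s. snd (z s)) has_vector_derivative K s ** fst (z s)) (at s within {a..b})"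
      using bounded_linear.has_vector_derivative[OF bounded_linear_snd z(2)[OF s]] by (simp add: F_def)
  qed (use z in auto)
  then show ?thesis by blast
qed

context jacobi_matrix
begin

lemma Ju_deriv: "s \<in> {a..b} \<Longrightarrow> ((\<lambda>s. J s *v u) has_vector_derivative P s *v u) (at s within {a..b})"
  by (rule mat_vec_const_deriv[OF J_deriv])

lemma Pu_deriv: "s \<in> {a..b} \<Longrightarrow> ((\<lambda>s. P s *v u) has_vector_derivative K s *v (J s *v u)) (at s within {a..b})"
  using mat_vec_const_deriv[OF P_deriv] by (simp add: matrix_vector_mul_assoc)

lemma Pu_deriv': "s \<in> {a..b} \<Longrightarrow> ((\<lambda>s. P s *v u) has_vector_derivative (K s *v (J s *v u) - 0 *\<^sub>R (J s *v u))) (at s within {a..b})"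
  using Pu_deriv by simp

lemma cont_J: "continuous_on {a..b} J" and cont_P: "continuous_on {a..b} P"
  using continuous_on_deriv[OF J_deriv] continuous_on_deriv[OF P_deriv] by simp_all

text \<open>Symmetry of \<open>K\<close> makes the difference of the two sides constant, and it is
  zero at \<open>a\<close> because \<open>J a = 0\<close>.\<close>

lemma wronskian:
  assumes "s \<in> {a..b}"
  shows "(J s *v u) \<bullet> (P s *v v) = (P s *v u) \<bullet> (J s *v v)"
proof -
  let ?f = "\<lambda>s. (J s *v u) \<bullet> (P s *v v) - (P s *v u) \<bullet> (J s *v v)"
  have "(?f has_vector_derivative 0) (at r within {a..b})" if r: "r \<in> {a..b}" for r
  proof -
    have "(?f has_vector_derivative
      ((J r *v u) \<bullet> (K r *v (J r *v v)) + (P r *v u) \<bullet> (P r *v v)) -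
      ((P r *v u) \<bullet> (P r *v v) + (K r *v (J r *v u)) \<bullet> (J r *v v))) (at r within {a..b})"
      by (intro has_vector_derivative_diff inner_deriv Ju_deriv Pu_deriv r)
    then show ?thesis using sym_K[OF r] by simp
  qed
  then have "?f s = ?f a" by (rule constant_on_Icc) (use assms ab in auto)
  then show ?thesis by (simp add: J_a)
qed

text \<open>Zero Cauchy data at one point make the Jacobi field vanish identically, hence also its
  derivative at \<open>a\<close>, which is \<open>u\<close>.\<close>

lemma J_P_inj:
  assumes "s \<in> {a..b}" "J s *v u = 0" "P s *v u = 0"
  shows "u = 0"
proof -
  have J0: "J r *v u = 0" if "r \<in> {a..b}" for r
    by (rule solution_zero[OF Ju_deriv Pu_deriv' assms(1) assms(2,3) that])
  have a: "a \<in> {a..b}" using ab by simp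
  have "((\<lambda>s. J s *v u) has_vector_derivative 0) (at a within {a..b})"
    by (rule has_vector_derivative_transform[OF a _ has_vector_derivative_const]) (use J0 in auto)
  then have "P a *v u = 0"
    using ivl_deriv_eq[OF ab a] Ju_deriv[OF a] by metis
  then show ?thesis by (simp add: P_a)
qed

text \<open>By compactness, a failure would produce a unit vector \<open>w\<close> with \<open>J t w = 0\<close> and, dividing
  the Wronskian identity by \<open>s - t\<close>, with \<open>|P t w|\<^sup>2 = 0\<close>.\<close>

lemma J_lower_bound:
  assumes t: "t \<in> {a..b}"
  obtains \<delta> c where "0 < \<delta>" "0 < c"
    "\<And>s u. s \<in> {a..b} \<Longrightarrow> \<bar>s - t\<bar> < \<delta> \<Longrightarrow> c * \<bar>s - t\<bar> * norm u \<le> norm (J s *v u)"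
proof (rule ccontr)
  assume neg: "\<not> thesis"
  have "\<exists>s u. s \<in> {a..b} \<and> \<bar>s - t\<bar> < inverse (real (Suc k)) \<and>
      norm (J s *v u) < inverse (real (Suc k)) * \<bar>s - t\<bar> * norm u" for k
  proof (rule ccontr)
    assume "\<not> ?thesis"
    then have "inverse (real (Suc k)) * \<bar>s - t\<bar> * norm u \<le> norm (J s *v u)"
      if "s \<in> {a..b}" "\<bar>s - t\<bar> < inverse (real (Suc k))" for s u using that by (meson not_le)
    then show False using neg that[of "inverse (real (Suc k))" "inverse (real (Suc k))"]
      by (simp del: of_nat_Suc)
  qed
  then obtain s u where su: "\<And>k. s k \<in> {a..b}" "\<And>k. \<bar>s k - t\<bar> < inverse (real (Suc k))"
    "\<And>k. norm (J (s k) *v u k) < inverse (real (Suc k)) * \<bar>s k - t\<bar> * norm (u k)" by metis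
  \<comment> \<open>The inequality in \<open>su\<close> is strict, which excludes both a zero vector
    and the point \<open>t\<close> itself.\<close>
  have ne: "s k \<noteq> t" "u k \<noteq> 0" for k
    using su(3)[of k] by auto
  define v where "v k = (1 / norm (u k)) *\<^sub>R u k" for k
  have v1: "norm (v k) = 1" for k using ne(2)[of k] by (simp add: v_def)
  have v2: "norm (J (s k) *v v k) \<le> inverse (real (Suc k)) * \<bar>s k - t\<bar>" for k
  proof -
    have "norm (J (s k) *v v k) = norm (J (s k) *v u k) / norm (u k)"
      by (simp add: v_def matrix_vector_mult_scaleR)
    then show ?thesis using su(3)[of k] ne(2)[of k] by (simp add: divide_le_eq)
  qed
  obtain w r where w: "w \<in> sphere 0 1" "strict_mono (r :: nat \<Rightarrow> nat)" "(v \<circ> r) \<longlonglongrightarrow> w"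
    using compact_sphere[of "0 :: real^'n" 1] v1 unfolding compact_def by (metis mem_sphere_0)
  have inv0: "(\<lambda>k. inverse (real (Suc k))) \<longlonglongrightarrow> 0" by (rule LIMSEQ_inverse_real_of_nat)
  have "(\<lambda>k. s k - t) \<longlonglongrightarrow> 0"
    by (rule Lim_null_comparison[OF _ inv0]) (use su(2) in \<open>auto intro!: always_eventually less_imp_le\<close>)
  then have "s \<longlonglongrightarrow> t" by (rule LIM_zero_cancel)
  then have st: "(\<lambda>k. s (r k)) \<longlonglongrightarrow> t" using LIMSEQ_subseq_LIMSEQ[OF _ w(2)] by (simp add: o_def)
  have Jlim: "(\<lambda>k. J (s (r k))) \<longlonglongrightarrow> J t" and Plim: "(\<lambda>k. P (s (r k))) \<longlonglongrightarrow> P t"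
    using continuous_on_tendsto_compose[OF cont_J st t] continuous_on_tendsto_compose[OF cont_P st t] su(1) by auto
  have vw: "(\<lambda>k. v (r k)) \<longlonglongrightarrow> w" using w(3) by (simp add: o_def)
  note mvt = bounded_bilinear.tendsto[OF bounded_bilinear_mat_vec]
  have inv0r: "(\<lambda>k. inverse (real (Suc (r k)))) \<longlonglongrightarrow> 0"
    using LIMSEQ_subseq_LIMSEQ[OF inv0 w(2)] by (simp add: o_def)
  have "(\<lambda>k. inverse (real (Suc (r k))) * \<bar>s (r k) - t\<bar>) \<longlonglongrightarrow> 0 * \<bar>t - t\<bar>"
    by (intro tendsto_intros inv0r st)
  then have b0: "(\<lambda>k. inverse (real (Suc (r k))) * \<bar>s (r k) - t\<bar>) \<longlonglongrightarrow> 0" by simp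
  have "(\<lambda>k. J (s (r k)) *v v (r k)) \<longlonglongrightarrow> 0"
    by (rule Lim_null_comparison[OF always_eventually b0]) (intro allI v2)
  with mvt[OF Jlim vw] have Jw: "J t *v w = 0" by (rule LIMSEQ_unique)
  \<comment> \<open>As \<open>J t *v w = 0\<close>, this is the difference quotient at
    \<open>t\<close> of the Jacobi field belonging to \<open>w\<close>.\<close>
  have quot: "(\<lambda>k. (1 / (s (r k) - t)) *\<^sub>R (J (s (r k)) *v w)) \<longlonglongrightarrow> P t *v w"
  proof -
    have "((\<lambda>q. (1 / (q - t)) *\<^sub>R (J q *v w - J t *v w)) \<longlongrightarrow> P t *v w) (at t within {a..b})"
    proof -
      have "((\<lambda>q. (1 / norm (q - t)) *\<^sub>R (J q *v w - J t *v w - (q - t) *\<^sub>R (P t *v w))) \<longlongrightarrow> 0) (at t within {a..b})"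
        using Ju_deriv[OF t, of w] unfolding has_vector_derivative_def has_derivative_within
        by (simp add: algebra_simps)
      then have "((\<lambda>q. norm ((1 / norm (q - t)) *\<^sub>R (J q *v w - J t *v w - (q - t) *\<^sub>R (P t *v w)))) \<longlongrightarrow> 0) (at t within {a..b})"
        by (rule tendsto_norm_zero)
      moreover have "\<forall>\<^sub>F q in at t within {a..b}. norm ((1 / norm (q - t)) *\<^sub>R (J q *v w - J t *v w - (q - t) *\<^sub>R (P t *v w)))
          = norm ((1 / (q - t)) *\<^sub>R (J q *v w - J t *v w) - P t *v w)"
        unfolding eventually_at_filter
      proof (rule always_eventually, intro allI impI)
        fix q assume "q \<noteq> t"
        then have "(1 / (q - t)) *\<^sub>R (J q *v w - J t *v w) - P t *v w = (1 / (q - t)) *\<^sub>R (J q *v w - J t *v w - (q - t) *\<^sub>R (P t *v w))"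
          by (simp add: scaleR_diff_right)
        then show "norm ((1 / norm (q - t)) *\<^sub>R (J q *v w - J t *v w - (q - t) *\<^sub>R (P t *v w)))
          = norm ((1 / (q - t)) *\<^sub>R (J q *v w - J t *v w) - P t *v w)" by simp
      qed
      ultimately have "((\<lambda>q. norm ((1 / (q - t)) *\<^sub>R (J q *v w - J t *v w) - P t *v w)) \<longlongrightarrow> 0) (at t within {a..b})"
        by (rule Lim_transform_eventually)
      then show ?thesis by (rule LIM_zero_cancel[OF tendsto_norm_zero_cancel])
    qed
    moreover have "filterlim (\<lambda>k. s (r k)) (at t within {a..b}) sequentially"
    proof (rule filterlim_at[THEN iffD2], rule conjI[OF always_eventually st], rule allI)
      show "s (r k) \<in> {a..b} \<and> s (r k) \<noteq> t" for k using su(1) ne(1) by blast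
    qed
    ultimately have "(\<lambda>k. (1 / (s (r k) - t)) *\<^sub>R (J (s (r k)) *v w - J t *v w)) \<longlonglongrightarrow> P t *v w"
      by (rule filterlim_compose[where g="\<lambda>q. (1 / (q - t)) *\<^sub>R (J q *v w - J t *v w)"])
    then show ?thesis using Jw by simp
  qed
  \<comment> \<open>The bound in \<open>v2\<close> contains the factor
    \<open>\<bar>s k - t\<bar>\<close>; after division by it the factor tending to zero still
    remains.\<close>
  have lhs: "(\<lambda>k. ((1 / (s (r k) - t)) *\<^sub>R (J (s (r k)) *v v (r k))) \<bullet> (P (s (r k)) *v w)) \<longlonglongrightarrow> 0 \<bullet> (P t *v w)"
  proof (intro tendsto_inner mvt Plim tendsto_const Lim_null_comparison[OF _ inv0r] always_eventually allI)
    fix k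
    have "\<bar>s (r k) - t\<bar> > 0" using ne(1) by simp
    then show "norm ((1 / (s (r k) - t)) *\<^sub>R (J (s (r k)) *v v (r k))) \<le> inverse (real (Suc (r k)))"
      using v2[of "r k"] by (simp add: divide_le_eq del: of_nat_Suc)
  qed
  have eq: "((1 / (s (r k) - t)) *\<^sub>R (J (s (r k)) *v v (r k))) \<bullet> (P (s (r k)) *v w) =
      (P (s (r k)) *v v (r k)) \<bullet> ((1 / (s (r k) - t)) *\<^sub>R (J (s (r k)) *v w))" for k
    using wronskian[OF su(1)] by simp
  have "(\<lambda>k. (P (s (r k)) *v v (r k)) \<bullet> ((1 / (s (r k) - t)) *\<^sub>R (J (s (r k)) *v w))) \<longlonglongrightarrow> 0"
    using lhs unfolding eq inner_zero_left .
  moreover have "(\<lambda>k. (P (s (r k)) *v v (r k)) \<bullet> ((1 / (s (r k) - t)) *\<^sub>R (J (s (r k)) *v w))) \<longlonglongrightarrow> (P t *v w) \<bullet> (P t *v w)"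
    by (intro tendsto_inner mvt Plim vw quot)
  ultimately have "0 = (P t *v w) \<bullet> (P t *v w)" by (rule LIMSEQ_unique)
  then have "w = 0" using J_P_inj[OF t Jw] by simp
  then show False using w(1) by simp
qed

definition conj_set :: "real set"
  where "conj_set = {t \<in> {a<..<b}. \<exists>u. u \<noteq> 0 \<and> J t *v u = 0}"

text \<open>Near an accumulation point the linear lower bound would be violated by kernel vectors of
  \<open>J s\<close>. That bound is available at \<open>a\<close> and \<open>b\<close> too, so
  conjugate values do not accumulate at the ends either.\<close>

lemma finite_conj_set: "finite conj_set"
proof (rule ccontr)
  assume "infinite conj_set"
  moreover have "conj_set \<subseteq> {a..b}" by (auto simp: conj_set_def)
  ultimately obtain t where t: "t \<in> {a..b}" "t islimpt conj_set"
    using compact_eq_Bolzano_Weierstrass[of "{a..b}"] by auto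
  obtain \<delta> c where d: "0 < \<delta>" "0 < c"
    "\<And>s u. s \<in> {a..b} \<Longrightarrow> \<bar>s - t\<bar> < \<delta> \<Longrightarrow> c * \<bar>s - t\<bar> * norm u \<le> norm (J s *v u)"
    using J_lower_bound[OF t(1)] by blast
  obtain s where s: "s \<in> conj_set" "s \<noteq> t" "dist s t < \<delta>"
    using t(2) d(1) by (meson islimpt_approachable)
  then obtain u where u: "u \<noteq> 0" "J s *v u = 0" "s \<in> {a..b}" by (auto simp: conj_set_def)
  have "c * \<bar>s - t\<bar> * norm u \<le> 0" using d(3)[of s u] s u by (simp add: dist_real_def)
  moreover have "0 < c * \<bar>s - t\<bar> * norm u" using d(2) s(2) u(1) by simp
  ultimately show False by simp
qed

text \<open>Multiplicity becomes the dimension of a matrix kernel: the Jacobi fields vanishing at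
  \<open>a\<close> are the \<open>J u\<close>, and the condition at \<open>t\<close> is
  \<open>J t *v u = 0\<close>.\<close>

lemma edim_kernel_eig:
  assumes t: "t \<in> {a<..b}"
  shows "edim (sl_eig K a t 0) = edim {u. J t *v u = 0}"
proof -
  interpret r: sturm_liouville K a t by (rule restrict[OF t])
  have sub: "{a..t} \<subseteq> {a..b}" using t by auto
  let ?f = "\<lambda>u s. if s \<in> {a..t} then J s *v u else 0"
  have lin: "linear ?f"
    by (rule linearI) (auto simp: fun_eq_iff matrix_vector_right_distrib scaleR_fun_def matrix_vector_mult_scaleR)
  have dJ: "((\<lambda>s. J s *v u) has_vector_derivative P s *v u) (at s within {a..t})"
    "((\<lambda>s. P s *v u) has_vector_derivative (K s *v (J s *v u) - 0 *\<^sub>R (J s *v u))) (at s within {a..t})"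
    if "s \<in> {a..t}" for s u
    using has_vector_derivative_within_subset[OF Ju_deriv sub] has_vector_derivative_within_subset[OF Pu_deriv' sub] that sub
    by blast+
  have at: "a \<in> {a..t}" using t by simp
  have inj: "inj_on ?f {u. J t *v u = 0}"
  proof (rule inj_onI)
    fix u v assume f: "?f u = ?f v"
    have z: "J s *v (u - v) = 0" if "s \<in> {a..t}" for s
      using fun_cong[OF f, of s] that by (simp add: matrix_vector_mult_diff_distrib)
    have "((\<lambda>s. J s *v (u - v)) has_vector_derivative 0) (at a within {a..t})"
      by (rule has_vector_derivative_transform[OF at _ has_vector_derivative_const]) (use z in auto)
    then have "P a *v (u - v) = 0"
      using ivl_deriv_eq[OF r.ab at] dJ(1)[OF at] by metis
    then show "u = v" by (simp add: P_a)
  qed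
  have "?f ` {u. J t *v u = 0} = sl_eig K a t 0"
  proof
    show "?f ` {u. J t *v u = 0} \<subseteq> sl_eig K a t 0"
      using r.solution_in_eig[OF dJ] J_a by auto
    show "sl_eig K a t 0 \<subseteq> ?f ` {u. J t *v u = 0}"
    proof
      fix x assume x: "x \<in> sl_eig K a t 0"
      note X = r.sl_eigD[OF x] r.sl_spaceD[OF r.sl_eigD(1)[OF x]]
      \<comment> \<open>The preimage is the initial derivative: \<open>x\<close> and
        \<open>J ?u\<close> then have the same Cauchy data at \<open>a\<close>.\<close>
      let ?u = "ivl_deriv a t x a"
      have eq: "x s = J s *v ?u" if s: "s \<in> {a..t}" for s
      proof -
        have "x s - J s *v ?u = 0"
        proof (rule r.solution_zero[where x="\<lambda>s. x s - J s *v ?u" and y="\<lambda>s. ivl_deriv a t x s - P s *v ?u" and \<mu>=0, OF _ _ at _ _ s])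
          fix q assume q: "q \<in> {a..t}"
          show "((\<lambda>s. x s - J s *v ?u) has_vector_derivative (ivl_deriv a t x q - P q *v ?u)) (at q within {a..t})"
            by (intro has_vector_derivative_diff dJ X(9) q)
          have "((\<lambda>s. ivl_deriv a t x s - P s *v ?u) has_vector_derivative
             ((K q *v x q - 0 *\<^sub>R x q) - (K q *v (J q *v ?u) - 0 *\<^sub>R (J q *v ?u)))) (at q within {a..t})"
            by (intro has_vector_derivative_diff dJ X(2) q)
          then show "((\<lambda>s. ivl_deriv a t x s - P s *v ?u) has_vector_derivative
             (K q *v (x q - J q *v ?u) - 0 *\<^sub>R (x q - J q *v ?u))) (at q within {a..t})"
            by (simp add: matrix_vector_mult_diff_distrib)
        qed (use X(4) J_a P_a in simp_all)
        then show ?thesis by simp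
      qed
      have "x = ?f ?u" using eq X(6) by (auto simp: fun_eq_iff)
      moreover have "J t *v ?u = 0" using eq[of t] X(5) t by simp
      ultimately show "x \<in> ?f ` {u. J t *v u = 0}" by blast
    qed
  qed
  then show ?thesis
    using edim_image_inj[OF lin _ inj] by (simp add: subspace_def matrix_vector_right_distrib matrix_vector_mult_scaleR)
qed

end

section \<open>Continuity and differentiability at a point from linear and quadratic bounds\<close>

lemma has_vector_derivative_lipschitz:
  fixes f :: "real \<Rightarrow> 'b::real_normed_vector"
  assumes "(f has_vector_derivative D) (at t within S)"
  obtains \<delta> where "0 < \<delta>"
    "\<And>s. s \<in> S \<Longrightarrow> \<bar>s - t\<bar> < \<delta> \<Longrightarrow> norm (f s - f t) \<le> (norm D + 1) * \<bar>s - t\<bar>"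
proof -
  have "\<forall>e>0. \<exists>d>0. \<forall>s\<in>S. norm (s - t) < d \<longrightarrow> norm (f s - f t - (s - t) *\<^sub>R D) \<le> e * norm (s - t)"
    using assms unfolding has_vector_derivative_def has_derivative_within_alt by blast
  then obtain d where d: "d > 0" "\<And>s. s \<in> S \<Longrightarrow> norm (s - t) < d \<Longrightarrow> norm (f s - f t - (s - t) *\<^sub>R D) \<le> 1 * norm (s - t)"
    by (meson zero_less_one)
  have "norm (f s - f t) \<le> (norm D + 1) * \<bar>s - t\<bar>" if s: "s \<in> S" "\<bar>s - t\<bar> < d" for s
  proof -
    have "norm (f s - f t) \<le> norm (f s - f t - (s - t) *\<^sub>R D) + norm ((s - t) *\<^sub>R D)"
      by (metis norm_triangle_ineq diff_add_cancel)
    moreover have "norm ((s - t) *\<^sub>R D) = norm D * \<bar>s - t\<bar>" by simp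
    moreover have "norm (f s - f t - (s - t) *\<^sub>R D) \<le> \<bar>s - t\<bar>" using d(2)[of s] s by simp
    ultimately show ?thesis unfolding distrib_right mult_1 by linarith
  qed
  then show ?thesis using that d(1) by blast
qed

lemma has_vector_derivative_quadratic:
  fixes r :: "real \<Rightarrow> 'b::real_normed_vector"
  assumes "0 < \<delta>" "r t = 0" "\<And>s. s \<in> S \<Longrightarrow> \<bar>s - t\<bar> < \<delta> \<Longrightarrow> norm (r s) \<le> C * \<bar>s - t\<bar>\<^sup>2"
  shows "(r has_vector_derivative 0) (at t within S)"
  unfolding has_vector_derivative_def has_derivative_within_alt
proof (intro conjI allI impI)
  fix e :: real assume e: "0 < e"
  let ?d = "min \<delta> (e / (\<bar>C\<bar> + 1))"
  have "norm (r s - r t - (s - t) *\<^sub>R 0) \<le> e * norm (s - t)" if s: "s \<in> S" "norm (s - t) < ?d" for s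
  proof -
    have "norm (r s) \<le> C * \<bar>s - t\<bar>\<^sup>2" using assms(3) s by simp
    also have "\<dots> \<le> (\<bar>C\<bar> + 1) * \<bar>s - t\<bar>\<^sup>2" by (intro mult_right_mono) auto
    also have "\<dots> = ((\<bar>C\<bar> + 1) * \<bar>s - t\<bar>) * \<bar>s - t\<bar>" by (simp add: power2_eq_square)
    also have "\<dots> \<le> e * \<bar>s - t\<bar>"
      using s by (intro mult_right_mono) (auto simp: field_simps)
    finally show ?thesis using assms(2) by simp
  qed
  moreover have "0 < ?d" using assms(1) e by (simp add: add_nonneg_pos)
  ultimately show "\<exists>d>0. \<forall>s\<in>S. norm (s - t) < d \<longrightarrow> norm (r s - r t - (s - t) *\<^sub>R 0) \<le> e * norm (s - t)"
    by blast
qed simp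

lemma continuous_lipschitz_at:
  fixes r :: "real \<Rightarrow> 'b::real_normed_vector"
  assumes "0 < \<delta>" "r t = 0" "\<And>s. s \<in> S \<Longrightarrow> \<bar>s - t\<bar> < \<delta> \<Longrightarrow> norm (r s) \<le> C * \<bar>s - t\<bar>"
  shows "continuous (at t within S) r"
  unfolding continuous_within_eps_delta
proof (intro allI impI)
  fix e :: real assume e: "0 < e"
  let ?d = "min \<delta> (e / (\<bar>C\<bar> + 1))"
  have "dist (r s) (r t) < e" if s: "s \<in> S" "dist s t < ?d" for s
  proof -
    have "norm (r s) \<le> C * \<bar>s - t\<bar>" using assms(3) s by (simp add: dist_real_def)
    also have "\<dots> \<le> (\<bar>C\<bar> + 1) * \<bar>s - t\<bar>" by (intro mult_right_mono) auto
    also have "\<dots> < e" using s by (auto simp: field_simps dist_real_def)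
    finally show ?thesis using assms(2) by simp
  qed
  moreover have "0 < ?d" using assms(1) e by (simp add: add_nonneg_pos)
  ultimately show "\<exists>d>0. \<forall>s\<in>S. dist s t < d \<longrightarrow> dist (r s) (r t) < e" by blast
qed

lemma mat_vec_norm_bound:
  obtains C where "0 < C" "\<And>(A::real^'n^'m) x. norm (A *v x) \<le> C * norm A * norm x"
proof -
  have "\<exists>C>0. \<forall>(A::real^'n^'m) x. norm (A *v x) \<le> norm A * norm x * C"
    by (rule bounded_bilinear.pos_bounded[OF bounded_bilinear_mat_vec])
  then show ?thesis using that by (auto simp: mult_ac)
qed

section \<open>Legendre's identity and the bound of the index by the conjugate values\<close>

context jacobi_matrix
begin

text \<open>Where \<open>J t\<close> is injective it is bounded below, and a small perturbation
  keeps half of the bound. Unlike at a conjugate value there is no factor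
  \<open>\<bar>s - t\<bar>\<close>.\<close>

lemma regular_lower_bound:
  assumes t: "t \<in> {a..b}" and inj: "\<And>u. J t *v u = 0 \<Longrightarrow> u = 0"
  obtains \<delta> c where "0 < \<delta>" "0 < c"
    "\<And>s u. s \<in> {a..b} \<Longrightarrow> \<bar>s - t\<bar> < \<delta> \<Longrightarrow> c * norm u \<le> norm (J s *v u)"
proof -
  have "inj ((*v) (J t))"
  proof (rule injI)
    fix x y assume "J t *v x = J t *v y"
    then have "J t *v (x - y) = 0" by (simp add: matrix_vector_mult_diff_distrib)
    then show "x = y" using inj by fastforce
  qed
  then obtain c where c: "0 < c" "\<And>u. norm u * c \<le> norm (J t *v u)"
    using linear_inj_bounded_below_pos[OF matrix_vector_mul_linear[of "J t"]] by (metis mult.commute)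
  obtain C where C: "0 < C" "\<And>(A::real^'n^'n) x. norm (A *v x) \<le> C * norm A * norm x"
    using mat_vec_norm_bound by blast
  \<comment> \<open>With this tolerance the perturbation changes \<open>norm (J t *v u)\<close> by
    at most \<open>c / 2 * norm u\<close>.\<close>
  have "0 < c / (2 * C)" using c C by simp
  then obtain \<delta> where d: "0 < \<delta>" "\<And>s. s \<in> {a..b} \<Longrightarrow> dist s t < \<delta> \<Longrightarrow> dist (J s) (J t) < c / (2 * C)"
    using cont_J t unfolding continuous_on_iff by metis
  have "c / 2 * norm u \<le> norm (J s *v u)" if s: "s \<in> {a..b}" "\<bar>s - t\<bar> < \<delta>" for s u
  proof -
    have "norm ((J t - J s) *v u) \<le> C * norm (J t - J s) * norm u" by (rule C)
    also have "\<dots> \<le> C * (c / (2 * C)) * norm u"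
      using d(2)[of s] s C(1) by (intro mult_right_mono mult_left_mono) (auto simp: dist_norm norm_minus_commute)
    also have "\<dots> = c / 2 * norm u" using C(1) by simp
    finally have "norm ((J t - J s) *v u) \<le> c / 2 * norm u" .
    moreover have "norm (J t *v u) \<le> norm (J s *v u) + norm ((J t - J s) *v u)"
      using norm_triangle_ineq[of "J s *v u" "(J t - J s) *v u"] by (simp add: matrix_vector_mult_diff_rdistrib)
    ultimately show ?thesis using c(2)[of u] by (simp add: algebra_simps)
  qed
  then show ?thesis using that[of \<delta> "c / 2"] d(1) c(1) by simp
qed

text \<open>The representation \<open>X = J v\<close> need not be unique at conjugate values, so \<open>v\<close> is not assumed to be
  continuous. The symmetry of the Wronskian lets one expand \<open>\<langle>P v, X\<rangle>\<close> around a fixed vector \<open>w\<close>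
  with an error of second order in \<open>(v - w, X - J w)\<close>; hence it is continuous everywhere and
  differentiable outside the conjugate values, which suffices for the fundamental theorem of calculus.\<close>

lemma legendre_expansion:
  assumes s: "s \<in> {a..b}" and v: "J s *v v = X"
  shows "(P s *v v) \<bullet> X = (P s *v w) \<bullet> (J s *v w) + 2 * ((P s *v w) \<bullet> (X - J s *v w))
    + (P s *v (v - w)) \<bullet> (X - J s *v w)"
proof -
  have "(P s *v (v - w)) \<bullet> (J s *v w) = (J s *v (v - w)) \<bullet> (P s *v w)" by (rule wronskian[OF s, symmetric])
  then show ?thesis unfolding v[symmetric]
    by (simp add: matrix_vector_mult_diff_distrib inner_diff_left inner_diff_right inner_commute)
qed

context
  fixes X v
  assumes X: "X \<in> sl_space a b" and v: "\<And>s. s \<in> {a..b} \<Longrightarrow> J s *v v s = X s"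
begin

text \<open>\<open>Y\<close> vanishes at \<open>t\<close> and is O(|s - t|), and
  \<open>J s *v (v s - v t) = Y s\<close>. The general lower bound for \<open>J\<close> then makes
  \<open>v s - v t\<close> bounded off \<open>t\<close>, the regular one makes it O(|s - t|).
  Consequently the remainder \<open>r\<close> is of first order everywhere and of second order at
  regular points.\<close>

lemma legendre_local:
  assumes t: "t \<in> {a..b}"
  defines "Y \<equiv> \<lambda>s. X s - J s *v v t"
  defines "r \<equiv> \<lambda>s. (P s *v (v s - v t)) \<bullet> Y s"
  shows "(Y has_vector_derivative (ivl_deriv a b X t - P t *v v t)) (at t within {a..b})"
    and "Y t = 0"
    and "((\<lambda>s. (P s *v v s) \<bullet> X s) has_vector_derivative D) (at t within {a..b}) \<longleftrightarrow>
      ((\<lambda>s. (P s *v v t) \<bullet> (J s *v v t) + 2 * ((P s *v v t) \<bullet> Y s) + r s) has_vector_derivative D) (at t within {a..b})"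
    and "continuous (at t within {a..b}) r"
    and "(\<And>u. J t *v u = 0 \<Longrightarrow> u = 0) \<Longrightarrow> (r has_vector_derivative 0) (at t within {a..b})"
    and "\<And>s. s \<in> {a..b} \<Longrightarrow> (P s *v v s) \<bullet> X s = (P s *v v t) \<bullet> (J s *v v t) + 2 * ((P s *v v t) \<bullet> Y s) + r s"
proof -
  show Yd: "(Y has_vector_derivative (ivl_deriv a b X t - P t *v v t)) (at t within {a..b})"
    unfolding Y_def by (intro has_vector_derivative_diff Ju_deriv sl_spaceD(7)[OF X] t)
  show Y0: "Y t = 0" using v[OF t] by (simp add: Y_def)
  show ex: "(P s *v v s) \<bullet> X s = (P s *v v t) \<bullet> (J s *v v t) + 2 * ((P s *v v t) \<bullet> Y s) + r s"
    if "s \<in> {a..b}" for s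
    unfolding r_def Y_def by (rule legendre_expansion[OF that v[OF that]])
  show "((\<lambda>s. (P s *v v s) \<bullet> X s) has_vector_derivative D) (at t within {a..b}) \<longleftrightarrow>
      ((\<lambda>s. (P s *v v t) \<bullet> (J s *v v t) + 2 * ((P s *v v t) \<bullet> Y s) + r s) has_vector_derivative D) (at t within {a..b})"
    by (rule has_vector_derivative_cong_on[OF t ex])
  obtain \<delta>1 where d1: "0 < \<delta>1" "\<And>s. s \<in> {a..b} \<Longrightarrow> \<bar>s - t\<bar> < \<delta>1 \<Longrightarrow>
      norm (Y s - Y t) \<le> (norm (ivl_deriv a b X t - P t *v v t) + 1) * \<bar>s - t\<bar>"
    using has_vector_derivative_lipschitz[OF Yd] by blast
  define L where "L = norm (ivl_deriv a b X t - P t *v v t) + 1"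
  have L: "0 \<le> L" "\<And>s. s \<in> {a..b} \<Longrightarrow> \<bar>s - t\<bar> < \<delta>1 \<Longrightarrow> norm (Y s) \<le> L * \<bar>s - t\<bar>"
    using d1(2) Y0 by (simp_all add: L_def)
  obtain C where C: "0 < C" "\<And>(A::real^'n^'n) x. norm (A *v x) \<le> C * norm A * norm x"
    using mat_vec_norm_bound by blast
  obtain Q where Q: "0 \<le> Q" "\<And>s. s \<in> {a..b} \<Longrightarrow> norm (P s) \<le> Q"
    using continuous_on_Icc_bound[OF cont_P] by blast
  have rb: "norm (r s) \<le> C * Q * norm (v s - v t) * norm (Y s)" if s: "s \<in> {a..b}" for s
  proof -
    have "norm (r s) \<le> norm (P s *v (v s - v t)) * norm (Y s)"
      unfolding r_def using Cauchy_Schwarz_ineq2 by (simp only: real_norm_def)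
    also have "\<dots> \<le> (C * norm (P s) * norm (v s - v t)) * norm (Y s)" by (intro mult_right_mono C) auto
    also have "\<dots> \<le> C * Q * norm (v s - v t) * norm (Y s)"
      using Q C(1) s by (intro mult_right_mono mult_left_mono) auto
    finally show ?thesis .
  qed
  have r0: "r t = 0" by (simp add: r_def)
  have Jy: "J s *v (v s - v t) = Y s" if "s \<in> {a..b}" for s
    using v[OF that] by (simp add: Y_def matrix_vector_mult_diff_distrib)
  show "continuous (at t within {a..b}) r"
  proof -
    obtain \<delta>2 c where d2: "0 < \<delta>2" "0 < c"
      "\<And>s u. s \<in> {a..b} \<Longrightarrow> \<bar>s - t\<bar> < \<delta>2 \<Longrightarrow> c * \<bar>s - t\<bar> * norm u \<le> norm (J s *v u)"
      using J_lower_bound[OF t] by blast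
    show ?thesis
    proof (rule continuous_lipschitz_at[of "min \<delta>1 \<delta>2" _ _ _ "C * Q * (L / c) * L"])
      fix s assume s: "s \<in> {a..b}" "\<bar>s - t\<bar> < min \<delta>1 \<delta>2"
      show "norm (r s) \<le> C * Q * (L / c) * L * \<bar>s - t\<bar>"
      proof (cases "s = t")
        case False
        have "c * \<bar>s - t\<bar> * norm (v s - v t) \<le> L * \<bar>s - t\<bar>"
          using d2(3)[of s "v s - v t"] L(2)[of s] s Jy[of s] by simp
        then have "norm (v s - v t) \<le> L / c" using d2(2) False by (simp add: field_simps)
        then have "norm (v s - v t) * norm (Y s) \<le> (L / c) * (L * \<bar>s - t\<bar>)"
          using L s d2(2) by (intro mult_mono) auto
        then have "C * Q * (norm (v s - v t) * norm (Y s)) \<le> C * Q * ((L / c) * (L * \<bar>s - t\<bar>))"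
          using C(1) Q(1) by (intro mult_left_mono) auto
        then show ?thesis using rb[OF s(1)] by (simp add: mult.assoc)
      qed (simp add: r0)
    qed (use d1 d2 r0 in auto)
  qed
  show "(r has_vector_derivative 0) (at t within {a..b})" if inj: "\<And>u. J t *v u = 0 \<Longrightarrow> u = 0"
  proof -
    obtain \<delta>2 c where d2: "0 < \<delta>2" "0 < c"
      "\<And>s u. s \<in> {a..b} \<Longrightarrow> \<bar>s - t\<bar> < \<delta>2 \<Longrightarrow> c * norm u \<le> norm (J s *v u)"
      using regular_lower_bound[OF t inj] by blast
    show ?thesis
    proof (rule has_vector_derivative_quadratic[of "min \<delta>1 \<delta>2" _ _ _ "C * Q * (1 / c) * L * L"])
      fix s assume s: "s \<in> {a..b}" "\<bar>s - t\<bar> < min \<delta>1 \<delta>2"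
      have "c * norm (v s - v t) \<le> L * \<bar>s - t\<bar>"
        using d2(3)[of s "v s - v t"] L(2)[of s] s Jy[of s] by simp
      then have "norm (v s - v t) \<le> (1 / c) * (L * \<bar>s - t\<bar>)" using d2(2) by (simp add: field_simps)
      then have "norm (v s - v t) * norm (Y s) \<le> ((1 / c) * (L * \<bar>s - t\<bar>)) * (L * \<bar>s - t\<bar>)"
        using L s d2(2) by (intro mult_mono) auto
      then have "C * Q * (norm (v s - v t) * norm (Y s)) \<le> C * Q * (((1 / c) * (L * \<bar>s - t\<bar>)) * (L * \<bar>s - t\<bar>))"
        using C(1) Q(1) by (intro mult_left_mono) auto
      then show "norm (r s) \<le> C * Q * (1 / c) * L * L * \<bar>s - t\<bar>\<^sup>2"
        using rb[OF s(1)] by (simp add: power2_eq_square mult_ac)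
    qed (use d1 d2 r0 in auto)
  qed
qed

text \<open>Off the conjugate values the derivative of <P v, X> is the integrand of the form minus
  |X' - P v|^2. Since \<open>X\<close> vanishes at both ends, integration leaves the form equal to
  the integral of that square.\<close>

lemma legendre_nonneg: "0 \<le> sl_form K a b X X"
proof -
  let ?X' = "ivl_deriv a b X"
  let ?F = "\<lambda>s. (P s *v v s) \<bullet> X s"
  let ?q = "\<lambda>s. ?X' s \<bullet> ?X' s + (K s *v X s) \<bullet> X s"
  let ?n = "\<lambda>s. (?X' s - P s *v v s) \<bullet> (?X' s - P s *v v s)"
  note XD = sl_spaceD[OF X]
  have cF: "continuous_on {a..b} ?F"
    unfolding continuous_on_eq_continuous_within
  proof
    fix t assume t: "t \<in> {a..b}"
    note l = legendre_local[OF t]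
    have c1: "continuous (at t within {a..b}) (\<lambda>s. P s *v v t)" "continuous (at t within {a..b}) (\<lambda>s. J s *v v t)"
      "continuous (at t within {a..b}) (\<lambda>s. X s - J s *v v t)"
      using has_vector_derivative_continuous[OF Pu_deriv[OF t]] has_vector_derivative_continuous[OF Ju_deriv[OF t]]
        has_vector_derivative_continuous[OF l(1)] by blast+
    have "continuous (at t within {a..b}) (\<lambda>s. (P s *v v t) \<bullet> (J s *v v t) + 2 * ((P s *v v t) \<bullet> (X s - J s *v v t))
        + (P s *v (v s - v t)) \<bullet> (X s - J s *v v t))"
      by (intro continuous_add continuous_mult continuous_const continuous_inner c1 l(4))
    then show "continuous (at t within {a..b}) ?F"
      by (rule continuous_transform_within[OF _ zero_less_one t]) (simp add: l(6))
  qed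
  have dF: "(?F has_vector_derivative (?q s - ?n s)) (at s)" if s: "s \<in> {a<..<b} - conj_set" for s
  proof -
    have sab: "s \<in> {a..b}" using s by auto
    have inj: "u = 0" if "J s *v u = 0" for u using s that by (auto simp: conj_set_def)
    note l = legendre_local[OF sab]
    have Y0: "X s - J s *v v s = 0" by (rule l(2))
    have "((\<lambda>q. (P q *v v s) \<bullet> (J q *v v s) + 2 * ((P q *v v s) \<bullet> (X q - J q *v v s))
        + (P q *v (v q - v s)) \<bullet> (X q - J q *v v s)) has_vector_derivative
        (((P s *v v s) \<bullet> (P s *v v s) + (K s *v (J s *v v s)) \<bullet> (J s *v v s))
        + 2 * ((P s *v v s) \<bullet> (?X' s - P s *v v s) + (K s *v (J s *v v s)) \<bullet> (X s - J s *v v s)) + 0)) (at s within {a..b})"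
      by (intro has_vector_derivative_add inner_deriv Ju_deriv Pu_deriv sab l(1) l(5)[OF inj]
          bounded_linear.has_vector_derivative[OF bounded_linear_mult_right])
    then have "(?F has_vector_derivative
        (((P s *v v s) \<bullet> (P s *v v s) + (K s *v (J s *v v s)) \<bullet> (J s *v v s))
        + 2 * ((P s *v v s) \<bullet> (?X' s - P s *v v s) + (K s *v (J s *v v s)) \<bullet> (X s - J s *v v s)) + 0)) (at s within {a..b})"
      unfolding l(3) .
    moreover have "(((P s *v v s) \<bullet> (P s *v v s) + (K s *v (J s *v v s)) \<bullet> (J s *v v s))
        + 2 * ((P s *v v s) \<bullet> (?X' s - P s *v v s) + (K s *v (J s *v v s)) \<bullet> (X s - J s *v v s)) + 0) = ?q s - ?n s"
      unfolding Y0 using v[OF sab] by (simp add: inner_diff_left inner_diff_right inner_commute)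
    ultimately show ?thesis using at_within_Icc_at[of a s b] s by auto
  qed
  have "((\<lambda>s. ?q s - ?n s) has_integral (?F b - ?F a)) {a..b}"
    by (rule fundamental_theorem_of_calculus_interior_strong[OF finite_conj_set _ dF cF]) (use ab in auto)
  then have i1: "((\<lambda>s. ?q s - ?n s) has_integral 0) {a..b}" using XD by simp
  have i2: "(?q has_integral sl_form K a b X X) {a..b}"
    unfolding sl_form_def
    by (intro integrable_integral integrable_continuous_real continuous_intros XD cont_K)
  have "((\<lambda>s. ?q s - (?q s - ?n s)) has_integral (sl_form K a b X X - 0)) {a..b}"
    by (rule has_integral_diff[OF i2 i1])
  then have "(?n has_integral sl_form K a b X X) {a..b}" by simp
  then show ?thesis by (rule has_integral_nonneg) simp
qed

end

text \<open>For \<open>w\<close> in a basis of the kernel of \<open>J t\<close>, the condition <X t,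
  P t w> = 0 is imposed, one for each unit of multiplicity. Together these conditions put
  \<open>X t\<close> into the range of \<open>J t\<close>. At other interior points \<open>J\<close>
  is onto, and at the ends \<open>X\<close> is zero. So \<open>X = J v\<close>, and a negative
  definite subspace contains no such \<open>X\<close> except 0.\<close>

lemma index_le_conj_sum:
  "form_index (sl_form K a b) (sl_space a b) \<le> (\<Sum>t\<in>conj_set. edim (sl_eig K a t 0))"
proof -
  let ?N = "\<lambda>t. {u. J t *v u = 0}"
  have "\<exists>B. \<forall>t. B t \<subseteq> ?N t \<and> independent (B t) \<and> ?N t \<subseteq> span (B t)"
    by (intro choice allI) (metis basis_exists)
  then obtain B where B: "\<And>t. B t \<subseteq> ?N t" "\<And>t. independent (B t)" "\<And>t. ?N t \<subseteq> span (B t)" by blast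
  have fB: "finite (B t)" for t using B(2) independent_imp_finite by blast
  have "edim (sl_eig K a t 0) = enat (card (B t))" if "t \<in> conj_set" for t
    using edim_kernel_eig[of t] edim_basis[OF B(2,1,3), of t] fB that by (simp add: conj_set_def)
  then have N: "(\<Sum>t\<in>conj_set. edim (sl_eig K a t 0)) = enat (\<Sum>t\<in>conj_set. card (B t))"
    by (simp add: enat_sum)
  have "edim W \<le> enat (\<Sum>t\<in>conj_set. card (B t))"
    if W: "subspace W" "W \<subseteq> sl_space a b" "negative_definite_on (sl_form K a b) W" for W
  proof -
    let ?I = "Sigma conj_set B"
    have "edim W \<le> enat (card ?I)"
    proof (rule edim_le_functionals[of ?I W "\<lambda>(t, w) X. X t \<bullet> (P t *v w)"])
      show "finite ?I" using finite_conj_set fB by blast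
      show "functional_on W ((\<lambda>(t, w) X. X t \<bullet> (P t *v w)) i)" if "i \<in> ?I" for i
        by (auto simp: functional_on_def scaleR_fun_def inner_add_left split: prod.split)
      fix X assume XW: "X \<in> W" and z: "\<And>i. i \<in> ?I \<Longrightarrow> (\<lambda>(t, w) X. X t \<bullet> (P t *v w)) i X = 0"
      have XS: "X \<in> sl_space a b" using XW W(2) by blast
      have r: "\<exists>v. J s *v v = X s" if s: "s \<in> {a..b}" for s
      proof -
        consider "s = a \<or> s = b" | "s \<in> conj_set" | "s \<in> {a<..<b}" "s \<notin> conj_set" using s by fastforce
        then show ?thesis
        proof cases
          case 1
          then show ?thesis using sl_spaceD(2,3)[OF XS] by (intro exI[of _ 0]) auto
        next
          case 2
          have "X s \<in> range ((*v) (J s))"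
          proof (rule range_orthogonal_kernel[where P="P s"])
            show "(J s *v u) \<bullet> (P s *v w) = 0" if "J s *v w = 0" for u w
              using wronskian[OF s, of u w] that by simp
            show "w = 0" if "J s *v w = 0" "P s *v w = 0" for w using J_P_inj[OF s that] .
            show "X s \<bullet> (P s *v w) = 0" if "J s *v w = 0" for w
            proof -
              have "span (B s) \<subseteq> {w. X s \<bullet> (P s *v w) = 0}"
              proof (rule span_minimal)
                show "B s \<subseteq> {w. X s \<bullet> (P s *v w) = 0}" using z[of "(s, _)"] 2 by auto
                show "subspace {w. X s \<bullet> (P s *v w) = 0}"
                  by (auto simp: subspace_def matrix_vector_right_distrib matrix_vector_mult_scaleR inner_add_right)
              qed
              then show ?thesis using B(3)[of s] that by blast
            qed
          qed
          then show ?thesis by force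
        next
          case 3
          then have "inj ((*v) (J s))"
            by (intro injI) (metis (mono_tags, lifting) conj_set_def matrix_vector_mult_diff_distrib mem_Collect_eq right_minus_eq)
          then have "surj ((*v) (J s))" by (intro linear_injective_imp_surjective) auto
          then show ?thesis by (metis surjD)
        qed
      qed
      then obtain v where "\<And>s. s \<in> {a..b} \<Longrightarrow> J s *v v s = X s" by metis
      then have "0 \<le> sl_form K a b X X" using legendre_nonneg[OF XS] by blast
      then show "X = 0" using W(3) XW by (force simp: negative_definite_on_def)
    qed (use W in auto)
    moreover have "card ?I = (\<Sum>t\<in>conj_set. card (B t))" using finite_conj_set fB by (simp add: card_SigmaI)
    ultimately show ?thesis by simp
  qed
  then show ?thesis unfolding N form_index_def by (intro Sup_least) blast
qed

end

subsection \<open>The Green operator and its Rayleigh quotient\<close>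

text \<open>The nonnegative quadratic polynomial in \<open>c\<close> has no positive discriminant.
  The isotropic case is treated separately, because the forms to which this is applied are merely
  semidefinite.\<close>

lemma semidefinite_cauchy_schwarz:
  fixes B :: "'v::real_vector \<Rightarrow> 'v \<Rightarrow> real"
  assumes V: "subspace V" "x \<in> V" "y \<in> V"
    and add: "\<And>u v w. u \<in> V \<Longrightarrow> v \<in> V \<Longrightarrow> w \<in> V \<Longrightarrow> B (u + v) w = B u w + B v w"
    and scale: "\<And>c u w. u \<in> V \<Longrightarrow> w \<in> V \<Longrightarrow> B (c *\<^sub>R u) w = c * B u w"
    and sym: "\<And>u w. u \<in> V \<Longrightarrow> w \<in> V \<Longrightarrow> B u w = B w u"
    and pos: "\<And>u. u \<in> V \<Longrightarrow> 0 \<le> B u u"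
  shows "(B x y)\<^sup>2 \<le> B x x * B y y"
proof -
  have q: "0 \<le> B x x + 2 * c * B x y + c\<^sup>2 * B y y" for c
  proof -
    have cy: "c *\<^sub>R y \<in> V" and xcy: "x + c *\<^sub>R y \<in> V"
      using V by (auto simp: subspace_scale subspace_add)
    have "B (x + c *\<^sub>R y) (x + c *\<^sub>R y) = B x (x + c *\<^sub>R y) + c * B y (x + c *\<^sub>R y)"
      using add[OF V(2) cy xcy] scale[OF V(3) xcy] by simp
    also have "B x (x + c *\<^sub>R y) = B x x + c * B x y"
      using sym[OF V(2) xcy] add[OF V(2) cy V(2)] scale[OF V(3) V(2)] sym[OF V(2,3)] by simp
    also have "B y (x + c *\<^sub>R y) = B x y + c * B y y"
      using sym[OF V(3) xcy] add[OF V(2) cy V(3)] scale[OF V(3) V(3)] by simp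
    finally have "B (x + c *\<^sub>R y) (x + c *\<^sub>R y) = B x x + 2 * c * B x y + c\<^sup>2 * B y y"
      by (simp add: algebra_simps power2_eq_square)
    then show ?thesis using pos[OF xcy] by simp
  qed
  show ?thesis
  proof (cases "B y y = 0")
    case True
    have "B x y = 0"
    proof (rule ccontr)
      assume n: "B x y \<noteq> 0"
      \<comment> \<open>If \<open>B y y = 0\<close> the polynomial is affine in \<open>c\<close>;
        this value of \<open>c\<close> would make it -1.\<close>
      have "0 \<le> B x x + 2 * (- (B x x + 1) / (2 * B x y)) * B x y" using q[of "- (B x x + 1) / (2 * B x y)"] True by simp
      moreover have "2 * (- (B x x + 1) / (2 * B x y)) * B x y = - (B x x + 1)" using n by (simp add: field_simps)
      ultimately show False by linarith
    qed
    then show ?thesis using True by simp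
  next
    case False
    then have p: "0 < B y y" using pos[OF V(3)] by simp
    have "0 \<le> B x x + 2 * (- (B x y / B y y)) * B x y + (- (B x y / B y y))\<^sup>2 * B y y" by (rule q)
    also have "\<dots> = B x x - (B x y)\<^sup>2 / B y y"
      using False by (simp add: power2_eq_square field_simps)
    finally show ?thesis using p by (simp add: field_simps)
  qed
qed

text \<open>No values are prescribed outside the interval, unlike in \<open>sl_space\<close>.
  Functions that agree on the interval are not identified, so \<open>L2_inner\<close> is only
  semidefinite here.\<close>

definition cont_space :: "real \<Rightarrow> real \<Rightarrow> (real \<Rightarrow> real^'n) set"
  where "cont_space a b = {f. continuous_on {a..b} f}"

lemma subspace_cont_space: "subspace (cont_space a b)"
  by (auto simp: subspace_def cont_space_def plus_fun_def zero_fun_def scaleR_fun_def intro!: continuous_intros)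

lemma L2_bilinear:
  assumes "f \<in> cont_space a b" "g \<in> cont_space a b" "h \<in> cont_space a b"
  shows "L2_inner a b (f + g) h = L2_inner a b f h + L2_inner a b g h"
    and "L2_inner a b (c *\<^sub>R f) h = c * L2_inner a b f h"
    and "L2_inner a b h (f + g) = L2_inner a b h f + L2_inner a b h g"
    and "L2_inner a b h (c *\<^sub>R f) = c * L2_inner a b h f"
    and "L2_inner a b h (f - g) = L2_inner a b h f - L2_inner a b h g"
    and "L2_inner a b (f - g) h = L2_inner a b f h - L2_inner a b g h"
proof -
  have i: "(\<lambda>s. f s \<bullet> h s) integrable_on {a..b}" "(\<lambda>s. g s \<bullet> h s) integrable_on {a..b}"
    using assms by (auto simp: cont_space_def intro!: L2_inner_integrable)
  show 1: "L2_inner a b (f + g) h = L2_inner a b f h + L2_inner a b g h"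
    unfolding L2_inner_def plus_fun_def inner_add_left by (rule integral_add[OF i])
  show 2: "L2_inner a b (c *\<^sub>R f) h = c * L2_inner a b f h"
    unfolding L2_inner_def scaleR_fun_def by simp
  show 3: "L2_inner a b (f - g) h = L2_inner a b f h - L2_inner a b g h"
    unfolding L2_inner_def fun_diff_def inner_diff_left by (rule integral_diff[OF i])
  show "L2_inner a b h (f + g) = L2_inner a b h f + L2_inner a b h g"
    "L2_inner a b h (c *\<^sub>R f) = c * L2_inner a b h f"
    "L2_inner a b h (f - g) = L2_inner a b h f - L2_inner a b h g"
    using 1 2 3 by (simp_all only: L2_inner_commute[of a b h])
qed

lemma L2_cauchy_schwarz:
  assumes "f \<in> cont_space a b" "g \<in> cont_space a b"
  shows "(L2_inner a b f g)\<^sup>2 \<le> L2_inner a b f f * L2_inner a b g g"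
  by (rule semidefinite_cauchy_schwarz[OF subspace_cont_space assms, of "L2_inner a b",
        OF L2_bilinear(1) L2_bilinear(2) L2_inner_commute L2_inner_self_ge_0])

lemma quadratic_cancel:
  fixes d I n :: real
  assumes "0 < d" "0 \<le> (d\<^sup>2 * I - 2 * d * n) + d * n"
  shows "n \<le> d * I"
proof -
  have "(d\<^sup>2 * I - 2 * d * n) + d * n = d * (d * I - n)" by (simp add: power2_eq_square algebra_simps)
  then have "0 \<le> d * I - n" using assms by (simp add: zero_le_mult_iff)
  then show ?thesis by simp
qed

text \<open>Cauchy-Schwarz for the integral of \<open>x'\<close>, obtained by integrating |(q - p)
  x' - (x q - x p)|^2 >= 0.\<close>

lemma norm_increment_bound:
  fixes x :: "real \<Rightarrow> 'b::euclidean_space"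
  assumes x: "\<And>s. s \<in> {p..q} \<Longrightarrow> (x has_vector_derivative x' s) (at s within {p..q})"
    and c: "continuous_on {p..q} x'" and pq: "p < q"
  shows "(norm (x q - x p))\<^sup>2 \<le> (q - p) * integral {p..q} (\<lambda>s. x' s \<bullet> x' s)"
proof -
  define m where "m = x q - x p"
  define I where "I = integral {p..q} (\<lambda>s. x' s \<bullet> x' s)"
  have i: "(x' has_integral m) {p..q}"
    unfolding m_def by (rule fundamental_theorem_of_calculus) (use pq x in auto)
  have i1: "((\<lambda>s. x' s \<bullet> m) has_integral (m \<bullet> m)) {p..q}"
    using has_integral_linear[OF i bounded_linear_inner_left[of m]] by (simp add: o_def)
  have i2: "((\<lambda>s. x' s \<bullet> x' s) has_integral I) {p..q}"
    unfolding I_def by (intro integrable_integral L2_inner_integrable c)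
  have i3: "((\<lambda>s. m \<bullet> m) has_integral ((q - p) * (m \<bullet> m))) {p..q}"
    using has_integral_const_real[of "m \<bullet> m" p q] pq by simp
  have hi: "((\<lambda>s. ((q - p)\<^sup>2 * (x' s \<bullet> x' s) - 2 * (q - p) * (x' s \<bullet> m)) + m \<bullet> m) has_integral
      (((q - p)\<^sup>2 * I - 2 * (q - p) * (m \<bullet> m)) + (q - p) * (m \<bullet> m))) {p..q}"
    by (intro has_integral_add has_integral_diff has_integral_mult_right i1 i2 i3)
  have e: "((q - p)\<^sup>2 * (x' s \<bullet> x' s) - 2 * (q - p) * (x' s \<bullet> m)) + m \<bullet> m =
      ((q - p) *\<^sub>R x' s - m) \<bullet> ((q - p) *\<^sub>R x' s - m)" for s
    by (simp add: inner_diff_left inner_diff_right inner_commute power2_eq_square algebra_simps)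
  have nn: "0 \<le> ((q - p)\<^sup>2 * I - 2 * (q - p) * (m \<bullet> m)) + (q - p) * (m \<bullet> m)"
    by (rule has_integral_nonneg[OF hi]) (simp only: e inner_ge_zero)
  have "m \<bullet> m \<le> (q - p) * I" by (rule quadratic_cancel[OF _ nn]) (use pq in simp)
  then show ?thesis by (simp add: m_def I_def dot_square_norm)
qed

text \<open>The slack \<open>x \<bullet> x\<close> on the left makes the shifted form bound the \<open>L\<^sup>2\<close> norm, so that the shifted
  problem \<open>- x'' + (K + l) x = f\<close> is uniquely solvable.\<close>

lemma (in sturm_liouville) coercive_shift:
  obtains l where "0 < l" "\<And>s x. s \<in> {a..b} \<Longrightarrow> x \<bullet> x \<le> (K s *v x) \<bullet> x + l * (x \<bullet> x)"
proof -
  obtain C where C: "0 < C" "\<And>(A::real^'n^'n) x. norm (A *v x) \<le> C * norm A * norm x"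
    using mat_vec_norm_bound by blast
  obtain Q where Q: "0 \<le> Q" "\<And>s. s \<in> {a..b} \<Longrightarrow> norm (K s) \<le> Q"
    using continuous_on_Icc_bound[OF cont_K] by blast
  show ?thesis
  proof (rule that[of "C * Q + 1"])
    show "0 < C * Q + 1" using C Q by (simp add: add_nonneg_pos)
    fix s x assume s: "s \<in> {a..b}"
    have "\<bar>(K s *v x) \<bullet> x\<bar> \<le> norm (K s *v x) * norm x" by (rule Cauchy_Schwarz_ineq2)
    also have "\<dots> \<le> (C * norm (K s) * norm x) * norm x" by (intro mult_right_mono C) auto
    also have "\<dots> \<le> C * Q * norm x * norm x" using C(1) Q s by (intro mult_right_mono mult_left_mono) auto
    also have "\<dots> = C * Q * (x \<bullet> x)" by (simp add: dot_square_norm power2_eq_square)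
    finally show "x \<bullet> x \<le> (K s *v x) \<bullet> x + (C * Q + 1) * (x \<bullet> x)" by (simp add: algebra_simps abs_le_iff)
  qed
qed

text \<open>Shooting: a solution of the initial value problem is corrected at \<open>b\<close> by a
  solution \<open>J c\<close> of the homogeneous shifted problem. Coercivity rules out nonzero
  homogeneous solutions with zero end values, so \<open>J b\<close> is invertible.\<close>

lemma (in sturm_liouville) green_operator_exists:
  assumes l: "\<And>s x. s \<in> {a..b} \<Longrightarrow> x \<bullet> x \<le> (K s *v x) \<bullet> x + l * (x \<bullet> x)"
    and f: "continuous_on {a..b} f"
  shows "\<exists>x x'. (\<forall>s\<in>{a..b}. (x has_vector_derivative x' s) (at s within {a..b})) \<and>
    (\<forall>s\<in>{a..b}. (x' has_vector_derivative (K s *v x s + l *\<^sub>R x s - f s)) (at s within {a..b})) \<and>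
    x a = 0 \<and> x b = 0"
proof -
  let ?K = "\<lambda>s. K s + l *\<^sub>R mat 1"
  have Kv: "?K s *v x = K s *v x + l *\<^sub>R x" for s x
    by (simp add: matrix_vector_mult_add_rdistrib scaleR_matrix_vector_assoc[symmetric])
  interpret L: sturm_liouville ?K a b
    using ab sym_K smooth_path_on_add[OF smooth_K smooth_path_on_const]
    by unfold_locales (auto simp: Kv inner_add_left inner_add_right)
  obtain J P where "jacobi_matrix ?K a b J P" using L.jacobi_matrix_exists by blast
  then interpret jacobi_matrix ?K a b J P .
  have b: "b \<in> {a..b}" "a \<in> {a..b}" using ab by auto
  \<comment> \<open>If \<open>J u\<close> vanishes at \<open>b\<close>, its energy integral equals
    the boundary terms, which are zero. Hence the nonnegative integrand vanishes, in particular at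
    \<open>a\<close>, where \<open>P a = 1\<close>.\<close>
  have inj: "u = 0" if u: "J b *v u = 0" for u
  proof -
    have g: "((\<lambda>s. (P s *v u) \<bullet> (P s *v u) + (?K s *v (J s *v u)) \<bullet> (J s *v u)) has_integral
        ((P b *v u) \<bullet> (J b *v u) - (P a *v u) \<bullet> (J a *v u))) {a..b}"
      by (rule green_has_integral[OF Ju_deriv Pu_deriv])
    let ?g = "\<lambda>s. (P s *v u) \<bullet> (P s *v u) + (?K s *v (J s *v u)) \<bullet> (J s *v u)"
    have c: "continuous_on {a..b} ?g" by (intro continuous_intros cont_P cont_J L.cont_K)
    have p: "(P s *v u) \<bullet> (P s *v u) \<le> ?g s" "0 \<le> ?g s" if "s \<in> {a..b}" for s
    proof -
      have "0 \<le> (?K s *v (J s *v u)) \<bullet> (J s *v u)"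
        using order_trans[OF inner_ge_zero l[OF that, of "J s *v u"]] by (simp add: Kv inner_add_left)
      then show "(P s *v u) \<bullet> (P s *v u) \<le> ?g s" "0 \<le> ?g s" by auto
    qed
    have "integral {a..b} ?g = 0" using integral_unique[OF g] u J_a by simp
    then have "?g a = 0" using integral_eq_0_iff[OF c ab p(2)] b by blast
    then have "(P a *v u) \<bullet> (P a *v u) \<le> 0" using p(1)[OF b(2)] by simp
    then show "u = 0" by (metis P_a inner_gt_zero_iff matrix_vector_mul_lid not_le)
  qed
  have "surj ((*v) (J b))"
  proof (rule linear_injective_imp_surjective)
    show "inj ((*v) (J b))"
    proof (rule injI)
      fix x y assume "J b *v x = J b *v y"
      then show "x = y" using inj[of "x - y"] by (simp add: matrix_vector_mult_diff_distrib)
    qed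
  qed auto
  define F where "F s = (\<lambda>z :: (real^'n) \<times> (real^'n). (snd z, ?K s *v fst z))" for s
  have "linear (F s)" for s
    unfolding F_def by (intro linearI) (simp_all add: matrix_vector_right_distrib matrix_vector_mult_scaleR)
  moreover have "continuous_on {a..b} (\<lambda>s. F s z)" for z
    unfolding F_def by (intro continuous_intros L.cont_K)
  moreover have "continuous_on {a..b} (\<lambda>s. (0 :: real^'n, - f s))" by (intro continuous_intros f)
  ultimately obtain z where z: "z a = 0"
    "\<And>s. s \<in> {a..b} \<Longrightarrow> (z has_vector_derivative (F s (z s) + (0, - f s))) (at s within {a..b})"
    using linear_ode_exists_pointwise[OF less_imp_le[OF ab]] by blast
  have z1: "((\<lambda>s. fst (z s)) has_vector_derivative snd (z s)) (at s within {a..b})"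
    and z2: "((\<lambda>s. snd (z s)) has_vector_derivative (?K s *v fst (z s) - f s)) (at s within {a..b})"
    if "s \<in> {a..b}" for s
    using bounded_linear.has_vector_derivative[OF bounded_linear_fst z(2)[OF that]]
      bounded_linear.has_vector_derivative[OF bounded_linear_snd z(2)[OF that]] by (simp_all add: F_def)
  obtain c where c: "J b *v c = fst (z b)" using \<open>surj ((*v) (J b))\<close> by (metis surjD)
  show ?thesis
  proof (rule exI[of _ "\<lambda>s. fst (z s) - J s *v c"], rule exI[of _ "\<lambda>s. snd (z s) - P s *v c"], intro conjI ballI)
    fix s assume s: "s \<in> {a..b}"
    show "((\<lambda>s. fst (z s) - J s *v c) has_vector_derivative (snd (z s) - P s *v c)) (at s within {a..b})"
      by (intro has_vector_derivative_diff z1 Ju_deriv s)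
    have "((\<lambda>s. snd (z s) - P s *v c) has_vector_derivative ((?K s *v fst (z s) - f s) - ?K s *v (J s *v c))) (at s within {a..b})"
      by (intro has_vector_derivative_diff z2 Pu_deriv s)
    then show "((\<lambda>s. snd (z s) - P s *v c) has_vector_derivative
      (K s *v (fst (z s) - J s *v c) + l *\<^sub>R (fst (z s) - J s *v c) - f s)) (at s within {a..b})"
      unfolding Kv by (simp add: matrix_vector_mult_diff_distrib algebra_simps)
  qed (use z(1) c J_a in auto)
qed

section \<open>The Green operator on continuous functions\<close>

locale green_operator = sturm_liouville K a b
  for K :: "real \<Rightarrow> real^'n^'n" and a b :: real +
  fixes l :: real and G G' :: "(real \<Rightarrow> real^'n) \<Rightarrow> real \<Rightarrow> real^'n"
  assumes l_pos: "0 < l"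
    and coercive: "s \<in> {a..b} \<Longrightarrow> x \<bullet> x \<le> (K s *v x) \<bullet> x + l * (x \<bullet> x)"
    and G_deriv: "f \<in> cont_space a b \<Longrightarrow> s \<in> {a..b} \<Longrightarrow> (G f has_vector_derivative G' f s) (at s within {a..b})"
    and G'_deriv: "f \<in> cont_space a b \<Longrightarrow> s \<in> {a..b} \<Longrightarrow>
      (G' f has_vector_derivative (K s *v G f s + l *\<^sub>R G f s - f s)) (at s within {a..b})"
    and G_ends: "f \<in> cont_space a b \<Longrightarrow> G f a = 0" "f \<in> cont_space a b \<Longrightarrow> G f b = 0"

lemma (in sturm_liouville) green_operator_obtain: "\<exists>l G G'. green_operator K a b l G G'"
proof -
  obtain l where l: "0 < l" "\<And>s x. s \<in> {a..b} \<Longrightarrow> x \<bullet> x \<le> (K s *v x) \<bullet> x + l * (x \<bullet> x)"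
    using coercive_shift by blast
  define Q where "Q f x x' \<longleftrightarrow> (\<forall>s\<in>{a..b}. (x has_vector_derivative x' s) (at s within {a..b})) \<and>
    (\<forall>s\<in>{a..b}. (x' has_vector_derivative (K s *v x s + l *\<^sub>R x s - f s)) (at s within {a..b})) \<and>
    x a = 0 \<and> x b = 0" for f x x'
  have ex: "\<exists>x x'. Q f x x'" if "f \<in> cont_space a b" for f
    using green_operator_exists[OF l(2)] that unfolding cont_space_def Q_def by blast
  \<comment> \<open>A solution and its derivative are chosen as a pair, separately for each
    \<open>f\<close>. Symmetry and linearity of the resulting operator are therefore derived
    afterwards from the equation.\<close>
  define S where "S f = (SOME xx. Q f (fst xx) (snd xx))" for f
  have S: "Q f (fst (S f)) (snd (S f))" if "f \<in> cont_space a b" for f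
    unfolding S_def by (rule someI_ex) (use ex[OF that] in \<open>simp add: split_paired_Ex\<close>)
  have "green_operator K a b l (\<lambda>f. fst (S f)) (\<lambda>f. snd (S f))"
    by unfold_locales (use l S[unfolded Q_def] in blast)+
  then show ?thesis by blast
qed

context green_operator
begin

abbreviation C :: "(real \<Rightarrow> real^'n) set" where "C \<equiv> cont_space a b"
abbreviation ip where "ip \<equiv> L2_inner a b"

lemma G_cont: "f \<in> C \<Longrightarrow> continuous_on {a..b} (G f)" and G'_cont: "f \<in> C \<Longrightarrow> continuous_on {a..b} (G' f)"
  by (rule continuous_on_deriv[OF G_deriv], assumption+) (rule continuous_on_deriv[OF G'_deriv], assumption+)

lemma G_in_C: "f \<in> C \<Longrightarrow> G f \<in> C"
  using G_cont by (simp add: cont_space_def)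

lemma ip_has_integral: "f \<in> C \<Longrightarrow> g \<in> C \<Longrightarrow> ((\<lambda>s. f s \<bullet> g s) has_integral ip f g) {a..b}"
  unfolding L2_inner_def cont_space_def by (intro integrable_integral L2_inner_integrable) auto

text \<open>The weak form of the shifted equation. Finitely many corners of the test function are
  allowed, because the broken Jacobi fields are to be inserted.\<close>

lemma G_weak:
  assumes f: "f \<in> C" and S: "finite S" and w: "w \<in> C" "w a = 0" "w b = 0"
    and p: "\<And>s. s \<in> {a<..<b} - S \<Longrightarrow> (w has_vector_derivative p s) (at s)"
  shows "((\<lambda>s. G' f s \<bullet> p s + (K s *v G f s + l *\<^sub>R G f s) \<bullet> w s) has_integral ip f w) {a..b}"
proof -
  have "((\<lambda>s. G' f s \<bullet> p s + (K s *v G f s + l *\<^sub>R G f s - f s) \<bullet> w s) has_integral (G' f b \<bullet> w b - G' f a \<bullet> w a)) {a..b}"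
  proof (rule fundamental_theorem_of_calculus_interior_strong[OF S])
    show "continuous_on {a..b} (\<lambda>s. G' f s \<bullet> w s)"
      using w(1) by (intro continuous_intros G'_cont f) (simp add: cont_space_def)
    fix s assume s: "s \<in> {a<..<b} - S"
    then have "(G' f has_vector_derivative (K s *v G f s + l *\<^sub>R G f s - f s)) (at s)"
      using G'_deriv[OF f, of s] at_within_Icc_at[of a s b] by auto
    from inner_deriv[OF this p[OF s]]
    show "((\<lambda>s. G' f s \<bullet> w s) has_vector_derivative (G' f s \<bullet> p s + (K s *v G f s + l *\<^sub>R G f s - f s) \<bullet> w s)) (at s)" .
  qed (use ab in auto)
  from has_integral_add[OF this ip_has_integral[OF f w(1)]] w
  show ?thesis by (simp add: inner_diff_left algebra_simps)
qed

lemma G_weak_G: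
  assumes f: "f \<in> C" and g: "g \<in> C"
  shows "((\<lambda>s. G' f s \<bullet> G' g s + (K s *v G f s + l *\<^sub>R G f s) \<bullet> G g s) has_integral ip f (G g)) {a..b}"
proof (rule G_weak[OF f finite.emptyI G_in_C[OF g] G_ends[OF g]])
  fix s assume "s \<in> {a<..<b} - {}"
  then show "(G g has_vector_derivative G' g s) (at s)"
    using G_deriv[OF g, of s] at_within_Icc_at[of a s b] by auto
qed

lemma G_sym:
  assumes f: "f \<in> C" and g: "g \<in> C"
  shows "ip (G f) g = ip f (G g)"
proof -
  have "((\<lambda>s. G' f s \<bullet> G' g s + (K s *v G f s + l *\<^sub>R G f s) \<bullet> G g s) has_integral ip g (G f)) {a..b}"
  proof (rule has_integral_eq[OF _ G_weak_G[OF g f]])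
    fix s assume "s \<in> {a..b}"
    from sym_K[OF this, of "G g s" "G f s"]
    show "G' g s \<bullet> G' f s + (K s *v G g s + l *\<^sub>R G g s) \<bullet> G f s = G' f s \<bullet> G' g s + (K s *v G f s + l *\<^sub>R G f s) \<bullet> G g s"
      by (simp add: inner_add_left inner_add_right inner_commute)
  qed
  then have "ip g (G f) = ip f (G g)" using G_weak_G[OF f g] has_integral_unique by blast
  then show ?thesis by (simp add: L2_inner_commute[of a b "G f"])
qed

text \<open>The weak equation is tested with \<open>G f\<close> itself; the slack in
  \<open>coercive\<close> pays for the term \<open>ip (G f) (G f)\<close>.\<close>

lemma G_energy:
  assumes f: "f \<in> C"
  shows "integral {a..b} (\<lambda>s. G' f s \<bullet> G' f s) + ip (G f) (G f) \<le> ip (G f) f"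
proof -
  have i1: "((\<lambda>s. G' f s \<bullet> G' f s) has_integral integral {a..b} (\<lambda>s. G' f s \<bullet> G' f s)) {a..b}"
    by (intro integrable_integral L2_inner_integrable G'_cont f)
  have "integral {a..b} (\<lambda>s. G' f s \<bullet> G' f s) + ip (G f) (G f) \<le> ip f (G f)"
  proof (rule has_integral_le[OF has_integral_add[OF i1 ip_has_integral[OF G_in_C[OF f] G_in_C[OF f]]] G_weak_G[OF f f]])
    fix s assume "s \<in> {a..b}"
    then show "G' f s \<bullet> G' f s + G f s \<bullet> G f s \<le> G' f s \<bullet> G' f s + (K s *v G f s + l *\<^sub>R G f s) \<bullet> G f s"
      using coercive[of s "G f s"] by (simp add: inner_add_left)
  qed
  then show ?thesis by (simp add: L2_inner_commute[of a b f])
qed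

lemma G_bounds:
  assumes f: "f \<in> C"
  shows "ip (G f) (G f) \<le> ip (G f) f" "0 \<le> ip (G f) f" "ip (G f) f \<le> ip f f"
    "integral {a..b} (\<lambda>s. G' f s \<bullet> G' f s) \<le> ip f f"
proof -
  have n: "0 \<le> integral {a..b} (\<lambda>s. G' f s \<bullet> G' f s)"
    using L2_inner_self_ge_0[of a b "G' f"] by (simp add: L2_inner_def)
  have g: "0 \<le> ip (G f) (G f)" by (rule L2_inner_self_ge_0)
  show 1: "ip (G f) (G f) \<le> ip (G f) f" and "0 \<le> ip (G f) f"
    using G_energy[OF f] n g by linarith+
  \<comment> \<open>One factor \<open>ip (G f) f\<close> cancels from this chain, which bounds the
    operator \<open>G\<close> by 1.\<close>
  have "(ip (G f) f)\<^sup>2 \<le> ip (G f) (G f) * ip f f" by (rule L2_cauchy_schwarz[OF G_in_C[OF f] f])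
  also have "\<dots> \<le> ip (G f) f * ip f f" using 1 by (intro mult_right_mono L2_inner_self_ge_0)
  finally have "ip (G f) f * ip (G f) f \<le> ip (G f) f * ip f f" by (simp add: power2_eq_square)
  then show 2: "ip (G f) f \<le> ip f f"
    using \<open>0 \<le> ip (G f) f\<close> L2_inner_self_ge_0[of a b f] by (cases "ip (G f) f = 0") auto
  show "integral {a..b} (\<lambda>s. G' f s \<bullet> G' f s) \<le> ip f f" using G_energy[OF f] g 2 by linarith
qed

text \<open>The energy bound controls the L2 norm of the derivative, which gives a Hoelder constant
  depending only on \<open>ip f f\<close>. This is the equicontinuity for the Arzela-Ascoli
  theorem.\<close>

lemma G_holder:
  assumes f: "f \<in> C" and s: "s \<in> {a..b}" and r: "r \<in> {a..b}"
  shows "(norm (G f s - G f r))\<^sup>2 \<le> \<bar>s - r\<bar> * ip f f"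
proof -
  have *: "(norm (G f q - G f p))\<^sup>2 \<le> (q - p) * ip f f" if pq: "p < q" "p \<in> {a..b}" "q \<in> {a..b}" for p q
  proof -
    have sub: "{p..q} \<subseteq> {a..b}" using pq by auto
    have "(norm (G f q - G f p))\<^sup>2 \<le> (q - p) * integral {p..q} (\<lambda>s. G' f s \<bullet> G' f s)"
    proof (rule norm_increment_bound[OF _ continuous_on_subset[OF G'_cont[OF f] sub] pq(1)])
      show "(G f has_vector_derivative G' f s) (at s within {p..q})" if "s \<in> {p..q}" for s
        using has_vector_derivative_within_subset[OF G_deriv[OF f] sub] that sub by blast
    qed
    also have "integral {p..q} (\<lambda>s. G' f s \<bullet> G' f s) \<le> integral {a..b} (\<lambda>s. G' f s \<bullet> G' f s)"
      by (intro integral_subset_le sub L2_inner_integrable G'_cont f continuous_on_subset[OF G'_cont[OF f] sub]) auto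
    also have "\<dots> \<le> ip f f" by (rule G_bounds[OF f])
    finally show ?thesis using pq by (simp add: mult_left_mono)
  qed
  consider "s = r" | "s < r" | "r < s" by linarith
  then show ?thesis using *[of s r] *[of r s] s r by cases (auto simp: norm_minus_commute)
qed

lemma G_sup_bound:
  assumes f: "f \<in> C" and s: "s \<in> {a..b}"
  shows "(norm (G f s))\<^sup>2 \<le> (b - a) * ip f f"
proof -
  have "(norm (G f s - G f a))\<^sup>2 \<le> \<bar>s - a\<bar> * ip f f" by (rule G_holder[OF f s]) (use ab in auto)
  also have "\<dots> \<le> (b - a) * ip f f" using s by (intro mult_right_mono L2_inner_self_ge_0) auto
  finally show ?thesis using G_ends[OF f] by simp
qed

lemma C_ops: "f \<in> C \<Longrightarrow> g \<in> C \<Longrightarrow> f + g \<in> C" "f \<in> C \<Longrightarrow> g \<in> C \<Longrightarrow> f - g \<in> C" "f \<in> C \<Longrightarrow> c *\<^sub>R f \<in> C"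
  using subspace_add[OF subspace_cont_space] subspace_diff[OF subspace_cont_space]
    subspace_scale[OF subspace_cont_space] by blast+

lemma C_zeroI:
  assumes "u \<in> C" "\<And>h. h \<in> C \<Longrightarrow> ip u h = 0" "s \<in> {a..b}"
  shows "u s = 0"
  using assms(2)[OF assms(1)] L2_inner_self_eq_0[OF _ ab, of u] assms by (auto simp: cont_space_def)

text \<open>By symmetry \<open>ip (G f) h = ip f (G h)\<close> is linear in \<open>f\<close>, and a
  continuous function orthogonal to all of \<open>C\<close> is zero on the interval.\<close>

lemma G_linear:
  assumes f: "f \<in> C" and g: "g \<in> C" and s: "s \<in> {a..b}"
  shows "G (f - g) s = G f s - G g s" "G (c *\<^sub>R f) s = c *\<^sub>R G f s"
proof -
  have "(G (f - g) - (G f - G g)) s = 0"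
  proof (rule C_zeroI[OF _ _ s])
    show "G (f - g) - (G f - G g) \<in> C" by (intro C_ops G_in_C f g)
    fix h assume h: "h \<in> C"
    note c = G_in_C[OF f] G_in_C[OF g] G_in_C[OF C_ops(2)[OF f g]] G_in_C[OF h]
    have "ip (G (f - g)) h = ip f (G h) - ip g (G h)"
      using G_sym[OF C_ops(2)[OF f g] h] L2_bilinear(6)[OF f g c(4)] by simp
    then show "ip (G (f - g) - (G f - G g)) h = 0"
      using L2_bilinear(6)[OF c(3) C_ops(2)[OF c(1,2)] h] L2_bilinear(6)[OF c(1,2) h] G_sym[OF f h] G_sym[OF g h] by simp
  qed
  then show "G (f - g) s = G f s - G g s" by simp
  have "(G (c *\<^sub>R f) - c *\<^sub>R G f) s = 0"
  proof (rule C_zeroI[OF _ _ s])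
    show "G (c *\<^sub>R f) - c *\<^sub>R G f \<in> C" by (intro C_ops G_in_C f)
    fix h assume h: "h \<in> C"
    note c = G_in_C[OF f] G_in_C[OF C_ops(3)[OF f]] G_in_C[OF h]
    have "ip (G (c *\<^sub>R f)) h = c * ip f (G h)"
      using G_sym[OF C_ops(3)[OF f] h] L2_bilinear(2)[OF f f c(3)] by simp
    then show "ip (G (c *\<^sub>R f) - c *\<^sub>R G f) h = 0"
      using L2_bilinear(6)[OF c(2) C_ops(3)[OF c(1)] h] L2_bilinear(2)[OF c(1) c(1) h] G_sym[OF f h] by simp
  qed
  then show "G (c *\<^sub>R f) s = c *\<^sub>R G f s" by (simp add: scaleR_fun_def)
qed

text \<open>Coercivity applied to an eigenfunction even gives \<open>1 - l \<le> \<mu>\<close>. The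
  bound supplies the lower end of the spectrum and makes \<open>\<mu> + l\<close> nonzero.\<close>

lemma eig_gt:
  assumes "e \<in> sl_eig K a b \<mu>" "e \<noteq> 0"
  shows "- l < \<mu>"
proof -
  note E = sl_eigD[OF assms(1)] sl_spaceD[OF sl_eigD(1)[OF assms(1)]]
  have p: "0 < ip e e"
    using L2_inner_space(3)[OF E(1) E(1) E(1)] L2_inner_self_ge_0[of a b e] assms(2) by simp
  have i: "((\<lambda>s. ivl_deriv a b e s \<bullet> ivl_deriv a b e s + (K s *v e s) \<bullet> e s) has_integral sl_form K a b e e) {a..b}"
    unfolding sl_form_def by (intro integrable_integral integrable_continuous_real continuous_intros E cont_K)
  have ie: "((\<lambda>s. e s \<bullet> e s) has_integral ip e e) {a..b}"
    by (intro ip_has_integral) (use E(7) in \<open>simp_all add: cont_space_def\<close>)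
  have "(1 - l) * ip e e \<le> sl_form K a b e e"
  proof (rule has_integral_le[OF has_integral_mult_right[OF ie] i])
    fix s assume "s \<in> {a..b}"
    then have "e s \<bullet> e s \<le> (K s *v e s) \<bullet> e s + l * (e s \<bullet> e s)" by (rule coercive)
    then show "(1 - l) * (e s \<bullet> e s) \<le> ivl_deriv a b e s \<bullet> ivl_deriv a b e s + (K s *v e s) \<bullet> e s"
      using inner_ge_zero[of "ivl_deriv a b e s"] unfolding left_diff_distrib mult_1 by linarith
  qed
  then have "(1 - l) * ip e e \<le> \<mu> * ip e e" using form_eig[OF assms(1) E(1)] by simp
  then show ?thesis using p by simp
qed

text \<open>The weak statement that an eigenfunction for \<open>\<mu>\<close> belongs to the
  eigenvalue \<open>1 / (\<mu> + l)\<close> of \<open>G\<close>: the weak equation for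
  \<open>G f\<close> and Green's formula for \<open>e\<close> are subtracted.\<close>

lemma G_eig:
  assumes e: "e \<in> sl_eig K a b \<mu>" and f: "f \<in> C"
  shows "ip f e = (\<mu> + l) * ip (G f) e"
proof -
  note E = sl_eigD[OF e] sl_spaceD[OF sl_eigD(1)[OF e]]
  have eC: "e \<in> C" using E(7) by (simp add: cont_space_def)
  let ?e' = "ivl_deriv a b e"
  have "((\<lambda>s. G' f s \<bullet> ?e' s + (K s *v G f s + l *\<^sub>R G f s) \<bullet> e s) has_integral ip f e) {a..b}"
  proof (rule G_weak[OF f finite.emptyI eC E(4,5)])
    fix s assume "s \<in> {a<..<b} - {}"
    then show "(e has_vector_derivative ?e' s) (at s)"
      using E(9)[of s] at_within_Icc_at[of a s b] by auto
  qed
  moreover have "((\<lambda>s. ?e' s \<bullet> G' f s + (K s *v e s - \<mu> *\<^sub>R e s) \<bullet> G f s) has_integral (?e' b \<bullet> G f b - ?e' a \<bullet> G f a)) {a..b}"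
    by (rule green_has_integral[OF G_deriv[OF f] E(2)])
  ultimately have D: "((\<lambda>s. (G' f s \<bullet> ?e' s + (K s *v G f s + l *\<^sub>R G f s) \<bullet> e s) -
      (?e' s \<bullet> G' f s + (K s *v e s - \<mu> *\<^sub>R e s) \<bullet> G f s)) has_integral (ip f e - 0)) {a..b}"
    using G_ends[OF f] by (intro has_integral_diff) simp_all
  have "((\<lambda>s. (\<mu> + l) * (G f s \<bullet> e s)) has_integral (ip f e - 0)) {a..b}"
  proof (rule has_integral_eq[OF _ D])
    fix s assume "s \<in> {a..b}"
    from sym_K[OF this, of "e s" "G f s"]
    show "(G' f s \<bullet> ?e' s + (K s *v G f s + l *\<^sub>R G f s) \<bullet> e s) -
      (?e' s \<bullet> G' f s + (K s *v e s - \<mu> *\<^sub>R e s) \<bullet> G f s) = (\<mu> + l) * (G f s \<bullet> e s)"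
      by (simp add: inner_add_left inner_diff_left inner_add_right inner_diff_right inner_commute distrib_right)
  qed
  then have "((\<lambda>s. (\<mu> + l) * (G f s \<bullet> e s)) has_integral ip f e) {a..b}" by simp
  moreover have "((\<lambda>s. (\<mu> + l) * (G f s \<bullet> e s)) has_integral (\<mu> + l) * ip (G f) e) {a..b}"
    by (intro has_integral_mult_right ip_has_integral G_in_C f eC)
  ultimately show ?thesis using has_integral_unique by blast
qed

text \<open>\<open>G\<close> turns L2 convergence into pointwise convergence by its sup bound; this
  allows an identity between functions to be obtained from L2 limits.\<close>

lemma ip_tendsto_0_pointwise:
  assumes f: "\<And>n. f n \<in> C" and lim: "(\<lambda>n. ip (f n) (f n)) \<longlonglongrightarrow> 0" and s: "s \<in> {a..b}"
  shows "(\<lambda>n. G (f n) s) \<longlonglongrightarrow> 0"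
proof -
  have "(\<lambda>n. (b - a) * ip (f n) (f n)) \<longlonglongrightarrow> (b - a) * 0" by (intro tendsto_intros lim)
  then have l0: "(\<lambda>n. (b - a) * ip (f n) (f n)) \<longlonglongrightarrow> 0" by simp
  have "(\<lambda>n. (norm (G (f n) s))\<^sup>2) \<longlonglongrightarrow> 0"
    by (rule Lim_null_comparison[OF always_eventually l0]) (use G_sup_bound[OF f s] in simp)
  then have "(\<lambda>n. sqrt ((norm (G (f n) s))\<^sup>2)) \<longlonglongrightarrow> sqrt 0" by (rule tendsto_real_sqrt)
  then show ?thesis by (simp add: tendsto_norm_zero_iff)
qed

lemma uniform_ip_tendsto:
  assumes x: "\<And>n. x n \<in> C" and h: "h \<in> C"
    and unif: "\<And>e. 0 < e \<Longrightarrow> \<exists>N. \<forall>n s. n \<ge> N \<and> s \<in> {a..b} \<longrightarrow> norm (x n s - h s) < e"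
  shows "(\<lambda>n. ip (x n - h) (x n - h)) \<longlonglongrightarrow> 0"
proof (rule LIMSEQ_I)
  fix r :: real assume r: "0 < r"
  \<comment> \<open>Chosen so that a uniform error \<open>e\<close> has squared L2 norm at most
    \<open>r / 2\<close>.\<close>
  define e where "e = sqrt (r / (2 * (b - a)))"
  have "r / (2 * d) * d = r / 2" if "0 < d" for d :: real using that by simp
  from this[of "b - a"] have e: "0 < e" "e\<^sup>2 * (b - a) = r / 2"
    using r ab by (simp_all add: e_def del: times_divide_eq_left)
  obtain N where N: "\<And>n s. n \<ge> N \<Longrightarrow> s \<in> {a..b} \<Longrightarrow> norm (x n s - h s) < e" using unif[OF e(1)] by blast
  have "norm (ip (x n - h) (x n - h) - 0) < r" if n: "n \<ge> N" for n
  proof -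
    have "((\<lambda>s::real. e\<^sup>2) has_integral (e\<^sup>2 * (b - a))) {a..b}"
      using has_integral_const_real[of "e\<^sup>2" a b] ab by (simp add: mult.commute)
    then have "ip (x n - h) (x n - h) \<le> e\<^sup>2 * (b - a)"
    proof (rule has_integral_le[OF ip_has_integral[OF C_ops(2)[OF x h] C_ops(2)[OF x h]]])
      fix s assume "s \<in> {a..b}"
      then have "(norm (x n s - h s))\<^sup>2 \<le> e\<^sup>2" using N[OF n, of s] by (intro power_mono) auto
      then show "(x n - h) s \<bullet> (x n - h) s \<le> e\<^sup>2" by (simp add: dot_square_norm)
    qed
    then show ?thesis using e(2) r L2_inner_self_ge_0[of a b "x n - h"] by simp
  qed
  then show "\<exists>N. \<forall>n\<ge>N. norm (ip (x n - h) (x n - h) - 0) < r" by blast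
qed

lemma ip_tendsto_right:
  assumes x: "\<And>n. x n \<in> C" and h: "h \<in> C" and g: "g \<in> C"
    and lim: "(\<lambda>n. ip (x n - h) (x n - h)) \<longlonglongrightarrow> 0"
  shows "(\<lambda>n. ip (x n) g) \<longlonglongrightarrow> ip h g"
proof -
  have "(\<lambda>n. ip (x n - h) (x n - h) * ip g g) \<longlonglongrightarrow> 0 * ip g g" by (intro tendsto_intros lim)
  then have l0: "(\<lambda>n. ip (x n - h) (x n - h) * ip g g) \<longlonglongrightarrow> 0" by simp
  have "(\<lambda>n. (ip (x n - h) g)\<^sup>2) \<longlonglongrightarrow> 0"
    by (rule Lim_null_comparison[OF always_eventually l0])
      (use L2_cauchy_schwarz[OF C_ops(2)[OF x h] g] in simp)
  then have "(\<lambda>n. sqrt ((ip (x n - h) g)\<^sup>2)) \<longlonglongrightarrow> sqrt 0" by (rule tendsto_real_sqrt)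
  then have "(\<lambda>n. ip (x n - h) g) \<longlonglongrightarrow> 0" by (simp add: tendsto_rabs_zero_iff)
  then have "(\<lambda>n. ip (x n) g - ip h g) \<longlonglongrightarrow> 0" unfolding L2_bilinear(6)[OF x h g] .
  then show ?thesis by (rule LIM_zero_cancel)
qed

section \<open>The Rayleigh quotient on the orthogonal complement of negative eigenfields\<close>

definition orth_compl :: "(real \<Rightarrow> real^'n) set \<Rightarrow> (real \<Rightarrow> real^'n) set"
  where "orth_compl E = {f \<in> C. \<forall>e\<in>E. ip f e = 0}"

context
  fixes E :: "(real \<Rightarrow> real^'n) set"
  assumes E: "\<And>e. e \<in> E \<Longrightarrow> \<exists>\<mu><0. e \<in> sl_eig K a b \<mu>"
begin

abbreviation V where "V \<equiv> orth_compl E"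

lemma E_in_C: "e \<in> E \<Longrightarrow> e \<in> C"
  using E sl_spaceD(5)[OF sl_eigD(1)] unfolding cont_space_def by blast

lemma V_in_C: "f \<in> V \<Longrightarrow> f \<in> C"
  by (simp add: orth_compl_def)

lemma subspace_V: "subspace V"
  unfolding subspace_def
proof (intro conjI ballI allI)
  show "0 \<in> V" using subspace_0[OF subspace_cont_space] by (simp add: orth_compl_def L2_inner_def)
  show "x + y \<in> V" if "x \<in> V" "y \<in> V" for x y
    using that L2_bilinear(1)[of x a b y] E_in_C C_ops(1)[of x y] by (simp add: orth_compl_def)
  show "c *\<^sub>R x \<in> V" if "x \<in> V" for x c
    using that L2_bilinear(2)[of x a b x] E_in_C C_ops(3)[of x c] by (simp add: orth_compl_def)
qed

text \<open>\<open>G\<close> preserves the complement of eigenfunctions, by \<open>G_eig\<close> and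
  \<open>\<mu> + l \<noteq> 0\<close>. The zero function may belong to \<open>E\<close> and
  satisfies no such bound, hence the case distinction.\<close>

lemma G_in_V:
  assumes f: "f \<in> V"
  shows "G f \<in> V"
proof -
  have "ip (G f) e = 0" if e: "e \<in> E" for e
  proof (cases "e = 0")
    case False
    obtain \<mu> where \<mu>: "e \<in> sl_eig K a b \<mu>" using E e by blast
    have "(\<mu> + l) * ip (G f) e = 0" using G_eig[OF \<mu> V_in_C[OF f]] f e by (simp add: orth_compl_def)
    moreover have "\<mu> + l \<noteq> 0" using eig_gt[OF \<mu> False] by simp
    ultimately show ?thesis by simp
  qed (simp add: L2_inner_def)
  then show ?thesis using G_in_C[OF V_in_C[OF f]] by (simp add: orth_compl_def)
qed

text \<open>The largest eigenvalue of \<open>G\<close> on \<open>V\<close>, once attained. The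
  supremum is over the unit ball instead of the sphere, so that the set is nonempty even if all of
  \<open>V\<close> has norm zero.\<close>

definition rq_sup :: real
  where "rq_sup = Sup {ip (G f) f |f. f \<in> V \<and> ip f f \<le> 1}"

lemma rq_bdd: "bdd_above {ip (G f) f |f. f \<in> V \<and> ip f f \<le> 1}"
  by (rule bdd_aboveI[of _ 1]) (use G_bounds(3) V_in_C in fastforce)

lemma ip_zero:
  assumes "f \<in> C" "ip f f = 0" "g \<in> C"
  shows "ip f g = 0"
proof -
  have "(ip f g)\<^sup>2 \<le> 0" using L2_cauchy_schwarz[OF assms(1,3)] assms(2) by simp
  then show ?thesis by simp
qed

lemma ip_G_scale:
  assumes f: "f \<in> C" and g: "g \<in> C"
  shows "ip (G (c *\<^sub>R f)) g = c * ip (G f) g"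
  using G_sym[OF C_ops(3)[OF f] g] G_sym[OF f g] L2_bilinear(2)[OF f f G_in_C[OF g]] by simp

lemma rq_le: 
  assumes f: "f \<in> V"
  shows "ip (G f) f \<le> rq_sup * ip f f"
proof (cases "ip f f = 0")
  case True
  then show ?thesis
    using ip_zero[OF V_in_C[OF f] True G_in_C[OF V_in_C[OF f]]] L2_inner_commute[of a b f "G f"] by simp
next
  case False
  note fC = V_in_C[OF f]
  have p: "0 < ip f f" using False L2_inner_self_ge_0[of a b f] by simp
  let ?c = "1 / sqrt (ip f f)"
  have cV: "?c *\<^sub>R f \<in> V" using subspace_scale[OF subspace_V f] .
  have "ip (?c *\<^sub>R f) (?c *\<^sub>R f) = ?c * ?c * ip f f"
    using L2_bilinear(2)[OF fC fC C_ops(3)[OF fC]] L2_bilinear(4)[OF fC fC fC] by simp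
  also have "\<dots> = 1" using p by simp
  finally have "ip (G (?c *\<^sub>R f)) (?c *\<^sub>R f) \<le> rq_sup"
    unfolding rq_sup_def using cV by (intro cSup_upper rq_bdd) auto
  moreover have "ip (G (?c *\<^sub>R f)) (?c *\<^sub>R f) = ?c * ?c * ip (G f) f"
    using ip_G_scale[OF fC C_ops(3)[OF fC]] L2_bilinear(4)[OF fC fC G_in_C[OF fC]] by simp
  moreover have "?c * ?c = 1 / ip f f" using p by simp
  ultimately show ?thesis using p by (simp add: divide_le_eq)
qed

text \<open>\<open>defect\<close> is a semidefinite form on the orthogonal complement. By Cauchy-Schwarz, vectors with small
  defect almost solve \<open>G f = rq_sup f\<close>.\<close>

definition defect :: "(real \<Rightarrow> real^'n) \<Rightarrow> (real \<Rightarrow> real^'n) \<Rightarrow> real"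
  where "defect f g = rq_sup * ip f g - ip (G f) g"

lemma defect_cauchy_schwarz:
  assumes "f \<in> V" "g \<in> V"
  shows "(defect f g)\<^sup>2 \<le> defect f f * defect g g"
proof (rule semidefinite_cauchy_schwarz[OF subspace_V assms])
  fix u v w assume h: "u \<in> V" "v \<in> V" "w \<in> V"
  note c = h[THEN V_in_C]
  have "ip (G (u + v)) w = ip (G u) w + ip (G v) w"
    using G_sym[OF C_ops(1)[OF c(1,2)] c(3)] G_sym[OF c(1,3)] G_sym[OF c(2,3)]
      L2_bilinear(1)[OF c(1,2) G_in_C[OF c(3)]] by simp
  then show "defect (u + v) w = defect u w + defect v w"
    using L2_bilinear(1)[OF c] by (simp add: defect_def algebra_simps)
next
  fix c u w assume h: "u \<in> V" "w \<in> V"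
  note C = h[THEN V_in_C]
  show "defect (c *\<^sub>R u) w = c * defect u w"
    using ip_G_scale[OF C] L2_bilinear(2)[OF C(1,1,2)] by (simp add: defect_def algebra_simps)
next
  fix u w assume h: "u \<in> V" "w \<in> V"
  note C = h[THEN V_in_C]
  show "defect u w = defect w u"
    unfolding defect_def G_sym[OF C] L2_inner_commute[of a b u w] L2_inner_commute[of a b u "G w"]
    by (rule refl)
next
  fix u assume "u \<in> V"
  then show "0 \<le> defect u u" using rq_le[of u] by (simp add: defect_def)
qed

text \<open>The residual \<open>y\<close> satisfies \<open>defect f y = ip y y\<close>, and
  \<open>defect y y\<close> is at most \<open>rq_sup * ip y y\<close> because \<open>G\<close> is
  nonnegative. Cauchy-Schwarz for \<open>defect\<close> then allows one factor \<open>ip y y\<close>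
  to be cancelled.\<close>

lemma defect_residual:
  assumes f: "f \<in> V" and M: "0 < rq_sup"
  defines "y \<equiv> rq_sup *\<^sub>R f - G f"
  shows "y \<in> V" "ip y y \<le> rq_sup * defect f f"
proof -
  note fC = V_in_C[OF f]
  show y: "y \<in> V" unfolding y_def
    using subspace_diff[OF subspace_V subspace_scale[OF subspace_V f] G_in_V[OF f]] .
  note yC = V_in_C[OF y]
  have e: "defect f y = ip y y"
    unfolding defect_def
    using L2_bilinear(6)[OF C_ops(3)[OF fC] G_in_C[OF fC] yC, of rq_sup] L2_bilinear(2)[OF fC fC yC, of rq_sup]
    by (simp add: y_def)
  have d: "defect y y \<le> rq_sup * ip y y" using G_bounds(2)[OF yC] by (simp add: defect_def)
  have d0: "0 \<le> defect f f" using rq_le[OF f] by (simp add: defect_def)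
  have "ip y y * ip y y \<le> defect f f * defect y y"
    using defect_cauchy_schwarz[OF f y] unfolding e by (simp add: power2_eq_square)
  also have "\<dots> \<le> defect f f * (rq_sup * ip y y)" using d d0 by (rule mult_left_mono)
  finally have "ip y y * ip y y \<le> (rq_sup * defect f f) * ip y y" by (simp add: mult_ac)
  then show "ip y y \<le> rq_sup * defect f f"
    using L2_inner_self_ge_0[of a b y] M d0 by (cases "ip y y = 0") auto
qed

text \<open>A maximizing sequence is mapped by \<open>G\<close> to an equicontinuous sequence, and the Arzela-Ascoli limit is an eigenfunction.\<close>

lemma rq_attained:
  assumes w: "w \<in> V" "0 < ip (G w) w"
  obtains h where "h \<in> V" "0 < ip h h" "\<And>s. s \<in> {a..b} \<Longrightarrow> G h s = rq_sup *\<^sub>R h s"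
proof -
  have M: "0 < rq_sup"
  proof -
    have "0 < rq_sup * ip w w" using rq_le[OF w(1)] w(2) by simp
    then show ?thesis using L2_inner_self_ge_0[of a b w] by (simp add: zero_less_mult_iff)
  qed
  let ?S = "{ip (G f) f |f. f \<in> V \<and> ip f f \<le> 1}"
  have "0 \<in> V" using subspace_0[OF subspace_V] .
  moreover have "ip 0 0 \<le> 1" by (simp add: L2_inner_def)
  ultimately have ne: "?S \<noteq> {}" by blast
  have "\<exists>f. f \<in> V \<and> ip f f \<le> 1 \<and> rq_sup - inverse (real (Suc n)) < ip (G f) f" for n
  proof -
    have "rq_sup - inverse (real (Suc n)) < Sup ?S" unfolding rq_sup_def by (simp del: of_nat_Suc)
    then show ?thesis using less_cSup_iff[OF ne rq_bdd] by blast
  qed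
  then obtain f where f: "\<And>n. f n \<in> V" "\<And>n. ip (f n) (f n) \<le> 1"
    "\<And>n. rq_sup - inverse (real (Suc n)) < ip (G (f n)) (f n)" by metis
  note fC = V_in_C[OF f(1)]
  have holder: "(norm (G (f n) s - G (f n) r))\<^sup>2 \<le> \<bar>s - r\<bar>" if "s \<in> {a..b}" "r \<in> {a..b}" for n s r
  proof -
    have "(norm (G (f n) s - G (f n) r))\<^sup>2 \<le> \<bar>s - r\<bar> * ip (f n) (f n)" by (rule G_holder[OF fC that])
    also have "\<dots> \<le> \<bar>s - r\<bar> * 1" using f(2) by (intro mult_left_mono) auto
    finally show ?thesis by simp
  qed
  obtain h k where h: "continuous_on {a..b} h" "strict_mono (k :: nat \<Rightarrow> nat)"
    "\<And>e. 0 < e \<Longrightarrow> \<exists>N. \<forall>n s. n \<ge> N \<and> s \<in> {a..b} \<longrightarrow> norm (G (f (k n)) s - h s) < e"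
  proof (rule Arzela_Ascoli[of "{a..b}" "\<lambda>n. G (f n)" "sqrt (b - a)"])
    fix n s assume s: "s \<in> {a..b}"
    have "(norm (G (f n) s))\<^sup>2 \<le> (b - a) * ip (f n) (f n)" by (rule G_sup_bound[OF fC s])
    also have "\<dots> \<le> (b - a) * 1" using f(2) ab by (intro mult_left_mono) auto
    finally show "norm (G (f n) s) \<le> sqrt (b - a)" by (simp add: real_le_rsqrt)
  next
    fix s e :: real assume s: "s \<in> {a..b}" and e: "0 < e"
    \<comment> \<open>Hoelder exponent 1/2: tolerance \<open>e\<close> corresponds to distance
      \<open>e\<^sup>2\<close>, uniformly in \<open>n\<close>.\<close>
    have lt: "norm (G (f n) s - G (f n) r) < e" if "r \<in> {a..b}" "norm (s - r) < e\<^sup>2" for n r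
    proof -
      have "(norm (G (f n) s - G (f n) r))\<^sup>2 < e\<^sup>2" using holder[OF s that(1), of n] that(2) by simp
      then show ?thesis by (rule power2_less_imp_less) (use e in simp)
    qed
    show "\<exists>d. 0 < d \<and> (\<forall>n r. r \<in> {a..b} \<and> norm (s - r) < d \<longrightarrow> norm (G (f n) s - G (f n) r) < e)"
    proof (intro exI[of _ "e\<^sup>2"] conjI allI impI)
      show "0 < e\<^sup>2" using e by simp
      show "norm (G (f n) s - G (f n) r) < e" if "r \<in> {a..b} \<and> norm (s - r) < e\<^sup>2" for n r
        by (rule lt) (use that in simp_all)
    qed
  next
    show "compact {a..b}" by simp
  qed (fact that | (rule that; assumption))
  \<comment> \<open>The images \<open>G f\<close> converge; the maximizing sequence \<open>f\<close>
    itself is only bounded. The limit \<open>h\<close> belongs to the images.\<close>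
  define x where "x n = G (f (k n))" for n
  have hC: "h \<in> C" using h(1) by (simp add: cont_space_def)
  have xV: "x n \<in> V" and xC: "x n \<in> C" for n
    using G_in_V[OF f(1)] G_in_C[OF fC] by (simp_all add: x_def)
  have lim: "(\<lambda>n. ip (x n - h) (x n - h)) \<longlonglongrightarrow> 0"
    by (rule uniform_ip_tendsto[OF xC hC]) (use h(3) in \<open>simp add: x_def\<close>)
  have hV: "h \<in> V"
  proof -
    have "ip h e = 0" if e: "e \<in> E" for e
    proof -
      have "(\<lambda>n. ip (x n) e) \<longlonglongrightarrow> ip h e" by (rule ip_tendsto_right[OF xC hC E_in_C[OF e] lim])
      moreover have "(\<lambda>n. ip (x n) e) = (\<lambda>n. 0)" using xV e by (auto simp: orth_compl_def)
      ultimately show ?thesis using LIMSEQ_unique[OF _ tendsto_const] by metis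
    qed
    then show ?thesis using hC by (simp add: orth_compl_def)
  qed
  have k_inv: "(\<lambda>n. inverse (real (Suc (k n)))) \<longlonglongrightarrow> 0"
    using LIMSEQ_subseq_LIMSEQ[OF LIMSEQ_inverse_real_of_nat h(2)] by (simp add: o_def)
  have defect_bound: "defect (f n) (f n) \<le> inverse (real (Suc n))" for n
  proof -
    have "rq_sup * ip (f n) (f n) \<le> rq_sup * 1" using f(2) M by (intro mult_left_mono) auto
    then show ?thesis using f(3)[of n] by (simp add: defect_def)
  qed
  \<comment> \<open>The residuals of the maximizing subsequence tend to zero in L2, since their
    defects do. This is the substitute for convergence of \<open>f\<close>.\<close>
  define y where "y n = rq_sup *\<^sub>R f (k n) - x n" for n
  have yV: "y n \<in> V" and yb: "ip (y n) (y n) \<le> rq_sup * inverse (real (Suc (k n)))" for n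
  proof -
    show "y n \<in> V" using defect_residual(1)[OF f(1) M] by (simp add: y_def x_def)
    have "ip (y n) (y n) \<le> rq_sup * defect (f (k n)) (f (k n))"
      using defect_residual(2)[OF f(1) M] by (simp only: y_def x_def)
    also have "\<dots> \<le> rq_sup * inverse (real (Suc (k n)))" using defect_bound M by (intro mult_left_mono) auto
    finally show "ip (y n) (y n) \<le> rq_sup * inverse (real (Suc (k n)))" .
  qed
  have "(\<lambda>n. rq_sup * inverse (real (Suc (k n)))) \<longlonglongrightarrow> rq_sup * 0" by (intro tendsto_intros k_inv)
  then have l0: "(\<lambda>n. rq_sup * inverse (real (Suc (k n)))) \<longlonglongrightarrow> 0" by simp
  have ylim: "(\<lambda>n. ip (y n) (y n)) \<longlonglongrightarrow> 0"
  proof (rule Lim_null_comparison[OF always_eventually l0], rule allI)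
    show "norm (ip (y n) (y n)) \<le> rq_sup * inverse (real (Suc (k n)))" for n
      using yb[of n] L2_inner_self_ge_0[of a b "y n"] by (simp only: real_norm_def abs_of_nonneg)
  qed
  show ?thesis
  proof (rule that[OF hV])
    \<comment> \<open>Applying \<open>G\<close> to the residual gives
      \<open>G (y n) = rq_sup *\<^sub>R x n - G (x n)\<close>, in which every term has a pointwise
      limit.\<close>
    show "G h s = rq_sup *\<^sub>R h s" if s: "s \<in> {a..b}" for s
    proof -
      have "(\<lambda>n. G (x n - h) s) \<longlonglongrightarrow> 0" by (rule ip_tendsto_0_pointwise[OF C_ops(2)[OF xC hC] lim s])
      then have 1: "(\<lambda>n. G (x n) s - G h s) \<longlonglongrightarrow> 0" unfolding G_linear(1)[OF xC hC s] .
      have Gy: "G (y n) s = rq_sup *\<^sub>R x n s - G (x n) s" for n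
        unfolding y_def using G_linear(1)[OF C_ops(3)[OF fC] xC s] G_linear(2)[OF fC fC s] by (simp add: x_def)
      have "(\<lambda>n. G (y n) s) \<longlonglongrightarrow> 0" by (rule ip_tendsto_0_pointwise[OF V_in_C[OF yV] ylim s])
      then have 2: "(\<lambda>n. rq_sup *\<^sub>R x n s - G (x n) s) \<longlonglongrightarrow> 0" unfolding Gy .
      have "(\<lambda>n. x n s) \<longlonglongrightarrow> h s"
        unfolding LIMSEQ_iff using h(3) s by (fastforce simp: x_def)
      then have 3: "(\<lambda>n. rq_sup *\<^sub>R x n s) \<longlonglongrightarrow> rq_sup *\<^sub>R h s" by (intro tendsto_intros)
      have "(\<lambda>n. (G (x n) s - G h s) + (rq_sup *\<^sub>R x n s - G (x n) s)) \<longlonglongrightarrow> 0 + 0" by (rule tendsto_add[OF 1 2])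
      then have "(\<lambda>n. rq_sup *\<^sub>R x n s - G h s) \<longlonglongrightarrow> 0" by simp
      then have "(\<lambda>n. rq_sup *\<^sub>R x n s) \<longlonglongrightarrow> G h s" by (rule LIM_zero_cancel)
      then show ?thesis by (rule LIMSEQ_unique[OF _ 3])
    qed
    \<comment> \<open>If \<open>h\<close> were null, the images would tend to zero in L2 and, by
      Cauchy-Schwarz, so would the quotients, whose limit is \<open>rq_sup > 0\<close>.\<close>
    show "0 < ip h h"
    proof (rule ccontr)
      assume "\<not> ?thesis"
      then have h0: "ip h h = 0" using L2_inner_self_ge_0[of a b h] by simp
      have "ip (x n - h) (x n - h) = ip (x n) (x n)" for n
        using L2_bilinear(5)[OF xC hC C_ops(2)[OF xC hC]] L2_bilinear(6)[OF xC hC xC] L2_bilinear(6)[OF xC hC hC]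
          ip_zero[OF hC h0 xC] L2_inner_commute[of a b h "x n"] h0 by simp
      with lim have x0: "(\<lambda>n. ip (x n) (x n)) \<longlonglongrightarrow> 0" by simp
      have "(\<lambda>n. (ip (x n) (f (k n)))\<^sup>2) \<longlonglongrightarrow> 0"
      proof (rule Lim_null_comparison[OF always_eventually x0], rule allI)
        fix n
        have "(ip (x n) (f (k n)))\<^sup>2 \<le> ip (x n) (x n) * ip (f (k n)) (f (k n))" by (rule L2_cauchy_schwarz[OF xC fC])
        also have "\<dots> \<le> ip (x n) (x n) * 1" using f(2) by (intro mult_left_mono L2_inner_self_ge_0)
        finally show "norm ((ip (x n) (f (k n)))\<^sup>2) \<le> ip (x n) (x n)" by simp
      qed
      then have "(\<lambda>n. sqrt ((ip (x n) (f (k n)))\<^sup>2)) \<longlonglongrightarrow> sqrt 0" by (rule tendsto_real_sqrt)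
      then have A: "(\<lambda>n. ip (x n) (f (k n))) \<longlonglongrightarrow> 0" by (simp add: tendsto_rabs_zero_iff)
      have B: "(\<lambda>n. rq_sup - inverse (real (Suc (k n)))) \<longlonglongrightarrow> rq_sup - 0" by (intro tendsto_intros k_inv)
      have "rq_sup - 0 \<le> 0"
        by (rule LIMSEQ_le[OF B A]) (use f(3) in \<open>auto simp: x_def intro!: less_imp_le exI[of _ 0] simp del: of_nat_Suc\<close>)
      then show False using M by simp
    qed
  qed
qed

text \<open>The maximizer \<open>h\<close> of the quotient solves the system with eigenvalue
  \<open>1 / rq_sup - l\<close>. Were this negative, \<open>complete\<close> would make
  \<open>h\<close> orthogonal to its own multiple. So \<open>rq_sup = 1 / l\<close>, the quotient of
  \<open>w\<close> attains it, \<open>w\<close> has no defect, and its residual vanishes.\<close>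

lemma extremal_eigenfunction:
  assumes w: "w \<in> V" "0 < ip w w" and ge: "ip w w / l \<le> ip (G w) w"
    and complete: "\<And>\<mu> x f. \<mu> < 0 \<Longrightarrow> x \<in> sl_eig K a b \<mu> \<Longrightarrow> f \<in> V \<Longrightarrow> ip f x = 0"
    and s: "s \<in> {a..b}"
  shows "w s = l *\<^sub>R G w s"
proof -
  have "0 < ip w w / l" using w(2) l_pos by simp
  then have "0 < ip (G w) w" using ge by linarith
  then obtain h where h: "h \<in> V" "0 < ip h h" "\<And>s. s \<in> {a..b} \<Longrightarrow> G h s = rq_sup *\<^sub>R h s"
    using rq_attained[OF w(1)] by blast
  note hC = V_in_C[OF h(1)] and wC = V_in_C[OF w(1)]
  have "ip w w / l \<le> rq_sup * ip w w" using ge rq_le[OF w(1)] by linarith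
  then have "(1 / l) * ip w w \<le> rq_sup * ip w w" by simp
  then have Ml: "1 / l \<le> rq_sup" using w(2) by (rule mult_right_le_imp_le)
  then have M: "0 < rq_sup" using l_pos by (meson less_le_trans zero_less_divide_1_iff)
  have "\<not> 1 / rq_sup - l < 0"
  proof
    assume neg: "1 / rq_sup - l < 0"
    have "(\<lambda>s. if s \<in> {a..b} then G h s else 0) \<in> sl_eig K a b (1 / rq_sup - l)"
    proof (rule solution_in_eig[OF G_deriv[OF hC] _ G_ends[OF hC]])
      fix s assume s: "s \<in> {a..b}"
      have e: "K s *v G h s + l *\<^sub>R G h s - h s = K s *v G h s - (1 / rq_sup - l) *\<^sub>R G h s"
        using h(3)[OF s] M by (simp add: algebra_simps)
      show "(G' h has_vector_derivative (K s *v G h s - (1 / rq_sup - l) *\<^sub>R G h s)) (at s within {a..b})"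
        using G'_deriv[OF hC s] unfolding e .
    qed
    from complete[OF neg this h(1)] have "ip h (\<lambda>s. if s \<in> {a..b} then G h s else 0) = 0" .
    moreover have "ip h (\<lambda>s. if s \<in> {a..b} then G h s else 0) = ip h (rq_sup *\<^sub>R h)"
      unfolding L2_inner_def by (rule integral_cong) (simp add: h(3) scaleR_fun_def)
    ultimately have "rq_sup * ip h h = 0" using L2_bilinear(4)[OF hC hC hC] by simp
    then show False using M h(2) by simp
  qed
  then have "rq_sup = 1 / l" using Ml M l_pos by (simp add: field_simps)
  then have "defect w w \<le> 0" using ge by (simp add: defect_def)
  then have "rq_sup * defect w w \<le> 0" using M by (simp add: mult_le_0_iff)
  then have "ip (rq_sup *\<^sub>R w - G w) (rq_sup *\<^sub>R w - G w) \<le> 0"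
    using defect_residual(2)[OF w(1) M] by linarith
  then have "ip (rq_sup *\<^sub>R w - G w) (rq_sup *\<^sub>R w - G w) = 0"
    using L2_inner_self_ge_0[of a b "rq_sup *\<^sub>R w - G w"] by linarith
  then have "(rq_sup *\<^sub>R w - G w) s = 0"
    using L2_inner_self_eq_0[OF _ ab] C_ops(2)[OF C_ops(3)[OF wC] G_in_C[OF wC], of rq_sup] s
    unfolding cont_space_def by blast
  then have "(1 / l) *\<^sub>R w s = G w s" by (simp add: \<open>rq_sup = 1 / l\<close> scaleR_fun_def)
  then have "l *\<^sub>R ((1 / l) *\<^sub>R w s) = l *\<^sub>R G w s" by simp
  then show ?thesis using l_pos by simp
qed

end

end

subsection \<open>Broken Jacobi fields\<close>

lemma sum_apply_fun: "(\<Sum>t\<in>A. x t) s = (\<Sum>t\<in>A. x t s)"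
  by (induction A rule: infinite_finite_induct) auto

lemma inner_sum_sum: "(\<Sum>i\<in>A. f i) \<bullet> (\<Sum>j\<in>B. g j) = (\<Sum>i\<in>A. \<Sum>j\<in>B. f i \<bullet> g j)"
  by (subst inner_sum_left) (simp add: inner_sum_right)

lemma has_integral_sum2:
  fixes f :: "'i \<Rightarrow> 'j \<Rightarrow> real \<Rightarrow> real"
  assumes "finite A" "finite B" "\<And>i j. i \<in> A \<Longrightarrow> j \<in> B \<Longrightarrow> (f i j has_integral 0) S"
  shows "((\<lambda>s. \<Sum>i\<in>A. \<Sum>j\<in>B. f i j s) has_integral 0) S"
proof -
  have "((\<lambda>s. \<Sum>i\<in>A. \<Sum>j\<in>B. f i j s) has_integral (\<Sum>i\<in>A. \<Sum>j\<in>B. 0)) S"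
    by (intro has_integral_sum assms)
  then show ?thesis by simp
qed

text \<open>The form of two truncated Jacobi fields. The integrand is zero beyond the smaller of
  \<open>t\<close> and \<open>t'\<close>; up to there one integrates by parts against the field that
  vanishes at that end, which removes the boundary term. Both orders are needed, hence the symmetry
  of \<open>K\<close>.\<close>

lemma (in sturm_liouville) broken_form_pair:
  assumes t: "t \<in> {a..b}" and t': "t' \<in> {a..b}"
    and x: "\<And>s. s \<in> {a..b} \<Longrightarrow> (x has_vector_derivative x' s) (at s within {a..b})"
      "\<And>s. s \<in> {a..b} \<Longrightarrow> (x' has_vector_derivative K s *v x s) (at s within {a..b})" "x a = 0" "x t = 0"
    and y: "\<And>s. s \<in> {a..b} \<Longrightarrow> (y has_vector_derivative y' s) (at s within {a..b})"
      "\<And>s. s \<in> {a..b} \<Longrightarrow> (y' has_vector_derivative K s *v y s) (at s within {a..b})" "y a = 0" "y t' = 0"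
  shows "((\<lambda>s. (if s \<le> t then x' s else 0) \<bullet> (if s \<le> t' then y' s else 0)
    + (K s *v (if s \<le> t then x s else 0)) \<bullet> (if s \<le> t' then y s else 0)) has_integral 0) {a..b}"
proof -
  define r where "r = min t t'"
  have r: "{a..r} \<subseteq> {a..b}" "a \<le> r" using t t' by (auto simp: r_def)
  have "((\<lambda>s. x' s \<bullet> y' s + (K s *v x s) \<bullet> y s) has_integral 0) {a..r}"
  proof (cases "t \<le> t'")
    case True
    have "((\<lambda>s. y' s \<bullet> x' s + (K s *v y s) \<bullet> x s) has_integral (y' r \<bullet> x r - y' a \<bullet> x a)) {a..r}"
    proof (rule fundamental_theorem_of_calculus[OF r(2)])
      fix s assume s: "s \<in> {a..r}"
      then have sab: "s \<in> {a..b}" using r by auto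
      show "((\<lambda>s. y' s \<bullet> x s) has_vector_derivative y' s \<bullet> x' s + (K s *v y s) \<bullet> x s) (at s within {a..r})"
        by (intro inner_deriv has_vector_derivative_within_subset[OF _ r(1)] x y sab)
    qed
    then have "((\<lambda>s. y' s \<bullet> x' s + (K s *v y s) \<bullet> x s) has_integral 0) {a..r}"
      using True x(3,4) by (simp add: r_def)
    then show ?thesis
    proof (rule has_integral_eq[rotated])
      fix s assume "s \<in> {a..r}"
      then have "s \<in> {a..b}" using r by auto
      from sym_K[OF this, of "y s" "x s"]
      show "y' s \<bullet> x' s + (K s *v y s) \<bullet> x s = x' s \<bullet> y' s + (K s *v x s) \<bullet> y s"
        by (simp add: inner_commute)
    qed
  next
    case False
    have "((\<lambda>s. x' s \<bullet> y' s + (K s *v x s) \<bullet> y s) has_integral (x' r \<bullet> y r - x' a \<bullet> y a)) {a..r}"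
    proof (rule fundamental_theorem_of_calculus[OF r(2)])
      fix s assume s: "s \<in> {a..r}"
      then have sab: "s \<in> {a..b}" using r by auto
      show "((\<lambda>s. x' s \<bullet> y s) has_vector_derivative x' s \<bullet> y' s + (K s *v x s) \<bullet> y s) (at s within {a..r})"
        by (intro inner_deriv has_vector_derivative_within_subset[OF _ r(1)] x y sab)
    qed
    then show ?thesis using False y(3,4) by (simp add: r_def)
  qed
  then have "((\<lambda>s. if s \<in> {a..r} then x' s \<bullet> y' s + (K s *v x s) \<bullet> y s else 0) has_integral 0) {a..b}"
    by (rule has_integral_restrict[OF r(1), THEN iffD2])
  then show ?thesis
    by (rule has_integral_eq[rotated]) (auto simp: r_def)
qed

locale jacobi_green = jacobi_matrix K a b J P + green_operator K a b l G G'
  for K :: "real \<Rightarrow> real^'n^'n" and a b J P l G G'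
begin

text \<open>\<open>u\<close> assigns to each conjugate value the initial derivative of the Jacobi
  field that is cut off there.\<close>

definition broken :: "(real \<Rightarrow> real^'n) \<Rightarrow> real \<Rightarrow> real^'n"
  where "broken u s = (\<Sum>t\<in>conj_set. if s \<le> t then J s *v u t else 0)"

definition broken' :: "(real \<Rightarrow> real^'n) \<Rightarrow> real \<Rightarrow> real^'n"
  where "broken' u s = (\<Sum>t\<in>conj_set. if s \<le> t then P s *v u t else 0)"

text \<open>Dimensions are counted on the tuples, not on the broken fields. Setting
  \<open>u t = 0\<close> off \<open>conj_set\<close> makes a tuple the same as a choice of one
  kernel vector for each conjugate value. That a nonzero tuple yields a nonzero field is part of
  \<open>broken_not_smooth\<close>.\<close>

definition kernel_tuples :: "(real \<Rightarrow> real^'n) set"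
  where "kernel_tuples = {u. \<forall>t. if t \<in> conj_set then J t *v u t = 0 else u t = 0}"

lemma subspace_kernel_tuples: "subspace kernel_tuples"
  by (auto simp: subspace_def kernel_tuples_def matrix_vector_right_distrib scaleR_fun_def matrix_vector_mult_scaleR split: if_splits)

lemma conj_set_ab: "t \<in> conj_set \<Longrightarrow> t \<in> {a..b}" "t \<in> conj_set \<Longrightarrow> a < t" "t \<in> conj_set \<Longrightarrow> t < b"
  by (auto simp: conj_set_def)

lemma kernel_tuplesD: "u \<in> kernel_tuples \<Longrightarrow> t \<in> conj_set \<Longrightarrow> J t *v u t = 0"
  by (auto simp: kernel_tuples_def split: if_splits)

lemma truncated_cont:
  assumes "t \<in> {a..b}" "J t *v v = 0"
  shows "continuous_on {a..b} (\<lambda>s. if s \<le> t then J s *v v else 0)"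
proof -
  have "continuous_on ({a..t} \<union> {t..b}) (\<lambda>s. if s \<le> t then J s *v v else 0)"
  proof (rule continuous_on_If)
    show "continuous_on {a..t} (\<lambda>s. J s *v v)"
      by (intro continuous_intros continuous_on_subset[OF cont_J]) (use assms in auto)
  qed (use assms in auto)
  moreover have "{a..t} \<union> {t..b} = {a..b}" using assms by auto
  ultimately show ?thesis by simp
qed

lemma broken_in_C: "u \<in> kernel_tuples \<Longrightarrow> broken u \<in> C"
  unfolding cont_space_def broken_def[abs_def]
  by (auto intro!: continuous_on_sum truncated_cont conj_set_ab(1) kernel_tuplesD)

lemma broken_ends:
  shows "broken u a = 0" "broken u b = 0"
  by (auto simp: broken_def J_a dest: conj_set_ab(3) intro!: sum.neutral)

lemma broken_deriv:
  assumes s: "s \<in> {a<..<b} - conj_set"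
  shows "(broken u has_vector_derivative broken' u s) (at s)"
  unfolding broken_def[abs_def] broken'_def
proof (rule has_vector_derivative_sum)
  fix t assume t: "t \<in> conj_set"
  have J: "((\<lambda>s. J s *v u t) has_vector_derivative P s *v u t) (at s)"
    using Ju_deriv[of s "u t"] at_within_Icc_at[of a s b] s by auto
  show "((\<lambda>s. if s \<le> t then J s *v u t else 0) has_vector_derivative (if s \<le> t then P s *v u t else 0)) (at s)"
  proof (cases "s < t")
    case True
    have "((\<lambda>s. if s \<le> t then J s *v u t else 0) has_vector_derivative P s *v u t) (at s)"
      by (rule has_vector_derivative_transform_within_open[OF J, of "{..<t}"]) (use True in auto)
    then show ?thesis using True by simp
  next
    case False
    then have "t < s" using s t by (metis DiffD2 linorder_neqE)
    then have "((\<lambda>s. if s \<le> t then J s *v u t else 0) has_vector_derivative 0) (at s)"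
      by (intro has_vector_derivative_transform_within_open[OF has_vector_derivative_const, of "{t<..}"]) auto
    then show ?thesis using \<open>t < s\<close> by simp
  qed
qed

lemma broken_form_zero:
  assumes u: "u \<in> kernel_tuples"
  shows "((\<lambda>s. broken' u s \<bullet> broken' u s + (K s *v broken u s) \<bullet> broken u s) has_integral 0) {a..b}"
proof -
  have "((\<lambda>s. \<Sum>t\<in>conj_set. \<Sum>t'\<in>conj_set. (if s \<le> t then P s *v u t else 0) \<bullet> (if s \<le> t' then P s *v u t' else 0)
    + (K s *v (if s \<le> t then J s *v u t else 0)) \<bullet> (if s \<le> t' then J s *v u t' else 0)) has_integral 0) {a..b}"
    by (intro has_integral_sum2 finite_conj_set,
        rule broken_form_pair[OF conj_set_ab(1) conj_set_ab(1) Ju_deriv Pu_deriv _ _ Ju_deriv Pu_deriv])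
      (simp_all add: J_a kernel_tuplesD[OF u])
  moreover have "(\<Sum>t\<in>conj_set. \<Sum>t'\<in>conj_set. (if s \<le> t then P s *v u t else 0) \<bullet> (if s \<le> t' then P s *v u t' else 0)
    + (K s *v (if s \<le> t then J s *v u t else 0)) \<bullet> (if s \<le> t' then J s *v u t' else 0))
    = broken' u s \<bullet> broken' u s + (K s *v broken u s) \<bullet> broken u s" for s
    unfolding broken_def broken'_def
    by (simp only: inner_sum_sum sum.distrib linear_sum[OF matrix_vector_mul_linear])
  ultimately show ?thesis by simp
qed

text \<open>The shifted energy of \<open>l G w - w\<close> is nonnegative. Expanding it, with the
  unshifted form of \<open>w\<close> equal to zero, gives l^2 <w, G w> - 2 l |w|^2 + l |w|^2 >= 0.
  This transfers the vanishing of the form to the quotient of \<open>G\<close>.\<close>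

lemma broken_rayleigh:
  assumes u: "u \<in> kernel_tuples"
  shows "ip (broken u) (broken u) / l \<le> ip (G (broken u)) (broken u)"
proof -
  let ?w = "broken u" and ?p = "broken' u"
  note wC = broken_in_C[OF u]
  let ?A = "\<lambda>s. G' ?w s \<bullet> G' ?w s + (K s *v G ?w s + l *\<^sub>R G ?w s) \<bullet> G ?w s"
  let ?B = "\<lambda>s. G' ?w s \<bullet> ?p s + (K s *v G ?w s + l *\<^sub>R G ?w s) \<bullet> ?w s"
  let ?D = "\<lambda>s. ?p s \<bullet> ?p s + (K s *v ?w s) \<bullet> ?w s"
  have iA: "(?A has_integral ip ?w (G ?w)) {a..b}" by (rule G_weak_G[OF wC wC])
  have iB: "(?B has_integral ip ?w ?w) {a..b}"
    by (rule G_weak[OF wC finite_conj_set wC broken_ends broken_deriv])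
  have iD: "(?D has_integral 0) {a..b}" by (rule broken_form_zero[OF u])
  have iE: "((\<lambda>s. ?w s \<bullet> ?w s) has_integral ip ?w ?w) {a..b}" by (rule ip_has_integral[OF wC wC])
  have "((\<lambda>s. l\<^sup>2 * ?A s - 2 * l * ?B s + (?D s + l * (?w s \<bullet> ?w s))) has_integral
      (l\<^sup>2 * ip ?w (G ?w) - 2 * l * ip ?w ?w + (0 + l * ip ?w ?w))) {a..b}"
    by (intro has_integral_add has_integral_diff has_integral_mult_right iA iB iD iE)
  then have "0 \<le> l\<^sup>2 * ip ?w (G ?w) - 2 * l * ip ?w ?w + (0 + l * ip ?w ?w)"
  proof (rule has_integral_nonneg)
    fix s assume s: "s \<in> {a..b}"
    define q where "q = l *\<^sub>R G' ?w s - ?p s"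
    define d where "d = l *\<^sub>R G ?w s - ?w s"
    have "0 \<le> (K s *v d) \<bullet> d + l * (d \<bullet> d)" using order_trans[OF inner_ge_zero coercive[OF s, of d]] .
    then have "0 \<le> q \<bullet> q + ((K s *v d) \<bullet> d + l * (d \<bullet> d))" by (rule add_nonneg_nonneg[OF inner_ge_zero])
    also have "\<dots> = l\<^sup>2 * ?A s - 2 * l * ?B s + (?D s + l * (?w s \<bullet> ?w s))"
      using sym_K[OF s, of "?w s" "G ?w s"] unfolding q_def d_def
      by (simp add: inner_diff_left inner_diff_right inner_add_left inner_add_right matrix_vector_mult_diff_distrib
          matrix_vector_mult_scaleR inner_commute power2_eq_square algebra_simps)
    finally show "0 \<le> l\<^sup>2 * ?A s - 2 * l * ?B s + (?D s + l * (?w s \<bullet> ?w s))" .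
  qed
  also have "\<dots> = l * (l * ip ?w (G ?w) - ip ?w ?w)" by (simp add: power2_eq_square algebra_simps)
  finally have "ip ?w ?w \<le> l * ip ?w (G ?w)" using l_pos by (simp add: zero_le_mult_iff)
  then show ?thesis using l_pos L2_inner_commute[of a b ?w "G ?w"] by (simp add: divide_le_eq mult.commute)
qed

text \<open>At the largest \<open>t\<close> with \<open>u t \<noteq> 0\<close> the left derivative is \<open>P t (u t) \<noteq> 0\<close> and the right one is 0.\<close>

lemma broken_not_smooth:
  assumes u: "u \<in> kernel_tuples" "u \<noteq> 0"
    and w: "\<And>s. s \<in> {a..b} \<Longrightarrow> \<exists>d. (broken u has_vector_derivative d) (at s within {a..b})"
  shows False
proof -
  let ?T = "{t \<in> conj_set. u t \<noteq> 0}"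
  have fT: "finite ?T" using finite_conj_set by simp
  obtain r where "u r \<noteq> 0" using u(2) by (auto simp: fun_eq_iff)
  then have "r \<in> ?T" using u(1) unfolding kernel_tuples_def by (metis (mono_tags, lifting) mem_Collect_eq)
  then have ne: "?T \<noteq> {}" by blast
  define t where "t = Max ?T"
  have t: "t \<in> conj_set" "u t \<noteq> 0" using Max_in[OF fT ne] by (auto simp: t_def)
  have tmax: "u q = 0" if "q \<in> conj_set" "t < q" for q
    using Max_ge[OF fT, of q] that by (force simp: t_def)
  note tab = conj_set_ab[OF t(1)]
  \<comment> \<open>The conjugate value just before \<open>t\<close>, or \<open>a\<close> if there
    is none. Beyond the midpoint \<open>t1\<close> only the summand belonging to \<open>t\<close> is
    left of the broken field up to \<open>t\<close>.\<close>
  define t0 where "t0 = Max (insert a {q \<in> conj_set. q < t})"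
  have f0: "finite (insert a {q \<in> conj_set. q < t})" using finite_conj_set by simp
  have t0: "a \<le> t0" "t0 < t" "\<And>q. q \<in> conj_set \<Longrightarrow> q < t \<Longrightarrow> q \<le> t0"
    using Max_ge[OF f0] Max_in[OF f0] tab(2) by (auto simp: t0_def)
  define t1 where "t1 = (t0 + t) / 2"
  have t1: "a < t1" "t1 < t" "t0 < t1" using t0 by (auto simp: t1_def)
  have right: "broken u s = 0" if s: "s \<in> {t..b}" for s
    unfolding broken_def
  proof (rule sum.neutral, intro ballI)
    fix q assume q: "q \<in> conj_set"
    consider "q < s" | "s \<le> q" "t < q" | "s = t" "q = t" using s by force
    then show "(if s \<le> q then J s *v u q else 0) = 0"
      using tmax[OF q] kernel_tuplesD[OF u(1) t(1)] by cases auto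
  qed
  have left: "broken u s = J s *v u t" if s: "s \<in> {t1..t}" for s
  proof -
    have "broken u s = (\<Sum>q\<in>{t}. if s \<le> q then J s *v u q else 0)"
      unfolding broken_def
    proof (rule sum.mono_neutral_right[OF finite_conj_set])
      show "\<forall>q\<in>conj_set - {t}. (if s \<le> q then J s *v u q else 0) = 0"
      proof
        fix q assume q: "q \<in> conj_set - {t}"
        then consider "t < q" | "q < t" by fastforce
        then show "(if s \<le> q then J s *v u q else 0) = 0"
          using tmax[of q] t0(3)[of q] q s t1 by cases auto
      qed
    qed (use t in auto)
    then show ?thesis using s by simp
  qed
  obtain d where d: "(broken u has_vector_derivative d) (at t within {a..b})" using w[OF tab(1)] by blast
  have tr: "t \<in> {t..b}" and tl: "t \<in> {t1..t}" using tab t1 by auto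
  have "(broken u has_vector_derivative d) (at t within {t..b})"
    by (rule has_vector_derivative_within_subset[OF d]) (use tab in auto)
  moreover have "(broken u has_vector_derivative 0) (at t within {t..b})"
    by (rule has_vector_derivative_transform[OF tr right has_vector_derivative_const])
  ultimately have d0: "d = 0"
    using ivl_deriv_eq[OF tab(3) tr] by metis
  have "(broken u has_vector_derivative d) (at t within {t1..t})"
    by (rule has_vector_derivative_within_subset[OF d]) (use tab t1 in auto)
  moreover have "(broken u has_vector_derivative P t *v u t) (at t within {t1..t})"
    by (rule has_vector_derivative_transform[OF tl left has_vector_derivative_within_subset[OF Ju_deriv[OF tab(1)]]])
      (use tab t1 in auto)
  ultimately have "d = P t *v u t"
    using ivl_deriv_eq[OF t1(2) tl] by metis
  then have "u t = 0" using d0 J_P_inj[OF tab(1) kernel_tuplesD[OF u(1) t(1)]] by simp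
  then show False using t(2) by blast
qed

text \<open>The inequality c <= e, where \<open>L\<close> contains all negative eigenvalues. The
  contradiction uses one orthogonality condition for each basis vector of the negative
  eigenspaces.\<close>

lemma conj_sum_le_eig_sum:
  assumes L: "finite L" "L \<subseteq> {..<0}" "\<And>\<mu>. \<mu> < 0 \<Longrightarrow> \<mu> \<notin> L \<Longrightarrow> edim (sl_eig K a b \<mu>) = 0"
  shows "(\<Sum>t\<in>conj_set. edim (sl_eig K a t 0)) \<le> (\<Sum>\<mu>\<in>L. edim (sl_eig K a b \<mu>))"
proof -
  have "\<exists>B. independent B \<and> B \<subseteq> sl_eig K a b \<mu> \<and> sl_eig K a b \<mu> \<subseteq> span B \<and> finite B \<and>
      edim (sl_eig K a b \<mu>) = enat (card B)" for \<mu>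
    using edim_eig_finite[of \<mu>] by (metis edim_finite_obtain enat_ile)
  then obtain B where B: "\<And>\<mu>. independent (B \<mu>)" "\<And>\<mu>. B \<mu> \<subseteq> sl_eig K a b \<mu>"
    "\<And>\<mu>. sl_eig K a b \<mu> \<subseteq> span (B \<mu>)" "\<And>\<mu>. finite (B \<mu>)" "\<And>\<mu>. edim (sl_eig K a b \<mu>) = enat (card (B \<mu>))"
    by metis
  let ?N = "\<lambda>t. {v. J t *v v = 0}"
  have sN: "subspace (?N t)" for t
    by (auto simp: subspace_def matrix_vector_right_distrib matrix_vector_mult_scaleR)
  have eN: "edim (?N t) = enat (dim (?N t))" for t
    using basis_exists[of "?N t"] edim_basis independent_imp_finite by metis
  \<comment> \<open>Tuples concentrated at one conjugate value; \<open>kernel_tuples\<close>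
    contains their direct sum, whose dimension is the sum of the multiplicities.\<close>
  define Vt where "Vt t = (\<lambda>v s. if s = t then v else 0) ` ?N t" for t :: real
  have linVt: "linear (\<lambda>v s. if s = t then v else (0::real^'n))" for t :: real
    by (rule linearI) (auto simp: fun_eq_iff scaleR_fun_def)
  have s1: "subspace (Vt t)" for t unfolding Vt_def by (rule linear_subspace_image[OF linVt sN])
  have s2: "edim (Vt t) = enat (dim (?N t))" for t
    unfolding Vt_def eN[symmetric] by (rule edim_image_inj[OF linVt sN]) (auto intro!: inj_onI dest: fun_cong[of _ _ t])
  have s3: "\<forall>t\<in>conj_set. x t = 0" if x: "\<And>t. t \<in> conj_set \<Longrightarrow> x t \<in> Vt t" "(\<Sum>t\<in>conj_set. x t) = 0" for x
  proof
    fix t assume t: "t \<in> conj_set"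
    have z: "x q s = 0" if "q \<in> conj_set" "s \<noteq> q" for q s using x(1)[OF that(1)] that(2) by (auto simp: Vt_def)
    have "(\<Sum>q\<in>conj_set. x q t) = 0"
      using fun_cong[OF x(2), of t] by (simp add: sum_apply_fun)
    moreover have "(\<Sum>q\<in>conj_set. x q t) = (\<Sum>q\<in>{t}. x q t)"
      by (rule sum.mono_neutral_right[OF finite_conj_set]) (use t z in auto)
    ultimately have "x t t = 0" by simp
    then have "x t s = 0" for s using z[OF t, of s] by (cases "s = t") auto
    then show "x t = 0" by (simp add: fun_eq_iff)
  qed
  have s4: "Vt t \<subseteq> kernel_tuples" if "t \<in> conj_set" for t
    using that by (auto simp: Vt_def kernel_tuples_def)
  obtain U where U: "independent U" "finite U" "card U = (\<Sum>t\<in>conj_set. dim (?N t))" "U \<subseteq> kernel_tuples"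
    by (rule edim_direct_sum_ge[OF finite_conj_set s1 s2 s3 subspace_kernel_tuples s4])
  let ?I = "Sigma L B"
  have cI: "card ?I = (\<Sum>\<mu>\<in>L. card (B \<mu>))" using L(1) B(4) by (simp add: card_SigmaI)
  have fI: "finite ?I" using L(1) B(4) by blast
  define E where "E = snd ` ?I"
  have E: "\<exists>\<mu><0. e \<in> sl_eig K a b \<mu>" if "e \<in> E" for e
    using that B(2) L(2) unfolding E_def by force
  have eC: "e \<in> C" if "e \<in> E" for e
    using E[OF that] sl_spaceD(5)[OF sl_eigD(1)] unfolding cont_space_def by blast
  have badd: "broken (u + v) = broken u + broken v" "broken (c *\<^sub>R u) = c *\<^sub>R broken u" for u v c
    by (auto simp: fun_eq_iff broken_def scaleR_fun_def matrix_vector_right_distrib matrix_vector_mult_scaleR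
        scaleR_sum_right sum.distrib[symmetric] intro!: sum.cong)
  have "card U \<le> card ?I"
  proof (rule ccontr)
    assume "\<not> ?thesis"
    then have lt: "card ?I < card U" by simp
    have fn: "functional_on kernel_tuples (\<lambda>u. ip (broken u) (snd i))" if "i \<in> ?I" for i
    proof -
      have e: "snd i \<in> C" using that by (intro eC) (simp add: E_def)
      show ?thesis unfolding functional_on_def badd
        using L2_bilinear(1,2)[OF broken_in_C broken_in_C e] by blast
    qed
    obtain u where u: "u \<in> kernel_tuples" "u \<noteq> 0" "\<And>i. i \<in> ?I \<Longrightarrow> ip (broken u) (snd i) = 0"
      using functionals_common_zero[OF fI subspace_kernel_tuples U(4,1,2) lt, of "\<lambda>i u. ip (broken u) (snd i)"] fn
      by blast
    have wV: "broken u \<in> orth_compl E"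
      using u(3) broken_in_C[OF u(1)] by (auto simp: orth_compl_def E_def)
    \<comment> \<open>Orthogonality to the bases extends to their spans; negative numbers outside
      \<open>L\<close> have only the zero eigenfunction.\<close>
    have complete: "ip f x = 0" if "\<mu> < 0" "x \<in> sl_eig K a b \<mu>" "f \<in> orth_compl E" for \<mu> x f
    proof (cases "\<mu> \<in> L")
      case True
      have fC: "f \<in> C" using that(3) by (simp add: orth_compl_def)
      have "span (B \<mu>) \<subseteq> {x \<in> C. ip f x = 0}"
      proof (rule span_minimal)
        show "B \<mu> \<subseteq> {x \<in> C. ip f x = 0}"
          using that(3) True eC unfolding orth_compl_def E_def by force
        show "subspace {x \<in> C. ip f x = 0}"
          unfolding subspace_def
        proof (intro conjI ballI allI)
          show "0 \<in> {x \<in> C. ip f x = 0}" using subspace_0[OF subspace_cont_space] by (simp add: L2_inner_def)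
          show "x + y \<in> {x \<in> C. ip f x = 0}" if "x \<in> {x \<in> C. ip f x = 0}" "y \<in> {x \<in> C. ip f x = 0}" for x y
            using that L2_bilinear(3)[of x a b y f] C_ops(1)[of x y] fC by simp
          show "c *\<^sub>R x \<in> {x \<in> C. ip f x = 0}" if "x \<in> {x \<in> C. ip f x = 0}" for c x
            using that L2_bilinear(4)[of x a b x f] C_ops(3)[of x c] fC by simp
        qed
      qed
      then show ?thesis using B(3)[of \<mu>] that(2) by blast
    next
      case False
      then have "edim (sl_eig K a b \<mu>) = enat 0" using L(3) that(1) by (simp add: zero_enat_def)
      then have "B \<mu> = {}" using B(4)[of \<mu>] B(5)[of \<mu>] by simp
      then have "x = 0" using B(3)[of \<mu>] that(2) by auto
      then show ?thesis by (simp add: L2_inner_def)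
    qed
    \<comment> \<open>A broken field that vanishes on the interval is excluded here as well: it
      would be differentiable too, which contradicts \<open>u \<noteq> 0\<close>.\<close>
    have diff: "\<exists>d. (broken u has_vector_derivative d) (at s within {a..b})" if s: "s \<in> {a..b}" for s
    proof (cases "ip (broken u) (broken u) = 0")
      case True
      have cb: "continuous_on {a..b} (broken u)" using broken_in_C[OF u(1)] by (simp add: cont_space_def)
      have z: "broken u s = 0" if "s \<in> {a..b}" for s
        using L2_inner_self_eq_0[OF cb ab] True that by blast
      have "(broken u has_vector_derivative 0) (at s within {a..b})"
        by (rule has_vector_derivative_transform[OF s z has_vector_derivative_const])
      then show ?thesis ..
    next
      case False
      then have p: "0 < ip (broken u) (broken u)" using L2_inner_self_ge_0[of a b "broken u"] by simp
      have z: "broken u s = l *\<^sub>R G (broken u) s" if "s \<in> {a..b}" for s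
        by (rule extremal_eigenfunction[OF E wV p broken_rayleigh[OF u(1)] complete that])
      have "(broken u has_vector_derivative l *\<^sub>R G' (broken u) s) (at s within {a..b})"
        by (rule has_vector_derivative_transform[OF s z
            bounded_linear.has_vector_derivative[OF bounded_linear_scaleR_right G_deriv[OF broken_in_C[OF u(1)] s]]])
      then show ?thesis ..
    qed
    show False by (rule broken_not_smooth[OF u(1,2) diff])
  qed
  moreover have "(\<Sum>t\<in>conj_set. edim (sl_eig K a t 0)) = enat (card U)"
  proof -
    have "edim (sl_eig K a t 0) = enat (dim (?N t))" if "t \<in> conj_set" for t
      using edim_kernel_eig[of t] conj_set_ab[OF that] eN[of t] by simp
    then show ?thesis unfolding U(3) enat_sum by (intro sum.cong) auto
  qed
  moreover have "(\<Sum>\<mu>\<in>L. edim (sl_eig K a b \<mu>)) = enat (card ?I)"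
    unfolding cI enat_sum using B(5) by (intro sum.cong) auto
  ultimately show ?thesis by simp
qed

end

text \<open>The three inequalities form a cycle once the eigenvalue set is finite. Finite support
  sets are returned so that infinite sums over intervals reduce to finite ones.\<close>

theorem sturm_liouville_index:
  assumes "sturm_liouville K a b"
  obtains L T l where "finite L" "L \<subseteq> {..<0}" "finite T" "T \<subseteq> {a<..<b}" "l < 0" "L \<subseteq> {l<..}"
    "\<And>\<mu>. \<mu> < 0 \<Longrightarrow> \<mu> \<notin> L \<Longrightarrow> edim (sl_eig K a b \<mu>) = 0"
    "\<And>t. t \<in> {a<..<b} \<Longrightarrow> t \<notin> T \<Longrightarrow> edim (sl_eig K a t 0) = 0"
    "form_index (sl_form K a b) (sl_space a b) = (\<Sum>\<mu>\<in>L. edim (sl_eig K a b \<mu>))"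
    "(\<Sum>\<mu>\<in>L. edim (sl_eig K a b \<mu>)) = (\<Sum>t\<in>T. edim (sl_eig K a t 0))"
proof -
  interpret sturm_liouville K a b by fact
  obtain J P where "jacobi_matrix K a b J P" using jacobi_matrix_exists by blast
  then interpret jacobi_matrix K a b J P .
  obtain l G G' where "green_operator K a b l G G'" using green_operator_obtain by blast
  then interpret green_operator K a b l G G' .
  interpret jacobi_green K a b J P l G G' ..
  define L where "L = {\<mu>. \<mu> < 0 \<and> edim (sl_eig K a b \<mu>) \<noteq> 0}"
  define N where "N = (\<Sum>t\<in>conj_set. edim (sl_eig K a t 0))"
  \<comment> \<open>Finitely many conjugate values, each of multiplicity at most the dimension of
    the system.\<close>
  obtain k where k: "N = enat k"
  proof -
    have "N \<le> (\<Sum>t\<in>conj_set. enat CARD('a))"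
      unfolding N_def
    proof (rule sum_mono)
      fix t assume "t \<in> conj_set"
      then interpret r: sturm_liouville K a t using conj_set_ab by (intro restrict) auto
      show "edim (sl_eig K a t 0) \<le> enat CARD('a)" by (rule r.edim_eig_finite)
    qed
    also have "\<dots> = enat (\<Sum>t\<in>conj_set. CARD('a))" by (rule enat_sum[symmetric])
    finally show ?thesis using that by (metis enat_ile)
  qed
  have bound: "(\<Sum>\<mu>\<in>M. edim (sl_eig K a b \<mu>)) \<le> enat k" if "finite M" "M \<subseteq> L" for M
    using eig_sum_le_index[of M] index_le_conj_sum that unfolding k[symmetric] N_def L_def by force
  \<comment> \<open>Each member of \<open>L\<close> contributes at least 1 to a sum bounded by
    \<open>k\<close>, so more than \<open>k\<close> eigenvalues are impossible.\<close>
  have fin: "finite L"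
  proof (rule ccontr)
    assume "infinite L"
    then obtain M where M: "M \<subseteq> L" "finite M" "card M = Suc k" using infinite_arbitrarily_large by blast
    have "enat (Suc k) = (\<Sum>\<mu>\<in>M. enat 1)" unfolding enat_sum[symmetric] by (simp add: M(3))
    also have "\<dots> \<le> (\<Sum>\<mu>\<in>M. edim (sl_eig K a b \<mu>))"
    proof (rule sum_mono)
      fix \<mu> assume "\<mu> \<in> M"
      then have "edim (sl_eig K a b \<mu>) \<noteq> 0" using M(1) by (auto simp: L_def)
      then show "enat 1 \<le> edim (sl_eig K a b \<mu>)" by (cases "edim (sl_eig K a b \<mu>)") (auto simp: zero_enat_def)
    qed
    also have "\<dots> \<le> enat k" using bound M by blast
    finally show False by simp
  qed
  have L: "L \<subseteq> {..<0}" "\<And>\<mu>. \<mu> < 0 \<Longrightarrow> \<mu> \<notin> L \<Longrightarrow> edim (sl_eig K a b \<mu>) = 0" by (auto simp: L_def)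
  have i1: "(\<Sum>\<mu>\<in>L. edim (sl_eig K a b \<mu>)) \<le> form_index (sl_form K a b) (sl_space a b)"
    by (rule eig_sum_le_index[OF fin L(1)])
  have i2: "form_index (sl_form K a b) (sl_space a b) \<le> N" unfolding N_def by (rule index_le_conj_sum)
  have i3: "N \<le> (\<Sum>\<mu>\<in>L. edim (sl_eig K a b \<mu>))" unfolding N_def by (rule conj_sum_le_eig_sum[OF fin L])
  show ?thesis
  \<comment> \<open>The lower end \<open>- l - 1\<close> lies below every eigenvalue, because all of
    them exceed \<open>- l\<close>.\<close>
  proof (rule that[of L conj_set "- l - 1"])
    show "L \<subseteq> {- l - 1<..}"
    proof
      fix \<mu> assume "\<mu> \<in> L"
      then have "edim (sl_eig K a b \<mu>) \<noteq> 0" by (simp add: L_def)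
      then have "\<not> sl_eig K a b \<mu> \<subseteq> {0}" using edim_basis[of "{}" "sl_eig K a b \<mu>"] by (auto simp: zero_enat_def independent_empty)
      then obtain e where "e \<in> sl_eig K a b \<mu>" "e \<noteq> 0" by blast
      from eig_gt[OF this] show "\<mu> \<in> {- l - 1<..}" by simp
    qed
    show "edim (sl_eig K a t 0) = 0" if t: "t \<in> {a<..<b}" "t \<notin> conj_set" for t
    proof -
      have "u = 0" if "J t *v u = 0" for u using t that unfolding conj_set_def by blast
      then have "{u. J t *v u = 0} \<subseteq> span {}" by auto
      then have "edim {u. J t *v u = 0} = 0"
        using edim_basis[OF independent_empty empty_subsetI] by (simp add: zero_enat_def)
      moreover have "t \<in> {a<..b}" using t by simp
      ultimately show ?thesis using edim_kernel_eig by simp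
    qed
    show "- l - 1 < 0" using l_pos by simp
    show "conj_set \<subseteq> {a<..<b}" by (auto simp: conj_set_def)
    show "form_index (sl_form K a b) (sl_space a b) = (\<Sum>\<mu>\<in>L. edim (sl_eig K a b \<mu>))"
      using i1 i2 i3 by (meson order.antisym order.trans)
    show "(\<Sum>\<mu>\<in>L. edim (sl_eig K a b \<mu>)) = (\<Sum>t\<in>conj_set. edim (sl_eig K a t 0))"
      using i1 i2 i3 unfolding N_def by (meson order.antisym order.trans)
  qed (rule fin finite_conj_set L | assumption)+
qed

subsection \<open>Smooth functions of several variables\<close>

text \<open>The point comes last, so that the derivative in a fixed direction is again a function of
  the point and can be iterated.\<close>

definition dird :: "('a::real_normed_vector \<Rightarrow> 'b::real_normed_vector) \<Rightarrow> 'a \<Rightarrow> 'a \<Rightarrow> 'b"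
  where "dird f v x = frechet_derivative f (at x) v"

lemma dird_eq: "(f has_derivative f') (at x) \<Longrightarrow> dird f v x = f' v"
  unfolding dird_def by (metis frechet_derivative_at)

lemma frechet_derivative_cong_open:
  assumes "open S" "x \<in> S" "\<And>y. y \<in> S \<Longrightarrow> f y = g y"
  shows "frechet_derivative f (at x) = frechet_derivative g (at x)"
proof -
  have "(f has_derivative D) (at x) \<longleftrightarrow> (g has_derivative D) (at x)" for D
    using has_derivative_transform_within_open[of f D x UNIV S g] has_derivative_transform_within_open[of g D x UNIV S f]
      assms by auto
  then show ?thesis by (simp add: frechet_derivative_def)
qed

lemma differentiable_cong_open:
  assumes "open S" "x \<in> S" "\<And>y. y \<in> S \<Longrightarrow> f y = g y" "f differentiable (at x)"
  shows "g differentiable (at x)"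
  using assms has_derivative_transform_within_open[of f _ x UNIV S g] unfolding differentiable_def by auto

lemma Ck_on_cong:
  assumes "open S" "\<And>x. x \<in> S \<Longrightarrow> f x = g x" "Ck_on k f S"
  shows "Ck_on k g S"
  using assms(2,3)
proof (induction k arbitrary: f g)
  case 0
  then show ?case using continuous_on_cong[of S S f g] by simp
next
  case (Suc k)
  have fe: "frechet_derivative f (at x) = frechet_derivative g (at x)" if "x \<in> S" for x
    by (rule frechet_derivative_cong_open[OF assms(1) that Suc.prems(1)])
  have "g differentiable (at x)" if "x \<in> S" for x
    by (rule differentiable_cong_open[OF assms(1) that Suc.prems(1)]) (use Suc.prems(2) that in simp_all)
  moreover have "Ck_on k (\<lambda>x. frechet_derivative g (at x) v) S" for v
    by (rule Suc.IH[of "\<lambda>x. frechet_derivative f (at x) v"]) (use fe Suc.prems(2) in simp_all)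
  ultimately show ?case by simp
qed

lemma Ck_on_Suc_D: "Ck_on (Suc k) f S \<Longrightarrow> Ck_on k f S"
proof (induction k arbitrary: f)
  case 0
  then show ?case
    by (auto simp: continuous_on_eq_continuous_within intro!: differentiable_imp_continuous_within
        intro: differentiable_at_withinI)
next
  case (Suc k)
  have "Ck_on k (\<lambda>x. frechet_derivative f (at x) v) S" for v
    using Suc.prems by (intro Suc.IH) (simp del: Ck_on.simps(2) add: Ck_on.simps(2)[of "Suc k" f])
  then show ?case using Suc.prems by simp
qed

lemma Ck_on_const: "Ck_on k (\<lambda>_. c) S"
proof (induction k arbitrary: c)
  case (Suc k)
  have "frechet_derivative (\<lambda>_. c) (at x) = (\<lambda>_. 0)" for x :: 'a
    by (metis frechet_derivative_at has_derivative_const)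
  then show ?case using Suc[of 0] by simp
qed simp

lemma Ck_on_linear:
  assumes L: "bounded_linear L" and S: "open S"
  shows "Ck_on k f S \<Longrightarrow> Ck_on k (\<lambda>x. L (f x)) S"
proof (induction k arbitrary: f)
  case 0
  then show ?case using bounded_linear.continuous_on[OF L] by simp
next
  case (Suc k)
  have d: "((\<lambda>x. L (f x)) has_derivative (\<lambda>v. L (frechet_derivative f (at x) v))) (at x)" if "x \<in> S" for x
    by (rule bounded_linear.has_derivative[OF L]) (use Suc.prems that in \<open>simp add: frechet_derivative_works\<close>)
  have "Ck_on k (\<lambda>x. frechet_derivative (\<lambda>x. L (f x)) (at x) v) S" for v
    by (rule Ck_on_cong[OF S _ Suc.IH[of "\<lambda>x. frechet_derivative f (at x) v"]])
      (use Suc.prems frechet_derivative_at[OF d] in \<open>auto simp: fun_eq_iff\<close>)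
  then show ?case using d unfolding Ck_on.simps(2) differentiable_def by blast
qed

lemma Ck_on_add:
  assumes S: "open S"
  shows "Ck_on k f S \<Longrightarrow> Ck_on k g S \<Longrightarrow> Ck_on k (\<lambda>x. f x + g x) S"
proof (induction k arbitrary: f g)
  case 0
  then show ?case by (simp add: continuous_on_add)
next
  case (Suc k)
  have d: "((\<lambda>x. f x + g x) has_derivative (\<lambda>v. frechet_derivative f (at x) v + frechet_derivative g (at x) v)) (at x)"
    if "x \<in> S" for x
    by (rule has_derivative_add) (use Suc.prems that in \<open>simp_all add: frechet_derivative_works\<close>)
  have "Ck_on k (\<lambda>x. frechet_derivative (\<lambda>x. f x + g x) (at x) v) S" for v
    by (rule Ck_on_cong[OF S _ Suc.IH[of "\<lambda>x. frechet_derivative f (at x) v" "\<lambda>x. frechet_derivative g (at x) v"]])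
      (use Suc.prems frechet_derivative_at[OF d] in \<open>auto simp: fun_eq_iff\<close>)
  then show ?case using d unfolding Ck_on.simps(2) differentiable_def by blast
qed

lemma Ck_on_bilinear:
  assumes B: "bounded_bilinear B" and S: "open S"
  shows "Ck_on k f S \<Longrightarrow> Ck_on k g S \<Longrightarrow> Ck_on k (\<lambda>x. B (f x) (g x)) S"
proof (induction k arbitrary: f g)
  case 0
  then show ?case using bounded_bilinear.continuous_on[OF B] by simp
next
  case (Suc k)
  have d: "((\<lambda>x. B (f x) (g x)) has_derivative
      (\<lambda>v. B (f x) (frechet_derivative g (at x) v) + B (frechet_derivative f (at x) v) (g x))) (at x)"
    if "x \<in> S" for x
    by (rule bounded_bilinear.FDERIV[OF B]) (use Suc.prems that in \<open>simp_all add: frechet_derivative_works\<close>)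
  have "Ck_on k (\<lambda>x. frechet_derivative (\<lambda>x. B (f x) (g x)) (at x) v) S" for v
  proof (rule Ck_on_cong[OF S _ Ck_on_add[OF S Suc.IH Suc.IH]])
    show "B (f x) (frechet_derivative g (at x) v) + B (frechet_derivative f (at x) v) (g x) =
      frechet_derivative (\<lambda>x. B (f x) (g x)) (at x) v" if "x \<in> S" for x
      using frechet_derivative_at[OF d[OF that]] by (simp add: fun_eq_iff)
  qed (use Suc.prems Ck_on_Suc_D[of k f S] Ck_on_Suc_D[of k g S] in auto)
  then show ?case using d unfolding Ck_on.simps(2) differentiable_def by blast
qed

lemma smooth_on_const: "smooth_on (\<lambda>_. c) S"
  by (simp add: smooth_on_def Ck_on_const)

lemma smooth_on_linear: "bounded_linear L \<Longrightarrow> open S \<Longrightarrow> smooth_on f S \<Longrightarrow> smooth_on (\<lambda>x. L (f x)) S"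
  by (auto simp: smooth_on_def intro: Ck_on_linear)

lemma smooth_on_add: "open S \<Longrightarrow> smooth_on f S \<Longrightarrow> smooth_on g S \<Longrightarrow> smooth_on (\<lambda>x. f x + g x) S"
  by (auto simp: smooth_on_def intro: Ck_on_add)

lemma smooth_on_diff: "open S \<Longrightarrow> smooth_on f S \<Longrightarrow> smooth_on g S \<Longrightarrow> smooth_on (\<lambda>x. f x - g x) S"
  using smooth_on_add[of S f "\<lambda>x. - g x"] smooth_on_linear[OF bounded_linear_minus[OF bounded_linear_ident], of S g]
  by simp

lemma smooth_on_sum: "open S \<Longrightarrow> (\<And>i. i \<in> I \<Longrightarrow> smooth_on (f i) S) \<Longrightarrow> smooth_on (\<lambda>x. \<Sum>i\<in>I. f i x) S"
  by (induction I rule: infinite_finite_induct) (auto intro: smooth_on_add smooth_on_const)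

lemma smooth_on_bilinear:
  "bounded_bilinear B \<Longrightarrow> open S \<Longrightarrow> smooth_on f S \<Longrightarrow> smooth_on g S \<Longrightarrow> smooth_on (\<lambda>x. B (f x) (g x)) S"
  by (auto simp: smooth_on_def intro: Ck_on_bilinear)

lemma smooth_on_has_derivative:
  assumes "smooth_on f S" "x \<in> S"
  shows "(f has_derivative (\<lambda>v. dird f v x)) (at x)"
proof -
  have "Ck_on (Suc 0) f S" using assms unfolding smooth_on_def by blast
  then show ?thesis using assms(2) by (simp add: frechet_derivative_works dird_def)
qed

lemma smooth_on_dird: "smooth_on f S \<Longrightarrow> smooth_on (dird f v) S"
  unfolding smooth_on_def dird_def[abs_def]
proof
  fix k assume "\<forall>k. Ck_on k f S"
  then have "Ck_on (Suc k) f S" by blast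
  then show "Ck_on k (\<lambda>x. frechet_derivative f (at x) v) S" by simp
qed

lemma smooth_on_continuous: "smooth_on f S \<Longrightarrow> continuous_on S f"
  unfolding smooth_on_def using Ck_on.simps(1) by metis

lemma linear_dird: "smooth_on f S \<Longrightarrow> x \<in> S \<Longrightarrow> linear (\<lambda>v. dird f v x)"
  using smooth_on_has_derivative has_derivative_linear by blast

lemma det_differentiable:
  fixes F :: "'a::real_normed_vector \<Rightarrow> real^'n^'n"
  assumes "\<And>i j. (\<lambda>x. F x $ i $ j) differentiable (at x)"
  shows "(\<lambda>x. det (F x)) differentiable (at x)"
proof -
  have "(\<lambda>x. \<Prod>i\<in>UNIV. F x $ i $ p i) differentiable (at x)" for p
  proof -
    have "\<forall>i. \<exists>D. ((\<lambda>x. F x $ i $ p i) has_derivative D) (at x)" using assms by (simp add: differentiable_def)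
    then obtain D where D: "\<And>i. ((\<lambda>x. F x $ i $ p i) has_derivative D i) (at x)" by metis
    have "((\<lambda>x. \<Prod>i\<in>UNIV. F x $ i $ p i) has_derivative
        (\<lambda>y. \<Sum>i\<in>UNIV. D i y * (\<Prod>j\<in>UNIV - {i}. F x $ j $ p j))) (at x)"
      by (rule has_derivative_prod) (rule D)
    then show ?thesis unfolding differentiable_def by blast
  qed
  then show ?thesis unfolding det_def
    by (intro differentiable_sum ballI differentiable_mult differentiable_const) (auto simp: finite_permutations)
qed

lemma matrix_inv_cancel:
  assumes "invertible (A :: real^'n^'n)"
  shows "A ** matrix_inv A = mat 1" "matrix_inv A ** A = mat 1"
  using someI_ex[OF assms[unfolded invertible_def]] by (simp_all add: matrix_inv_def)

lemma matrix_inv_cramer: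
  fixes A :: "real^'n^'n"
  assumes "invertible A"
  shows "matrix_inv A $ i $ j = det (\<chi> k l. if l = i then axis j 1 $ k else A $ k $ l) / det A"
proof -
  have "A *v (matrix_inv A *v axis j 1) = axis j 1"
    using matrix_inv_cancel(1)[OF assms] by (simp add: matrix_vector_mul_assoc)
  moreover have "det A \<noteq> 0" using assms invertible_det_nz by blast
  ultimately have "matrix_inv A *v axis j 1 = (\<chi> k. det (\<chi> k' l. if l = k then axis j 1 $ k' else A $ k' $ l) / det A)"
    using cramer[of A] by blast
  moreover have "(matrix_inv A *v axis j 1) $ i = matrix_inv A $ i $ j"
    by (simp add: matrix_vector_mult_basis column_def)
  ultimately show ?thesis by simp
qed

text \<open>Differentiability of the entries comes from Cramer's rule; the value of the derivative
  is then forced by differentiating \<open>matrix_inv (M y) ** M y = mat 1\<close>.\<close>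

lemma matrix_inv_has_derivative:
  fixes M :: "'a::real_normed_vector \<Rightarrow> real^'n^'n"
  assumes S: "open S" "x \<in> S" and inv: "\<And>y. y \<in> S \<Longrightarrow> invertible (M y)" and M: "(M has_derivative M') (at x)"
  shows "((\<lambda>y. matrix_inv (M y)) has_derivative (\<lambda>v. - (matrix_inv (M x) ** M' v ** matrix_inv (M x)))) (at x)"
proof -
  have dM: "(\<lambda>y. M y $ i $ j) differentiable (at x)" for i j
    using bounded_linear.has_derivative[OF bounded_linear_vec_nth bounded_linear.has_derivative[OF bounded_linear_vec_nth M]]
    unfolding differentiable_def by blast
  have "(\<lambda>y. matrix_inv (M y)) differentiable (at x)"
  proof (rule differentiable_componentwise_within[of _ x UNIV, THEN iffD2], rule ballI)
    fix b :: "real^'n^'n" assume "b \<in> Basis"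
    then obtain i j where b: "b = axis i (axis j 1)" by (auto simp: Basis_vec_def)
    have nz: "det (M y) \<noteq> 0" if "y \<in> S" for y using inv[OF that] invertible_det_nz by blast
    have "(\<lambda>y. (\<chi> k l. if l = i then axis j 1 $ k else M y $ k $ l) $ k $ l) differentiable (at x)" for k l
      using dM[of k l] by (cases "l = i") auto
    then have "(\<lambda>y. det (\<chi> k l. if l = i then axis j 1 $ k else M y $ k $ l) / det (M y)) differentiable (at x)"
      using nz[OF S(2)] dM by (intro differentiable_divide det_differentiable) auto
    then have "(\<lambda>y. matrix_inv (M y) $ i $ j) differentiable (at x)"
      by (rule differentiable_cong_open[OF S, rotated]) (simp add: matrix_inv_cramer[OF inv])
    then show "(\<lambda>y. matrix_inv (M y) \<bullet> b) differentiable (at x)" by (simp add: b inner_axis)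
  qed
  then obtain N' where N: "((\<lambda>y. matrix_inv (M y)) has_derivative N') (at x)" unfolding differentiable_def by blast
  let ?N = "matrix_inv (M x)"
  have "((\<lambda>y. matrix_inv (M y) ** M y) has_derivative (\<lambda>v. ?N ** M' v + N' v ** M x)) (at x)"
    by (rule bounded_bilinear.FDERIV[OF bounded_bilinear_mat_mat N M])
  moreover have "((\<lambda>y. matrix_inv (M y) ** M y) has_derivative (\<lambda>v. 0)) (at x)"
    by (rule has_derivative_transform_within_open[OF has_derivative_const S]) (simp add: matrix_inv_cancel(2) inv)
  ultimately have "(\<lambda>v. ?N ** M' v + N' v ** M x) = (\<lambda>v. 0)" by (rule has_derivative_unique)
  then have "N' v = - (?N ** M' v ** ?N)" for v
  proof -
    assume "(\<lambda>v. ?N ** M' v + N' v ** M x) = (\<lambda>v. 0)"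
    then have "N' v ** M x = - (?N ** M' v)" by (metis (mono_tags) add.commute eq_neg_iff_add_eq_0)
    then have "N' v ** (M x ** ?N) = - (?N ** M' v) ** ?N" by (simp add: matrix_mul_assoc)
    then show ?thesis
      using matrix_inv_cancel(1)[OF inv[OF S(2)]] bounded_bilinear.minus_left[OF bounded_bilinear_mat_mat] by simp
  qed
  then have "N' = (\<lambda>v. - (?N ** M' v ** ?N))" by (rule ext)
  then show ?thesis using N by simp
qed

text \<open>The derivative is a polynomial in the inverse and the derivative of \<open>M\<close>, so
  each order of regularity of the inverse gives the next.\<close>

lemma smooth_on_matrix_inv:
  fixes M :: "'a::real_normed_vector \<Rightarrow> real^'n^'n"
  assumes S: "open S" and M: "smooth_on M S" and inv: "\<And>y. y \<in> S \<Longrightarrow> invertible (M y)"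
  shows "smooth_on (\<lambda>y. matrix_inv (M y)) S"
  unfolding smooth_on_def
proof
  let ?N = "\<lambda>y. matrix_inv (M y)"
  have d: "(?N has_derivative (\<lambda>v. - (?N x ** dird M v x ** ?N x))) (at x)" if "x \<in> S" for x
    by (rule matrix_inv_has_derivative[OF S that inv smooth_on_has_derivative[OF M that]])
  fix k show "Ck_on k ?N S"
  proof (induction k)
    case 0
    have "continuous (at x within S) ?N" if "x \<in> S" for x
      using has_derivative_continuous[OF d[OF that]] continuous_at_imp_continuous_at_within by blast
    then show ?case by (simp add: continuous_on_eq_continuous_within)
  next
    case (Suc k)
    have "Ck_on k (\<lambda>x. - (?N x ** dird M v x ** ?N x)) S" for v
      using smooth_on_dird[OF M, of v] unfolding smooth_on_def
      by (intro Ck_on_linear[OF bounded_linear_minus[OF bounded_linear_ident] S]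
          Ck_on_bilinear[OF bounded_bilinear_mat_mat S] Suc) auto
    then have "Ck_on k (\<lambda>x. frechet_derivative ?N (at x) v) S" for v
      by (rule Ck_on_cong[OF S, rotated]) (use frechet_derivative_at[OF d] in \<open>auto simp: fun_eq_iff\<close>)
    then show ?case using d unfolding Ck_on.simps(2) differentiable_def by blast
  qed
qed

lemma has_derivative_along_line:
  assumes "(f has_derivative f') (at (p + r *\<^sub>R u))"
  shows "((\<lambda>r. f (p + r *\<^sub>R u)) has_vector_derivative f' u) (at r)"
proof -
  have "((\<lambda>r. p + r *\<^sub>R u) has_derivative (\<lambda>h. h *\<^sub>R u)) (at r)" by (auto intro!: derivative_eq_intros)
  from has_derivative_compose[OF this assms]
  have "((\<lambda>r. f (p + r *\<^sub>R u)) has_derivative (\<lambda>h. f' (h *\<^sub>R u))) (at r)" .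
  moreover have "f' (h *\<^sub>R u) = h *\<^sub>R f' u" for h
    using has_derivative_linear[OF assms] by (rule linear_cmul)
  ultimately show ?thesis by (simp add: has_vector_derivative_def)
qed

text \<open>The mean value theorem in direction \<open>u\<close>, applied to the increment in
  direction \<open>v\<close>, and then once more in direction \<open>v\<close>.\<close>

lemma second_difference:
  fixes f :: "'a::real_normed_vector \<Rightarrow> real"
  assumes f: "smooth_on f S" and h: "0 < h"
    and S: "\<And>r k. 0 \<le> r \<Longrightarrow> r \<le> h \<Longrightarrow> 0 \<le> k \<Longrightarrow> k \<le> h \<Longrightarrow> x + r *\<^sub>R u + k *\<^sub>R v \<in> S"
  obtains r k where "0 < r" "r < h" "0 < k" "k < h"
    "f (x + h *\<^sub>R u + h *\<^sub>R v) - f (x + h *\<^sub>R u) - f (x + h *\<^sub>R v) + f x = h * (h * dird (dird f u) v (x + r *\<^sub>R u + k *\<^sub>R v))"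
proof -
  let ?\<phi> = "\<lambda>r. f ((x + h *\<^sub>R v) + r *\<^sub>R u) - f (x + r *\<^sub>R u)"
  have d: "(?\<phi> has_real_derivative (dird f u ((x + h *\<^sub>R v) + r *\<^sub>R u) - dird f u (x + r *\<^sub>R u))) (at r)"
    if "0 \<le> r" "r \<le> h" for r
  proof -
    have "(x + h *\<^sub>R v) + r *\<^sub>R u \<in> S" "x + r *\<^sub>R u \<in> S"
      using S[OF that, of h] S[OF that, of 0] h by (simp_all add: algebra_simps)
    then show ?thesis unfolding has_real_derivative_iff_has_vector_derivative
      by (intro has_vector_derivative_diff has_derivative_along_line smooth_on_has_derivative[OF f])
  qed
  obtain r where r: "0 < r" "r < h" "?\<phi> h - ?\<phi> 0 = (h - 0) * (dird f u ((x + h *\<^sub>R v) + r *\<^sub>R u) - dird f u (x + r *\<^sub>R u))"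
    using MVT2[OF h d] by blast
  let ?\<psi> = "\<lambda>k. dird f u ((x + r *\<^sub>R u) + k *\<^sub>R v)"
  have d2: "(?\<psi> has_real_derivative dird (dird f u) v ((x + r *\<^sub>R u) + k *\<^sub>R v)) (at k)" if "0 \<le> k" "k \<le> h" for k
  proof -
    have "(x + r *\<^sub>R u) + k *\<^sub>R v \<in> S" using S[OF _ _ that, of r] r by simp
    then show ?thesis unfolding has_real_derivative_iff_has_vector_derivative
      by (intro has_derivative_along_line smooth_on_has_derivative[OF smooth_on_dird[OF f]])
  qed
  obtain k where k: "0 < k" "k < h" "?\<psi> h - ?\<psi> 0 = (h - 0) * dird (dird f u) v ((x + r *\<^sub>R u) + k *\<^sub>R v)"
    using MVT2[OF h d2] by blast
  have "?\<psi> h - ?\<psi> 0 = dird f u ((x + h *\<^sub>R v) + r *\<^sub>R u) - dird f u (x + r *\<^sub>R u)" by (simp add: algebra_simps)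
  then show ?thesis using that[OF r(1,2) k(1,2)] r(3) k(3) by (simp add: algebra_simps)
qed

text \<open>The second difference is symmetric in \<open>u\<close> and \<open>v\<close>. On small
  parallelograms it represents both mixed derivatives at nearby points, and continuity does the
  rest.\<close>

lemma dird_commute_real:
  fixes f :: "'a::real_normed_vector \<Rightarrow> real"
  assumes S: "open S" "x \<in> S" and f: "smooth_on f S"
  shows "dird (dird f u) v x = dird (dird f v) u x"
proof (rule ccontr)
  assume ne: "\<not> ?thesis"
  define e where "e = \<bar>dird (dird f u) v x - dird (dird f v) u x\<bar> / 2"
  have e: "0 < e" using ne by (simp add: e_def)
  have c: "continuous_on S (dird (dird f u) v)" "continuous_on S (dird (dird f v) u)"
    using f smooth_on_dird smooth_on_continuous by blast+
  obtain d1 where d1: "0 < d1" "\<And>y. y \<in> S \<Longrightarrow> dist y x < d1 \<Longrightarrow> dist (dird (dird f u) v y) (dird (dird f u) v x) < e"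
    using c(1) S(2) e unfolding continuous_on_iff by metis
  obtain d2 where d2: "0 < d2" "\<And>y. y \<in> S \<Longrightarrow> dist y x < d2 \<Longrightarrow> dist (dird (dird f v) u y) (dird (dird f v) u x) < e"
    using c(2) S(2) e unfolding continuous_on_iff by metis
  obtain d3 where d3: "0 < d3" "ball x d3 \<subseteq> S" using S open_contains_ball by metis
  define d where "d = Min {d1, d2, d3}"
  have d: "0 < d" "d \<le> d1" "d \<le> d2" "d \<le> d3" using d1 d2 d3 by (auto simp: d_def)
  \<comment> \<open>This side length keeps the parallelogram within distance \<open>d / 2\<close> of
    \<open>x\<close>; the summand 1 avoids a zero denominator.\<close>
  define h where "h = d / (2 * (norm u + norm v + 1))"
  have nn: "0 < norm u + norm v + 1" by (simp add: add_nonneg_pos)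
  have h: "0 < h" using d(1) nn by (simp add: h_def)
  have cancel: "d / (2 * n) * n = d / 2" if "0 < n" for n :: real using that by simp
  have near: "dist (x + r *\<^sub>R u + k *\<^sub>R v) x < d" if "0 \<le> r" "r \<le> h" "0 \<le> k" "k \<le> h" for r k
  proof -
    have "norm (r *\<^sub>R u + k *\<^sub>R v) \<le> r * norm u + k * norm v"
      using norm_triangle_ineq[of "r *\<^sub>R u" "k *\<^sub>R v"] that by simp
    also have "\<dots> \<le> h * norm u + h * norm v" using that by (intro add_mono mult_right_mono) auto
    also have "\<dots> \<le> h * (norm u + norm v + 1)" using h by (simp add: algebra_simps)
    also have "\<dots> = d / 2" unfolding h_def by (rule cancel[OF nn])
    finally show ?thesis using d(1) by (simp add: dist_norm add.assoc)
  qed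
  have inS: "x + r *\<^sub>R u + k *\<^sub>R v \<in> S" if "0 \<le> r" "r \<le> h" "0 \<le> k" "k \<le> h" for r k
    using near[OF that] d3(2) d(4) by (auto simp: dist_commute)
  obtain r k where rk: "0 < r" "r < h" "0 < k" "k < h"
    "f (x + h *\<^sub>R u + h *\<^sub>R v) - f (x + h *\<^sub>R u) - f (x + h *\<^sub>R v) + f x = h * (h * dird (dird f u) v (x + r *\<^sub>R u + k *\<^sub>R v))"
    by (rule second_difference[OF f h inS])
  have inS': "x + k *\<^sub>R v + r *\<^sub>R u \<in> S" if "0 \<le> k" "k \<le> h" "0 \<le> r" "r \<le> h" for r k
    using inS[OF that(3,4,1,2)] by (simp add: algebra_simps)
  obtain k' r' where rk': "0 < k'" "k' < h" "0 < r'" "r' < h"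
    "f (x + h *\<^sub>R v + h *\<^sub>R u) - f (x + h *\<^sub>R v) - f (x + h *\<^sub>R u) + f x = h * (h * dird (dird f v) u (x + k' *\<^sub>R v + r' *\<^sub>R u))"
    by (rule second_difference[OF f h inS'])
  have sw: "x + k' *\<^sub>R v + r' *\<^sub>R u = x + r' *\<^sub>R u + k' *\<^sub>R v" "x + h *\<^sub>R v + h *\<^sub>R u = x + h *\<^sub>R u + h *\<^sub>R v"
    by (simp_all add: algebra_simps)
  have "h * (h * dird (dird f u) v (x + r *\<^sub>R u + k *\<^sub>R v)) = h * (h * dird (dird f v) u (x + r' *\<^sub>R u + k' *\<^sub>R v))"
    using rk(5) rk'(5) unfolding sw by linarith
  then have "dird (dird f u) v (x + r *\<^sub>R u + k *\<^sub>R v) = dird (dird f v) u (x + r' *\<^sub>R u + k' *\<^sub>R v)" using h by simp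
  moreover have "dist (dird (dird f u) v (x + r *\<^sub>R u + k *\<^sub>R v)) (dird (dird f u) v x) < e"
    using rk near[of r k] inS[of r k] d by (intro d1(2)) auto
  moreover have "dist (dird (dird f v) u (x + r' *\<^sub>R u + k' *\<^sub>R v)) (dird (dird f v) u x) < e"
    using rk' near[of r' k'] inS[of r' k'] d by (intro d2(2)) auto
  ultimately show False unfolding e_def dist_real_def by (smt (verit) field_sum_of_halves)
qed

lemma dird_commute:
  fixes f :: "'a::real_normed_vector \<Rightarrow> 'b::euclidean_space"
  assumes S: "open S" "x \<in> S" and f: "smooth_on f S"
  shows "dird (dird f u) v x = dird (dird f v) u x"
proof (rule euclidean_eqI)
  fix e :: 'b assume "e \<in> Basis"
  have sm: "smooth_on (\<lambda>x. f x \<bullet> e) S" by (rule smooth_on_linear[OF bounded_linear_inner_left S(1) f])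
  have in1: "dird (\<lambda>y. F y \<bullet> e) w y = dird F w y \<bullet> e" if "smooth_on F S" "y \<in> S" for F w y
    by (rule dird_eq, rule bounded_linear.has_derivative[OF bounded_linear_inner_left smooth_on_has_derivative[OF that]])
  have "dird (dird f u) v x \<bullet> e = dird (dird (\<lambda>y. f y \<bullet> e) u) v x" for u v
  proof -
    have "frechet_derivative (\<lambda>y. dird f u y \<bullet> e) (at x) = frechet_derivative (dird (\<lambda>y. f y \<bullet> e) u) (at x)"
      by (rule frechet_derivative_cong_open[OF S]) (simp add: in1[OF f])
    then have "dird (dird (\<lambda>y. f y \<bullet> e) u) v x = dird (\<lambda>y. dird f u y \<bullet> e) v x" by (simp add: dird_def[of _ v])
    then show ?thesis using in1[OF smooth_on_dird[OF f] S(2)] by simp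
  qed
  then show "dird (dird f u) v x \<bullet> e = dird (dird f v) u x \<bullet> e"
    using dird_commute_real[OF S sm] by simp
qed

text \<open>The product rule for a family of linear maps given only pointwise: expansion over the
  basis reduces it to products of scalars and vectors, without a normed space of linear
  maps.\<close>

lemma has_derivative_linear_family:
  fixes F :: "'a::real_normed_vector \<Rightarrow> 'b::euclidean_space \<Rightarrow> 'c::real_normed_vector"
  assumes S: "open S" "x \<in> S" and lin: "\<And>y. y \<in> S \<Longrightarrow> linear (F y)"
    and F: "\<And>e. ((\<lambda>y. F y e) has_derivative F' e) (at x)"
    and w: "(w has_derivative w') (at x)"
  shows "((\<lambda>y. F y (w y)) has_derivative (\<lambda>h. F' (w x) h + F x (w' h))) (at x)"
proof -
  have ex: "F y v = (\<Sum>e\<in>Basis. (v \<bullet> e) *\<^sub>R F y e)" if "y \<in> S" for y v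
  proof -
    have "F y v = F y (\<Sum>e\<in>Basis. (v \<bullet> e) *\<^sub>R e)" by (simp add: euclidean_representation)
    then show ?thesis using lin[OF that] by (simp add: linear_sum linear_cmul)
  qed
  have F'ex: "F' v h = (\<Sum>e\<in>Basis. (v \<bullet> e) *\<^sub>R F' e h)" for v h
  proof -
    have "((\<lambda>y. \<Sum>e\<in>Basis. (v \<bullet> e) *\<^sub>R F y e) has_derivative (\<lambda>h. \<Sum>e\<in>Basis. (v \<bullet> e) *\<^sub>R F' e h)) (at x)"
      by (intro has_derivative_sum has_derivative_scaleR_right F)
    then have "((\<lambda>y. F y v) has_derivative (\<lambda>h. \<Sum>e\<in>Basis. (v \<bullet> e) *\<^sub>R F' e h)) (at x)"
      by (rule has_derivative_transform_within_open[OF _ S]) (simp add: ex[symmetric])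
    from has_derivative_unique[OF F this] show ?thesis by (simp add: fun_eq_iff)
  qed
  have "((\<lambda>y. \<Sum>e\<in>Basis. (w y \<bullet> e) *\<^sub>R F y e) has_derivative
      (\<lambda>h. \<Sum>e\<in>Basis. ((w x \<bullet> e) *\<^sub>R F' e h + (w' h \<bullet> e) *\<^sub>R F x e))) (at x)"
    by (intro has_derivative_sum has_derivative_scaleR F has_derivative_inner_left w)
  then have "((\<lambda>y. F y (w y)) has_derivative
      (\<lambda>h. \<Sum>e\<in>Basis. ((w x \<bullet> e) *\<^sub>R F' e h + (w' h \<bullet> e) *\<^sub>R F x e))) (at x)"
    by (rule has_derivative_transform_within_open[OF _ S]) (simp add: ex[symmetric])
  moreover have "(\<Sum>e\<in>Basis. ((w x \<bullet> e) *\<^sub>R F' e h + (w' h \<bullet> e) *\<^sub>R F x e)) = F' (w x) h + F x (w' h)" for h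
    using F'ex[of "w x" h] ex[OF S(2), of "w' h"] by (simp add: sum.distrib)
  ultimately show ?thesis by simp
qed

lemma has_derivative_bilinear_family:
  fixes F :: "'a::real_normed_vector \<Rightarrow> 'b::euclidean_space \<Rightarrow> 'b \<Rightarrow> 'c::real_normed_vector"
  assumes S: "open S" "x \<in> S" and lin: "\<And>y v. y \<in> S \<Longrightarrow> linear (\<lambda>u. F y u v)" "\<And>y u. y \<in> S \<Longrightarrow> linear (F y u)"
    and F: "\<And>u v. ((\<lambda>y. F y u v) has_derivative F' u v) (at x)"
    and p: "(p has_derivative p') (at x)" and q: "(q has_derivative q') (at x)"
  shows "((\<lambda>y. F y (p y) (q y)) has_derivative (\<lambda>h. F' (p x) (q x) h + F x (p x) (q' h) + F x (p' h) (q x))) (at x)"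
proof -
  have 1: "((\<lambda>y. F y u (q y)) has_derivative (\<lambda>h. F' u (q x) h + F x u (q' h))) (at x)" for u
    by (rule has_derivative_linear_family[OF S lin(2) F q])
  show ?thesis
    by (rule has_derivative_linear_family[where F="\<lambda>y u. F y u (q y)" and F'="\<lambda>u h. F' u (q x) h + F x u (q' h)",
          OF S lin(1) 1 p])
qed

subsection \<open>Metric, connection and curvature in a chart\<close>

locale riemannian_atlas =
  fixes A :: "('m::topological_space, 'n::finite) chart set" and g :: "('m, 'n) metric"
  assumes atlas: "smooth_atlas A" and metric: "riemannian_metric A g"
begin

abbreviation coords :: "('m, 'n) chart \<Rightarrow> (real^'n) set"
  where "coords c \<equiv> snd c ` fst c"

abbreviation overlap :: "('m, 'n) chart \<Rightarrow> ('m, 'n) chart \<Rightarrow> (real^'n) set"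
  where "overlap c d \<equiv> snd c ` (fst c \<inter> fst d)"

abbreviation chr where "chr \<equiv> christoffel A g"

definition gi :: "('m, 'n) chart \<Rightarrow> real^'n \<Rightarrow> real^'n \<Rightarrow> real^'n \<Rightarrow> real"
  where "gi c x u v = u \<bullet> (metric_matrix A g c x *v v)"

text \<open>The tangent vector with component \<open>w\<close> in the chart \<open>c\<close>;
  \<open>coord_vec\<close> is the case of a basis vector. It inverts the passage from a tangent
  vector to its component.\<close>

definition lift :: "('m, 'n) chart \<Rightarrow> 'm \<Rightarrow> real^'n \<Rightarrow> ('m, 'n) tvec"
  where "lift c p w = (\<lambda>d. if d \<in> A \<and> p \<in> fst d then coord_change c d p w else 0)"

lemma chart:
  assumes "c \<in> A"
  shows "open (fst c)" "open (coords c)" "continuous_on (fst c) (snd c)" "continuous_on (coords c) (chart_inv c)"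
    "\<And>p. p \<in> fst c \<Longrightarrow> chart_inv c (snd c p) = p"
  using atlas assms unfolding smooth_atlas_def is_chart_def homeomorphism_def by blast+

lemma chart_cover: obtains c where "c \<in> A" "p \<in> fst c"
  using atlas unfolding smooth_atlas_def by blast

lemma open_overlap:
  assumes c: "c \<in> A" and d: "d \<in> A"
  shows "open (overlap c d)"
proof -
  have "open (coords c \<inter> chart_inv c -` fst d)"
    by (rule continuous_open_preimage[OF chart(4)[OF c] chart(2)[OF c] chart(1)[OF d]])
  moreover have "coords c \<inter> chart_inv c -` fst d = overlap c d" using chart(5)[OF c] by auto
  ultimately show ?thesis by simp
qed

lemma transition_at: "c \<in> A \<Longrightarrow> p \<in> fst c \<Longrightarrow> transition c d (snd c p) = snd d p"
  by (simp add: transition_def chart)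

lemma transition_smooth: "c \<in> A \<Longrightarrow> d \<in> A \<Longrightarrow> smooth_on (transition c d) (overlap c d)"
  using atlas unfolding smooth_atlas_def by blast

lemma coord_change_dird: "coord_change c d p v = dird (transition c d) v (snd c p)"
  by (simp add: coord_change_def dird_def)

lemma transition_deriv:
  assumes "c \<in> A" "d \<in> A" "p \<in> fst c" "p \<in> fst d"
  shows "(transition c d has_derivative coord_change c d p) (at (snd c p))"
  using smooth_on_has_derivative[OF transition_smooth[OF assms(1,2)], of "snd c p"] assms
  by (simp add: coord_change_dird[abs_def])

lemma coord_change_linear:
  assumes "c \<in> A" "d \<in> A" "p \<in> fst c" "p \<in> fst d"
  shows "linear (coord_change c d p)"
  by (rule has_derivative_linear[OF transition_deriv[OF assms]])

lemma coord_change_comp: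
  assumes A: "c \<in> A" "d \<in> A" "e \<in> A" and p: "p \<in> fst c" "p \<in> fst d" "p \<in> fst e"
  shows "coord_change d e p (coord_change c d p v) = coord_change c e p v"
proof -
  have d1: "(transition d e has_derivative coord_change d e p) (at (transition c d (snd c p)))"
    unfolding transition_at[OF A(1) p(1)] by (rule transition_deriv[OF A(2,3) p(2,3)])
  have "((\<lambda>y. transition d e (transition c d y)) has_derivative (\<lambda>v. coord_change d e p (coord_change c d p v))) (at (snd c p))"
    by (rule has_derivative_compose[OF transition_deriv[OF A(1,2) p(1,2)] d1])
  then have "(transition c e has_derivative (\<lambda>v. coord_change d e p (coord_change c d p v))) (at (snd c p))"
    by (rule has_derivative_transform_within_open[OF _ open_overlap[OF A(1,2)]])
      (use p A in \<open>auto simp: transition_at\<close>)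
  then show ?thesis using has_derivative_unique[OF transition_deriv[OF A(1,3) p(1,3)]] by metis
qed

lemma coord_change_id:
  assumes "c \<in> A" "p \<in> fst c"
  shows "coord_change c c p v = v"
proof -
  have "(transition c c has_derivative (\<lambda>v. v)) (at (snd c p))"
    by (rule has_derivative_transform_within_open[OF has_derivative_ident chart(2)[OF assms(1)]])
      (use assms in \<open>auto simp: transition_at\<close>)
  then show ?thesis using has_derivative_unique[OF transition_deriv[OF assms(1,1,2,2)]] by metis
qed

lemma coord_change_surj:
  assumes "c \<in> A" "d \<in> A" "p \<in> fst c" "p \<in> fst d"
  shows "coord_change c d p (coord_change d c p v) = v"
  using coord_change_comp[OF assms(2,1,2,4,3,4)] coord_change_id[OF assms(2,4)] by simp

lemma tangent_spaceI:
  assumes "\<And>c. \<not> (c \<in> A \<and> p \<in> fst c) \<Longrightarrow> v c = 0"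
    and "\<And>c d. c \<in> A \<Longrightarrow> d \<in> A \<Longrightarrow> p \<in> fst c \<Longrightarrow> p \<in> fst d \<Longrightarrow> v d = coord_change c d p (v c)"
  shows "v \<in> tangent_space A p"
  using assms unfolding tangent_space_def by blast

lemma tangent_spaceD:
  assumes "v \<in> tangent_space A p"
  shows "\<not> (c \<in> A \<and> p \<in> fst c) \<Longrightarrow> v c = 0"
    and "c \<in> A \<Longrightarrow> d \<in> A \<Longrightarrow> p \<in> fst c \<Longrightarrow> p \<in> fst d \<Longrightarrow> v d = coord_change c d p (v c)"
  using assms unfolding tangent_space_def by blast+

lemma lift_in:
  assumes "c \<in> A" "p \<in> fst c"
  shows "lift c p w \<in> tangent_space A p" "lift c p w c = w"
  using assms coord_change_id[OF assms] coord_change_comp[OF assms(1)]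
  by (auto simp: tangent_space_def lift_def)

lemma lift_component:
  assumes "c \<in> A" "p \<in> fst c" "v \<in> tangent_space A p"
  shows "lift c p (v c) = v"
proof (rule ext)
  fix d show "lift c p (v c) d = v d"
    using tangent_spaceD(1)[OF assms(3), of d] tangent_spaceD(2)[OF assms(3,1) _ assms(2), of d]
    by (cases "d \<in> A \<and> p \<in> fst d") (auto simp: lift_def)
qed

lemma lift_linear:
  assumes "c \<in> A" "p \<in> fst c"
  shows "linear (lift c p)"
  by (rule linearI)
    (use coord_change_linear[OF assms(1) _ assms(2)] in
      \<open>auto simp: lift_def fun_eq_iff scaleR_fun_def linear_add linear_cmul\<close>)

lemma subspace_tangent: "subspace (tangent_space A p)"
proof -
  have l: "linear (coord_change c d p)" if "c \<in> A" "d \<in> A" "p \<in> fst c" "p \<in> fst d" for c d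
    using coord_change_linear that .
  show ?thesis
    unfolding subspace_def
  proof (intro conjI ballI allI)
    show "0 \<in> tangent_space A p" by (rule tangent_spaceI) (simp_all add: linear_0[OF l])
    fix u v r assume u: "u \<in> tangent_space A p"
    show "r *\<^sub>R u \<in> tangent_space A p"
    proof (rule tangent_spaceI)
      fix c d assume "c \<in> A" "d \<in> A" "p \<in> fst c" "p \<in> fst d"
      then show "(r *\<^sub>R u) d = coord_change c d p ((r *\<^sub>R u) c)"
        using tangent_spaceD(2)[OF u, of c d] by (simp add: scaleR_fun_def linear_cmul[OF l])
    qed (simp add: scaleR_fun_def tangent_spaceD(1)[OF u])
    assume v: "v \<in> tangent_space A p"
    show "u + v \<in> tangent_space A p"
    proof (rule tangent_spaceI)
      fix c d assume "c \<in> A" "d \<in> A" "p \<in> fst c" "p \<in> fst d"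
      then show "(u + v) d = coord_change c d p ((u + v) c)"
        using tangent_spaceD(2)[OF u, of c d] tangent_spaceD(2)[OF v, of c d] by (simp add: linear_add[OF l])
    qed (simp add: tangent_spaceD(1)[OF u] tangent_spaceD(1)[OF v])
  qed
qed

lemma tangent_eqI:
  assumes "c \<in> A" "p \<in> fst c" "u \<in> tangent_space A p" "v \<in> tangent_space A p" "u c = v c"
  shows "u = v"
  using lift_component[OF assms(1,2)] assms(3,4,5) by metis

lemma metricD:
  assumes "u \<in> tangent_space A p" "v \<in> tangent_space A p" "w \<in> tangent_space A p"
  shows "g p u v = g p v u" "g p (u + v) w = g p u w + g p v w" "g p (r *\<^sub>R u) v = r * g p u v"
    "u \<noteq> 0 \<Longrightarrow> 0 < g p u u" "g p w (u + v) = g p w u + g p w v" "g p v (r *\<^sub>R u) = r * g p v u"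
proof -
  have i: "inner_product_on (g p) (tangent_space A p)" using metric by (simp add: riemannian_metric_def)
  note h = i[unfolded inner_product_on_def]
  note sym = h[THEN conjunct1, rule_format] and add = h[THEN conjunct2, THEN conjunct1, rule_format]
    and scale = h[THEN conjunct2, THEN conjunct2, THEN conjunct1, rule_format]
    and pos = h[THEN conjunct2, THEN conjunct2, THEN conjunct2, rule_format]
  have uv: "u + v \<in> tangent_space A p" and ru: "r *\<^sub>R u \<in> tangent_space A p"
    by (rule subspace_add[OF subspace_tangent assms(1,2)], rule subspace_scale[OF subspace_tangent assms(1)])
  show "g p u v = g p v u" "g p (u + v) w = g p u w + g p v w" "g p (r *\<^sub>R u) v = r * g p u v"
    by (rule sym[OF assms(1,2)], rule add[OF assms], rule scale[OF assms(1,2)])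
  show "u \<noteq> 0 \<Longrightarrow> 0 < g p u u" by (rule pos[OF assms(1)])
  show "g p w (u + v) = g p w u + g p w v"
    unfolding sym[OF assms(3) uv] add[OF assms] sym[OF assms(1,3)] sym[OF assms(2,3)] ..
  show "g p v (r *\<^sub>R u) = r * g p v u"
    unfolding sym[OF assms(2) ru] scale[OF assms(1,2)] sym[OF assms(1,2)] ..
qed

text \<open>\<open>metric_matrix\<close> records the metric on coordinate vectors only; expansion
  over the basis in both arguments gives the rest.\<close>

lemma metric_lift:
  assumes c: "c \<in> A" "p \<in> fst c"
  shows "g p (lift c p u) (lift c p v) = gi c (snd c p) u v"
proof -
  let ?h = "\<lambda>u v. g p (lift c p u) (lift c p v)"
  note L = lift_in(1)[OF c] and lin = lift_linear[OF c]
  have l1: "linear (\<lambda>u. ?h u v)" for v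
    by (rule linearI) (simp_all add: linear_add[OF lin] linear_cmul[OF lin] metricD(2)[OF L L L] metricD(3)[OF L L L])
  have l2: "linear (\<lambda>v. ?h u v)" for u
    by (rule linearI) (simp_all add: linear_add[OF lin] linear_cmul[OF lin] metricD(5)[OF L L L] metricD(6)[OF L L L])
  have basis: "(\<Sum>i\<in>UNIV. (w $ i) *\<^sub>R axis i 1) = w" for w :: "real^'n"
    using basis_expansion[of w] by (simp add: scalar_mult_eq_scaleR)
  have "?h u v = ?h (\<Sum>i\<in>UNIV. (u $ i) *\<^sub>R axis i 1) (\<Sum>j\<in>UNIV. (v $ j) *\<^sub>R axis j 1)" unfolding basis ..
  also have "\<dots> = (\<Sum>i\<in>UNIV. u $ i * ?h (axis i 1) (\<Sum>j\<in>UNIV. (v $ j) *\<^sub>R axis j 1))"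
    by (simp only: linear_sum[OF l1] linear_cmul[OF l1] real_scaleR_def)
  also have "\<dots> = (\<Sum>i\<in>UNIV. u $ i * (\<Sum>j\<in>UNIV. v $ j * ?h (axis i 1) (axis j 1)))"
    by (simp only: linear_sum[OF l2] linear_cmul[OF l2] real_scaleR_def)
  finally have "?h u v = (\<Sum>i\<in>UNIV. u $ i * (\<Sum>j\<in>UNIV. v $ j * ?h (axis i 1) (axis j 1)))" .
  moreover have "?h (axis i 1) (axis j 1) = metric_matrix A g c (snd c p) $ i $ j" for i j
    using c by (simp add: metric_matrix_def chart coord_vec_def lift_def)
  ultimately show ?thesis
    unfolding gi_def inner_vec_def matrix_vector_mult_def by (simp add: mult.commute)
qed

lemma metric_component:
  assumes "c \<in> A" "p \<in> fst c" "u \<in> tangent_space A p" "v \<in> tangent_space A p"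
  shows "g p u v = gi c (snd c p) (u c) (v c)"
  using metric_lift[OF assms(1,2), of "u c" "v c"] lift_component[OF assms(1,2)] assms(3,4) by simp

lemma gi_linear: "linear (\<lambda>u. gi c x u v)" "linear (gi c x u)"
  by (auto intro!: linearI simp: gi_def inner_add_left inner_add_right matrix_vector_right_distrib matrix_vector_mult_scaleR)

lemmas gi_simps = linear_add[OF gi_linear(1)] linear_add[OF gi_linear(2)] linear_diff[OF gi_linear(1)]
  linear_diff[OF gi_linear(2)] linear_cmul[OF gi_linear(1)] linear_cmul[OF gi_linear(2)]

section \<open>The Levi-Civita connection and the curvature tensor in one chart\<close>

context
  fixes c assumes c: "c \<in> A"
begin

lemma gi_sym:
  assumes "x \<in> coords c"
  shows "gi c x u v = gi c x v u"
proof -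
  obtain p where p: "p \<in> fst c" "x = snd c p" using assms by blast
  show ?thesis unfolding p(2) metric_lift[OF c p(1), symmetric]
    by (rule metricD(1)[OF lift_in(1)[OF c p(1)] lift_in(1)[OF c p(1)] lift_in(1)[OF c p(1)]])
qed

lemma gi_pos:
  assumes "x \<in> coords c" "u \<noteq> 0"
  shows "0 < gi c x u u"
proof -
  obtain p where p: "p \<in> fst c" "x = snd c p" using assms by blast
  have "lift c p u \<noteq> 0" using lift_in(2)[OF c p(1), of u] assms(2) by (metis zero_fun_apply)
  then show ?thesis unfolding p(2) metric_lift[OF c p(1), symmetric]
    using metricD(4)[OF lift_in(1)[OF c p(1)] lift_in(1)[OF c p(1)] lift_in(1)[OF c p(1)]] by blast
qed

lemma gi_nondegenerate:
  assumes "x \<in> coords c" "\<And>w. gi c x u w = gi c x v w"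
  shows "u = v"
proof (rule ccontr)
  assume "u \<noteq> v"
  then have "0 < gi c x (u - v) (u - v)" using gi_pos[OF assms(1)] by simp
  also have "gi c x (u - v) (u - v) = 0" using assms(2)[of "u - v"] by (simp add: linear_diff[OF gi_linear(1)])
  finally show False by simp
qed

lemma metric_invertible:
  assumes "x \<in> coords c"
  shows "invertible (metric_matrix A g c x)"
proof -
  let ?M = "metric_matrix A g c x"
  have "u = 0" if "?M *v u = 0" for u
    using gi_pos[OF assms, of u] that by (force simp: gi_def)
  then obtain B where "B ** ?M = mat 1" using matrix_left_invertible_ker[of ?M] by blast
  then show ?thesis using matrix_left_right_inverse invertible_def by blast
qed

lemma metric_smooth: "smooth_on (metric_matrix A g c) (coords c)"
  using metric c by (simp add: riemannian_metric_def)

lemma gi_smooth: "smooth_on (\<lambda>y. gi c y u v) (coords c)"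
  unfolding gi_def
  by (intro smooth_on_bilinear[OF bounded_bilinear_inner chart(2)[OF c]] smooth_on_const
      smooth_on_bilinear[OF bounded_bilinear_mat_vec chart(2)[OF c]] metric_smooth)

lemma metric_deriv_dird: "metric_deriv A g c x w u v = dird (\<lambda>y. gi c y u v) w x"
  by (simp add: metric_deriv_def dird_def gi_def)

lemma gi_has_derivative:
  assumes "x \<in> coords c"
  shows "((\<lambda>y. gi c y u v) has_derivative (\<lambda>w. metric_deriv A g c x w u v)) (at x)"
  unfolding metric_deriv_dird by (rule smooth_on_has_derivative[OF gi_smooth assms])

lemma metric_deriv_linear:
  assumes x: "x \<in> coords c"
  shows "linear (\<lambda>w. metric_deriv A g c x w u v)" "linear (\<lambda>u. metric_deriv A g c x w u v)"
    "linear (\<lambda>v. metric_deriv A g c x w u v)" "metric_deriv A g c x w u v = metric_deriv A g c x w v u"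
proof -
  note d = gi_has_derivative[OF x]
  show "linear (\<lambda>w. metric_deriv A g c x w u v)" by (rule has_derivative_linear[OF d])
  show sym: "metric_deriv A g c x w u v = metric_deriv A g c x w v u" for u v
  proof -
    have "((\<lambda>y. gi c y u v) has_derivative (\<lambda>w. metric_deriv A g c x w v u)) (at x)"
      by (rule has_derivative_transform_within_open[OF d chart(2)[OF c] x]) (rule gi_sym)
    from has_derivative_unique[OF d this] show ?thesis by (simp add: fun_eq_iff)
  qed
  show l: "linear (\<lambda>u. metric_deriv A g c x w u v)" for v
  proof (rule linearI)
    fix u u' r
    have "((\<lambda>y. gi c y u v + gi c y u' v) has_derivative (\<lambda>w. metric_deriv A g c x w u v + metric_deriv A g c x w u' v)) (at x)"
      by (intro has_derivative_add d)
    then have "((\<lambda>y. gi c y (u + u') v) has_derivative (\<lambda>w. metric_deriv A g c x w u v + metric_deriv A g c x w u' v)) (at x)"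
      by (simp only: linear_add[OF gi_linear(1)])
    from has_derivative_unique[OF d this]
    show "metric_deriv A g c x w (u + u') v = metric_deriv A g c x w u v + metric_deriv A g c x w u' v"
      by (simp add: fun_eq_iff)
    have "((\<lambda>y. r *\<^sub>R gi c y u v) has_derivative (\<lambda>w. r *\<^sub>R metric_deriv A g c x w u v)) (at x)"
      by (intro has_derivative_scaleR_right d)
    then have "((\<lambda>y. gi c y (r *\<^sub>R u) v) has_derivative (\<lambda>w. r *\<^sub>R metric_deriv A g c x w u v)) (at x)"
      by (simp only: linear_cmul[OF gi_linear(1)])
    from has_derivative_unique[OF d this]
    show "metric_deriv A g c x w (r *\<^sub>R u) v = r *\<^sub>R metric_deriv A g c x w u v"
      by (simp add: fun_eq_iff)
  qed
  show "linear (\<lambda>v. metric_deriv A g c x w u v)" using l[of u] by (subst sym)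
qed

text \<open>Multiplying by the metric cancels the inverse matrix in \<open>christoffel\<close>.
  Together with nondegeneracy this formula characterizes the connection, and its algebraic
  properties are derived from it.\<close>

lemma koszul:
  assumes x: "x \<in> coords c"
  shows "2 * gi c x (chr c x u v) w =
    metric_deriv A g c x u v w + metric_deriv A g c x v u w - metric_deriv A g c x w u v"
proof -
  let ?md = "metric_deriv A g c x"
  let ?\<xi> = "\<chi> l. (?md u v (axis l 1) + ?md v u (axis l 1) - ?md (axis l 1) u v) / 2"
  note ml = metric_deriv_linear[OF x]
  have "metric_matrix A g c x *v chr c x u v = ?\<xi>"
    unfolding christoffel_def using matrix_inv_cancel(1)[OF metric_invertible[OF x]]
    by (simp add: matrix_vector_mul_assoc)
  then have "gi c x w (chr c x u v) = w \<bullet> ?\<xi>" by (simp add: gi_def)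
  also have "\<dots> = (\<Sum>l\<in>UNIV. (w $ l) * ((?md u v (axis l 1) + ?md v u (axis l 1) - ?md (axis l 1) u v) / 2))"
    by (simp add: inner_vec_def)
  finally have "2 * gi c x w (chr c x u v) = (\<Sum>l\<in>UNIV. (w $ l) * (?md u v (axis l 1) + ?md v u (axis l 1) - ?md (axis l 1) u v))"
    by (simp add: sum_distrib_left)
  also have "\<dots> = (\<Sum>l\<in>UNIV. (w $ l) * ?md u v (axis l 1))
      + (\<Sum>l\<in>UNIV. (w $ l) * ?md v u (axis l 1)) - (\<Sum>l\<in>UNIV. (w $ l) * ?md (axis l 1) u v)"
    by (simp only: distrib_left right_diff_distrib sum.distrib sum_subtractf)
  finally have "2 * gi c x w (chr c x u v) = (\<Sum>l\<in>UNIV. (w $ l) * ?md u v (axis l 1))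
      + (\<Sum>l\<in>UNIV. (w $ l) * ?md v u (axis l 1)) - (\<Sum>l\<in>UNIV. (w $ l) * ?md (axis l 1) u v)" .
  moreover have ex: "(\<Sum>l\<in>UNIV. (w $ l) * f (axis l 1)) = f w" if "linear f" for f :: "real^'n \<Rightarrow> real"
  proof -
    have "f w = f (\<Sum>i\<in>UNIV. (w $ i) *\<^sub>R axis i 1)"
      using basis_expansion[of w] by (simp add: scalar_mult_eq_scaleR)
    then show ?thesis using that by (simp add: linear_sum linear_cmul)
  qed
  ultimately show ?thesis
    using ex[OF ml(3)[of u v]] ex[OF ml(3)[of v u]] ex[OF ml(1)[of u v]] gi_sym[OF x, of "chr c x u v" w] by simp
qed

lemma chr_sym:
  assumes x: "x \<in> coords c"
  shows "chr c x u v = chr c x v u"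
proof (rule gi_nondegenerate[OF x])
  fix w
  show "gi c x (chr c x u v) w = gi c x (chr c x v u) w"
    using koszul[OF x, of u v w] koszul[OF x, of v u w] metric_deriv_linear(4)[OF x, of w u v] by simp
qed

text \<open>In the sum of two instances of the Koszul formula all terms cancel except the derivative
  in direction \<open>w\<close>.\<close>

lemma metric_compatible:
  assumes x: "x \<in> coords c"
  shows "metric_deriv A g c x w u v = gi c x (chr c x w u) v + gi c x u (chr c x w v)"
proof -
  note s = metric_deriv_linear(4)[OF x]
  show ?thesis
    using koszul[OF x, of w u v] koszul[OF x, of w v u] gi_sym[OF x, of u "chr c x w v"]
      s[of w v u] s[of u w v] s[of v w u] by simp
qed

lemma chr_linear:
  assumes x: "x \<in> coords c"
  shows "linear (\<lambda>u. chr c x u v)" "linear (chr c x u)"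
proof -
  note ml = metric_deriv_linear(1-3)[OF x]
  have l: "linear (\<lambda>u. chr c x u v)" for v
  proof (rule linearI)
    fix u u' r
    show "chr c x (u + u') v = chr c x u v + chr c x u' v"
    proof (rule gi_nondegenerate[OF x])
      fix w show "gi c x (chr c x (u + u') v) w = gi c x (chr c x u v + chr c x u' v) w"
        using koszul[OF x, of "u + u'" v w] koszul[OF x, of u v w] koszul[OF x, of u' v w]
        by (simp add: gi_simps linear_add[OF ml(1)] linear_add[OF ml(2)] linear_add[OF ml(3)])
    qed
    show "chr c x (r *\<^sub>R u) v = r *\<^sub>R chr c x u v"
    proof (rule gi_nondegenerate[OF x])
      fix w
      have "2 * gi c x (chr c x (r *\<^sub>R u) v) w = r * (2 * gi c x (chr c x u v) w)"
        unfolding koszul[OF x] by (simp add: linear_cmul[OF ml(1)] linear_cmul[OF ml(2)] linear_cmul[OF ml(3)] algebra_simps)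
      then show "gi c x (chr c x (r *\<^sub>R u) v) w = gi c x (r *\<^sub>R chr c x u v) w" by (simp add: gi_simps)
    qed
  qed
  then show "linear (\<lambda>u. chr c x u v)" .
  have "linear (\<lambda>v. chr c x v u)" by (rule l)
  then show "linear (chr c x u)" by (subst chr_sym[OF x, abs_def])
qed

lemma chr_smooth: "smooth_on (\<lambda>y. chr c y u v) (coords c)"
proof -
  note o = chart(2)[OF c]
  have md: "smooth_on (\<lambda>y. metric_deriv A g c y w u v) (coords c)" for w u v
    unfolding metric_deriv_dird using smooth_on_dird[OF gi_smooth, of u v w] by (simp add: eta_contract_eq)
  have e: "(\<chi> l. f l) = (\<Sum>l\<in>UNIV. f l *\<^sub>R axis l 1)" for f :: "'n \<Rightarrow> real"
    using basis_expansion[of "\<chi> l. f l"] by (simp add: scalar_mult_eq_scaleR)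
  have "smooth_on (\<lambda>y. \<chi> l. (metric_deriv A g c y u v (axis l 1) + metric_deriv A g c y v u (axis l 1)
           - metric_deriv A g c y (axis l 1) u v) / 2) (coords c)"
    unfolding e divide_inverse
    by (intro smooth_on_sum o smooth_on_linear[OF bounded_linear_scaleR_left o]
        smooth_on_linear[OF bounded_linear_mult_left o] smooth_on_diff smooth_on_add md)
  then show ?thesis unfolding christoffel_def
    by (intro smooth_on_bilinear[OF bounded_bilinear_mat_vec o] smooth_on_matrix_inv[OF o metric_smooth metric_invertible])
qed

text \<open>R(u,v)w for fields with constant components, whose bracket is zero: the derivative of
  the connection, antisymmetrized, plus the quadratic terms.\<close>

definition curv :: "real^'n \<Rightarrow> real^'n \<Rightarrow> real^'n \<Rightarrow> real^'n \<Rightarrow> real^'n"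
  where "curv x u v w = dird (\<lambda>y. chr c y v w) u x - dird (\<lambda>y. chr c y u w) v x
    + chr c x u (chr c x v w) - chr c x v (chr c x u w)"

lemma curvature_field_curv:
  assumes x: "x \<in> coords c"
  shows "curvature_field A g c (\<lambda>_. u) (\<lambda>_. v) (\<lambda>_. w) x = curv x u v w"
proof -
  have f0: "frechet_derivative (\<lambda>_::real^'n. w :: real^'n) (at y) = (\<lambda>_. 0)" for y w
    by (metis frechet_derivative_at has_derivative_const)
  have n: "nabla A g c (\<lambda>_. v) (\<lambda>_. w) = (\<lambda>y. chr c y v w)" for v w
    by (simp add: nabla_def fun_eq_iff f0)
  have b: "lie_bracket (\<lambda>_::real^'n. u :: real^'n) (\<lambda>_. v) = (\<lambda>_. 0)"
    by (simp add: lie_bracket_def fun_eq_iff f0)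
  have "nabla A g c (\<lambda>_. 0) (\<lambda>_. w) x = 0"
    by (simp add: n linear_0[OF chr_linear(1)[OF x]])
  then show ?thesis unfolding curvature_field_def n b
    by (simp add: curv_def nabla_def dird_def)
qed

lemma dird_chr_linear:
  assumes x: "x \<in> coords c"
  shows "linear (\<lambda>w. dird (\<lambda>y. chr c y u v) w x)" "linear (\<lambda>u. dird (\<lambda>y. chr c y u v) w x)"
    "linear (\<lambda>v. dird (\<lambda>y. chr c y u v) w x)"
proof -
  note d = smooth_on_has_derivative[OF chr_smooth x] and o = chart(2)[OF c]
  show "linear (\<lambda>w. dird (\<lambda>y. chr c y u v) w x)" by (rule has_derivative_linear[OF d])
  show "linear (\<lambda>u. dird (\<lambda>y. chr c y u v) w x)"
  proof (rule linearI)
    fix u u' r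
    have "((\<lambda>y. chr c y (u + u') v) has_derivative (\<lambda>w. dird (\<lambda>y. chr c y u v) w x + dird (\<lambda>y. chr c y u' v) w x)) (at x)"
      by (rule has_derivative_transform_within_open[OF has_derivative_add[OF d d] o x])
        (simp add: linear_add[OF chr_linear(1)])
    from dird_eq[OF this] show "dird (\<lambda>y. chr c y (u + u') v) w x = dird (\<lambda>y. chr c y u v) w x + dird (\<lambda>y. chr c y u' v) w x" .
    have "((\<lambda>y. chr c y (r *\<^sub>R u) v) has_derivative (\<lambda>w. r *\<^sub>R dird (\<lambda>y. chr c y u v) w x)) (at x)"
      by (rule has_derivative_transform_within_open[OF has_derivative_scaleR_right[OF d] o x])
        (simp add: linear_cmul[OF chr_linear(1)])
    from dird_eq[OF this] show "dird (\<lambda>y. chr c y (r *\<^sub>R u) v) w x = r *\<^sub>R dird (\<lambda>y. chr c y u v) w x" .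
  qed
  show "linear (\<lambda>v. dird (\<lambda>y. chr c y u v) w x)"
  proof (rule linearI)
    fix v v' r
    have "((\<lambda>y. chr c y u (v + v')) has_derivative (\<lambda>w. dird (\<lambda>y. chr c y u v) w x + dird (\<lambda>y. chr c y u v') w x)) (at x)"
      by (rule has_derivative_transform_within_open[OF has_derivative_add[OF d d] o x])
        (simp add: linear_add[OF chr_linear(2)])
    from dird_eq[OF this] show "dird (\<lambda>y. chr c y u (v + v')) w x = dird (\<lambda>y. chr c y u v) w x + dird (\<lambda>y. chr c y u v') w x" .
    have "((\<lambda>y. chr c y u (r *\<^sub>R v)) has_derivative (\<lambda>w. r *\<^sub>R dird (\<lambda>y. chr c y u v) w x)) (at x)"
      by (rule has_derivative_transform_within_open[OF has_derivative_scaleR_right[OF d] o x])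
        (simp add: linear_cmul[OF chr_linear(2)])
    from dird_eq[OF this] show "dird (\<lambda>y. chr c y u (r *\<^sub>R v)) w x = r *\<^sub>R dird (\<lambda>y. chr c y u v) w x" .
  qed
qed

lemma curv_linear:
  assumes x: "x \<in> coords c"
  shows "linear (\<lambda>v. curv x u v w)"
proof -
  note l = dird_chr_linear[OF x] chr_linear[OF x]
  show ?thesis unfolding curv_def
    by (rule linearI)
      (simp_all add: linear_add[OF l(1)] linear_add[OF l(2)] linear_add[OF l(3)] linear_add[OF l(4)] linear_add[OF l(5)]
        linear_cmul[OF l(1)] linear_cmul[OF l(2)] linear_cmul[OF l(3)] linear_cmul[OF l(4)] linear_cmul[OF l(5)] algebra_simps)
qed

lemma curv_antisym: "curv x u v w = - curv x v u w"
  by (simp add: curv_def)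

lemma curv_bianchi:
  assumes x: "x \<in> coords c"
  shows "curv x u v w + curv x v w u + curv x w u v = 0"
proof -
  note s = chr_sym[OF x]
  have ds: "dird (\<lambda>y. chr c y u v) w x = dird (\<lambda>y. chr c y v u) w x" for u v w
  proof -
    have "frechet_derivative (\<lambda>y. chr c y u v) (at x) = frechet_derivative (\<lambda>y. chr c y v u) (at x)"
      by (rule frechet_derivative_cong_open[OF chart(2)[OF c] x chr_sym])
    then show ?thesis by (simp add: dird_def)
  qed
  show ?thesis unfolding curv_def
    using ds[of v w u] ds[of u w v] ds[of u v w] s[of v w] s[of u w] s[of u v] by simp
qed

text \<open>Metric compatibility is differentiated once more. The second derivatives of <w, z>
  commute, and their difference is <R(u,v)w, z> + <w, R(u,v)z>.\<close>

lemma curv_skew: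
  assumes x: "x \<in> coords c"
  shows "gi c x (curv x u v w) z = - gi c x (curv x u v z) w"
proof -
  have o: "open (coords c)" by (rule chart(2)[OF c])
  have second: "dird (dird (\<lambda>y. gi c y w z) v) u x =
      gi c x (chr c x u (chr c x v w)) z + gi c x (chr c x v w) (chr c x u z) + gi c x (dird (\<lambda>y. chr c y v w) u x) z
    + gi c x (chr c x u w) (chr c x v z) + gi c x w (chr c x u (chr c x v z)) + gi c x w (dird (\<lambda>y. chr c y v z) u x)"
    for u v
  proof -
    have d1: "((\<lambda>y. gi c y (chr c y v w) z) has_derivative (\<lambda>h. metric_deriv A g c x h (chr c x v w) z
        + gi c x (chr c x v w) 0 + gi c x (dird (\<lambda>y. chr c y v w) h x) z)) (at x)"
      by (rule has_derivative_bilinear_family[where F="gi c" and F'="\<lambda>a b h. metric_deriv A g c x h a b",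
            OF o x gi_linear gi_has_derivative[OF x] smooth_on_has_derivative[OF chr_smooth x] has_derivative_const])
    have d2: "((\<lambda>y. gi c y w (chr c y v z)) has_derivative (\<lambda>h. metric_deriv A g c x h w (chr c x v z)
        + gi c x w (dird (\<lambda>y. chr c y v z) h x) + gi c x 0 (chr c x v z))) (at x)"
      by (rule has_derivative_bilinear_family[where F="gi c" and F'="\<lambda>a b h. metric_deriv A g c x h a b",
            OF o x gi_linear gi_has_derivative[OF x] has_derivative_const smooth_on_has_derivative[OF chr_smooth x]])
    have "(dird (\<lambda>y. gi c y w z) v has_derivative (\<lambda>h. (metric_deriv A g c x h (chr c x v w) z
        + gi c x (chr c x v w) 0 + gi c x (dird (\<lambda>y. chr c y v w) h x) z) + (metric_deriv A g c x h w (chr c x v z)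
        + gi c x w (dird (\<lambda>y. chr c y v z) h x) + gi c x 0 (chr c x v z)))) (at x)"
      by (rule has_derivative_transform_within_open[OF has_derivative_add[OF d1 d2] o x])
        (simp add: metric_deriv_dird[symmetric] metric_compatible)
    from dird_eq[OF this] show ?thesis
      by (simp add: metric_compatible[OF x] linear_0[OF gi_linear(1)] linear_0[OF gi_linear(2)])
  qed
  have "dird (dird (\<lambda>y. gi c y w z) v) u x = dird (dird (\<lambda>y. gi c y w z) u) v x"
    by (rule dird_commute_real[OF o x gi_smooth])
  then have "gi c x (curv x u v w) z + gi c x w (curv x u v z) = 0"
    unfolding second curv_def by (simp add: gi_simps)
  then show ?thesis using gi_sym[OF x, of w "curv x u v z"] by simp
qed

text \<open>The first Bianchi identity for \<open>u\<close>, \<open>v\<close>, \<open>z\<close> is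
  paired with \<open>u\<close>. The term with R(v,z) vanishes by skew symmetry, and the two
  remaining ones are the two sides.\<close>

lemma curv_self_adjoint:
  assumes x: "x \<in> coords c"
  shows "gi c x (curv x u v u) z = gi c x (curv x u z u) v"
proof -
  have "gi c x (curv x u v z + curv x v z u + curv x z u v) u = 0"
    unfolding curv_bianchi[OF x] by (rule linear_0[OF gi_linear(1)])
  moreover have "gi c x (curv x v z u) u = 0" using curv_skew[OF x, of v z u u] by simp
  moreover have "gi c x (curv x z u v) u = - gi c x (curv x u z v) u"
    unfolding curv_antisym[of x z u v] by (rule linear_neg[OF gi_linear(1)])
  ultimately show ?thesis
    using curv_skew[OF x, of u v u z] curv_skew[OF x, of u z u v] by (simp add: gi_simps)
qed

end

end

subsection \<open>Change of charts\<close>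

lemma has_vector_derivative_compose_at:
  assumes "(F has_derivative F') (at (x s))" "(x has_vector_derivative x') (at s within S)"
  shows "((\<lambda>r. F (x r)) has_vector_derivative F' x') (at s within S)"
proof -
  have "((\<lambda>r. F (x r)) has_derivative (\<lambda>h. F' (h *\<^sub>R x'))) (at s within S)"
    using assms(2) has_derivative_compose[of x "\<lambda>h. h *\<^sub>R x'" s S F F'] assms(1) by (simp add: has_vector_derivative_def)
  moreover have "F' (h *\<^sub>R x') = h *\<^sub>R F' x'" for h
    using has_derivative_linear[OF assms(1)] by (rule linear_cmul)
  ultimately show ?thesis by (simp add: has_vector_derivative_def)
qed

lemma has_vector_derivative_local:
  assumes V: "open V" "s \<in> V" "s \<in> S" and e: "\<And>r. r \<in> S \<Longrightarrow> r \<in> V \<Longrightarrow> f r = g r"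
    and f: "(f has_vector_derivative D) (at s within S)"
  shows "(g has_vector_derivative D) (at s within S)"
proof -
  obtain d where d: "0 < d" "ball s d \<subseteq> V" using V open_contains_ball by metis
  show ?thesis
  proof (rule has_vector_derivative_transform_within[OF f d(1) V(3)])
    fix r assume r: "r \<in> S" "dist r s < d"
    then have "r \<in> ball s d" by (simp add: dist_commute)
    then show "f r = g r" using e[OF r(1)] d(2) by blast
  qed
qed

lemma has_vector_derivative_Un:
  assumes "(f has_vector_derivative D) (at s within S)" "(f has_vector_derivative D) (at s within T)"
  shows "(f has_vector_derivative D) (at s within S \<union> T)"
  using assms unfolding has_vector_derivative_def has_derivative_within by (simp add: Lim_within_Un)

text \<open>The filter is trivial there, so the statement holds vacuously; it lets a point of one
  piece be treated as a point of a union of two intervals.\<close>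

lemma has_vector_derivative_outside:
  assumes "closed T" "s \<notin> T"
  shows "(f has_vector_derivative D) (at s within T)"
proof -
  have "at s within T = bot"
    using assms by (metis closed_limpt trivial_limit_within)
  then show ?thesis by (simp add: has_vector_derivative_def has_derivative_def bounded_linear_scaleR_left)
qed

lemma has_vector_derivative_linear_family:
  fixes F :: "'a::real_normed_vector \<Rightarrow> 'b::euclidean_space \<Rightarrow> 'c::real_normed_vector"
  assumes Q: "open Q" "x s \<in> Q" and lin: "\<And>y. y \<in> Q \<Longrightarrow> linear (F y)"
    and F: "\<And>e. ((\<lambda>y. F y e) has_derivative F' e) (at (x s))"
    and x: "(x has_vector_derivative x') (at s within S)" and w: "(w has_vector_derivative w') (at s within S)"
  shows "((\<lambda>r. F (x r) (w r)) has_vector_derivative (F' (w s) x' + F (x s) w')) (at s within S)"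
proof -
  have "((\<lambda>z. F (fst z) (snd z)) has_derivative (\<lambda>h. F' (snd (x s, w s)) (fst h) + F (fst (x s, w s)) (snd h))) (at (x s, w s))"
  proof (rule has_derivative_linear_family[where S="Q \<times> UNIV"])
    show "open (Q \<times> (UNIV :: 'b set))" using Q by (intro open_Times) auto
    show "((\<lambda>y. F (fst y) e) has_derivative (\<lambda>h. F' e (fst h))) (at (x s, w s))" for e
      by (rule has_derivative_compose[where f=fst and g="\<lambda>y. F y e"]) (auto intro!: derivative_eq_intros F)
  qed (use Q lin in \<open>auto intro!: derivative_eq_intros\<close>)
  from has_vector_derivative_compose_at[where x="\<lambda>r. (x r, w r)", OF this has_vector_derivative_Pair[OF x w]]
  show ?thesis by simp
qed

lemma has_vector_derivative_bilinear_family: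
  fixes F :: "'a::real_normed_vector \<Rightarrow> 'b::euclidean_space \<Rightarrow> 'b \<Rightarrow> 'c::real_normed_vector"
  assumes Q: "open Q" "x s \<in> Q" and lin: "\<And>y v. y \<in> Q \<Longrightarrow> linear (\<lambda>u. F y u v)" "\<And>y u. y \<in> Q \<Longrightarrow> linear (F y u)"
    and F: "\<And>u v. ((\<lambda>y. F y u v) has_derivative F' u v) (at (x s))"
    and x: "(x has_vector_derivative x') (at s within S)" and p: "(p has_vector_derivative p') (at s within S)"
    and q: "(q has_vector_derivative q') (at s within S)"
  shows "((\<lambda>r. F (x r) (p r) (q r)) has_vector_derivative
    (F' (p s) (q s) x' + F (x s) (p s) q' + F (x s) p' (q s))) (at s within S)"
proof -
  let ?z = "(x s, p s, q s)"
  have "((\<lambda>z. F (fst z) (fst (snd z)) (snd (snd z))) has_derivative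
    (\<lambda>h. F' (fst (snd ?z)) (snd (snd ?z)) (fst h) + F (fst ?z) (fst (snd ?z)) (snd (snd h)) + F (fst ?z) (fst (snd h)) (snd (snd ?z)))) (at ?z)"
  proof (rule has_derivative_bilinear_family[where S="Q \<times> UNIV"])
    show "open (Q \<times> (UNIV :: ('b \<times> 'b) set))" using Q by (intro open_Times) auto
    show "((\<lambda>y. F (fst y) u v) has_derivative (\<lambda>h. F' u v (fst h))) (at ?z)" for u v
      by (rule has_derivative_compose[where f=fst and g="\<lambda>y. F y u v"]) (auto intro!: derivative_eq_intros F)
  qed (use Q lin in \<open>auto intro!: derivative_eq_intros\<close>)
  from has_vector_derivative_compose_at[where x="\<lambda>r. (x r, p r, q r)", OF this
      has_vector_derivative_Pair[OF x has_vector_derivative_Pair[OF p q]]]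
  show ?thesis by simp
qed

text \<open>Gram-Schmidt, run over natural numbers up to \<open>CARD('n)\<close> and transported to
  the index type by a bijection. A dimension count provides the next vector outside the
  span.\<close>

lemma orthonormal_family_exists:
  fixes B :: "real^'n \<Rightarrow> real^'n \<Rightarrow> real"
  assumes lin: "\<And>v. linear (\<lambda>u. B u v)" and sym: "\<And>u v. B u v = B v u" and pos: "\<And>u. u \<noteq> 0 \<Longrightarrow> 0 < B u u"
  obtains e :: "'n \<Rightarrow> real^'n" where "\<And>i j. B (e i) (e j) = (if i = j then 1 else 0)"
proof -
  have "\<exists>e :: nat \<Rightarrow> real^'n. \<forall>i<k. \<forall>j<k. B (e i) (e j) = (if i = j then 1 else 0)" if "k \<le> CARD('n)" for k
    using that
  proof (induction k)
    case (Suc k)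
    then obtain e :: "nat \<Rightarrow> real^'n" where e: "\<And>i j. i < k \<Longrightarrow> j < k \<Longrightarrow> B (e i) (e j) = (if i = j then 1 else 0)"
      by fastforce
    have "dim (e ` {..<k}) \<le> card (e ` {..<k})" by (rule dim_le_card') simp
    also have "\<dots> \<le> k" using card_image_le[of "{..<k}" e] by simp
    also have "k < dim (UNIV :: (real^'n) set)" using Suc.prems by simp
    finally have "span (e ` {..<k}) \<noteq> UNIV" by (metis dim_span less_irrefl)
    then obtain v where v: "v \<notin> span (e ` {..<k})" by blast
    define w where "w = v - (\<Sum>i<k. B v (e i) *\<^sub>R e i)"
    have "w \<noteq> 0"
    proof
      assume "w = 0"
      then have "v = (\<Sum>i<k. B v (e i) *\<^sub>R e i)" by (simp add: w_def)
      also have "\<dots> \<in> span (e ` {..<k})" by (intro span_sum span_scale span_base) auto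
      finally show False using v by blast
    qed
    have we: "B w (e j) = 0" if j: "j < k" for j
    proof -
      have "B w (e j) = B v (e j) - (\<Sum>i<k. B v (e i) * B (e i) (e j))"
        by (simp add: w_def linear_diff[OF lin] linear_sum[OF lin] linear_cmul[OF lin])
      also have "(\<Sum>i<k. B v (e i) * B (e i) (e j)) = (\<Sum>i\<in>{j}. B v (e i) * B (e i) (e j))"
        by (rule sum.mono_neutral_right) (use j e in auto)
      finally show ?thesis using e[OF j j] by simp
    qed
    define n where "n = (1 / sqrt (B w w)) *\<^sub>R w"
    have p: "0 < B w w" using pos[OF \<open>w \<noteq> 0\<close>] .
    have nl: "B n u = (1 / sqrt (B w w)) * B w u" for u by (simp add: n_def linear_cmul[OF lin])
    have nn: "B n n = 1" unfolding nl sym[of w n] nl using p by simp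
    have ne: "B n (e j) = 0" "B (e j) n = 0" if "j < k" for j using nl[of "e j"] we[OF that] sym[of n "e j"] by auto
    let ?e = "e(k := n)"
    have "B (?e i) (?e j) = (if i = j then 1 else 0)" if "i < Suc k" "j < Suc k" for i j
      using that nn ne e by (cases "i = k"; cases "j = k") auto
    then show ?case by blast
  qed simp
  then obtain e :: "nat \<Rightarrow> real^'n" where e: "\<And>i j. i < CARD('n) \<Longrightarrow> j < CARD('n) \<Longrightarrow> B (e i) (e j) = (if i = j then 1 else 0)"
    by blast
  obtain f :: "'n \<Rightarrow> nat" where f: "bij_betw f UNIV {..<CARD('n)}"
    using ex_bij_betw_finite_nat[of "UNIV :: 'n set"] by (auto simp: atLeast0LessThan)
  have "f i < CARD('n)" for i using bij_betw_apply[OF f, of i] by simp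
  moreover have "f i = f j \<longleftrightarrow> i = j" for i j using f by (auto simp: bij_betw_def inj_on_def)
  ultimately show ?thesis using e by (intro that[of "\<lambda>i. e (f i)"]) auto
qed

context riemannian_atlas
begin

context
  fixes c d x assumes c: "c \<in> A" and d: "d \<in> A" and x: "x \<in> overlap c d"
begin

lemma overlap_in: "x \<in> coords c" "transition c d x \<in> coords d"
  using x by (auto simp: transition_at[OF c])

lemma metric_transform: "gi c x u v = gi d (transition c d x) (dird (transition c d) u x) (dird (transition c d) v x)"
proof -
  obtain p where p: "p \<in> fst c" "p \<in> fst d" "x = snd c p" using x by blast
  have l: "lift c p w = lift d p (dird (transition c d) w x)" for w
  proof -
    have "lift c p w d = dird (transition c d) w x"
      using d p(2) by (simp add: lift_def coord_change_dird p(3))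
    then show ?thesis using lift_component[OF d p(2) lift_in(1)[OF c p(1), of w]] by simp
  qed
  show ?thesis
    using metric_lift[OF c p(1), of u v] metric_lift[OF d p(2), of "dird (transition c d) u x" "dird (transition c d) v x"]
    by (simp add: l p(3) transition_at[OF c p(1)])
qed

lemma dird_transition_linear: "linear (\<lambda>v. dird (transition c d) v x)"
  by (rule linear_dird[OF transition_smooth[OF c d] x])

lemma dird_transition_surj: "\<exists>v. dird (transition c d) v x = w"
proof -
  obtain p where p: "p \<in> fst c" "p \<in> fst d" "x = snd c p" using x by blast
  then show ?thesis using coord_change_surj[OF c d p(1,2)] by (metis coord_change_dird)
qed

lemma second_transition_sym:
  "dird (dird (transition c d) v) u x = dird (dird (transition c d) u) v x"
  by (rule dird_commute[OF open_overlap[OF c d] x transition_smooth[OF c d]])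

end

lemma metric_deriv_transform:
  assumes c: "c \<in> A" and d: "d \<in> A" and x: "x \<in> overlap c d"
  defines "\<phi> \<equiv> transition c d"
  shows "metric_deriv A g c x w u v =
    metric_deriv A g d (\<phi> x) (dird \<phi> w x) (dird \<phi> u x) (dird \<phi> v x)
    + gi d (\<phi> x) (dird \<phi> u x) (dird (dird \<phi> v) w x) + gi d (\<phi> x) (dird (dird \<phi> u) w x) (dird \<phi> v x)"
proof -
  note sm = transition_smooth[OF c d] and o = open_overlap[OF c d]
  have F: "((\<lambda>y. gi d (\<phi> y) a b) has_derivative (\<lambda>h. metric_deriv A g d (\<phi> x) (dird \<phi> h x) a b)) (at x)" for a b
    unfolding \<phi>_def
    by (rule has_derivative_compose[OF smooth_on_has_derivative[OF sm x] gi_has_derivative[OF d overlap_in(2)[OF c d x]]])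
  have D: "(dird \<phi> u has_derivative (\<lambda>h. dird (dird \<phi> u) h x)) (at x)" for u
    unfolding \<phi>_def by (rule smooth_on_has_derivative[OF smooth_on_dird[OF sm] x])
  have "((\<lambda>y. gi d (\<phi> y) (dird \<phi> u y) (dird \<phi> v y)) has_derivative
    (\<lambda>h. metric_deriv A g d (\<phi> x) (dird \<phi> h x) (dird \<phi> u x) (dird \<phi> v x)
      + gi d (\<phi> x) (dird \<phi> u x) (dird (dird \<phi> v) h x) + gi d (\<phi> x) (dird (dird \<phi> u) h x) (dird \<phi> v x))) (at x)"
    by (rule has_derivative_bilinear_family[where F="\<lambda>y. gi d (\<phi> y)", OF o x gi_linear F D D])
  then have "((\<lambda>y. gi c y u v) has_derivative
    (\<lambda>h. metric_deriv A g d (\<phi> x) (dird \<phi> h x) (dird \<phi> u x) (dird \<phi> v x)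
      + gi d (\<phi> x) (dird \<phi> u x) (dird (dird \<phi> v) h x) + gi d (\<phi> x) (dird (dird \<phi> u) h x) (dird \<phi> v x))) (at x)"
    by (rule has_derivative_transform_within_open[OF _ o x]) (simp add: metric_transform[OF c d] \<phi>_def)
  from has_derivative_unique[OF gi_has_derivative[OF c overlap_in(1)[OF c d x]] this]
  show ?thesis by (simp add: fun_eq_iff)
qed

lemma christoffel_transform:
  assumes c: "c \<in> A" and d: "d \<in> A" and x: "x \<in> overlap c d"
  defines "\<phi> \<equiv> transition c d"
  shows "dird \<phi> (chr c x u v) x = chr d (\<phi> x) (dird \<phi> u x) (dird \<phi> v x) + dird (dird \<phi> v) u x"
proof -
  let ?D = "\<lambda>v. dird \<phi> v x" and ?y = "\<phi> x"
  have y: "?y \<in> coords d" and xc: "x \<in> coords c" unfolding \<phi>_def by (rule overlap_in[OF c d x])+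
  note mt = metric_deriv_transform[OF c d x, folded \<phi>_def] and s2 = second_transition_sym[OF c d x, folded \<phi>_def]
    and gs = gi_sym[OF d y]
  show ?thesis
  proof (rule gi_nondegenerate[OF d y])
    fix W
    obtain w where W: "W = ?D w" using dird_transition_surj[OF c d x] unfolding \<phi>_def by metis
    have "2 * gi d ?y (?D (chr c x u v)) (?D w) = 2 * gi c x (chr c x u v) w"
      using metric_transform[OF c d x] by (simp add: \<phi>_def)
    also have "\<dots> = 2 * gi d ?y (chr d ?y (?D u) (?D v)) (?D w) + 2 * gi d ?y (dird (dird \<phi> v) u x) (?D w)"
      unfolding koszul[OF c xc] koszul[OF d y] mt
      using s2[of u v] s2[of w u] s2[of w v] gs[of "?D v" "dird (dird \<phi> u) w x"] gs[of "?D u" "dird (dird \<phi> v) w x"]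
        gs[of "?D v" "dird (dird \<phi> w) u x"] gs[of "?D u" "dird (dird \<phi> w) v x"] by simp
    finally show "gi d ?y (?D (chr c x u v)) W = gi d ?y (chr d ?y (?D u) (?D v) + dird (dird \<phi> v) u x) W"
      unfolding W by (simp add: gi_simps)
  qed
qed

text \<open>The transformation law, differentiated in direction \<open>h\<close>: the left and right
  sides of the equation are the two ways of computing that derivative.\<close>

lemma christoffel_deriv_transform:
  assumes c: "c \<in> A" and d: "d \<in> A" and x: "x \<in> overlap c d"
  defines "\<phi> \<equiv> transition c d"
  shows "dird (dird \<phi> (chr c x u v)) h x + dird \<phi> (dird (\<lambda>y. chr c y u v) h x) x =
    dird (\<lambda>y. chr d y (dird \<phi> u x) (dird \<phi> v x)) (dird \<phi> h x) (\<phi> x)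
    + chr d (\<phi> x) (dird \<phi> u x) (dird (dird \<phi> v) h x) + chr d (\<phi> x) (dird (dird \<phi> u) h x) (dird \<phi> v x)
    + dird (dird (dird \<phi> v) u) h x"
proof -
  note sm = transition_smooth[OF c d, folded \<phi>_def] and o = open_overlap[OF c d]
  have y: "\<phi> z \<in> coords d" and xc: "z \<in> coords c" if "z \<in> overlap c d" for z
    unfolding \<phi>_def using overlap_in[OF c d that] by blast+
  have D: "(dird \<phi> u has_derivative (\<lambda>h. dird (dird \<phi> u) h x)) (at x)" for u
    by (rule smooth_on_has_derivative[OF smooth_on_dird[OF sm] x])
  have L: "((\<lambda>y. dird \<phi> (chr c y u v) y) has_derivative
      (\<lambda>h. dird (dird \<phi> (chr c x u v)) h x + dird \<phi> (dird (\<lambda>y. chr c y u v) h x) x)) (at x)"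
    by (rule has_derivative_linear_family[where F="\<lambda>y e. dird \<phi> e y", OF o x linear_dird[OF sm] D
        smooth_on_has_derivative[OF chr_smooth[OF c] xc[OF x]]])
  have F: "((\<lambda>y. chr d (\<phi> y) a b) has_derivative (\<lambda>h. dird (\<lambda>y. chr d y a b) (dird \<phi> h x) (\<phi> x))) (at x)" for a b
    by (rule has_derivative_compose[OF smooth_on_has_derivative[OF sm x] smooth_on_has_derivative[OF chr_smooth[OF d] y[OF x]]])
  have "((\<lambda>y. chr d (\<phi> y) (dird \<phi> u y) (dird \<phi> v y)) has_derivative
    (\<lambda>h. dird (\<lambda>y. chr d y (dird \<phi> u x) (dird \<phi> v x)) (dird \<phi> h x) (\<phi> x)
    + chr d (\<phi> x) (dird \<phi> u x) (dird (dird \<phi> v) h x) + chr d (\<phi> x) (dird (dird \<phi> u) h x) (dird \<phi> v x))) (at x)"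
    by (rule has_derivative_bilinear_family[where F="\<lambda>y. chr d (\<phi> y)", OF o x chr_linear(1)[OF d y] chr_linear(2)[OF d y] F D D])
  from has_derivative_add[OF this smooth_on_has_derivative[OF smooth_on_dird[OF smooth_on_dird[OF sm]] x]]
  have R: "((\<lambda>y. dird \<phi> (chr c y u v) y) has_derivative
    (\<lambda>h. dird (\<lambda>y. chr d y (dird \<phi> u x) (dird \<phi> v x)) (dird \<phi> h x) (\<phi> x)
    + chr d (\<phi> x) (dird \<phi> u x) (dird (dird \<phi> v) h x) + chr d (\<phi> x) (dird (dird \<phi> u) h x) (dird \<phi> v x)
    + dird (dird (dird \<phi> v) u) h x)) (at x)"
    by (rule has_derivative_transform_within_open[OF _ o x]) (simp add: christoffel_transform[OF c d] \<phi>_def)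
  from has_derivative_unique[OF L R] show ?thesis by (simp add: fun_eq_iff)
qed

text \<open>Tensoriality. After antisymmetrization in \<open>u\<close> and \<open>v\<close> the
  second and third derivatives of the transition cancel by symmetry, and the terms that
  differentiate \<open>chr c x b w\<close> along the transition cancel between \<open>e\<close> and
  \<open>f\<close>.\<close>

lemma curv_transform:
  assumes c: "c \<in> A" and d: "d \<in> A" and x: "x \<in> overlap c d"
  defines "\<phi> \<equiv> transition c d"
  shows "curv d (\<phi> x) (dird \<phi> u x) (dird \<phi> v x) (dird \<phi> w x) = dird \<phi> (curv c x u v w) x"
proof -
  note sm = transition_smooth[OF c d, folded \<phi>_def]
  note lin = dird_transition_linear[OF c d x, folded \<phi>_def]
  note dt = christoffel_deriv_transform[OF c d x, folded \<phi>_def] and ct = christoffel_transform[OF c d x, folded \<phi>_def]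
  have y: "\<phi> x \<in> coords d" unfolding \<phi>_def by (rule overlap_in[OF c d x])
  note cl = chr_linear(2)[OF d y]
  have s2: "dird (dird \<phi> v) u x = dird (dird \<phi> u) v x"
    unfolding \<phi>_def by (rule second_transition_sym[OF c d x])
  have s3: "dird (dird (dird \<phi> w) v) u x = dird (dird (dird \<phi> w) u) v x"
    by (rule dird_commute[OF open_overlap[OF c d] x smooth_on_dird[OF sm]])
  have e: "dird \<phi> (chr c x a (chr c x b w)) x = chr d (\<phi> x) (dird \<phi> a x) (chr d (\<phi> x) (dird \<phi> b x) (dird \<phi> w x))
      + chr d (\<phi> x) (dird \<phi> a x) (dird (dird \<phi> w) b x) + dird (dird \<phi> (chr c x b w)) a x" for a b
    unfolding ct[of a "chr c x b w"] ct[of b w] by (simp add: linear_add[OF cl])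
  have f: "dird \<phi> (dird (\<lambda>y. chr c y b w) a x) x =
    dird (\<lambda>y. chr d y (dird \<phi> b x) (dird \<phi> w x)) (dird \<phi> a x) (\<phi> x)
    + chr d (\<phi> x) (dird \<phi> b x) (dird (dird \<phi> w) a x) + chr d (\<phi> x) (dird (dird \<phi> b) a x) (dird \<phi> w x)
    + dird (dird (dird \<phi> w) b) a x - dird (dird \<phi> (chr c x b w)) a x" for a b
    using dt[of b w a] by (simp add: algebra_simps)
  have "dird \<phi> (curv c x u v w) x = dird \<phi> (dird (\<lambda>y. chr c y v w) u x) x - dird \<phi> (dird (\<lambda>y. chr c y u w) v x) x
    + dird \<phi> (chr c x u (chr c x v w)) x - dird \<phi> (chr c x v (chr c x u w)) x"
    unfolding curv_def[OF c] by (simp add: linear_add[OF lin] linear_diff[OF lin])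
  also have "\<dots> = curv d (\<phi> x) (dird \<phi> u x) (dird \<phi> v x) (dird \<phi> w x)"
    unfolding e f curv_def[OF d] s3 s2 by simp
  finally show ?thesis ..
qed

lemma curvature_component:
  assumes "c \<in> A" "p \<in> fst c"
  shows "curvature A g p u v w c = curv c (snd c p) (u c) (v c) (w c)"
  using assms curvature_field_curv[OF assms(1)] by (simp add: curvature_def)

lemma curvature_tangent:
  assumes u: "u \<in> tangent_space A p" and v: "v \<in> tangent_space A p" and w: "w \<in> tangent_space A p"
  shows "curvature A g p u v w \<in> tangent_space A p"
proof (rule tangent_spaceI)
  fix c d assume c: "c \<in> A" "p \<in> fst c" and d: "d \<in> A" "p \<in> fst d"
  have x: "snd c p \<in> overlap c d" using c d by blast
  show "curvature A g p u v w d = coord_change c d p (curvature A g p u v w c)"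
    unfolding curvature_component[OF c] curvature_component[OF d] coord_change_dird curv_transform[OF c(1) d(1) x, symmetric]
    using tangent_spaceD(2)[OF u c(1) d(1) c(2) d(2)] tangent_spaceD(2)[OF v c(1) d(1) c(2) d(2)]
      tangent_spaceD(2)[OF w c(1) d(1) c(2) d(2)]
    by (simp add: transition_at[OF c] coord_change_dird)
qed (auto simp: curvature_def)

end

subsection \<open>Parallel frames along a curve\<close>

locale riemannian_curve = riemannian_atlas A g
  for A :: "('m::topological_space, 'n::finite) chart set" and g :: "('m, 'n) metric" +
  fixes \<gamma> :: "real \<Rightarrow> 'm" and a b :: real
  assumes ab: "a < b" and curve: "smooth_curve A {a..b} \<gamma>"
begin

abbreviation xc :: "('m, 'n) chart \<Rightarrow> real \<Rightarrow> real^'n"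
  where "xc c s \<equiv> snd c (\<gamma> s)"

abbreviation vel where "vel \<equiv> velocity A {a..b} \<gamma>"

text \<open>\<open>\<gamma>\<close> is continuous only on the interval, so the part of it inside a
  chart is relatively open; \<open>V\<close> is an open set of reals with that trace.\<close>

lemma chart_window:
  assumes c: "c \<in> A"
  obtains V where "open V" "\<And>s. s \<in> {a..b} \<Longrightarrow> s \<in> V \<longleftrightarrow> \<gamma> s \<in> fst c"
proof -
  have "continuous_on {a..b} \<gamma>" using curve by (simp add: smooth_curve_def)
  then obtain V where V: "open V" "V \<inter> {a..b} = \<gamma> -` fst c \<inter> {a..b}"
    using chart(1)[OF c] unfolding continuous_on_open_invariant by blast
  show ?thesis by (rule that[OF V(1)]) (use V(2) in blast)
qed

text \<open>Smoothness of curves and fields is expressed within chart windows, covariant derivatives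
  within the interval; the filters are the same.\<close>

lemma window_within:
  assumes c: "c \<in> A" and s: "\<gamma> s \<in> fst c" "s \<in> {p..q}" and pq: "{p..q} \<subseteq> {a..b}"
  shows "at s within {r \<in> {p..q}. \<gamma> r \<in> fst c} = at s within {p..q}"
proof -
  obtain V where V: "open V" "\<And>s. s \<in> {a..b} \<Longrightarrow> s \<in> V \<longleftrightarrow> \<gamma> s \<in> fst c" using chart_window[OF c] by blast
  show ?thesis
    by (rule at_within_nhd[of s V]) (use V s pq in auto)
qed

lemma window_perfect:
  assumes c: "c \<in> A" and pq: "p < q" "{p..q} \<subseteq> {a..b}"
  shows "perfect_on {r \<in> {p..q}. \<gamma> r \<in> fst c}"
  using perfect_on_Icc[OF pq(1)] window_within[OF c _ _ pq(2)] by (auto simp: perfect_on_def)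

lemma local_deriv:
  assumes c: "c \<in> A" and s: "\<gamma> s \<in> fst c" "s \<in> {p..q}" and pq: "{p..q} \<subseteq> {a..b}"
    and e: "\<And>r. r \<in> {p..q} \<Longrightarrow> \<gamma> r \<in> fst c \<Longrightarrow> f r = h r"
    and f: "(f has_vector_derivative D) (at s within {p..q})"
  shows "(h has_vector_derivative D) (at s within {p..q})"
proof -
  obtain V where V: "open V" "\<And>s. s \<in> {a..b} \<Longrightarrow> s \<in> V \<longleftrightarrow> \<gamma> s \<in> fst c" using chart_window[OF c] by blast
  show ?thesis
  proof (rule has_vector_derivative_local[OF V(1) _ s(2) _ f])
    show "s \<in> V" using V(2) s pq by blast
    show "f r = h r" if "r \<in> {p..q}" "r \<in> V" for r using e[OF that(1)] V(2)[of r] that pq by blast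
  qed
qed

lemma xc_smooth: "c \<in> A \<Longrightarrow> smooth_path_on (xc c) {s \<in> {a..b}. \<gamma> s \<in> fst c}"
  using curve by (simp add: smooth_curve_def)

lemma xc_deriv:
  assumes c: "c \<in> A" and s: "s \<in> {a..b}" "\<gamma> s \<in> fst c"
  shows "(xc c has_vector_derivative vel s c) (at s within {a..b})"
proof -
  obtain D where "(xc c has_vector_derivative D) (at s within {r \<in> {a..b}. \<gamma> r \<in> fst c})"
    using smooth_path_on_obtain[OF xc_smooth[OF c]] s by blast
  then have D: "(xc c has_vector_derivative D) (at s within {a..b})"
    unfolding window_within[OF c s(2,1) order_refl] .
  then show ?thesis
    using ivl_deriv_eq[OF ab s(1) D] c s by (simp add: velocity_def ivl_deriv_def)
qed

lemma vel_smooth: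
  assumes c: "c \<in> A"
  shows "smooth_path_on (\<lambda>s. vel s c) {s \<in> {a..b}. \<gamma> s \<in> fst c}"
proof (rule smooth_path_on_deriv[OF window_perfect[OF c ab order_refl] xc_smooth[OF c]])
  fix s assume s: "s \<in> {s \<in> {a..b}. \<gamma> s \<in> fst c}"
  then show "(xc c has_vector_derivative vel s c) (at s within {s \<in> {a..b}. \<gamma> s \<in> fst c})"
    using xc_deriv[OF c, of s] window_within[OF c _ _ order_refl, of s] by simp
qed

lemma vel_tangent:
  assumes s: "s \<in> {a..b}"
  shows "vel s \<in> tangent_space A (\<gamma> s)"
proof (rule tangent_spaceI)
  fix c d assume c: "c \<in> A" "\<gamma> s \<in> fst c" and d: "d \<in> A" "\<gamma> s \<in> fst d"
  have "((\<lambda>r. transition c d (xc c r)) has_vector_derivative coord_change c d (\<gamma> s) (vel s c)) (at s within {a..b})"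
    by (rule has_vector_derivative_compose_at[OF transition_deriv[OF c(1) d(1) c(2) d(2)] xc_deriv[OF c(1) s c(2)]])
  then have "(xc d has_vector_derivative coord_change c d (\<gamma> s) (vel s c)) (at s within {a..b})"
    by (rule local_deriv[OF c s order_refl, rotated]) (simp add: transition_at[OF c(1)])
  then have "ivl_deriv a b (xc d) s = coord_change c d (\<gamma> s) (vel s c)" by (rule ivl_deriv_eq[OF ab s])
  then show "vel s d = coord_change c d (\<gamma> s) (vel s c)"
    using ivl_deriv_eq[OF ab s xc_deriv[OF d(1) s d(2)]] by simp
qed (auto simp: velocity_def)

lemma chr_path_smooth:
  assumes c: "c \<in> A" and J: "perfect_on J" "J \<subseteq> {s \<in> {a..b}. \<gamma> s \<in> fst c}"
    and u: "smooth_path_on u J" and v: "smooth_path_on v J"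
  shows "smooth_path_on (\<lambda>s. chr c (xc c s) (u s) (v s)) J"
proof -
  have basis: "(\<Sum>i\<in>UNIV. (w $ i) *\<^sub>R axis i 1) = w" for w :: "real^'n"
    using basis_expansion[of w] by (simp add: scalar_mult_eq_scaleR)
  have x: "xc c s \<in> coords c" if "s \<in> J" for s using that J by auto
  have "smooth_path_on (\<lambda>s. \<Sum>i\<in>UNIV. \<Sum>j\<in>UNIV. (u s $ i) *\<^sub>R (v s $ j) *\<^sub>R chr c (xc c s) (axis i 1) (axis j 1)) J"
    by (intro smooth_path_on_sum smooth_path_on_bilinear[OF bounded_bilinear_scaleR J(1)]
        smooth_path_on_linear[OF bounded_linear_vec_nth] u v
        smooth_path_on_compose[OF J(1) smooth_path_on_subset[OF xc_smooth[OF c] J(2)] x chr_smooth[OF c]])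
  then show ?thesis
  proof (rule smooth_path_on_cong[rotated])
    fix s assume "s \<in> J"
    note l = chr_linear[OF c x[OF this]]
    have "chr c (xc c s) (u s) (v s) = chr c (xc c s) (\<Sum>i\<in>UNIV. (u s $ i) *\<^sub>R axis i 1) (\<Sum>j\<in>UNIV. (v s $ j) *\<^sub>R axis j 1)"
      unfolding basis ..
    also have "\<dots> = (\<Sum>i\<in>UNIV. (u s $ i) *\<^sub>R chr c (xc c s) (axis i 1) (\<Sum>j\<in>UNIV. (v s $ j) *\<^sub>R axis j 1))"
      by (simp only: linear_sum[OF l(1)] linear_cmul[OF l(1)])
    also have "\<dots> = (\<Sum>i\<in>UNIV. \<Sum>j\<in>UNIV. (u s $ i) *\<^sub>R (v s $ j) *\<^sub>R chr c (xc c s) (axis i 1) (axis j 1))"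
      by (simp only: linear_sum[OF l(2)] linear_cmul[OF l(2)] scaleR_sum_right)
    finally show "(\<Sum>i\<in>UNIV. \<Sum>j\<in>UNIV. (u s $ i) *\<^sub>R (v s $ j) *\<^sub>R chr c (xc c s) (axis i 1) (axis j 1)) =
      chr c (xc c s) (u s) (v s)" ..
  qed
qed

text \<open>Vanishing covariant derivative, written as the linear equation in every chart. This form
  asserts differentiability along with the equation.\<close>

definition parallel_on :: "real set \<Rightarrow> (real \<Rightarrow> ('m, 'n) tvec) \<Rightarrow> bool"
  where "parallel_on I X \<longleftrightarrow> (\<forall>s\<in>I. X s \<in> tangent_space A (\<gamma> s) \<and> (\<forall>c\<in>A. \<gamma> s \<in> fst c \<longrightarrow>
    ((\<lambda>r. X r c) has_vector_derivative - chr c (xc c s) (vel s c) (X s c)) (at s within I)))"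

lemma parallel_onD:
  assumes "parallel_on I X" "s \<in> I"
  shows "X s \<in> tangent_space A (\<gamma> s)"
    "c \<in> A \<Longrightarrow> \<gamma> s \<in> fst c \<Longrightarrow> ((\<lambda>r. X r c) has_vector_derivative - chr c (xc c s) (vel s c) (X s c)) (at s within I)"
  using assms unfolding parallel_on_def by blast+

text \<open>The linear equation is solved in the single chart \<open>c\<close>; in the other charts
  it follows from the transformation law of the Christoffel symbols.\<close>

lemma parallel_in_chart:
  assumes c: "c \<in> A" and pq: "p \<le> q" "{p..q} \<subseteq> {a..b}" "\<And>s. s \<in> {p..q} \<Longrightarrow> \<gamma> s \<in> fst c"
    and v: "v \<in> tangent_space A (\<gamma> p)"
  shows "\<exists>X. parallel_on {p..q} X \<and> X p = v"
proof -
  have p: "p \<in> {p..q}" using pq(1) by simp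
  \<comment> \<open>Outside the interval the curve may leave the chart, where linearity is not
    known; the value 0 makes \<open>F s\<close> linear for every \<open>s\<close>.\<close>
  define F where "F s = (\<lambda>y. if s \<in> {p..q} then - chr c (xc c s) (vel s c) y else 0)" for s
  have "linear (F s)" for s
  proof (cases "s \<in> {p..q}")
    case True
    then have "xc c s \<in> coords c" using pq(3) by blast
    from linear_compose_neg[OF chr_linear(2)[OF c this, of "vel s c"]] True
    show ?thesis by (simp add: F_def)
  next
    case False
    have "F s = (\<lambda>y. 0)" unfolding F_def if_not_P[OF False] ..
    then show ?thesis by (simp add: linear_zero)
  qed
  moreover have "continuous_on {p..q} (\<lambda>s. F s y)" for y
  proof -
    let ?J = "{s \<in> {a..b}. \<gamma> s \<in> fst c}"
    have "continuous_on ?J (\<lambda>s. - chr c (xc c s) (vel s c) y)"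
      by (intro continuous_on_minus smooth_path_on_continuous chr_path_smooth[OF c window_perfect[OF c ab order_refl] order_refl]
          vel_smooth[OF c] smooth_path_on_const)
    then have "continuous_on {p..q} (\<lambda>s. - chr c (xc c s) (vel s c) y)"
      by (rule continuous_on_subset) (use pq in blast)
    then show ?thesis using continuous_on_cong[of "{p..q}" "{p..q}" "\<lambda>s. F s y" "\<lambda>s. - chr c (xc c s) (vel s c) y"]
      by (simp add: F_def)
  qed
  ultimately obtain y where y: "y p = v c"
    "\<And>s. s \<in> {p..q} \<Longrightarrow> (y has_vector_derivative (F s (y s) + 0)) (at s within {p..q})"
    using linear_ode_exists_pointwise[OF pq(1), of F "\<lambda>_. 0" "v c"] continuous_on_const by blast
  define X where "X s = lift c (\<gamma> s) (y s)" for s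
  have XT: "X s \<in> tangent_space A (\<gamma> s)" if "s \<in> {p..q}" for s
    unfolding X_def by (rule lift_in(1)[OF c pq(3)[OF that]])
  have "((\<lambda>r. X r d) has_vector_derivative - chr d (xc d s) (vel s d) (X s d)) (at s within {p..q})"
    if s: "s \<in> {p..q}" and d: "d \<in> A" "\<gamma> s \<in> fst d" for s d
  proof -
    have sab: "s \<in> {a..b}" and cs: "\<gamma> s \<in> fst c" using s pq by auto
    have xo: "xc c s \<in> overlap c d" using cs d by blast
    let ?\<phi> = "transition c d"
    note sm = transition_smooth[OF c d(1)]
    have y': "(y has_vector_derivative - chr c (xc c s) (vel s c) (y s)) (at s within {p..q})"
      using y(2)[OF s] s by (simp add: F_def)
    have "((\<lambda>r. dird ?\<phi> (y r) (xc c r)) has_vector_derivative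
        (dird (dird ?\<phi> (y s)) (vel s c) (xc c s) + dird ?\<phi> (- chr c (xc c s) (vel s c) (y s)) (xc c s))) (at s within {p..q})"
      by (rule has_vector_derivative_linear_family[where F="\<lambda>x e. dird ?\<phi> e x" and x="xc c", OF open_overlap[OF c d(1)] xo
            linear_dird[OF sm] smooth_on_has_derivative[OF smooth_on_dird[OF sm] xo]
            has_vector_derivative_within_subset[OF xc_deriv[OF c sab cs] pq(2)] y'])
    moreover have "dird (dird ?\<phi> (y s)) (vel s c) (xc c s) + dird ?\<phi> (- chr c (xc c s) (vel s c) (y s)) (xc c s) =
        - chr d (xc d s) (vel s d) (X s d)"
    proof -
      have 1: "dird ?\<phi> (vel s c) (xc c s) = vel s d"
        using tangent_spaceD(2)[OF vel_tangent[OF sab] c d(1) cs d(2)] by (simp add: coord_change_dird)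
      have 2: "dird ?\<phi> (y s) (xc c s) = X s d"
        using d by (simp add: X_def lift_def coord_change_dird)
      show ?thesis
        unfolding linear_neg[OF linear_dird[OF sm xo]] christoffel_transform[OF c d(1) xo] 1 2 transition_at[OF c cs] by simp
    qed
    ultimately have "((\<lambda>r. dird ?\<phi> (y r) (xc c r)) has_vector_derivative - chr d (xc d s) (vel s d) (X s d)) (at s within {p..q})"
      by simp
    then show ?thesis
      by (rule local_deriv[OF d s pq(2), rotated]) (simp add: X_def lift_def coord_change_dird d)
  qed
  moreover have "X p = v" unfolding X_def y(1) by (rule lift_component[OF c pq(3)[OF p] v])
  ultimately show ?thesis unfolding parallel_on_def using XT by blast
qed

lemma parallel_glue:
  assumes pqr: "p \<le> q" "q \<le> r" and X: "parallel_on {p..q} X" and Y: "parallel_on {q..r} Y" and e: "Y q = X q"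
  shows "parallel_on {p..r} (\<lambda>s. if s \<le> q then X s else Y s)"
proof -
  let ?Z = "\<lambda>s. if s \<le> q then X s else Y s"
  have Zl: "?Z s = X s" if "s \<in> {p..q}" for s using that by simp
  have Zr: "?Z s = Y s" if "s \<in> {q..r}" for s using that e by (cases "s = q") auto
  have un: "{p..r} = {p..q} \<union> {q..r}" using pqr by auto
  have T: "?Z s \<in> tangent_space A (\<gamma> s)" if "s \<in> {p..r}" for s
    using parallel_onD(1)[OF X, of s] parallel_onD(1)[OF Y, of s] Zl[of s] Zr[of s] that unfolding un by auto
  have "((\<lambda>r. ?Z r c) has_vector_derivative - chr c (xc c s) (vel s c) (?Z s c)) (at s within {p..r})"
    if s: "s \<in> {p..r}" and c: "c \<in> A" "\<gamma> s \<in> fst c" for s c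
    unfolding un
  proof (rule has_vector_derivative_Un)
    show "((\<lambda>r. ?Z r c) has_vector_derivative - chr c (xc c s) (vel s c) (?Z s c)) (at s within {p..q})"
    proof (cases "s \<in> {p..q}")
      case True
      show ?thesis unfolding Zl[OF True]
        by (rule has_vector_derivative_transform[OF True _ parallel_onD(2)[OF X True c]]) simp
    qed (simp add: has_vector_derivative_outside)
    show "((\<lambda>r. ?Z r c) has_vector_derivative - chr c (xc c s) (vel s c) (?Z s c)) (at s within {q..r})"
    proof (cases "s \<in> {q..r}")
      case True
      show ?thesis unfolding Zr[OF True]
        by (rule has_vector_derivative_transform[OF True _ parallel_onD(2)[OF Y True c]]) (use Zr in simp)
    qed (simp add: has_vector_derivative_outside)
  qed
  then show ?thesis unfolding parallel_on_def using T by blast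
qed

text \<open>Solvability on an interval passes to adjacent unions and holds on short intervals inside
  one chart; the Bolzano principle gives the whole interval.\<close>

lemma parallel_exists:
  assumes v: "v \<in> tangent_space A (\<gamma> a)"
  shows "\<exists>X. parallel_on {a..b} X \<and> X a = v"
proof -
  \<comment> \<open>The Bolzano principle ranges over all short intervals around a point, also those
    that leave the domain; for these \<open>Q\<close> is true by its premises.\<close>
  define Q where "Q p q \<longleftrightarrow> (a \<le> p \<longrightarrow> p \<le> q \<longrightarrow> q \<le> b \<longrightarrow>
    (\<forall>v\<in>tangent_space A (\<gamma> p). \<exists>X. parallel_on {p..q} X \<and> X p = v))" for p q
  have "Q a b"
  proof (rule Bolzano[of a b Q])
    fix p q r assume Q: "Q p q" "Q q r" "p \<le> q" "q \<le> r"
    show "Q p r"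
      unfolding Q_def
    proof (intro impI ballI)
      fix v assume h: "a \<le> p" "p \<le> r" "r \<le> b" "v \<in> tangent_space A (\<gamma> p)"
      obtain X where X: "parallel_on {p..q} X" "X p = v" using Q h unfolding Q_def by fastforce
      have "X q \<in> tangent_space A (\<gamma> q)" using parallel_onD(1)[OF X(1)] Q(3) by simp
      then obtain Y where Y: "parallel_on {q..r} Y" "Y q = X q" using Q h unfolding Q_def by fastforce
      show "\<exists>X. parallel_on {p..r} X \<and> X p = v"
        using parallel_glue[OF Q(3,4) X(1) Y] X(2) Q(3) by (intro exI[of _ "\<lambda>s. if s \<le> q then X s else Y s"]) simp
    qed
  next
    fix x assume x: "a \<le> x" "x \<le> b"
    obtain c where c: "c \<in> A" "\<gamma> x \<in> fst c" using chart_cover by blast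
    obtain V where V: "open V" "\<And>s. s \<in> {a..b} \<Longrightarrow> s \<in> V \<longleftrightarrow> \<gamma> s \<in> fst c" using chart_window[OF c(1)] by blast
    then have "x \<in> V" using x c by auto
    then obtain d where d: "0 < d" "ball x d \<subseteq> V" using V(1) open_contains_ball by metis
    have "Q p q" if pq: "p \<le> x \<and> x \<le> q \<and> q - p < d" for p q
      unfolding Q_def
    proof (intro impI ballI)
      fix v assume h: "a \<le> p" "p \<le> q" "q \<le> b" "v \<in> tangent_space A (\<gamma> p)"
      have "\<gamma> s \<in> fst c" if "s \<in> {p..q}" for s
      proof -
        have "s \<in> ball x d" using that pq by (auto simp: dist_real_def)
        then show ?thesis using V(2)[of s] d(2) that h by auto
      qed
      then show "\<exists>X. parallel_on {p..q} X \<and> X p = v"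
        using parallel_in_chart[OF c(1) h(2) _ _ h(4)] h(1,3) by (meson atLeastatMost_subset_iff)
    qed
    then show "\<exists>d>0. \<forall>p q. p \<le> x \<and> x \<le> q \<and> q - p < d \<longrightarrow> Q p q" using d(1) by blast
  qed (use ab in simp)
  then show ?thesis using v ab unfolding Q_def by simp
qed

text \<open>In a chart the derivative of the inner product is the metric derivative minus the two
  Christoffel terms, which is zero by metric compatibility.\<close>

lemma parallel_inner_constant:
  assumes X: "parallel_on {a..b} X" and Y: "parallel_on {a..b} Y" and s: "s \<in> {a..b}"
  shows "g (\<gamma> s) (X s) (Y s) = g (\<gamma> a) (X a) (Y a)"
proof (rule constant_on_Icc[where f="\<lambda>s. g (\<gamma> s) (X s) (Y s)", OF _ s])
  fix s assume s: "s \<in> {a..b}"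
  obtain c where c: "c \<in> A" "\<gamma> s \<in> fst c" using chart_cover by blast
  have x: "xc c s \<in> coords c" using c by blast
  have "((\<lambda>r. gi c (xc c r) (X r c) (Y r c)) has_vector_derivative
    (metric_deriv A g c (xc c s) (vel s c) (X s c) (Y s c) + gi c (xc c s) (X s c) (- chr c (xc c s) (vel s c) (Y s c))
      + gi c (xc c s) (- chr c (xc c s) (vel s c) (X s c)) (Y s c))) (at s within {a..b})"
    by (rule has_vector_derivative_bilinear_family[where F="gi c" and x="xc c", OF chart(2)[OF c(1)] x gi_linear
          gi_has_derivative[OF c(1) x] xc_deriv[OF c(1) s c(2)] parallel_onD(2)[OF X s c] parallel_onD(2)[OF Y s c]])
  then have "((\<lambda>r. gi c (xc c r) (X r c) (Y r c)) has_vector_derivative 0) (at s within {a..b})"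
    unfolding metric_compatible[OF c(1) x] linear_neg[OF gi_linear(1)] linear_neg[OF gi_linear(2)] by simp
  then show "((\<lambda>s. g (\<gamma> s) (X s) (Y s)) has_vector_derivative 0) (at s within {a..b})"
    by (rule local_deriv[OF c s order_refl, rotated])
      (simp add: metric_component[OF c(1) _ parallel_onD(1)[OF X] parallel_onD(1)[OF Y]])
qed (use ab in simp)

text \<open>The equation has smooth coefficients \<open>w j\<close> and is linear in the components
  of \<open>X\<close>, so every order of regularity yields the next.\<close>

lemma parallel_smooth:
  assumes X: "parallel_on {a..b} X" and c: "c \<in> A"
  shows "smooth_path_on (\<lambda>s. X s c) {s \<in> {a..b}. \<gamma> s \<in> fst c}"
proof -
  let ?J = "{s \<in> {a..b}. \<gamma> s \<in> fst c}"
  have J: "perfect_on ?J" by (rule window_perfect[OF c ab order_refl])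
  define w where "w j s = - chr c (xc c s) (vel s c) (axis j 1)" for j s
  have w: "smooth_path_on (w j) ?J" for j
    unfolding w_def[abs_def]
    by (intro smooth_path_on_minus chr_path_smooth[OF c J order_refl] vel_smooth[OF c] smooth_path_on_const)
  have D: "((\<lambda>r. X r c) has_vector_derivative (\<Sum>j\<in>UNIV. (X s c \<bullet> axis j 1) *\<^sub>R w j s)) (at s within ?J)"
    if s: "s \<in> ?J" for s
  proof -
    have sab: "s \<in> {a..b}" and cs: "\<gamma> s \<in> fst c" using s by blast+
    have x: "xc c s \<in> coords c" using cs by blast
    note l = chr_linear(2)[OF c x, of "vel s c"]
    have "X s c = (\<Sum>j\<in>UNIV. (X s c $ j) *\<^sub>R axis j 1)"
      using basis_expansion[of "X s c"] by (simp add: scalar_mult_eq_scaleR)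
    then have "chr c (xc c s) (vel s c) (X s c) = chr c (xc c s) (vel s c) (\<Sum>j\<in>UNIV. (X s c $ j) *\<^sub>R axis j 1)"
      by (rule arg_cong)
    also have "\<dots> = (\<Sum>j\<in>UNIV. (X s c $ j) *\<^sub>R chr c (xc c s) (vel s c) (axis j 1))"
      by (simp only: linear_sum[OF l] linear_cmul[OF l])
    finally have e: "- chr c (xc c s) (vel s c) (X s c) = (\<Sum>j\<in>UNIV. (X s c \<bullet> axis j 1) *\<^sub>R w j s)"
      by (simp add: w_def sum_negf inner_axis)
    show ?thesis
      using parallel_onD(2)[OF X sab c cs] unfolding window_within[OF c cs sab order_refl] e .
  qed
  show ?thesis
  proof (rule Cpath_smooth_path_on[OF J])
    fix k show "Cpath k (\<lambda>s. X s c) ?J"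
    proof (induction k)
      case 0
      show ?case unfolding Cpath.simps(1) by (rule continuous_on_deriv[OF D])
    next
      case (Suc k)
      have "Cpath k (\<lambda>s. \<Sum>j\<in>UNIV. (X s c \<bullet> axis j 1) *\<^sub>R w j s) ?J"
        by (intro Cpath_sum Cpath_bilinear[OF bounded_bilinear_scaleR] Cpath_bilinear[OF bounded_bilinear_inner]
            Cpath_const Suc smooth_path_on_Cpath[OF w])
      then show ?case unfolding Cpath.simps(2) using D by (intro exI conjI ballI)
    qed
  qed
qed

lemma parallel_frame_exists:
  "\<exists>E :: 'n \<Rightarrow> real \<Rightarrow> ('m, 'n) tvec. (\<forall>i. parallel_on {a..b} (E i)) \<and>
    (\<forall>i j. \<forall>s\<in>{a..b}. g (\<gamma> s) (E i s) (E j s) = (if i = j then 1 else 0))"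
proof -
  obtain c where c: "c \<in> A" "\<gamma> a \<in> fst c" using chart_cover by blast
  have x: "xc c a \<in> coords c" using c by blast
  obtain e :: "'n \<Rightarrow> real^'n" where e: "\<And>i j. gi c (xc c a) (e i) (e j) = (if i = j then 1 else 0)"
    using orthonormal_family_exists[of "gi c (xc c a)"] gi_linear(1) gi_sym[OF c(1) x] gi_pos[OF c(1) x] by metis
  have "\<exists>X. parallel_on {a..b} X \<and> X a = lift c (\<gamma> a) (e i)" for i
    by (rule parallel_exists[OF lift_in(1)[OF c]])
  then obtain E where E: "\<And>i. parallel_on {a..b} (E i)" "\<And>i. E i a = lift c (\<gamma> a) (e i)" by metis
  have "g (\<gamma> s) (E i s) (E j s) = (if i = j then 1 else 0)" if "s \<in> {a..b}" for i j s
    unfolding parallel_inner_constant[OF E(1) E(1) that] E(2) metric_lift[OF c] by (rule e)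
  then show ?thesis using E(1) by blast
qed

end

subsection \<open>Vector fields in a parallel frame\<close>

text \<open>Negative definite subspaces correspond under \<open>f\<close>, with equal dimension.
  Only the diagonal values of the forms enter this correspondence.\<close>

lemma form_index_image:
  assumes f: "linear f" "inj_on f V" and V: "subspace V" and H: "\<And>x. x \<in> V \<Longrightarrow> H (f x) (f x) = h x x"
  shows "form_index H (f ` V) = form_index h V"
proof -
  have nz: "f x = 0 \<longleftrightarrow> x = 0" if "x \<in> V" for x
    using inj_onD[OF f(2), of x 0] that subspace_0[OF V] linear_0[OF f(1)] by auto
  have "{edim W |W. subspace W \<and> W \<subseteq> f ` V \<and> negative_definite_on H W} =
    {edim W |W. subspace W \<and> W \<subseteq> V \<and> negative_definite_on h W}" (is "?L = ?R")
  proof (intro subset_antisym subsetI)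
    fix k assume "k \<in> ?L"
    then obtain W where W: "k = edim W" "subspace W" "W \<subseteq> f ` V" "negative_definite_on H W" by blast
    let ?W = "V \<inter> f -` W"
    have sW: "subspace ?W" by (intro subspace_inter V linear_subspace_vimage f(1) W(2))
    have im: "f ` ?W = W" using W(3) by blast
    have "edim (f ` ?W) = edim ?W"
      by (rule edim_image_inj[OF f(1) sW inj_on_subset[OF f(2)]]) blast
    moreover have "negative_definite_on h ?W"
      using W(4) H nz unfolding negative_definite_on_def by auto
    ultimately show "k \<in> ?R" using W(1) sW unfolding im by blast
  next
    fix k assume "k \<in> ?R"
    then obtain W where W: "k = edim W" "subspace W" "W \<subseteq> V" "negative_definite_on h W" by blast
    have "edim (f ` W) = edim W" by (rule edim_image_inj[OF f(1) W(2) inj_on_subset[OF f(2) W(3)]])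
    moreover have "subspace (f ` W)" by (rule linear_subspace_image[OF f(1) W(2)])
    moreover have "negative_definite_on H (f ` W)"
      unfolding negative_definite_on_def
    proof (intro ballI impI)
      fix X assume "X \<in> f ` W" "X \<noteq> 0"
      then obtain x where x: "x \<in> W" "X = f x" "x \<noteq> 0" using linear_0[OF f(1)] by blast
      then show "H X X < 0" using W(3,4) H unfolding negative_definite_on_def by auto
    qed
    ultimately show "k \<in> ?L" using W(1,3) by (metis (mono_tags, lifting) image_mono mem_Collect_eq)
  qed
  then show ?thesis by (simp add: form_index_def)
qed

lemma infsum_finite_support:
  fixes f :: "'a \<Rightarrow> enat"
  assumes "finite T" "T \<subseteq> S" "\<And>x. x \<in> S \<Longrightarrow> x \<notin> T \<Longrightarrow> f x = 0"
  shows "infsum f S = sum f T"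
proof -
  have "infsum f S = infsum f T" by (rule infsum_cong_neutral) (use assms in auto)
  then show ?thesis using assms(1) by simp
qed

locale riemannian_frame = riemannian_curve A g \<gamma> a b
  for A :: "('m::topological_space, 'n::finite) chart set" and g :: "('m, 'n) metric" and \<gamma> a b +
  fixes E :: "'n \<Rightarrow> real \<Rightarrow> ('m, 'n) tvec"
  assumes E_parallel: "parallel_on {a..b} (E i)"
    and E_orthonormal: "s \<in> {a..b} \<Longrightarrow> g (\<gamma> s) (E i s) (E j s) = (if i = j then 1 else 0)"
begin

definition comb :: "real \<Rightarrow> real^'n \<Rightarrow> ('m, 'n) tvec"
  where "comb s y = (\<Sum>i\<in>UNIV. (y $ i) *\<^sub>R E i s)"

definition coef :: "real \<Rightarrow> ('m, 'n) tvec \<Rightarrow> real^'n"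
  where "coef s v = (\<chi> i. g (\<gamma> s) v (E i s))"

definition to_field :: "real \<Rightarrow> (real \<Rightarrow> real^'n) \<Rightarrow> real \<Rightarrow> ('m, 'n) tvec"
  where "to_field t y = (\<lambda>s. if s \<in> {a..t} then comb s (y s) else 0)"

text \<open>The column index is the argument of the curvature operator and the row index the test
  vector, so that \<open>Kmat s *v y\<close> is the coefficient vector of its value on
  \<open>comb s y\<close>.\<close>

definition Kmat :: "real \<Rightarrow> real^'n^'n"
  where "Kmat s = (\<chi> i j. g (\<gamma> s) (curvature A g (\<gamma> s) (vel s) (E j s) (vel s)) (E i s))"

lemma E_tangent: "s \<in> {a..b} \<Longrightarrow> E i s \<in> tangent_space A (\<gamma> s)"
  by (rule parallel_onD(1)[OF E_parallel])

lemma comb_component: "comb s y c = (\<Sum>i\<in>UNIV. (y $ i) *\<^sub>R E i s c)"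
  by (simp add: comb_def sum_apply_fun scaleR_fun_def)

lemma comb_linear: "linear (comb s)"
  by (rule linearI) (simp_all add: comb_def scaleR_add_left sum.distrib scaleR_sum_right)

lemma comb_tangent: "s \<in> {a..b} \<Longrightarrow> comb s y \<in> tangent_space A (\<gamma> s)"
  unfolding comb_def by (intro subspace_sum subspace_tangent subspace_scale E_tangent)

lemma g_comb_right:
  assumes s: "s \<in> {a..b}" and v: "v \<in> tangent_space A (\<gamma> s)"
  shows "g (\<gamma> s) v (comb s z) = (\<Sum>j\<in>UNIV. z $ j * g (\<gamma> s) v (E j s))"
proof -
  obtain c where c: "c \<in> A" "\<gamma> s \<in> fst c" using chart_cover by blast
  show ?thesis
    unfolding metric_component[OF c v comb_tangent[OF s]] metric_component[OF c v E_tangent[OF s]] comb_component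
    by (simp add: linear_sum[OF gi_linear(2)] linear_cmul[OF gi_linear(2)])
qed

lemma g_sym: "u \<in> tangent_space A p \<Longrightarrow> v \<in> tangent_space A p \<Longrightarrow> g p u v = g p v u"
  using metricD(1) by blast

lemma coef_comb:
  assumes s: "s \<in> {a..b}"
  shows "coef s (comb s y) = y"
proof -
  have "g (\<gamma> s) (comb s y) (E i s) = y $ i" for i
  proof -
    have "g (\<gamma> s) (comb s y) (E i s) = (\<Sum>j\<in>UNIV. y $ j * (if i = j then 1 else 0))"
      unfolding g_sym[OF comb_tangent[OF s] E_tangent[OF s]] g_comb_right[OF s E_tangent[OF s]] E_orthonormal[OF s] ..
    then show ?thesis by (simp add: if_distrib cong: if_cong)
  qed
  then show ?thesis by (simp add: coef_def vec_eq_iff)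
qed

text \<open>Orthonormality makes the combination map injective; in the component of one chart it is
  an endomorphism of \<open>real^'n\<close>, hence also onto.\<close>

lemma comb_coef:
  assumes s: "s \<in> {a..b}" and v: "v \<in> tangent_space A (\<gamma> s)"
  shows "comb s (coef s v) = v"
proof -
  obtain c where c: "c \<in> A" "\<gamma> s \<in> fst c" using chart_cover by blast
  let ?T = "\<lambda>y. comb s y c"
  have lin: "linear ?T"
    by (rule linearI) (simp_all add: linear_add[OF comb_linear] linear_cmul[OF comb_linear] scaleR_fun_def)
  have "inj ?T"
  proof (rule injI)
    fix y z assume "?T y = ?T z"
    then have "comb s y = comb s z" by (rule tangent_eqI[OF c comb_tangent[OF s] comb_tangent[OF s]])
    then show "y = z" using coef_comb[OF s] by metis
  qed
  then have "surj ?T" by (rule linear_inj_imp_surj[OF lin])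
  then obtain y where "v c = ?T y" by (metis surjD)
  then have "v = comb s y" by (rule tangent_eqI[OF c v comb_tangent[OF s]])
  then show ?thesis using coef_comb[OF s] by simp
qed

lemma g_comb:
  assumes s: "s \<in> {a..b}"
  shows "g (\<gamma> s) (comb s y) (comb s z) = y \<bullet> z"
proof -
  have "g (\<gamma> s) (comb s y) (E j s) = y $ j" for j
    using coef_comb[OF s, of y] by (simp add: coef_def vec_eq_iff)
  then show ?thesis
    unfolding g_comb_right[OF s comb_tangent[OF s]] by (simp add: inner_vec_def mult.commute)
qed

lemma curvature_comb:
  assumes s: "s \<in> {a..b}"
  shows "curvature A g (\<gamma> s) (vel s) (comb s y) (vel s) = comb s (Kmat s *v y)"
proof -
  obtain c where c: "c \<in> A" "\<gamma> s \<in> fst c" using chart_cover by blast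
  have x: "xc c s \<in> coords c" using c by blast
  note vt = vel_tangent[OF s]
  note l = curv_linear[OF c(1) x, of "vel s c" "vel s c"]
  have ct: "curvature A g (\<gamma> s) (vel s) v (vel s) \<in> tangent_space A (\<gamma> s)" if "v \<in> tangent_space A (\<gamma> s)" for v
    by (rule curvature_tangent[OF vt that vt])
  have "g (\<gamma> s) (curvature A g (\<gamma> s) (vel s) (comb s y) (vel s)) (E i s) = (\<Sum>j\<in>UNIV. Kmat s $ i $ j * y $ j)" for i
    unfolding Kmat_def vec_lambda_beta
      metric_component[OF c ct[OF comb_tangent[OF s]] E_tangent[OF s]] metric_component[OF c ct[OF E_tangent[OF s]] E_tangent[OF s]]
      curvature_component[OF c] comb_component
    by (simp add: linear_sum[OF l] linear_cmul[OF l] linear_sum[OF gi_linear(1)] linear_cmul[OF gi_linear(1)] mult.commute)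
  then have "coef s (curvature A g (\<gamma> s) (vel s) (comb s y) (vel s)) = Kmat s *v y"
    by (simp add: coef_def vec_eq_iff matrix_vector_mult_def)
  then show ?thesis using comb_coef[OF s ct[OF comb_tangent[OF s]], of y] by simp
qed

text \<open>Self-adjointness of the curvature operator, read in the frame, says that the matrix
  equals its transpose.\<close>

lemma Kmat_sym:
  assumes s: "s \<in> {a..b}"
  shows "(Kmat s *v u) \<bullet> v = u \<bullet> (Kmat s *v v)"
proof -
  obtain c where c: "c \<in> A" "\<gamma> s \<in> fst c" using chart_cover by blast
  have x: "xc c s \<in> coords c" using c by blast
  note vt = vel_tangent[OF s]
  have "Kmat s $ i $ j = Kmat s $ j $ i" for i j
    unfolding Kmat_def vec_lambda_beta
      metric_component[OF c curvature_tangent[OF vt E_tangent[OF s] vt] E_tangent[OF s]] curvature_component[OF c]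
    by (rule curv_self_adjoint[OF c(1) x])
  then have "transpose (Kmat s) = Kmat s" by (simp add: transpose_def vec_eq_iff)
  then show ?thesis using dot_lmul_matrix[of u "Kmat s" v] by (metis inner_commute transpose_matrix_vector)
qed

lemma gi_path_smooth:
  assumes c: "c \<in> A" and J: "perfect_on J" "J \<subseteq> {s \<in> {a..b}. \<gamma> s \<in> fst c}"
    and u: "smooth_path_on u J" and v: "smooth_path_on v J"
  shows "smooth_path_on (\<lambda>s. gi c (xc c s) (u s) (v s)) J"
proof -
  have x: "xc c s \<in> coords c" if "s \<in> J" for s using that J by auto
  show ?thesis
    unfolding gi_def
    by (intro smooth_path_on_bilinear[OF bounded_bilinear_inner J(1)] u
        smooth_path_on_bilinear[OF bounded_bilinear_mat_vec J(1)] v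
        smooth_path_on_compose[OF J(1) smooth_path_on_subset[OF xc_smooth[OF c] J(2)] x metric_smooth[OF c]])
qed

lemma dird_chr_path_smooth:
  assumes c: "c \<in> A" and J: "perfect_on J" "J \<subseteq> {s \<in> {a..b}. \<gamma> s \<in> fst c}"
    and u: "smooth_path_on u J" and v: "smooth_path_on v J" and w: "smooth_path_on w J"
  shows "smooth_path_on (\<lambda>s. dird (\<lambda>y. chr c y (v s) (w s)) (u s) (xc c s)) J"
proof -
  have basis: "(\<Sum>i\<in>UNIV. (w $ i) *\<^sub>R axis i 1) = w" for w :: "real^'n"
    using basis_expansion[of w] by (simp add: scalar_mult_eq_scaleR)
  have x: "xc c s \<in> coords c" if "s \<in> J" for s using that J by auto
  let ?f = "\<lambda>i j k s. dird (\<lambda>y. chr c y (axis j 1) (axis k 1)) (axis i 1) (xc c s)"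
  have sf: "smooth_path_on (?f i j k) J" for i j k
    by (rule smooth_path_on_compose[where F="dird (\<lambda>y. chr c y (axis j 1) (axis k 1)) (axis i 1)",
          OF J(1) smooth_path_on_subset[OF xc_smooth[OF c] J(2)] x smooth_on_dird[OF chr_smooth[OF c]]])
  have "smooth_path_on (\<lambda>s. \<Sum>i\<in>UNIV. (u s $ i) *\<^sub>R (\<Sum>j\<in>UNIV. (v s $ j) *\<^sub>R (\<Sum>k\<in>UNIV. (w s $ k) *\<^sub>R ?f i j k s))) J"
    by (intro smooth_path_on_sum smooth_path_on_bilinear[OF bounded_bilinear_scaleR J(1)]
        smooth_path_on_linear[OF bounded_linear_vec_nth] u v w sf)
  then show ?thesis
  proof (rule smooth_path_on_cong[rotated])
    fix s assume "s \<in> J"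
    note l = dird_chr_linear[OF c x[OF this]]
    have "dird (\<lambda>y. chr c y (v s) (w s)) (u s) (xc c s) =
      dird (\<lambda>y. chr c y (\<Sum>j\<in>UNIV. (v s $ j) *\<^sub>R axis j 1) (\<Sum>k\<in>UNIV. (w s $ k) *\<^sub>R axis k 1)) (\<Sum>i\<in>UNIV. (u s $ i) *\<^sub>R axis i 1) (xc c s)"
      unfolding basis ..
    also have "\<dots> = (\<Sum>i\<in>UNIV. (u s $ i) *\<^sub>R dird (\<lambda>y. chr c y (\<Sum>j\<in>UNIV. (v s $ j) *\<^sub>R axis j 1) (\<Sum>k\<in>UNIV. (w s $ k) *\<^sub>R axis k 1)) (axis i 1) (xc c s))"
      by (simp only: linear_sum[OF l(1)] linear_cmul[OF l(1)])
    also have "\<dots> = (\<Sum>i\<in>UNIV. (u s $ i) *\<^sub>R (\<Sum>j\<in>UNIV. (v s $ j) *\<^sub>R dird (\<lambda>y. chr c y (axis j 1) (\<Sum>k\<in>UNIV. (w s $ k) *\<^sub>R axis k 1)) (axis i 1) (xc c s)))"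
      by (simp only: linear_sum[OF l(2)] linear_cmul[OF l(2)])
    also have "\<dots> = (\<Sum>i\<in>UNIV. (u s $ i) *\<^sub>R (\<Sum>j\<in>UNIV. (v s $ j) *\<^sub>R (\<Sum>k\<in>UNIV. (w s $ k) *\<^sub>R ?f i j k s)))"
      by (simp only: linear_sum[OF l(3)] linear_cmul[OF l(3)])
    finally show "(\<Sum>i\<in>UNIV. (u s $ i) *\<^sub>R (\<Sum>j\<in>UNIV. (v s $ j) *\<^sub>R (\<Sum>k\<in>UNIV. (w s $ k) *\<^sub>R ?f i j k s))) =
      dird (\<lambda>y. chr c y (v s) (w s)) (u s) (xc c s)" ..
  qed
qed

lemma smooth_path_chi:
  fixes f :: "'k::finite \<Rightarrow> real \<Rightarrow> 'b::real_normed_vector"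
  assumes "\<And>i. smooth_path_on (f i) J"
  shows "smooth_path_on (\<lambda>s. \<chi> i. f i s) J"
proof -
  have "\<exists>D. \<forall>i. (\<forall>s\<in>J. D i 0 s = f i s) \<and> (\<forall>k. \<forall>s\<in>J. (D i k has_vector_derivative D i (Suc k) s) (at s within J))"
    using assms unfolding smooth_path_on_def by (intro choice allI)
  then obtain D where D: "\<And>i s. s \<in> J \<Longrightarrow> D i 0 s = f i s"
    "\<And>i k s. s \<in> J \<Longrightarrow> (D i k has_vector_derivative D i (Suc k) s) (at s within J)" by blast
  show ?thesis
    unfolding smooth_path_on_def
  proof (intro exI[of _ "\<lambda>k s. \<chi> i. D i k s"] conjI allI ballI)
    show "(\<chi> i. D i 0 s) = (\<chi> i. f i s)" if "s \<in> J" for s using D(1)[OF that] by simp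
    show "((\<lambda>s. \<chi> i. D i k s) has_vector_derivative (\<chi> i. D i (Suc k) s)) (at s within J)" if "s \<in> J" for k s
    proof -
      have "((\<lambda>r. (1 / norm (r - s)) *\<^sub>R
          ((\<chi> i. D i k r) - ((\<chi> i. D i k s) + (r - s) *\<^sub>R (\<chi> i. D i (Suc k) s)))) \<longlongrightarrow> 0) (at s within J)"
      proof (rule vec_tendstoI)
        fix i
        have "((\<lambda>r. (1 / norm (r - s)) *\<^sub>R (D i k r - (D i k s + (r - s) *\<^sub>R D i (Suc k) s))) \<longlongrightarrow> 0) (at s within J)"
          using D(2)[OF that, of i k] unfolding has_vector_derivative_def has_derivative_within by (rule conjunct2)
        then show "((\<lambda>r. ((1 / norm (r - s)) *\<^sub>R
          ((\<chi> i. D i k r) - ((\<chi> i. D i k s) + (r - s) *\<^sub>R (\<chi> i. D i (Suc k) s)))) $ i) \<longlongrightarrow> 0 $ i) (at s within J)"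
          by simp
      qed
      then show ?thesis
        unfolding has_vector_derivative_def has_derivative_within
        by (intro conjI bounded_linear_scaleR_left)
    qed
  qed
qed

text \<open>The charts cover the curve, so it suffices to check smoothness in each chart window;
  frame coefficients are computed there from components.\<close>

lemma window_local:
  assumes pq: "p < q" "{p..q} \<subseteq> {a..b}"
    and f: "\<And>c. c \<in> A \<Longrightarrow> smooth_path_on f {s \<in> {p..q}. \<gamma> s \<in> fst c}"
  shows "smooth_path_on f {p..q}"
proof (rule smooth_path_on_local[OF perfect_on_Icc[OF pq(1)]])
  fix s assume s: "s \<in> {p..q}"
  obtain c where c: "c \<in> A" "\<gamma> s \<in> fst c" using chart_cover by blast
  obtain V where V: "open V" "\<And>s. s \<in> {a..b} \<Longrightarrow> s \<in> V \<longleftrightarrow> \<gamma> s \<in> fst c" using chart_window[OF c(1)] by blast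
  have "{p..q} \<inter> V = {s \<in> {p..q}. \<gamma> s \<in> fst c}" using V(2) pq(2) by blast
  then show "\<exists>U. open U \<and> s \<in> U \<and> smooth_path_on f ({p..q} \<inter> U)"
    using V s c pq(2) f[OF c(1)] by (intro exI[of _ V]) auto
qed

text \<open>Within a chart window the entries are built from the metric, the Christoffel symbols,
  their derivatives, the velocity and the frame, all smooth along the curve.\<close>

lemma Kmat_smooth: "smooth_path_on Kmat {a..b}"
proof (rule window_local[OF ab order_refl])
  fix c assume c: "c \<in> A"
  let ?J = "{s \<in> {a..b}. \<gamma> s \<in> fst c}"
  have J: "perfect_on ?J" by (rule window_perfect[OF c ab order_refl])
  note vs = vel_smooth[OF c] and Es = parallel_smooth[OF E_parallel c]
  have "smooth_path_on (\<lambda>s. gi c (xc c s) (curv c (xc c s) (vel s c) (E j s c) (vel s c)) (E i s c)) ?J" for i j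
    unfolding curv_def[OF c]
    by (intro gi_path_smooth[OF c J order_refl] smooth_path_on_diff smooth_path_on_add
        dird_chr_path_smooth[OF c J order_refl] chr_path_smooth[OF c J order_refl] vs Es)
  then have "smooth_path_on (\<lambda>s. \<chi> i j. gi c (xc c s) (curv c (xc c s) (vel s c) (E j s c) (vel s c)) (E i s c)) ?J"
    by (intro smooth_path_chi)
  then show "smooth_path_on Kmat ?J"
  proof (rule smooth_path_on_cong[rotated])
    fix s assume s: "s \<in> ?J"
    then have sab: "s \<in> {a..b}" and cs: "\<gamma> s \<in> fst c" by auto
    note vt = vel_tangent[OF sab]
    show "(\<chi> i j. gi c (xc c s) (curv c (xc c s) (vel s c) (E j s c) (vel s c)) (E i s c)) = Kmat s"
      unfolding Kmat_def
        metric_component[OF c cs curvature_tangent[OF vt E_tangent[OF sab] vt] E_tangent[OF sab]] curvature_component[OF c cs] ..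
  qed
qed

lemma sturm_liouville_Kmat: "sturm_liouville Kmat a b"
  by unfold_locales (use ab Kmat_smooth Kmat_sym in auto)

lemma to_field_linear: "linear (to_field t)"
  by (rule linearI)
    (auto simp: to_field_def fun_eq_iff scaleR_fun_def linear_add[OF comb_linear] linear_cmul[OF comb_linear])

context
  fixes t assumes t: "t \<in> {a<..b}"
begin

lemma sub_t: "a < t" "{a..t} \<subseteq> {a..b}" "s \<in> {a..t} \<Longrightarrow> s \<in> {a..b}"
  using t by auto

text \<open>Forms and nullities for \<open>t\<close> take derivatives within \<open>{a..t}\<close>,
  while the frame was built with derivatives within \<open>{a..b}\<close>; this reconciles the two
  also at the new end point \<open>t\<close>.\<close>

lemma velocity_restrict:
  assumes s: "s \<in> {a..t}"
  shows "velocity A {a..t} \<gamma> s = vel s"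
proof (rule ext)
  fix c
  show "velocity A {a..t} \<gamma> s c = vel s c"
  proof (cases "c \<in> A \<and> \<gamma> s \<in> fst c")
    case True
    then have "(xc c has_vector_derivative vel s c) (at s within {a..t})"
      using has_vector_derivative_within_subset[OF xc_deriv sub_t(2)] sub_t(3)[OF s] by blast
    then have "ivl_deriv a t (xc c) s = vel s c" by (rule ivl_deriv_eq[OF sub_t(1) s])
    then show ?thesis using True s by (simp add: velocity_def[of A "{a..t}"] ivl_deriv_def)
  qed (auto simp: velocity_def)
qed

lemma to_field_inj: "inj_on (to_field t) {y. \<forall>s. s \<notin> {a..t} \<longrightarrow> y s = 0}"
proof (rule inj_onI)
  fix y z assume y: "y \<in> {y. \<forall>s. s \<notin> {a..t} \<longrightarrow> y s = 0}" and z: "z \<in> {y. \<forall>s. s \<notin> {a..t} \<longrightarrow> y s = 0}"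
    and e: "to_field t y = to_field t z"
  show "y = z"
  proof (rule ext)
    fix s show "y s = z s"
    proof (cases "s \<in> {a..t}")
      case True
      then have "comb s (y s) = comb s (z s)" using fun_cong[OF e, of s] by (simp add: to_field_def)
      then show ?thesis using coef_comb[OF sub_t(3)[OF True]] by metis
    qed (use y z in simp)
  qed
qed

lemma to_field_variation:
  assumes y: "y \<in> sl_space a t"
  shows "to_field t y \<in> variation_fields A \<gamma> a t"
proof -
  have ys: "smooth_path_on y {a..t}" "y a = 0" "y t = 0" using y by (auto simp: sl_space_def)
  have "smooth_path_on (\<lambda>s. to_field t y s c) {s \<in> {a..t}. \<gamma> s \<in> fst c}" if c: "c \<in> A" for c
  proof -
    let ?J = "{s \<in> {a..t}. \<gamma> s \<in> fst c}"
    have J: "perfect_on ?J" by (rule window_perfect[OF c sub_t(1,2)])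
    have JJ: "?J \<subseteq> {s \<in> {a..b}. \<gamma> s \<in> fst c}" and Jt: "?J \<subseteq> {a..t}" using sub_t(3) by blast+
    have "smooth_path_on (\<lambda>s. \<Sum>i\<in>UNIV. (y s $ i) *\<^sub>R E i s c) ?J"
      by (intro smooth_path_on_sum smooth_path_on_bilinear[OF bounded_bilinear_scaleR J]
          smooth_path_on_linear[OF bounded_linear_vec_nth] smooth_path_on_subset[OF ys(1) Jt]
          smooth_path_on_subset[OF parallel_smooth[OF E_parallel c] JJ])
    then show ?thesis
      by (rule smooth_path_on_cong[rotated]) (simp add: to_field_def comb_component)
  qed
  moreover have "to_field t y s \<in> tangent_space A (\<gamma> s)" if "s \<in> {a..t}" for s
    using comb_tangent[OF sub_t(3)[OF that]] that by (simp add: to_field_def)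
  ultimately show ?thesis
    using ys(2,3) sub_t(1)
    by (simp add: variation_fields_def vector_fields_along_def to_field_def linear_0[OF comb_linear])
qed

text \<open>The coefficients are inner products with the frame, hence smooth in every chart window,
  and they vanish where the field does.\<close>

lemma variation_to_field:
  assumes X: "X \<in> variation_fields A \<gamma> a t"
  shows "\<exists>y\<in>sl_space a t. X = to_field t y"
proof -
  have XD: "\<And>s. s \<notin> {a..t} \<Longrightarrow> X s = 0" "\<And>s. s \<in> {a..t} \<Longrightarrow> X s \<in> tangent_space A (\<gamma> s)"
    "\<And>c. c \<in> A \<Longrightarrow> smooth_path_on (\<lambda>s. X s c) {s \<in> {a..t}. \<gamma> s \<in> fst c}" "X a = 0" "X t = 0"
    using X by (auto simp: variation_fields_def vector_fields_along_def)
  define y where "y = (\<lambda>s. if s \<in> {a..t} then coef s (X s) else 0)"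
  have eq: "X = to_field t y"
    using comb_coef[OF sub_t(3) XD(2)] XD(1) by (auto simp: to_field_def y_def fun_eq_iff)
  have z: "coef s 0 = 0" if "s \<in> {a..b}" for s
    using coef_comb[OF that, of 0] by (simp add: linear_0[OF comb_linear])
  have "smooth_path_on y {a..t}"
  proof (rule window_local[OF sub_t(1,2)])
    fix c assume c: "c \<in> A"
    let ?J = "{s \<in> {a..t}. \<gamma> s \<in> fst c}"
    have J: "perfect_on ?J" by (rule window_perfect[OF c sub_t(1,2)])
    have JJ: "?J \<subseteq> {s \<in> {a..b}. \<gamma> s \<in> fst c}" using sub_t(3) by blast
    have "smooth_path_on (\<lambda>s. \<chi> i. gi c (xc c s) (X s c) (E i s c)) ?J"
      by (intro smooth_path_chi gi_path_smooth[OF c J JJ] XD(3) c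
          smooth_path_on_subset[OF parallel_smooth[OF E_parallel c] JJ])
    then show "smooth_path_on y ?J"
    proof (rule smooth_path_on_cong[rotated])
      fix s assume s: "s \<in> ?J"
      then have st: "s \<in> {a..t}" and cs: "\<gamma> s \<in> fst c" by auto
      show "(\<chi> i. gi c (xc c s) (X s c) (E i s c)) = y s"
        using st by (simp add: y_def coef_def metric_component[OF c cs XD(2)[OF st] E_tangent[OF sub_t(3)[OF st]]])
    qed
  qed
  then have "y \<in> sl_space a t"
    using XD(4,5) z[of a] z[of t] ab t by (auto simp: sl_space_def y_def)
  then show ?thesis using eq by blast
qed

lemma to_field_image: "to_field t ` sl_space a t = variation_fields A \<gamma> a t"
  using to_field_variation variation_to_field by blast

text \<open>The frame is parallel, so its derivative cancels the Christoffel term and the covariant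
  derivative acts on the coefficients alone. The equality is one of functions on the whole line,
  since both sides are cut off in the same way; this allows it to be applied twice.\<close>

lemma cov_deriv_to_field:
  assumes y: "smooth_path_on y {a..t}"
  shows "cov_deriv A g {a..t} \<gamma> (to_field t y) = to_field t (ivl_deriv a t y)"
proof (intro ext)
  fix s c
  show "cov_deriv A g {a..t} \<gamma> (to_field t y) s c = to_field t (ivl_deriv a t y) s c"
  proof (cases "s \<in> {a..t}")
    case s: True
    note sab = sub_t(3)[OF s]
    show ?thesis
    proof (cases "c \<in> A \<and> \<gamma> s \<in> fst c")
      case True
      then have c: "c \<in> A" "\<gamma> s \<in> fst c" by auto
      have x: "xc c s \<in> coords c" using c by blast
      let ?G = "chr c (xc c s) (vel s c)"
      note l = chr_linear(2)[OF c(1) x, of "vel s c"]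
      have yi: "((\<lambda>r. y r $ i) has_vector_derivative ivl_deriv a t y s $ i) (at s within {a..t})" for i
        by (rule bounded_linear.has_vector_derivative[OF bounded_linear_vec_nth ivl_deriv_works(1)[OF sub_t(1) y s]])
      have Ei: "((\<lambda>r. E i r c) has_vector_derivative - ?G (E i s c)) (at s within {a..t})" for i
        by (rule has_vector_derivative_within_subset[OF parallel_onD(2)[OF E_parallel sab c] sub_t(2)])
      have "((\<lambda>r. \<Sum>i\<in>UNIV. (y r $ i) *\<^sub>R E i r c) has_vector_derivative
        (\<Sum>i\<in>UNIV. ((y s $ i) *\<^sub>R (- ?G (E i s c)) + (ivl_deriv a t y s $ i) *\<^sub>R E i s c))) (at s within {a..t})"
        by (intro has_vector_derivative_sum bounded_bilinear.has_vector_derivative[OF bounded_bilinear_scaleR yi Ei])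
      then have "((\<lambda>r. to_field t y r c) has_vector_derivative
        (\<Sum>i\<in>UNIV. ((y s $ i) *\<^sub>R (- ?G (E i s c)) + (ivl_deriv a t y s $ i) *\<^sub>R E i s c))) (at s within {a..t})"
        by (rule has_vector_derivative_transform[OF s, rotated]) (simp add: to_field_def comb_component)
      then have "vector_derivative (\<lambda>r. to_field t y r c) (at s within {a..t}) =
        (\<Sum>i\<in>UNIV. ((y s $ i) *\<^sub>R (- ?G (E i s c)) + (ivl_deriv a t y s $ i) *\<^sub>R E i s c))"
        using ivl_deriv_eq[OF sub_t(1) s] unfolding ivl_deriv_def by blast
      also have "\<dots> = comb s (ivl_deriv a t y s) c - ?G (comb s (y s) c)"
        unfolding comb_component by (simp add: linear_sum[OF l] linear_cmul[OF l] sum.distrib sum_negf sum_subtractf)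
      finally have "vector_derivative (\<lambda>r. to_field t y r c) (at s within {a..t}) =
        comb s (ivl_deriv a t y s) c - ?G (comb s (y s) c)" .
      then show ?thesis using c s by (simp add: cov_deriv_def velocity_restrict[OF s] to_field_def)
    next
      case False
      then have "comb s (ivl_deriv a t y s) c = 0"
        by (rule tangent_spaceD(1)[OF comb_tangent[OF sab]])
      then show ?thesis using False s by (auto simp: cov_deriv_def to_field_def)
    qed
  qed (auto simp: cov_deriv_def to_field_def)
qed

lemma curvature_along_to_field:
  assumes s: "s \<in> {a..t}"
  shows "curvature_along A g {a..t} \<gamma> (to_field t y) s = comb s (Kmat s *v y s)"
  using s by (simp add: curvature_along_def velocity_restrict[OF s] to_field_def curvature_comb[OF sub_t(3)[OF s]])

lemma index_form_to_field:
  assumes x: "x \<in> sl_space a t" and y: "y \<in> sl_space a t"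
  shows "index_form A g \<gamma> a t (to_field t x) (to_field t y) = sl_form Kmat a t x y"
  unfolding index_form_def sl_form_def
proof (rule integral_cong)
  fix s assume s: "s \<in> {a..t}"
  have sm: "smooth_path_on x {a..t}" "smooth_path_on y {a..t}" using x y by (auto simp: sl_space_def)
  show "g (\<gamma> s) (cov_deriv A g {a..t} \<gamma> (to_field t x) s) (cov_deriv A g {a..t} \<gamma> (to_field t y) s)
    + g (\<gamma> s) (curvature_along A g {a..t} \<gamma> (to_field t x) s) (to_field t y s) =
    ivl_deriv a t x s \<bullet> ivl_deriv a t y s + (Kmat s *v x s) \<bullet> y s"
    unfolding cov_deriv_to_field[OF sm(1)] cov_deriv_to_field[OF sm(2)] curvature_along_to_field[OF s]
    using s by (simp add: to_field_def g_comb[OF sub_t(3)[OF s]])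
qed

lemma eigenfields_to_field:
  "eigenfields A g \<gamma> a t \<mu> = to_field t ` sl_eig Kmat a t \<mu>"
proof -
  have "(\<forall>s\<in>{a..t}. - cov_deriv A g {a..t} \<gamma> (cov_deriv A g {a..t} \<gamma> (to_field t y)) s
    + curvature_along A g {a..t} \<gamma> (to_field t y) s = \<mu> *\<^sub>R to_field t y s) \<longleftrightarrow>
    (\<forall>s\<in>{a..t}. - ivl_deriv a t (ivl_deriv a t y) s + Kmat s *v y s = \<mu> *\<^sub>R y s)"
    if y: "y \<in> sl_space a t" for y
  proof (rule ball_cong[OF refl])
    fix s assume s: "s \<in> {a..t}"
    have sm: "smooth_path_on y {a..t}" using y by (simp add: sl_space_def)
    note l = comb_linear[of s]
    have "(- comb s (ivl_deriv a t (ivl_deriv a t y) s) + comb s (Kmat s *v y s) = \<mu> *\<^sub>R comb s (y s)) \<longleftrightarrow>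
      comb s (- ivl_deriv a t (ivl_deriv a t y) s + Kmat s *v y s) = comb s (\<mu> *\<^sub>R y s)"
      by (simp only: linear_add[OF l] linear_neg[OF l] linear_cmul[OF l])
    also have "\<dots> \<longleftrightarrow> - ivl_deriv a t (ivl_deriv a t y) s + Kmat s *v y s = \<mu> *\<^sub>R y s"
      using coef_comb[OF sub_t(3)[OF s]] by metis
    finally show "(- cov_deriv A g {a..t} \<gamma> (cov_deriv A g {a..t} \<gamma> (to_field t y)) s
      + curvature_along A g {a..t} \<gamma> (to_field t y) s = \<mu> *\<^sub>R to_field t y s) \<longleftrightarrow>
      (- ivl_deriv a t (ivl_deriv a t y) s + Kmat s *v y s = \<mu> *\<^sub>R y s)"
      unfolding cov_deriv_to_field[OF sm] cov_deriv_to_field[OF ivl_deriv_works(2)[OF sub_t(1) sm]]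
        curvature_along_to_field[OF s]
      using s by (simp add: to_field_def)
  qed
  note iff = this
  show ?thesis
  proof (intro subset_antisym subsetI)
    fix X assume X: "X \<in> eigenfields A g \<gamma> a t \<mu>"
    then have XV: "X \<in> variation_fields A \<gamma> a t" by (simp add: eigenfields_def)
    obtain y where y: "y \<in> sl_space a t" "X = to_field t y" using variation_to_field[OF XV] by blast
    have "\<forall>s\<in>{a..t}. - ivl_deriv a t (ivl_deriv a t y) s + Kmat s *v y s = \<mu> *\<^sub>R y s"
      by (rule iff[OF y(1), THEN iffD1]) (use X y(2) in \<open>simp add: eigenfields_def\<close>)
    then have "y \<in> sl_eig Kmat a t \<mu>" using y(1) by (simp add: sl_eig_def)
    then show "X \<in> to_field t ` sl_eig Kmat a t \<mu>" using y(2) by blast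
  next
    fix X assume "X \<in> to_field t ` sl_eig Kmat a t \<mu>"
    then obtain y where y: "y \<in> sl_eig Kmat a t \<mu>" "X = to_field t y" by blast
    have ys: "y \<in> sl_space a t" using y(1) by (simp add: sl_eig_def)
    have "\<forall>s\<in>{a..t}. - cov_deriv A g {a..t} \<gamma> (cov_deriv A g {a..t} \<gamma> (to_field t y)) s
      + curvature_along A g {a..t} \<gamma> (to_field t y) s = \<mu> *\<^sub>R to_field t y s"
      by (rule iff[OF ys, THEN iffD2]) (use y(1) in \<open>simp add: sl_eig_def\<close>)
    then show "X \<in> eigenfields A g \<gamma> a t \<mu>"
      using to_field_variation[OF ys] y(2) by (simp add: eigenfields_def)
  qed
qed

lemma nul_eq: "nul A g \<gamma> a t \<mu> = edim (sl_eig Kmat a t \<mu>)"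
proof -
  interpret sturm_liouville Kmat a t by (rule sturm_liouville.restrict[OF sturm_liouville_Kmat t])
  have "inj_on (to_field t) (sl_eig Kmat a t \<mu>)"
    by (rule inj_on_subset[OF to_field_inj]) (auto simp: sl_eig_def sl_space_def)
  then show ?thesis
    unfolding nul_def eigenfields_to_field by (rule edim_image_inj[OF to_field_linear subspace_eig])
qed

lemma ind_eq: "ind A g \<gamma> a t = form_index (sl_form Kmat a t) (sl_space a t)"
proof -
  have "inj_on (to_field t) (sl_space a t)"
    by (rule inj_on_subset[OF to_field_inj]) (auto simp: sl_space_def)
  then show ?thesis
    unfolding ind_def to_field_image[symmetric]
    by (rule form_index_image[OF to_field_linear _ subspace_sl_space]) (rule index_form_to_field)
qed

end

theorem index_theorem:
  "\<exists>\<mu>\<^sub>0<0.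
      ind A g \<gamma> a b = (\<Sum>\<^sub>\<infinity>\<mu>\<in>{..<0}. nul A g \<gamma> a b \<mu>)
    \<and> (\<Sum>\<^sub>\<infinity>\<mu>\<in>{..<0}. nul A g \<gamma> a b \<mu>) = (\<Sum>\<^sub>\<infinity>\<mu>\<in>{\<mu>\<^sub>0<..<0}. nul A g \<gamma> a b \<mu>)
    \<and> (\<Sum>\<^sub>\<infinity>\<mu>\<in>{\<mu>\<^sub>0<..<0}. nul A g \<gamma> a b \<mu>) = (\<Sum>\<^sub>\<infinity>t\<in>{a<..<b}. nul A g \<gamma> a t 0)
    \<and> ind A g \<gamma> a b = (\<Sum>\<^sub>\<infinity>t\<in>{t\<in>{a<..<b}. conjugate_value A g \<gamma> a t}. nul A g \<gamma> a t 0)"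
proof -
  have bb: "b \<in> {a<..b}" using ab by simp
  have tt: "t \<in> {a<..b}" if "t \<in> {a<..<b}" for t using that by simp
  obtain L T l where LT: "finite L" "L \<subseteq> {..<0}" "finite T" "T \<subseteq> {a<..<b}" "l < 0" "L \<subseteq> {l<..}"
    "\<And>\<mu>. \<mu> < 0 \<Longrightarrow> \<mu> \<notin> L \<Longrightarrow> edim (sl_eig Kmat a b \<mu>) = 0"
    "\<And>t. t \<in> {a<..<b} \<Longrightarrow> t \<notin> T \<Longrightarrow> edim (sl_eig Kmat a t 0) = 0"
    "form_index (sl_form Kmat a b) (sl_space a b) = (\<Sum>\<mu>\<in>L. edim (sl_eig Kmat a b \<mu>))"
    "(\<Sum>\<mu>\<in>L. edim (sl_eig Kmat a b \<mu>)) = (\<Sum>t\<in>T. edim (sl_eig Kmat a t 0))"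
    by (rule sturm_liouville_index[OF sturm_liouville_Kmat]) (rule that; assumption)
  have nulb: "nul A g \<gamma> a b \<mu> = 0" if "\<mu> < 0" "\<mu> \<notin> L" for \<mu> using LT(7)[OF that] nul_eq[OF bb] by simp
  have nult: "nul A g \<gamma> a t 0 = 0" if "t \<in> {a<..<b}" "t \<notin> T" for t using LT(8)[OF that] nul_eq[OF tt[OF that(1)]] by simp
  have s1: "(\<Sum>\<^sub>\<infinity>\<mu>\<in>{..<0}. nul A g \<gamma> a b \<mu>) = (\<Sum>\<mu>\<in>L. nul A g \<gamma> a b \<mu>)"
    by (rule infsum_finite_support[OF LT(1,2)]) (use nulb in auto)
  have s2: "(\<Sum>\<^sub>\<infinity>\<mu>\<in>{l<..<0}. nul A g \<gamma> a b \<mu>) = (\<Sum>\<mu>\<in>L. nul A g \<gamma> a b \<mu>)"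
    by (rule infsum_finite_support[OF LT(1)]) (use nulb LT(2,6) in auto)
  have s3: "(\<Sum>\<^sub>\<infinity>t\<in>{a<..<b}. nul A g \<gamma> a t 0) = (\<Sum>t\<in>T. nul A g \<gamma> a t 0)"
    by (rule infsum_finite_support[OF LT(3,4)]) (use nult in auto)
  \<comment> \<open>A value that is not conjugate has nullity zero, so restricting the sum to
    conjugate values does not change it.\<close>
  have s4: "(\<Sum>\<^sub>\<infinity>t\<in>{t\<in>{a<..<b}. conjugate_value A g \<gamma> a t}. nul A g \<gamma> a t 0) = (\<Sum>\<^sub>\<infinity>t\<in>{a<..<b}. nul A g \<gamma> a t 0)"
    by (rule infsum_cong_neutral) (auto simp: conjugate_value_def)
  have e1: "(\<Sum>\<mu>\<in>L. nul A g \<gamma> a b \<mu>) = (\<Sum>\<mu>\<in>L. edim (sl_eig Kmat a b \<mu>))"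
    using nul_eq[OF bb] by simp
  have e2: "(\<Sum>t\<in>T. nul A g \<gamma> a t 0) = (\<Sum>t\<in>T. edim (sl_eig Kmat a t 0))"
    by (rule sum.cong[OF refl], rule nul_eq[OF tt]) (use LT(4) in blast)
  show ?thesis
    unfolding ind_eq[OF bb] LT(9) s4
    by (intro exI[of _ l] conjI LT(5)) (simp_all only: s1 s2 s3 e1 e2 LT(10))
qed

end

theorem theorem2p1:
  fixes A :: "('m::{t2_space, second_countable_topology}, 'n::finite) chart set"
    and g :: "('m, 'n) metric"
    and \<gamma> :: "real \<Rightarrow> 'm"
    and a b :: real
  assumes "smooth_atlas A" and "riemannian_metric A g" and "complete_riemannian A g"
    and "a < b" and "geodesic A g {a..b} \<gamma>"
  shows "\<exists>\<mu>\<^sub>0<0.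
      ind A g \<gamma> a b = (\<Sum>\<^sub>\<infinity>\<mu>\<in>{..<0}. nul A g \<gamma> a b \<mu>)
    \<and> (\<Sum>\<^sub>\<infinity>\<mu>\<in>{..<0}. nul A g \<gamma> a b \<mu>) = (\<Sum>\<^sub>\<infinity>\<mu>\<in>{\<mu>\<^sub>0<..<0}. nul A g \<gamma> a b \<mu>)
    \<and> (\<Sum>\<^sub>\<infinity>\<mu>\<in>{\<mu>\<^sub>0<..<0}. nul A g \<gamma> a b \<mu>) = (\<Sum>\<^sub>\<infinity>t\<in>{a<..<b}. nul A g \<gamma> a t 0)
    \<and> ind A g \<gamma> a b = (\<Sum>\<^sub>\<infinity>t\<in>{t\<in>{a<..<b}. conjugate_value A g \<gamma> a t}. nul A g \<gamma> a t 0)"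
proof -
  have "smooth_curve A {a..b} \<gamma>" using assms(5) by (simp add: geodesic_def)
  then interpret riemannian_curve A g \<gamma> a b
    using assms(1,2,4) by unfold_locales auto
  obtain E :: "'n \<Rightarrow> real \<Rightarrow> ('m, 'n) tvec" where E: "\<And>i. parallel_on {a..b} (E i)"
    "\<And>i j s. s \<in> {a..b} \<Longrightarrow> g (\<gamma> s) (E i s) (E j s) = (if i = j then 1 else 0)"
    using parallel_frame_exists by blast
  interpret riemannian_frame A g \<gamma> a b E
    by unfold_locales (fact E)+
  show ?thesis by (rule index_theorem)
qed

end
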